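(* Let $q(t)>0$. Let $g(\zeta,0)$ be a rational function of the form $$b\,\frac{\prod_{k=1}^m(\zeta-\omega_k)}{\prod_{j=1}^n(\zeta-\zeta_j)},\qquad m\ge n,\quad |\zeta_j|>1,\quad g(0,0)>0,\qquad(\ast)$$ such that no two zeros of $g(\zeta,0)$ are related by $\omega_k=\omega_j^*$ (for any $k,j$, including $k=j$, so there are no zeros on $\partial\mathbb{D}$). Consider, locally in time, the equation $$\frac{\partial}{\partial t}\log g=\zeta(P+R)\frac{\partial}{\partial\zeta}\log g+\frac{\partial}{\partial\zeta}\big(\zeta(P+R)\big),\qquad(\ast\ast)$$ where $R$ is a function of the form $$R(\zeta,t)=\mathrm{i}\,\mathrm{Im}\sum_{\omega_j\in\mathbb{D}}\frac{2B_j(t)}{\omega_j(t)}+\sum_{\omega_j\in\mathbb{D}}\Big(\frac{2B_j(t)}{\zeta-\omega_j(t)}-\frac{2\overline{B_j(t)}\,\zeta}{1-\overline{\omega_j(t)}\,\zeta}\Big).$$ (1) For exactly one choice of $R(\zeta,t)$, namely that given by $B_j=A_j$ for each $j$ with $\omega_j\in\mathbb{D}$, where $A_j=\dfrac{q(t)}{g'(\omega_j,t)\,g^*(\omega_j,t)}$, there exists a solution $g(\zeta,t)$ of $(\ast\ast)$ which remains of the original rational form $(\ast)$ (with $b,\omega_k,\zeta_j$ depending on $t$). (2) A necessary and sufficient condition for this rational solution to also solve the Löwner-Kufarev equation $\dot f=\zeta f'P$ (with $f(z,t)=\int_0^zg(\zeta,t)\,d\zeta$) is that $R(\zeta,t)=0$.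 This occurs precisely under the condition that whenever $g(\zeta,t)$ has a zero $\omega_k$ in $\mathbb{D}$, the reflected point $\omega_k^*$ is a pole of $g(\zeta,t)$ of order strictly greater than that of the zero. This property is conserved in time. (3) Every pole $\zeta_j$ of $g$ moves out from the origin, and every zero $\omega_k$ inside the unit disk moves towards the origin, as time increases.
   Context: $\mathbb{D}$ is the open unit disk. Dot denotes $\partial/\partial t$ and prime denotes $\partial/\partial\zeta$. For a point $\omega$, $\omega^*=1/\bar\omega$; for a function $h$, $h^*(\zeta)=\overline{h(1/\bar\zeta)}$. In $(\ast)$ the $\omega_k$ are the zeros and the $\zeta_j$ the poles of $g$, with repetitions allowed to account for multiplicities; the formulas given for $R$ and $A_j$ are those for simple zeros $\omega_j$, a simplifying assumption under which they are derived. $P(\zeta,t)$ is the analytic function in $\mathbb{D}$ whose real part has boundary values $q(t)/|g(\zeta,t)|^2$ on $\partial\mathbb{D}$ and with $\mathrm{Im}\,P(0,t)=0$, i.e. $$P(\zeta,t)=\frac{1}{2\pi\mathrm{i}}\int_{\partial\mathbb{D}}\frac{q(t)}{|g(z,t)|^2}\frac{z+\zeta}{z-\zeta}\frac{dz}{z};$$ for rational $g$ it extends to a rational function. Equation $(\ast\ast)$ is equivalent, for $f(z,t)=\int_0^zg(\zeta,t)\,d\zeta$, to $\dot f=\zeta f'(P+R)$, which is a form of the Polubarinova-Galin equation $\mathrm{Re}[\dot f\,\overline{\zeta f'}]=q$ on $\partial\mathbb{D}$.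
   Formalization: Part (3) is proved only for rational solutions that also solve the Löwner-Kufarev equation (R=0); for general rational solutions it fails, as a pole can move inward. q is assumed continuous, zeros in the disk are simple, and the conditions in (2) are read over the whole time interval. *)

theory Defs
  imports "HOL-Complex_Analysis.Complex_Analysis"
begin

definition reflect :: "complex \<Rightarrow> complex" where
  "reflect w = 1 / cnj w"

definition star_fun :: "(complex \<Rightarrow> complex) \<Rightarrow> complex \<Rightarrow> complex" where
  "star_fun h z = cnj (h (1 / cnj z))"

definition rat_fun ::
  "nat \<Rightarrow> nat \<Rightarrow> complex \<Rightarrow> (nat \<Rightarrow> complex) \<Rightarrow> (nat \<Rightarrow> complex) \<Rightarrow> complex \<Rightarrow> complex" where
  "rat_fun m n b w p z = b * (\<Prod>k<m. z - w k) / (\<Prod>j<n. z - p j)"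

text \<open>The clause \<open>w k \<noteq> p j\<close> makes the \<open>w k\<close> really the zeros and the \<open>p j\<close> really the poles,
  each listed with multiplicity. Positivity at the origin forces \<open>b \<noteq> 0\<close> and \<open>w k \<noteq> 0\<close>.\<close>

definition rational_form ::
  "nat \<Rightarrow> nat \<Rightarrow> complex \<Rightarrow> (nat \<Rightarrow> complex) \<Rightarrow> (nat \<Rightarrow> complex) \<Rightarrow> bool" where
  "rational_form m n b w p \<longleftrightarrow>
     n \<le> m \<and> (\<forall>j<n. 1 < norm (p j)) \<and> (\<forall>k<m. \<forall>j<n. w k \<noteq> p j) \<and>
     Im (rat_fun m n b w p 0) = 0 \<and> Re (rat_fun m n b w p 0) > 0"

text \<open>The case \<open>j = k\<close> is included and excludes zeros on the unit circle.\<close>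

definition no_reflected_zeros :: "nat \<Rightarrow> (nat \<Rightarrow> complex) \<Rightarrow> bool" where
  "no_reflected_zeros m w \<longleftrightarrow> (\<forall>j<m. \<forall>k<m. w k \<noteq> reflect (w j))"

definition disk_zeros :: "nat \<Rightarrow> (nat \<Rightarrow> complex) \<Rightarrow> nat set" where
  "disk_zeros m w = {j. j < m \<and> w j \<in> ball 0 1}"

text \<open>Only the zeros inside the disk, which carry the coefficients of \<open>R\<close>, are required to be
  simple; zeros outside and poles may be multiple.\<close>

definition simple_disk_zeros :: "nat \<Rightarrow> (nat \<Rightarrow> complex) \<Rightarrow> bool" where
  "simple_disk_zeros m w \<longleftrightarrow> (\<forall>j\<in>disk_zeros m w. \<forall>k<m. w k = w j \<longrightarrow> k = j)"

definition admissible ::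
  "nat \<Rightarrow> nat \<Rightarrow> complex \<Rightarrow> (nat \<Rightarrow> complex) \<Rightarrow> (nat \<Rightarrow> complex) \<Rightarrow> bool" where
  "admissible m n b w p \<longleftrightarrow>
     rational_form m n b w p \<and> no_reflected_zeros m w \<and> simple_disk_zeros m w"

text \<open>In \<open>P_fun\<close>, \<open>A_coef\<close>, \<open>R_fun\<close> the time is frozen: \<open>c\<close> stands for the number \<open>q t\<close>.
  \<open>P_fun\<close> is meaningful for \<open>\<zeta>\<close> in the open unit disk.\<close>

definition P_fun :: "real \<Rightarrow> (complex \<Rightarrow> complex) \<Rightarrow> complex \<Rightarrow> complex" where
  "P_fun c g \<zeta> = 1 / (2 * of_real pi * \<i>) *
     contour_integral (circlepath 0 1)
       (\<lambda>z. of_real (c / (norm (g z))\<^sup>2) * ((z + \<zeta>) / (z - \<zeta>)) / z)"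

text \<open>If \<open>reflect w\<close> is a pole of \<open>g\<close>, then \<open>star_fun g\<close> has a pole at \<open>w\<close> and the coefficient is
  \<open>0\<close>. For \<open>g\<close> of the form \<open>rat_fun\<close> the convention \<open>x / 0 = 0\<close> gives this value as well:
  \<open>star_fun g w\<close> then evaluates to \<open>0\<close>, and so does the quotient.\<close>

definition A_coef :: "real \<Rightarrow> (complex \<Rightarrow> complex) \<Rightarrow> complex \<Rightarrow> complex" where
  "A_coef c g w = of_real c / (deriv g w * star_fun g w)"

definition R_fun :: "nat \<Rightarrow> (nat \<Rightarrow> complex) \<Rightarrow> (nat \<Rightarrow> complex) \<Rightarrow> complex \<Rightarrow> complex" where
  "R_fun m w B \<zeta> =
     \<i> * of_real (Im (\<Sum>j\<in>disk_zeros m w. 2 * B j / w j)) +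
     (\<Sum>j\<in>disk_zeros m w. 2 * B j / (\<zeta> - w j) - 2 * cnj (B j) * \<zeta> / (1 - cnj (w j) * \<zeta>))"

text \<open>The evolution equation on the time interval \<open>[0,T)\<close>, with \<open>\<partial> log g\<close> read as the logarithmic
  derivative \<open>\<partial>g / g\<close>. It is imposed at the points of the disk where \<open>log g\<close> exists, i.e. away
  from the zeros of \<open>g\<close>; there \<open>P\<close> is given by its integral and \<open>R\<close> is finite. Both sides being
  rational in \<open>\<zeta>\<close>, this is the same as equality of rational functions.\<close>

definition solves_log_eq ::
  "real \<Rightarrow> (real \<Rightarrow> real) \<Rightarrow> (real \<Rightarrow> complex \<Rightarrow> complex) \<Rightarrow> (real \<Rightarrow> complex \<Rightarrow> complex) \<Rightarrow> bool" where
  "solves_log_eq T q g R \<longleftrightarrow>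
     (\<forall>t\<in>{0..<T}. \<forall>\<zeta>\<in>ball 0 1. g t \<zeta> \<noteq> 0 \<longrightarrow>
        (\<exists>gdot. ((\<lambda>s. g s \<zeta>) has_vector_derivative gdot) (at t within {0..<T}) \<and>
           gdot / g t \<zeta> =
             \<zeta> * (P_fun (q t) (g t) \<zeta> + R t \<zeta>) * (deriv (g t) \<zeta> / g t \<zeta>) +
             deriv (\<lambda>z. z * (P_fun (q t) (g t) z + R t z)) \<zeta>))"

text \<open>A local solution on \<open>[0,T)\<close> with initial value \<open>g0\<close> that stays of the given rational form,
  the data \<open>b\<close>, \<open>w k\<close>, \<open>p j\<close> depending continuously on time, for the choice \<open>B\<close> of
  coefficients in \<open>R\<close>. The nondegeneracy conditions in \<open>admissible\<close> are open and hold at time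
  \<open>0\<close>; asking for them on all of \<open>[0,T)\<close> only makes precise that the problem is local in time.\<close>

definition rational_solution ::
  "(real \<Rightarrow> real) \<Rightarrow> nat \<Rightarrow> nat \<Rightarrow> (complex \<Rightarrow> complex) \<Rightarrow> real \<Rightarrow> (real \<Rightarrow> complex) \<Rightarrow>
   (real \<Rightarrow> nat \<Rightarrow> complex) \<Rightarrow> (real \<Rightarrow> nat \<Rightarrow> complex) \<Rightarrow> (real \<Rightarrow> nat \<Rightarrow> complex) \<Rightarrow> bool" where
  "rational_solution q m n g0 T b w p B \<longleftrightarrow>
     rat_fun m n (b 0) (w 0) (p 0) = g0 \<and>
     continuous_on {0..<T} b \<and>
     (\<forall>k<m. continuous_on {0..<T} (\<lambda>t. w t k)) \<and>
     (\<forall>j<n. continuous_on {0..<T} (\<lambda>t. p t j)) \<and>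
     (\<forall>t\<in>{0..<T}. admissible m n (b t) (w t) (p t)) \<and>
     solves_log_eq T q (\<lambda>t. rat_fun m n (b t) (w t) (p t)) (\<lambda>t. R_fun m (w t) (B t))"

text \<open>The particular choice of coefficients determined by the data themselves.\<close>

definition A_data ::
  "(real \<Rightarrow> real) \<Rightarrow> nat \<Rightarrow> nat \<Rightarrow> (real \<Rightarrow> complex) \<Rightarrow>
   (real \<Rightarrow> nat \<Rightarrow> complex) \<Rightarrow> (real \<Rightarrow> nat \<Rightarrow> complex) \<Rightarrow> real \<Rightarrow> nat \<Rightarrow> complex" where
  "A_data q m n b w p t j = A_coef (q t) (rat_fun m n (b t) (w t) (p t)) (w t j)"

definition primitive_fun :: "(complex \<Rightarrow> complex) \<Rightarrow> complex \<Rightarrow> complex" where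
  "primitive_fun g z = contour_integral (linepath 0 z) g"

definition solves_Loewner_Kufarev ::
  "real \<Rightarrow> (real \<Rightarrow> real) \<Rightarrow> (real \<Rightarrow> complex \<Rightarrow> complex) \<Rightarrow> bool" where
  "solves_Loewner_Kufarev T q g \<longleftrightarrow>
     (\<forall>t\<in>{0..<T}. \<forall>\<zeta>\<in>ball 0 1.
        ((\<lambda>s. primitive_fun (g s) \<zeta>) has_vector_derivative
           \<zeta> * deriv (primitive_fun (g t)) \<zeta> * P_fun (q t) (g t) \<zeta>) (at t within {0..<T}))"

text \<open>\<open>zorder\<close> is the order of vanishing, so the order of a pole is \<open>- zorder\<close>.\<close>

definition zeros_reflect_to_higher_poles :: "(complex \<Rightarrow> complex) \<Rightarrow> bool" where
  "zeros_reflect_to_higher_poles g \<longleftrightarrow>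
     (\<forall>w\<in>ball 0 1. g w = 0 \<longrightarrow>
        is_pole g (reflect w) \<and> - zorder g (reflect w) > zorder g w)"

end

theory Submission
  imports Defs "HOL-Computational_Algebra.Field_as_Ring" "HOL-Computational_Algebra.Polynomial_Factorial"
    "HOL-Computational_Algebra.Fundamental_Theorem_Algebra"
begin

text \<open>Write \<open>g = G / S\<close> with coprime polynomials, \<open>S\<close> monic, and let \<open>G\<^sup>#\<close> be the conjugate reciprocal of \<open>G\<close>.
  A Bezout equation gives a unique polynomial \<open>L\<close> of degree at most \<open>m\<close> with
  \<open>L G\<^sup># + L\<^sup># G = 2 q z\<^sup>m\<^sup>-\<^sup>n S S\<^sup>#\<close> and \<open>L / G\<close> real at the origin; on the circle it says
  \<open>Re (L / G) = q / |g|\<^sup>2\<close>, and by the Schwarz formula \<open>P + R = L / G\<close> for \<open>B = A\<close>. The evolution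
  equation with \<open>B = A\<close> then is \<open>G' S - G S' = (z L)' S - z L S'\<close> (time derivatives on the left), whose
  right-hand side is again resolved by a Bezout equation: an ordinary differential equation for the
  coefficients of \<open>G\<close> and \<open>S\<close> with locally Lipschitz right-hand side. Continuous monic polynomials have
  continuous roots, so its solutions have the required form.

  Conversely, the coefficients of a rational solution with arbitrary \<open>B\<close> are differentiable in time. If
  \<open>B j \<noteq> A j\<close> at some time, then \<open>R\<close> contributes a pole at \<open>1 / cnj (w j)\<close> that is incompatible with a
  reflected point which stays a zero of \<open>S\<close> of constant order; such times are therefore isolated for
  each order, hence countable, and by continuity the differential equation holds throughout and
  forces \<open>B = A\<close>.

  Poles follow the characteristics of the velocity \<open>- z L / G\<close>, so equal poles stay equal, and \<open>G\<close> at
  a reflected double pole satisfies a linear equation, so a reflected zero persists. If \<open>R = 0\<close>, zeros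
  in the disk move with velocity \<open>- z P\<close> and poles with \<open>- z L / G\<close>, where \<open>Re P > 0\<close> and, by reflection,
  \<open>Re (L / G) < 0\<close>.\<close>

section \<open>Complex polynomials\<close>

text \<open>Multiplied by \<open>g\<close>, the evolution equation is the conservation law
  \<open>g_t = (z (P + R) g)'\<close>. With \<open>P + R = L / G\<close> the flux
  \<open>z (P + R) g\<close> is \<open>z L / S\<close>: the zeros of \<open>g\<close> drop out, so
  numerator and denominator can evolve as polynomials of bounded degree. For another choice of
  \<open>B\<close> the flux gains a term \<open>z R g\<close>; its poles at the simple disk zeros
  are cancelled by \<open>g\<close>, those at the reflected points are not, so the obstruction is
  read off there. Two shortages of regularity shape the argument. A rational solution comes with
  continuous data and a time derivative at fixed points of the disk only, and zeros or poles that
  meet could a priori fail to be differentiable; hence the calculus is done on coefficients.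
  Moreover \<open>B\<close> is an arbitrary function of time, so \<open>B = A\<close> at most times
  cannot be extended by continuity of \<open>B\<close>; what is extended is the equation for the
  velocities of the coefficients.\<close>

definition pn :: "complex poly \<Rightarrow> real" where
  "pn p = (\<Sum>i\<le>degree p. norm (coeff p i))"

lemma pn_eq: "degree p \<le> N \<Longrightarrow> pn p = (\<Sum>i\<le>N. norm (coeff p i))"
  unfolding pn_def by (rule sum.mono_neutral_left) (auto simp: coeff_eq_0)

lemma pn_0 [simp]: "pn 0 = 0"
  by (simp add: pn_def)

lemma pn_nonneg [simp]: "0 \<le> pn p"
  by (simp add: pn_def sum_nonneg)

lemma norm_coeff_le_pn: "norm (coeff p i) \<le> pn p"
proof (cases "i \<le> degree p")
  case True
  then show ?thesis unfolding pn_def by (intro member_le_sum) auto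
qed (simp add: coeff_eq_0)

lemma pn_eq_0_iff [simp]: "pn p = 0 \<longleftrightarrow> p = 0"
proof
  assume "pn p = 0"
  then have "coeff p i = 0" for i
    using norm_coeff_le_pn[of p i] by simp
  then show "p = 0" by (simp add: poly_eq_iff)
qed simp

lemma pn_add: "pn (p + q) \<le> pn p + pn q"
proof -
  define N where "N = max (degree p) (degree q)"
  have "pn (p + q) = (\<Sum>i\<le>N. norm (coeff p i + coeff q i))"
    using pn_eq[of "p + q" N] degree_add_le_max[of p q] by (simp add: N_def)
  also have "\<dots> \<le> (\<Sum>i\<le>N. norm (coeff p i) + norm (coeff q i))"
    by (intro sum_mono norm_triangle_ineq)
  also have "\<dots> = pn p + pn q"
    by (simp add: sum.distrib pn_eq[of p N] pn_eq[of q N] N_def)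
  finally show ?thesis .
qed

lemma pn_minus [simp]: "pn (- p) = pn p"
  by (simp add: pn_def)

lemma pn_diff: "pn (p - q) \<le> pn p + pn q"
  using pn_add[of p "- q"] by simp

lemma pn_le_diff: "pn p \<le> pn q + pn (p - q)"
  using pn_add[of q "p - q"] by simp

lemma pn_sum: "pn (\<Sum>i\<in>A. f i) \<le> (\<Sum>i\<in>A. pn (f i))"
proof (induction A rule: infinite_finite_induct)
  case (insert x F)
  then show ?case using pn_add[of "f x" "sum f F"] by simp
qed auto

lemma pn_smult [simp]: "pn (smult c p) = norm c * pn p"
proof (cases "c = 0")
  case False
  then show ?thesis by (simp add: pn_def norm_mult sum_distrib_left)
qed simp

lemma pn_monom [simp]: "pn (monom c i) = norm c"
proof (cases "c = 0")
  case False
  then have "pn (monom c i) = (\<Sum>j\<le>i. norm (if j = i then c else 0))"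
    by (simp add: pn_def degree_monom_eq) (auto intro!: sum.cong)
  also have "\<dots> = (\<Sum>j\<in>{i}. norm c)"
    by (rule sum.mono_neutral_cong_right) auto
  finally show ?thesis by simp
qed simp

lemma pn_pCons: "pn (pCons a p) = norm a + pn p"
proof -
  have "pn (pCons a p) = (\<Sum>i\<le>Suc (degree p). norm (coeff (pCons a p) i))"
    by (rule pn_eq) (rule degree_pCons_le)
  also have "\<dots> = norm a + pn p"
    by (subst sum.atMost_Suc_shift) (simp add: pn_def)
  finally show ?thesis .
qed

text \<open>Submultiplicativity is the reason for measuring polynomials by the sum, and not the
  maximum, of the moduli of their coefficients: products are estimated without a factor depending on
  degrees.\<close>

lemma pn_mult: "pn (p * q) \<le> pn p * pn q"
proof (induction p)
  case (pCons a p)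
  have "pn (pCons a p * q) \<le> pn (smult a q) + pn (pCons 0 (p * q))"
    unfolding mult_pCons_left by (rule pn_add)
  also have "\<dots> \<le> norm a * pn q + pn p * pn q"
    using pCons.IH by (simp add: pn_pCons)
  also have "\<dots> = pn (pCons a p) * pn q"
    by (simp add: pn_pCons algebra_simps)
  finally show ?case .
qed simp

lemma pn_pderiv:
  assumes "degree p \<le> N"
  shows "pn (pderiv p) \<le> real N * pn p"
proof -
  have "pn (pderiv p) = (\<Sum>i<N. norm (coeff (pderiv p) i))"
  proof (cases N)
    case 0
    then have "pderiv p = 0" using assms by (simp add: pderiv_eq_0_iff)
    then show ?thesis using 0 by simp
  next
    case (Suc M)
    then have "degree (pderiv p) \<le> M" using assms by (simp add: degree_pderiv)
    then show ?thesis using Suc pn_eq[of "pderiv p" M] by (simp add: lessThan_Suc_atMost)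
  qed
  also have "\<dots> \<le> (\<Sum>i<N. real N * norm (coeff p (Suc i)))"
  proof (rule sum_mono)
    fix i assume "i \<in> {..<N}"
    then have "norm (of_nat (Suc i) :: complex) \<le> real N"
      unfolding norm_of_nat by simp
    then show "norm (coeff (pderiv p) i) \<le> real N * norm (coeff p (Suc i))"
      unfolding coeff_pderiv norm_mult by (rule mult_right_mono) simp
  qed
  also have "\<dots> = real N * (\<Sum>i<N. norm (coeff p (Suc i)))"
    by (simp add: sum_distrib_left)
  also have "(\<Sum>i<N. norm (coeff p (Suc i))) \<le> (\<Sum>i\<le>N. norm (coeff p i))"
    by (simp add: sum.lessThan_Suc_shift flip: lessThan_Suc_atMost del: sum.lessThan_Suc)
  also have "(\<Sum>i\<le>N. norm (coeff p i)) = pn p"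
    using pn_eq[OF assms] by simp
  finally show ?thesis by (simp add: mult_left_mono)
qed

lemma poly_eqI_infinite:
  fixes p q :: "complex poly"
  assumes "infinite {z. poly p z = poly q z}"
  shows "p = q"
proof (rule ccontr)
  assume "p \<noteq> q"
  then have "finite {z. poly (p - q) z = 0}" by (intro poly_roots_finite) simp
  then show False using assms by simp
qed

text \<open>\<open>rc N p\<close> is the polynomial \<open>z ^ N * cnj (p (1 / cnj z))\<close>, for \<open>degree p \<le> N\<close>.\<close>

definition rc :: "nat \<Rightarrow> complex poly \<Rightarrow> complex poly" where
  "rc N p = (\<Sum>i\<le>N. monom (cnj (coeff p (N - i))) i)"

lemma coeff_rc: "coeff (rc N p) i = (if i \<le> N then cnj (coeff p (N - i)) else 0)"
proof -
  have "coeff (rc N p) i = (\<Sum>j\<le>N. if j = i then cnj (coeff p (N - j)) else 0)"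
    by (simp add: rc_def coeff_sum)
  then show ?thesis by simp
qed

lemma degree_rc: "degree (rc N p) \<le> N"
  by (rule degree_le) (simp add: coeff_rc)

lemma rc_add: "rc N (p + q) = rc N p + rc N q"
  by (rule poly_eqI) (simp add: coeff_rc)

lemma rc_diff: "rc N (p - q) = rc N p - rc N q"
  by (rule poly_eqI) (simp add: coeff_rc)

lemma rc_smult: "rc N (smult c p) = smult (cnj c) (rc N p)"
  by (rule poly_eqI) (simp add: coeff_rc)

lemma rc_rc: "degree p \<le> N \<Longrightarrow> rc N (rc N p) = p"
  by (rule poly_eqI) (auto simp: coeff_rc coeff_eq_0)

lemma pn_rc: "pn (rc N p) \<le> pn p"
proof -
  have "pn (rc N p) = (\<Sum>i\<le>N. norm (coeff p (N - i)))"
    using pn_eq[OF degree_rc] by (simp add: coeff_rc)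
  also have "\<dots> = (\<Sum>i\<le>N. norm (coeff p i))"
    by (rule sum.reindex_bij_witness[of _ "\<lambda>i. N - i" "\<lambda>i. N - i"]) auto
  also have "\<dots> \<le> (\<Sum>i\<le>max N (degree p). norm (coeff p i))"
    by (rule sum_mono2) auto
  also have "\<dots> = pn p" by (rule pn_eq[symmetric]) simp
  finally show ?thesis .
qed

lemma poly_rc:
  assumes "degree p \<le> N" "z \<noteq> 0"
  shows "poly (rc N p) z = z ^ N * cnj (poly p (1 / cnj z))"
proof -
  have "poly (rc N p) z = (\<Sum>i\<le>N. cnj (coeff p (N - i)) * z ^ i)"
    by (simp add: rc_def poly_sum poly_monom)
  also have "\<dots> = (\<Sum>i\<le>N. cnj (coeff p i) * z ^ (N - i))"
    by (rule sum.reindex_bij_witness[of _ "\<lambda>i. N - i" "\<lambda>i. N - i"]) auto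
  also have "\<dots> = (\<Sum>i\<le>N. z ^ N * cnj (coeff p i * (1 / cnj z) ^ i))"
    using assms(2) by (intro sum.cong) (auto simp: power_diff power_divide)
  also have "\<dots> = z ^ N * cnj (\<Sum>i\<le>N. coeff p i * (1 / cnj z) ^ i)"
    by (simp add: sum_distrib_left cnj_sum)
  also have "(\<Sum>i\<le>N. coeff p i * (1 / cnj z) ^ i) = poly p (1 / cnj z)"
    unfolding poly_altdef using assms(1) by (intro sum.mono_neutral_right) (auto simp: coeff_eq_0)
  finally show ?thesis .
qed

lemma rc_mult:
  assumes "degree p \<le> a" "degree q \<le> b"
  shows "rc (a + b) (p * q) = rc a p * rc b q"
proof (rule poly_eqI_infinite)
  have "degree (p * q) \<le> a + b"
    using degree_mult_le[of p q] assms by linarith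
  then have "- {0} \<subseteq> {z. poly (rc (a + b) (p * q)) z = poly (rc a p * rc b q) z}"
    using assms by (auto simp: poly_rc power_add)
  moreover have "infinite (- {0 :: complex})"
    by (simp add: infinite_UNIV_char_0 finite_compl)
  ultimately show "infinite {z. poly (rc (a + b) (p * q)) z = poly (rc a p * rc b q) z}"
    using finite_subset by blast
qed

text \<open>Product and chain rule for \<open>z ^ N * cnj (p (1 / cnj z))\<close>; the factor
  \<open>z\<^sup>2\<close> clears the denominator of the inner derivative. Double roots at a point
  and at its reflection are compared by means of this formula.\<close>

lemma poly_pderiv_rc:
  assumes "degree p \<le> N" "z \<noteq> 0"
  shows "z\<^sup>2 * poly (pderiv (rc N p)) z =
    of_nat N * z ^ (N + 1) * cnj (poly p (1 / cnj z)) - z ^ N * cnj (poly (pderiv p) (1 / cnj z))"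
proof -
  have "((\<lambda>z. poly p (inverse z)) has_field_derivative
      poly (pderiv p) (inverse (cnj z)) * (- (inverse (cnj z) * 1 * inverse (cnj z)))) (at (cnj z))"
    using assms(2) by (auto intro!: derivative_eq_intros DERIV_chain2[OF poly_DERIV])
  from has_field_derivative_cnj_cnj[OF this]
  have "((\<lambda>z. cnj (poly p (inverse (cnj z)))) has_field_derivative
      cnj (poly (pderiv p) (inverse (cnj z)) * (- (inverse (cnj z) * 1 * inverse (cnj z))))) (at z)"
    by (simp only: o_def)
  from DERIV_mult[OF DERIV_power[OF DERIV_ident, of N] this]
  have d: "((\<lambda>z. z ^ N * cnj (poly p (inverse (cnj z)))) has_field_derivative
      of_nat N * z ^ (N - 1) * cnj (poly p (inverse (cnj z))) -
      z ^ N * cnj (poly (pderiv p) (inverse (cnj z))) / z\<^sup>2) (at z)"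
    by (simp add: algebra_simps divide_simps power2_eq_square)
  have "((\<lambda>z. poly (rc N p) z) has_field_derivative
      of_nat N * z ^ (N - 1) * cnj (poly p (inverse (cnj z))) -
      z ^ N * cnj (poly (pderiv p) (inverse (cnj z))) / z\<^sup>2) (at z)"
    by (rule has_field_derivative_transform_within_open[OF d, of "- {0}"])
      (use assms in \<open>auto simp: poly_rc inverse_eq_divide\<close>)
  from DERIV_unique[OF this poly_DERIV]
  have "poly (pderiv (rc N p)) z = of_nat N * z ^ (N - 1) * cnj (poly p (inverse (cnj z))) -
      z ^ N * cnj (poly (pderiv p) (inverse (cnj z))) / z\<^sup>2" by simp
  moreover have "z\<^sup>2 * (of_nat N * z ^ (N - 1)) = of_nat N * z ^ (N + 1)"
    by (cases N) (simp_all add: power2_eq_square)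
  ultimately show ?thesis
    using assms(2) by (simp add: right_diff_distrib inverse_eq_divide flip: mult.assoc)
qed

section \<open>The Bezout equation with degree bounds\<close>

definition no_common_root :: "complex poly \<Rightarrow> complex poly \<Rightarrow> bool" where
  "no_common_root A B \<longleftrightarrow> (\<forall>z. poly A z \<noteq> 0 \<or> poly B z \<noteq> 0)"

text \<open>All coefficients from index \<open>a\<close> on vanish. The zero polynomial is listed
  separately because its degree is \<open>0\<close>; this covers \<open>a = 0\<close>, the case of a
  constant modulus.\<close>

definition deg_less :: "complex poly \<Rightarrow> nat \<Rightarrow> bool" where
  "deg_less p a \<longleftrightarrow> p = 0 \<or> degree p < a"

lemma deg_less_diff: "deg_less p a \<Longrightarrow> deg_less q a \<Longrightarrow> deg_less (p - q) a"
  by (auto simp: deg_less_def intro: degree_diff_less)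

lemma deg_less_add: "deg_less p a \<Longrightarrow> deg_less q a \<Longrightarrow> deg_less (p + q) a"
  by (auto simp: deg_less_def intro: degree_add_less)

lemma deg_less_minus [simp]: "deg_less (- p) a = deg_less p a"
  by (auto simp: deg_less_def)

lemma deg_less_smult: "deg_less p a \<Longrightarrow> deg_less (smult c p) a"
  by (auto simp: deg_less_def)

lemma deg_less_sum: "(\<And>i. i \<in> I \<Longrightarrow> deg_less (f i) a) \<Longrightarrow> deg_less (\<Sum>i\<in>I. f i) a"
  by (induction I rule: infinite_finite_induct) (simp_all add: deg_less_add, simp_all add: deg_less_def)

lemma no_common_root_imp_coprime:
  assumes "no_common_root A B"
  shows "coprime A B"
proof (rule coprimeI)
  fix d assume d: "d dvd A" "d dvd B"
  show "is_unit d"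
  proof (rule ccontr)
    assume nu: "\<not> is_unit d"
    obtain z where "poly d z = 0"
    proof (cases "d = 0")
      case False
      then have "degree d \<noteq> 0" using nu by (simp add: is_unit_iff_degree)
      then have "\<not> constant (poly d)" by (metis constant_degree)
      then show ?thesis using fundamental_theorem_of_algebra that by blast
    qed (use that in auto)
    then have "poly A z = 0" "poly B z = 0" using d by (auto simp: dvd_def)
    then show False using assms by (auto simp: no_common_root_def)
  qed
qed

text \<open>Coprimality makes \<open>A\<close> divide \<open>U\<close>, whose degree is too small
  for that unless \<open>U = 0\<close>.\<close>

lemma bezout_unique:
  assumes "no_common_root A B" "A \<noteq> 0" "U * B + V * A = 0" "deg_less U (degree A)"
  shows "U = 0" "V = 0"
proof -
  have "A dvd U * B" using assms(3) by (metis dvd_minus_iff dvd_triv_right eq_neg_iff_add_eq_0)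
  then have "A dvd U"
    using no_common_root_imp_coprime[OF assms(1)] by (simp add: coprime_dvd_mult_left_iff)
  then show "U = 0" using assms(4) dvd_imp_degree_le[of A U] by (force simp: deg_less_def)
  then show "V = 0" using assms(2,3) by simp
qed

text \<open>A Bezout pair multiplied by \<open>X\<close> is normalised by reducing the cofactor of
  \<open>B\<close> modulo \<open>A\<close>; comparing degrees in the equation then bounds
  \<open>V\<close>.\<close>

lemma bezout_exists:
  assumes "no_common_root A B" "A \<noteq> 0" "degree A \<le> K" "degree B + degree A \<le> K + 1" "degree X \<le> K"
  shows "\<exists>U V. U * B + V * A = X \<and> deg_less U (degree A) \<and> degree V \<le> K - degree A"
proof -
  obtain x y where xy: "x * A + y * B = 1"
    using no_common_root_imp_coprime[OF assms(1)] bezout_coefficients_fst_snd[of A B] by auto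
  define U where "U = (X * y) mod A"
  define V where "V = X * x + (X * y) div A * B"
  have "U * B + V * A = (U + (X * y) div A * A) * B + X * (x * A)"
    by (simp add: V_def algebra_simps)
  also have "U + (X * y) div A * A = X * y" by (simp add: U_def)
  also have "X * y * B + X * (x * A) = X * (x * A + y * B)" by (simp add: algebra_simps)
  finally have eq: "U * B + V * A = X" by (simp add: xy)
  have degU: "deg_less U (degree A)"
    unfolding deg_less_def U_def using degree_mod_less[OF assms(2)] by blast
  have "degree (U * B) \<le> K"
  proof (cases "U = 0")
    case False
    then show ?thesis using degU degree_mult_le[of U B] assms(4) by (auto simp: deg_less_def)
  qed simp
  then have "degree (V * A) \<le> K"
    using eq assms(5) degree_diff_le[of X K "U * B"] by (metis add_diff_cancel_left')
  then have "degree V \<le> K - degree A"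
    using assms(2) by (cases "V = 0") (auto simp: degree_mult_eq)
  then show ?thesis using eq degU by blast
qed

lemma poly_as_sum_le: "degree p \<le> N \<Longrightarrow> p = (\<Sum>i\<le>N. monom (coeff p i) i)"
  by (rule poly_eqI) (auto simp: coeff_sum coeff_eq_0)

text \<open>Solutions for the monomials up to degree \<open>K\<close> combine linearly, and by
  uniqueness the combination is the solution for an arbitrary right-hand side. Thus the inverse of
  the Sylvester map is bounded.\<close>

lemma bezout_bound_at:
  assumes "no_common_root A B" "A \<noteq> 0" "degree A \<le> K" "degree B + degree A \<le> K + 1"
  shows "\<exists>C>0. \<forall>U V. deg_less U (degree A) \<longrightarrow> degree V \<le> K - degree A \<longrightarrow>
    pn U + pn V \<le> C * pn (U * B + V * A)"
proof -
  have "\<exists>U V. U * B + V * A = monom 1 i \<and> deg_less U (degree A) \<and> degree V \<le> K - degree A"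
    if "i \<le> K" for i
    using bezout_exists[OF assms] that by (simp add: degree_monom_eq)
  then obtain u v where uv: "\<And>i. i \<le> K \<Longrightarrow> u i * B + v i * A = monom 1 i"
    "\<And>i. i \<le> K \<Longrightarrow> deg_less (u i) (degree A)" "\<And>i. i \<le> K \<Longrightarrow> degree (v i) \<le> K - degree A"
    by metis
  define C where "C = 1 + (\<Sum>i\<le>K. pn (u i) + pn (v i))"
  have C0: "C > 0" unfolding C_def by (intro add_pos_nonneg sum_nonneg) auto
  have Ci: "pn (u i) + pn (v i) \<le> C" if "i \<le> K" for i
  proof -
    have "pn (u i) + pn (v i) \<le> (\<Sum>i\<le>K. pn (u i) + pn (v i))"
      using that by (intro member_le_sum) auto
    then show ?thesis by (simp add: C_def)
  qed
  show ?thesis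
  proof (intro exI conjI allI impI)
    fix U V :: "complex poly"
    assume U: "deg_less U (degree A)" and V: "degree V \<le> K - degree A"
    define X where "X = U * B + V * A"
    have "degree (U * B) \<le> K"
    proof (cases "U = 0")
      case False
      then show ?thesis using U degree_mult_le[of U B] assms(4) by (auto simp: deg_less_def)
    qed simp
    moreover have "degree (V * A) \<le> K" using degree_mult_le[of V A] V assms(3) by linarith
    ultimately have dX: "degree X \<le> K" unfolding X_def by (intro degree_add_le)
    define U' where "U' = (\<Sum>i\<le>K. smult (coeff X i) (u i))"
    define V' where "V' = (\<Sum>i\<le>K. smult (coeff X i) (v i))"
    have "U' * B + V' * A = (\<Sum>i\<le>K. smult (coeff X i) (u i * B + v i * A))"
      unfolding U'_def V'_def by (simp add: sum_distrib_right sum.distrib smult_add_right)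
    also have "\<dots> = (\<Sum>i\<le>K. monom (coeff X i) i)"
      by (intro sum.cong) (auto simp: uv smult_monom)
    also have "\<dots> = X" using poly_as_sum_le[OF dX] by simp
    finally have "(U - U') * B + (V - V') * A = 0" by (simp add: X_def algebra_simps)
    moreover have "deg_less (U - U') (degree A)"
      unfolding U'_def by (intro deg_less_diff U deg_less_sum deg_less_smult uv) auto
    ultimately have "U = U'" "V = V'"
      using bezout_unique[OF assms(1,2)] by (metis eq_iff_diff_eq_0)+
    then have "pn U + pn V \<le>
        (\<Sum>i\<le>K. norm (coeff X i) * pn (u i)) + (\<Sum>i\<le>K. norm (coeff X i) * pn (v i))"
      unfolding U'_def V'_def
      using pn_sum[of "\<lambda>i. smult (coeff X i) (u i)" "{..K}"]
        pn_sum[of "\<lambda>i. smult (coeff X i) (v i)" "{..K}"] by simp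
    also have "\<dots> = (\<Sum>i\<le>K. norm (coeff X i) * (pn (u i) + pn (v i)))"
      by (simp add: sum.distrib algebra_simps)
    also have "\<dots> \<le> (\<Sum>i\<le>K. norm (coeff X i) * C)"
      by (intro sum_mono mult_left_mono Ci) auto
    also have "\<dots> = C * pn X" by (simp add: pn_eq[OF dX] sum_distrib_left mult.commute)
    finally show "pn U + pn V \<le> C * pn (U * B + V * A)" by (simp add: X_def)
  qed (rule C0)
qed

text \<open>With perturbations smaller than \<open>1 / (2 * C)\<close> the error made by replacing
  \<open>A'\<close>, \<open>B'\<close> with \<open>A\<close>, \<open>B\<close> is at most half of
  the left-hand side; absorbing it doubles the constant. The degree restrictions refer to the
  unperturbed \<open>A\<close>.\<close>

lemma bezout_bound:
  assumes "no_common_root A B" "A \<noteq> 0" "degree A \<le> K" "degree B + degree A \<le> K + 1"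
  shows "\<exists>e>0. \<exists>C>0. \<forall>A' B' U V. pn (A' - A) < e \<longrightarrow> pn (B' - B) < e \<longrightarrow>
    deg_less U (degree A) \<longrightarrow> degree V \<le> K - degree A \<longrightarrow> pn U + pn V \<le> C * pn (U * B' + V * A')"
proof -
  obtain C where C: "C > 0" "\<And>U V. deg_less U (degree A) \<Longrightarrow> degree V \<le> K - degree A \<Longrightarrow>
    pn U + pn V \<le> C * pn (U * B + V * A)"
    using bezout_bound_at[OF assms] by blast
  show ?thesis
  proof (rule exI[of _ "1 / (2 * C)"], intro conjI exI[of _ "2 * C"] allI impI)
    fix A' B' U V :: "complex poly"
    assume e: "pn (A' - A) < 1 / (2 * C)" "pn (B' - B) < 1 / (2 * C)"
      and UV: "deg_less U (degree A)" "degree V \<le> K - degree A"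
    define P where "P = U * B' + V * A'"
    have "U * B + V * A = P - (U * (B' - B) + V * (A' - A))"
      by (simp add: P_def algebra_simps)
    then have "pn (U * B + V * A) \<le> pn P + pn (U * (B' - B) + V * (A' - A))"
      by (simp only: pn_diff)
    then have "pn (U * B + V * A) \<le> pn P + (pn U * pn (B' - B) + pn V * pn (A' - A))"
      using pn_diff[of P "U * (B' - B) + V * (A' - A)"]
        pn_add[of "U * (B' - B)" "V * (A' - A)"] pn_mult[of U "B' - B"] pn_mult[of V "A' - A"]
      by linarith
    also have "\<dots> \<le> pn P + (pn U * (1 / (2 * C)) + pn V * (1 / (2 * C)))"
      using e by (intro add_left_mono add_mono mult_left_mono) auto
    finally have "C * pn (U * B + V * A) \<le> C * (pn P + (pn U * (1 / (2 * C)) + pn V * (1 / (2 * C))))"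
      using C(1) by (simp add: mult_left_mono)
    also have "\<dots> = C * pn P + (pn U + pn V) / 2" using C(1) by (simp add: field_simps)
    finally have "pn U + pn V \<le> 2 * (C * pn P)"
      using C(2)[OF UV] by (smt (verit) field_sum_of_halves)
    then show "pn U + pn V \<le> 2 * C * pn (U * B' + V * A')"
      by (simp add: P_def mult.assoc)
  qed (use C in auto)
qed

text \<open>Cancelling the linear factor of a common root of \<open>A'\<close> and \<open>B'\<close>
  produces the nonzero pair \<open>(A1, - B1)\<close> in the kernel of the perturbed Bezout map,
  against its lower bound.\<close>

lemma no_common_root_open:
  assumes "no_common_root A B" "A \<noteq> 0" "degree A \<le> K" "degree B + degree A \<le> K + 1"
  shows "\<exists>e>0. \<forall>A' B'. pn (A' - A) < e \<longrightarrow> pn (B' - B) < e \<longrightarrow> degree A' = degree A \<longrightarrow> A' \<noteq> 0 \<longrightarrow>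
    degree B' + degree A \<le> K + 1 \<longrightarrow> no_common_root A' B'"
proof -
  obtain e C where e: "e > 0" "C > 0" "\<And>A' B' U V. pn (A' - A) < e \<Longrightarrow> pn (B' - B) < e \<Longrightarrow>
    deg_less U (degree A) \<Longrightarrow> degree V \<le> K - degree A \<Longrightarrow> pn U + pn V \<le> C * pn (U * B' + V * A')"
    using bezout_bound[OF assms] by metis
  show ?thesis
  proof (intro exI[of _ e] conjI allI impI e(1))
    fix A' B' assume near: "pn (A' - A) < e" "pn (B' - B) < e" and A': "degree A' = degree A" "A' \<noteq> 0"
      and B': "degree B' + degree A \<le> K + 1"
    show "no_common_root A' B'"
      unfolding no_common_root_def
    proof (rule allI, rule ccontr)
      fix z assume "\<not> (poly A' z \<noteq> 0 \<or> poly B' z \<noteq> 0)"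
      then obtain A1 B1 where 1: "A' = [:- z, 1:] * A1" "B' = [:- z, 1:] * B1"
        by (auto simp: poly_eq_0_iff_dvd dvd_def)
      have "A1 \<noteq> 0" using A' 1 by auto
      then have dA: "degree A = Suc (degree A1)" using A' 1 by (subst (asm) 1(1)) (simp add: degree_mult_eq del: mult_pCons_left)
      have "degree B1 \<le> K - degree A"
      proof (cases "B1 = 0")
        case False
        then have "degree B' = Suc (degree B1)" by (subst 1(2)) (simp add: degree_mult_eq del: mult_pCons_left)
        then show ?thesis using B' by linarith
      qed simp
      then have "pn A1 + pn (- B1) \<le> C * pn (A1 * B' + (- B1) * A')"
        using dA by (intro e(3)[OF near]) (auto simp: deg_less_def)
      also have "A1 * B' + (- B1) * A' = 0" unfolding 1 by (simp add: algebra_simps)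
      finally have "pn A1 = 0" using pn_nonneg[of A1] pn_nonneg[of "B1"] by (simp only: pn_minus pn_0)
      then show False using \<open>A1 \<noteq> 0\<close> by simp
    qed
  qed
qed

text \<open>Under the hypotheses of \<open>bez_spec\<close> the pair is unique by
  \<open>bezout_unique\<close>, so the choice operator merely turns the Bezout solution into a
  function of the data.\<close>

definition bez :: "nat \<Rightarrow> complex poly \<Rightarrow> complex poly \<Rightarrow> complex poly \<Rightarrow> complex poly \<times> complex poly" where
  "bez K A B X = (SOME (U, V). U * B + V * A = X \<and> deg_less U (degree A) \<and> degree V \<le> K - degree A)"

lemma bez_spec:
  assumes "no_common_root A B" "A \<noteq> 0" "degree A \<le> K" "degree B + degree A \<le> K + 1" "degree X \<le> K"
  shows "fst (bez K A B X) * B + snd (bez K A B X) * A = X"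
    "deg_less (fst (bez K A B X)) (degree A)" "degree (snd (bez K A B X)) \<le> K - degree A"
proof -
  have "case bez K A B X of (U, V) \<Rightarrow>
    U * B + V * A = X \<and> deg_less U (degree A) \<and> degree V \<le> K - degree A"
    unfolding bez_def using bezout_exists[OF assms] by (intro someI_ex[where P = "\<lambda>(U, V). U * B + V * A = X \<and> deg_less U (degree A) \<and> degree V \<le> K - degree A"]) auto
  then show "fst (bez K A B X) * B + snd (bez K A B X) * A = X"
    "deg_less (fst (bez K A B X)) (degree A)" "degree (snd (bez K A B X)) \<le> K - degree A"
    by (auto simp: case_prod_beta)
qed

section \<open>Locally Lipschitz polynomial-valued maps\<close>

text \<open>Both points vary near \<open>x0\<close>, so this is a Lipschitz bound on a neighbourhood
  and not only a comparison with \<open>x0\<close>. In filter form such bounds combine without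
  explicit radii.\<close>

definition loc_lip :: "('a::metric_space \<Rightarrow> complex poly) \<Rightarrow> 'a \<Rightarrow> bool" where
  "loc_lip f x0 \<longleftrightarrow>
    (\<exists>C. \<forall>\<^sub>F (x, y) in nhds x0 \<times>\<^sub>F nhds x0. pn (f x - f y) \<le> C * dist x y)"

lemma loc_lipI:
  assumes "\<forall>\<^sub>F (x, y) in nhds x0 \<times>\<^sub>F nhds x0. pn (f x - f y) \<le> C * dist x y"
  shows "loc_lip f x0"
  using assms unfolding loc_lip_def by blast

lemma loc_lipE:
  assumes "loc_lip f x0"
  obtains C where "0 \<le> C" "\<forall>\<^sub>F (x, y) in nhds x0 \<times>\<^sub>F nhds x0. pn (f x - f y) \<le> C * dist x y"
proof -
  obtain C where C: "\<forall>\<^sub>F (x, y) in nhds x0 \<times>\<^sub>F nhds x0. pn (f x - f y) \<le> C * dist x y"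
    using assms unfolding loc_lip_def by blast
  have "\<forall>\<^sub>F (x, y) in nhds x0 \<times>\<^sub>F nhds x0. pn (f x - f y) \<le> \<bar>C\<bar> * dist x y"
    using C by eventually_elim (auto intro: order_trans[OF _ mult_right_mono[OF abs_ge_self]])
  then show ?thesis using that[of "\<bar>C\<bar>"] by simp
qed

lemma eventually_pair_nhds:
  assumes "\<forall>\<^sub>F x in nhds x0. P x"
  shows "\<forall>\<^sub>F (x, y) in nhds x0 \<times>\<^sub>F nhds x0. P x \<and> P y"
  using eventually_prodI[OF assms assms] by (simp add: case_prod_unfold)

lemma loc_lip_near:
  assumes "loc_lip f x0"
  obtains C where "0 \<le> C" "\<forall>\<^sub>F x in nhds x0. pn (f x - f x0) \<le> C * dist x x0"
proof -
  obtain C where C: "0 \<le> C" "\<forall>\<^sub>F (x, y) in nhds x0 \<times>\<^sub>F nhds x0. pn (f x - f y) \<le> C * dist x y"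
    using loc_lipE[OF assms] .
  obtain P Q where PQ: "eventually P (nhds x0)" "eventually Q (nhds x0)"
    "\<And>x y. P x \<Longrightarrow> Q y \<Longrightarrow> pn (f x - f y) \<le> C * dist x y"
    using C(2) unfolding eventually_prod_filter by auto
  have "Q x0" using PQ(2) by (rule eventually_nhds_x_imp_x)
  have "\<forall>\<^sub>F x in nhds x0. pn (f x - f x0) \<le> C * dist x x0"
    by (rule eventually_mono[OF PQ(1)]) (use PQ(3) \<open>Q x0\<close> in blast)
  then show ?thesis using that C(1) by blast
qed

lemma loc_lip_close:
  assumes "loc_lip f x0" "0 < e"
  shows "\<forall>\<^sub>F x in nhds x0. pn (f x - f x0) < e"
proof -
  obtain C where C: "0 \<le> C" "\<forall>\<^sub>F x in nhds x0. pn (f x - f x0) \<le> C * dist x x0"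
    using loc_lip_near[OF assms(1)] .
  have "\<forall>\<^sub>F x in nhds x0. dist x x0 < e / (C + 1)"
    using C(1) assms(2) by (auto simp: eventually_nhds_metric intro!: exI[of _ "e / (C + 1)"])
  then show ?thesis using C(2)
  proof eventually_elim
    case (elim x)
    have "C * dist x x0 \<le> C * (e / (C + 1))" using elim C(1) by (intro mult_left_mono) auto
    also have "\<dots> < e" using C(1) assms(2) by (simp add: field_simps)
    finally show ?case using elim by linarith
  qed
qed

lemma loc_lip_bounded:
  assumes "loc_lip f x0"
  obtains M where "0 \<le> M" "\<forall>\<^sub>F x in nhds x0. pn (f x) \<le> M"
proof (rule that[of "pn (f x0) + 1"])
  show "\<forall>\<^sub>F x in nhds x0. pn (f x) \<le> pn (f x0) + 1"
    using loc_lip_close[OF assms zero_less_one]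
  proof eventually_elim
    case (elim x)
    then show ?case using pn_le_diff[of "f x" "f x0"] by linarith
  qed
qed simp

lemma loc_lip_const: "loc_lip (\<lambda>_. p) x0"
  by (rule loc_lipI[where C = 0]) (simp add: case_prod_unfold)

lemma loc_lip_add:
  assumes "loc_lip f x0" "loc_lip g x0"
  shows "loc_lip (\<lambda>x. f x + g x) x0"
proof -
  obtain C where C: "\<forall>\<^sub>F (x, y) in nhds x0 \<times>\<^sub>F nhds x0. pn (f x - f y) \<le> C * dist x y"
    using loc_lipE[OF assms(1)] .
  obtain D where D: "\<forall>\<^sub>F (x, y) in nhds x0 \<times>\<^sub>F nhds x0. pn (g x - g y) \<le> D * dist x y"
    using loc_lipE[OF assms(2)] .
  show ?thesis
  proof (rule loc_lipI[where C = "C + D"])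
    show "\<forall>\<^sub>F (x, y) in nhds x0 \<times>\<^sub>F nhds x0. pn (f x + g x - (f y + g y)) \<le> (C + D) * dist x y"
      using C D
    proof eventually_elim
      case (elim z)
      obtain x y where z: "z = (x, y)" by force
      have "f x + g x - (f y + g y) = (f x - f y) + (g x - g y)" by simp
      then have "pn (f x + g x - (f y + g y)) \<le> pn (f x - f y) + pn (g x - g y)" by (metis pn_add)
      then show ?case using elim by (simp add: z algebra_simps)
    qed
  qed
qed

lemma loc_lip_dominated:
  assumes "loc_lip f x0" "\<forall>\<^sub>F (x, y) in nhds x0 \<times>\<^sub>F nhds x0. pn (g x - g y) \<le> K * pn (f x - f y)" "0 \<le> K"
  shows "loc_lip g x0"
proof -
  obtain C where C: "\<forall>\<^sub>F (x, y) in nhds x0 \<times>\<^sub>F nhds x0. pn (f x - f y) \<le> C * dist x y"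
    using loc_lipE[OF assms(1)] .
  show ?thesis
  proof (rule loc_lipI[where C = "K * C"])
    show "\<forall>\<^sub>F (x, y) in nhds x0 \<times>\<^sub>F nhds x0. pn (g x - g y) \<le> K * C * dist x y"
      using C assms(2)
    proof eventually_elim
      case (elim z)
      then show ?case using mult_left_mono[OF _ assms(3)]
        by (cases z) (fastforce simp: mult.assoc intro: order_trans)
    qed
  qed
qed

lemma loc_lip_smult: "loc_lip f x0 \<Longrightarrow> loc_lip (\<lambda>x. smult c (f x)) x0"
  by (rule loc_lip_dominated[where K = "norm c"])
    (auto simp: case_prod_unfold simp flip: smult_diff_right)

lemma loc_lip_minus: "loc_lip f x0 \<Longrightarrow> loc_lip (\<lambda>x. - f x) x0"
  using loc_lip_smult[of f x0 "- 1"] by simp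

lemma loc_lip_diff: "loc_lip f x0 \<Longrightarrow> loc_lip g x0 \<Longrightarrow> loc_lip (\<lambda>x. f x - g x) x0"
  using loc_lip_add[OF _ loc_lip_minus, of f x0 g] by simp

lemma loc_lip_rc: "loc_lip f x0 \<Longrightarrow> loc_lip (\<lambda>x. rc N (f x)) x0"
  by (rule loc_lip_dominated[where K = 1]) (auto simp: case_prod_unfold pn_rc simp flip: rc_diff)

lemma loc_lip_pderiv:
  assumes "loc_lip f x0" "\<forall>\<^sub>F x in nhds x0. degree (f x) \<le> N"
  shows "loc_lip (\<lambda>x. pderiv (f x)) x0"
proof (rule loc_lip_dominated[OF assms(1), where K = "real N"])
  show "\<forall>\<^sub>F (x, y) in nhds x0 \<times>\<^sub>F nhds x0. pn (pderiv (f x) - pderiv (f y)) \<le> real N * pn (f x - f y)"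
    using eventually_pair_nhds[OF assms(2)]
    by eventually_elim (auto simp: case_prod_unfold intro: pn_pderiv degree_diff_le simp flip: pderiv_diff)
qed simp

lemma loc_lip_mult:
  assumes "loc_lip f x0" "loc_lip g x0"
  shows "loc_lip (\<lambda>x. f x * g x) x0"
proof -
  obtain C where C: "0 \<le> C" "\<forall>\<^sub>F (x, y) in nhds x0 \<times>\<^sub>F nhds x0. pn (f x - f y) \<le> C * dist x y"
    using loc_lipE[OF assms(1)] .
  obtain D where D: "0 \<le> D" "\<forall>\<^sub>F (x, y) in nhds x0 \<times>\<^sub>F nhds x0. pn (g x - g y) \<le> D * dist x y"
    using loc_lipE[OF assms(2)] .
  obtain M where M: "0 \<le> M" "\<forall>\<^sub>F x in nhds x0. pn (f x) \<le> M"
    using loc_lip_bounded[OF assms(1)] .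
  obtain N where N: "0 \<le> N" "\<forall>\<^sub>F x in nhds x0. pn (g x) \<le> N"
    using loc_lip_bounded[OF assms(2)] .
  show ?thesis
  proof (rule loc_lipI[where C = "C * N + M * D"])
    show "\<forall>\<^sub>F (x, y) in nhds x0 \<times>\<^sub>F nhds x0. pn (f x * g x - f y * g y) \<le> (C * N + M * D) * dist x y"
      using C(2) D(2) eventually_pair_nhds[OF M(2)] eventually_pair_nhds[OF N(2)]
    proof eventually_elim
      case (elim z)
      obtain x y where z: "z = (x, y)" by force
      have "f x * g x - f y * g y = (f x - f y) * g x + f y * (g x - g y)"
        by (simp add: algebra_simps)
      then have "pn (f x * g x - f y * g y) \<le> pn (f x - f y) * pn (g x) + pn (f y) * pn (g x - g y)"
        using pn_add[of "(f x - f y) * g x" "f y * (g x - g y)"] pn_mult[of "f x - f y" "g x"]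
          pn_mult[of "f y" "g x - g y"] by simp
      also have "\<dots> \<le> (C * dist x y) * N + M * (D * dist x y)"
        using elim C(1) D(1) M(1) N(1) by (intro add_mono mult_mono) (auto simp: z)
      finally show ?case by (simp add: z algebra_simps)
    qed
  qed
qed

text \<open>The difference of two solutions solves a Bezout equation whose right-hand side consists
  of differences of the data, multiplied by solutions that stay bounded. The constant of
  \<open>bezout_bound\<close> is uniform near \<open>x0\<close>, which makes the solution operator
  locally Lipschitz.\<close>

lemma loc_lip_bez:
  assumes A: "loc_lip A x0" and B: "loc_lip B x0" and X: "loc_lip X x0"
    and nc: "no_common_root (A x0) (B x0)"
    and deg: "\<forall>\<^sub>F x in nhds x0. A x \<noteq> 0 \<and> degree (A x) = a \<and> degree (B x) + a \<le> K + 1 \<and> degree (X x) \<le> K"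
    and "a \<le> K"
  shows "\<forall>\<^sub>F x in nhds x0. no_common_root (A x) (B x)" (is ?nc)
    and "loc_lip (\<lambda>x. fst (bez K (A x) (B x) (X x))) x0"
    and "loc_lip (\<lambda>x. snd (bez K (A x) (B x) (X x))) x0"
proof -
  have d0: "A x0 \<noteq> 0" "degree (A x0) = a" "degree (B x0) + degree (A x0) \<le> K + 1" "degree (A x0) \<le> K"
    using eventually_nhds_x_imp_x[OF deg] assms(6) by auto
  obtain e1 where e1: "e1 > 0" "\<And>A' B'. pn (A' - A x0) < e1 \<Longrightarrow> pn (B' - B x0) < e1 \<Longrightarrow>
    degree A' = degree (A x0) \<Longrightarrow> A' \<noteq> 0 \<Longrightarrow> degree B' + degree (A x0) \<le> K + 1 \<Longrightarrow> no_common_root A' B'"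
    using no_common_root_open[OF nc d0(1,4,3)] by metis
  show nce: ?nc
    using loc_lip_close[OF A e1(1)] loc_lip_close[OF B e1(1)] deg
    by eventually_elim (rule e1(2), auto simp: d0)
  define U where "U x = fst (bez K (A x) (B x) (X x))" for x
  define V where "V x = snd (bez K (A x) (B x) (X x))" for x
  have spec: "\<forall>\<^sub>F x in nhds x0. U x * B x + V x * A x = X x \<and> deg_less (U x) a \<and> degree (V x) \<le> K - a"
    using nce deg
  proof eventually_elim
    case (elim x)
    then show ?case using bez_spec[of "A x" "B x" K "X x"] assms(6) unfolding U_def V_def by auto
  qed
  obtain e C where e: "e > 0" "C > 0" "\<And>A' B' U V. pn (A' - A x0) < e \<Longrightarrow> pn (B' - B x0) < e \<Longrightarrow>
    deg_less U (degree (A x0)) \<Longrightarrow> degree V \<le> K - degree (A x0) \<Longrightarrow> pn U + pn V \<le> C * pn (U * B' + V * A')"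
    using bezout_bound[OF nc d0(1,4,3)] by metis
  obtain MX where MX: "0 \<le> MX" "\<forall>\<^sub>F x in nhds x0. pn (X x) \<le> MX"
    using loc_lip_bounded[OF X] .
  have bd: "\<forall>\<^sub>F x in nhds x0. pn (U x) + pn (V x) \<le> C * MX"
    using loc_lip_close[OF A e(1)] loc_lip_close[OF B e(1)] spec MX(2)
  proof eventually_elim
    case (elim x)
    then have "pn (U x) + pn (V x) \<le> C * pn (X x)" using e(3)[of "A x" "B x" "U x" "V x"] d0 by auto
    also have "\<dots> \<le> C * MX" using elim e(2) by simp
    finally show ?case .
  qed
  obtain CA where CA: "0 \<le> CA" "\<forall>\<^sub>F (x, y) in nhds x0 \<times>\<^sub>F nhds x0. pn (A x - A y) \<le> CA * dist x y"
    using loc_lipE[OF A] .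
  obtain CB where CB: "0 \<le> CB" "\<forall>\<^sub>F (x, y) in nhds x0 \<times>\<^sub>F nhds x0. pn (B x - B y) \<le> CB * dist x y"
    using loc_lipE[OF B] .
  obtain CX where CX: "0 \<le> CX" "\<forall>\<^sub>F (x, y) in nhds x0 \<times>\<^sub>F nhds x0. pn (X x - X y) \<le> CX * dist x y"
    using loc_lipE[OF X] .
  define M where "M = C * (CX + C * MX * CB + C * MX * CA)"
  have main: "\<forall>\<^sub>F (x, y) in nhds x0 \<times>\<^sub>F nhds x0. pn (U x - U y) + pn (V x - V y) \<le> M * dist x y"
    using CA(2) CB(2) CX(2) eventually_pair_nhds[OF spec] eventually_pair_nhds[OF bd]
      eventually_pair_nhds[OF loc_lip_close[OF A e(1)]] eventually_pair_nhds[OF loc_lip_close[OF B e(1)]]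
  proof eventually_elim
    case (elim z)
    obtain x y where z: "z = (x, y)" by force
    note el = elim[unfolded z, simplified]
    have "pn (U x - U y) + pn (V x - V y) \<le> C * pn ((U x - U y) * B x + (V x - V y) * A x)"
      using el by (intro e(3)) (auto simp: d0 intro: deg_less_diff degree_diff_le)
    also have "(U x - U y) * B x + (V x - V y) * A x =
        (U x * B x + V x * A x) - (U y * B y + V y * A y) - (U y * (B x - B y) + V y * (A x - A y))"
      by (simp add: algebra_simps)
    also have "\<dots> = X x - X y - (U y * (B x - B y) + V y * (A x - A y))"
      using el by simp
    also have "pn \<dots> \<le> pn (X x - X y) + (pn (U y) * pn (B x - B y) + pn (V y) * pn (A x - A y))"
      using pn_diff[of "X x - X y" "U y * (B x - B y) + V y * (A x - A y)"]
        pn_add[of "U y * (B x - B y)" "V y * (A x - A y)"] pn_mult[of "U y" "B x - B y"]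
        pn_mult[of "V y" "A x - A y"] by linarith
    also have "\<dots> \<le> CX * dist x y + ((C * MX) * (CB * dist x y) + (C * MX) * (CA * dist x y))"
    proof -
      have "pn (U y) \<le> C * MX" "pn (V y) \<le> C * MX"
        using el pn_nonneg[of "U y"] pn_nonneg[of "V y"] by linarith+
      then show ?thesis
        using el e(2) MX(1) CA(1) CB(1) by (intro add_mono mult_mono) auto
    qed
    finally have "pn (U x - U y) + pn (V x - V y) \<le>
      C * (CX * dist x y + ((C * MX) * (CB * dist x y) + (C * MX) * (CA * dist x y)))"
      using e(2) by simp
    then show ?case by (simp add: z M_def algebra_simps)
  qed
  have "\<forall>\<^sub>F (x, y) in nhds x0 \<times>\<^sub>F nhds x0. pn (U x - U y) \<le> M * dist x y"
    using main
  proof eventually_elim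
    case (elim z)
    then show ?case using pn_nonneg[of "V (fst z) - V (snd z)"] unfolding case_prod_unfold by linarith
  qed
  then show "loc_lip (\<lambda>x. fst (bez K (A x) (B x) (X x))) x0"
    unfolding U_def by (rule loc_lipI)
  have "\<forall>\<^sub>F (x, y) in nhds x0 \<times>\<^sub>F nhds x0. pn (V x - V y) \<le> M * dist x y"
    using main
  proof eventually_elim
    case (elim z)
    then show ?case using pn_nonneg[of "U (fst z) - U (snd z)"] unfolding case_prod_unfold by linarith
  qed
  then show "loc_lip (\<lambda>x. snd (bez K (A x) (B x) (X x))) x0"
    unfolding V_def by (rule loc_lipI)
qed

section \<open>Ordinary differential equations\<close>

lemma connected_local_iff:
  fixes I :: "'a::metric_space set"
  assumes "connected I" and loc: "\<And>t. t \<in> I \<Longrightarrow> \<exists>e>0. \<forall>s\<in>I. dist s t < e \<longrightarrow> (P s \<longleftrightarrow> P t)"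
    and "t0 \<in> I" "P t0" "t \<in> I"
  shows "P t"
proof -
  have "P t0 \<longleftrightarrow> P t"
  proof (rule connected_equivalence_relation[OF assms(1,3,5), of "\<lambda>x y. P x \<longleftrightarrow> P y"])
    fix a assume "a \<in> I"
    then obtain e where e: "e > 0" "\<And>s. s \<in> I \<Longrightarrow> dist s a < e \<Longrightarrow> P s \<longleftrightarrow> P a"
      using loc by blast
    have "openin (top_of_set I) (I \<inter> ball a e)" "a \<in> I \<inter> ball a e"
      using \<open>a \<in> I\<close> e(1) by (auto simp: openin_open_Int)
    moreover have "\<forall>x\<in>I \<inter> ball a e. P a \<longleftrightarrow> P x"
      using e(2) by (metis IntE dist_commute mem_ball)
    ultimately show "\<exists>T. openin (top_of_set I) T \<and> a \<in> T \<and> (\<forall>x\<in>T. P a \<longleftrightarrow> P x)"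
      by blast
  qed blast+
  then show ?thesis using assms(4) by simp
qed

lemma vector_derivative_bound:
  fixes f :: "real \<Rightarrow> 'a::real_normed_vector"
  assumes "convex S" "\<And>x. x \<in> S \<Longrightarrow> (f has_vector_derivative f' x) (at x within S)"
    and "\<And>x. x \<in> S \<Longrightarrow> norm (f' x) \<le> B" "x \<in> S" "y \<in> S"
  shows "norm (f x - f y) \<le> B * \<bar>x - y\<bar>"
proof -
  have "onorm (\<lambda>h. h *\<^sub>R f' x) \<le> B" if "x \<in> S" for x
    by (rule onorm_le) (use assms(3)[OF that] in \<open>simp add: mult.commute[of B] mult_left_mono\<close>)
  then show ?thesis
    using differentiable_bound[OF assms(1), of f "\<lambda>x h. h *\<^sub>R f' x" B x y] assms(2,4,5)
    by (auto simp: has_vector_derivative_def)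
qed

text \<open>Gronwall's argument: on a segment of length below \<open>d\<close> starting at a zero,
  with \<open>\<bar>C\<bar> * d \<le> 1 / 2\<close>, the maximum of the norm is at most half of
  itself. So the zero set is open in \<open>I\<close> as well as closed. The linear bound is asked
  only near zeros of \<open>y\<close>, because for a difference of two solutions the Lipschitz
  estimate is available only where they are close.\<close>

lemma linear_bound_imp_zero:
  fixes y :: "real \<Rightarrow> 'a::real_normed_vector"
  assumes "convex I" and deriv: "\<And>t. t \<in> I \<Longrightarrow> (y has_vector_derivative y' t) (at t within I)"
    and loc: "\<And>t. t \<in> I \<Longrightarrow> y t = 0 \<Longrightarrow>
      \<exists>e>0. \<exists>C. \<forall>s\<in>I. dist s t < e \<longrightarrow> norm (y' s) \<le> C * norm (y s)"
    and "t0 \<in> I" "y t0 = 0" "t \<in> I"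
  shows "y t = 0"
proof (rule connected_local_iff[of I "\<lambda>t. y t = 0" t0])
  have cont: "continuous_on I y"
    using deriv by (intro continuous_on_vector_derivative)
  fix t assume t: "t \<in> I"
  show "\<exists>e>0. \<forall>s\<in>I. dist s t < e \<longrightarrow> (y s = 0 \<longleftrightarrow> y t = 0)"
  proof (cases "y t = 0")
    case False
    then obtain e where "e > 0" "\<forall>s\<in>I. dist s t < e \<longrightarrow> dist (y s) (y t) < norm (y t)"
      using cont[unfolded continuous_on_iff, rule_format, OF t, of "norm (y t)"] by auto
    then show ?thesis using False by (intro exI[of _ e]) (auto simp: dist_norm)
  next
    case True
    obtain e C where e: "e > 0" "\<And>s. s \<in> I \<Longrightarrow> dist s t < e \<Longrightarrow> norm (y' s) \<le> C * norm (y s)"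
      using loc[OF t True] by blast
    define d where "d = min e (1 / (2 * (\<bar>C\<bar> + 1)))"
    have d: "d > 0" "d \<le> e" "\<bar>C\<bar> * d \<le> 1 / 2"
    proof -
      have "\<bar>C\<bar> * d \<le> \<bar>C\<bar> * (1 / (2 * (\<bar>C\<bar> + 1)))" by (rule mult_left_mono) (auto simp: d_def)
      also have "\<dots> \<le> 1 / 2" by (simp add: field_simps)
      finally show "\<bar>C\<bar> * d \<le> 1 / 2" .
    qed (use e in \<open>auto simp: d_def\<close>)
    have "y s = 0" if s: "s \<in> I" "dist s t < d" for s
    proof -
      define S where "S = closed_segment t s"
      have SI: "S \<subseteq> I" unfolding S_def using closed_segment_subset[OF t s(1) assms(1)] .
      have Sd: "dist u t < d" if "u \<in> S" for u
        using that s(2) segment_bound1[of u t s] by (simp add: S_def dist_norm)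
      have "compact S" "S \<noteq> {}" by (auto simp: S_def)
      then obtain u where u: "u \<in> S" "\<And>v. v \<in> S \<Longrightarrow> norm (y v) \<le> norm (y u)"
        using continuous_attains_sup[of S "\<lambda>v. norm (y v)"]
          continuous_on_norm[OF continuous_on_subset[OF cont SI]] by blast
      have "norm (y u - y t) \<le> (\<bar>C\<bar> * norm (y u)) * \<bar>u - t\<bar>"
      proof (rule vector_derivative_bound[of S])
        show "convex S" "u \<in> S" "t \<in> S" using u by (auto simp: S_def)
        fix x assume x: "x \<in> S"
        show "(y has_vector_derivative y' x) (at x within S)"
          using SI x by (intro has_vector_derivative_within_subset[OF deriv]) auto
        have "norm (y' x) \<le> C * norm (y x)"
          by (rule e(2)) (use x SI Sd[OF x] d(2) in auto)
        also have "\<dots> \<le> \<bar>C\<bar> * norm (y u)" using u(2)[OF x] by (intro mult_mono) auto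
        finally show "norm (y' x) \<le> \<bar>C\<bar> * norm (y u)" .
      qed
      also have "\<dots> \<le> (\<bar>C\<bar> * norm (y u)) * d"
        using Sd[OF u(1)] by (intro mult_left_mono) (auto simp: dist_norm)
      also have "\<dots> = (\<bar>C\<bar> * d) * norm (y u)" by simp
      also have "\<dots> \<le> 1 / 2 * norm (y u)" using d(3) by (intro mult_right_mono) auto
      finally have "norm (y u) = 0" using True by simp
      moreover have "norm (y s) \<le> norm (y u)" by (intro u(2)) (simp add: S_def)
      ultimately show ?thesis by simp
    qed
    then show ?thesis using True d(1) by blast
  qed
qed (use assms in \<open>auto simp: convex_connected\<close>)

text \<open>The base time \<open>t0\<close> may be any point of the interval, so the solution extends to both sides.\<close>

lemma picard_lindelof:
  fixes F :: "real \<Rightarrow> 'a::banach \<Rightarrow> 'a"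
  assumes cont: "continuous_on ({a..b} \<times> cball x0 r) (\<lambda>(t, x). F t x)"
    and bound: "\<And>t x. t \<in> {a..b} \<Longrightarrow> x \<in> cball x0 r \<Longrightarrow> norm (F t x) \<le> M"
    and lip: "\<And>t x y. t \<in> {a..b} \<Longrightarrow> x \<in> cball x0 r \<Longrightarrow> y \<in> cball x0 r \<Longrightarrow>
      norm (F t x - F t y) \<le> K * norm (x - y)"
    and "0 \<le> r" "(b - a) * M \<le> r" "0 \<le> M" "0 \<le> K" "(b - a) * K < 1" and t0: "t0 \<in> {a..b}"
  shows "\<exists>x. x t0 = x0 \<and> (\<forall>t\<in>{a..b}. x t \<in> cball x0 r \<and>
    (x has_vector_derivative F t (x t)) (at t within {a..b}))"
proof -
  \<comment> \<open>Functions are continued constantly outside \<open>{a..b}\<close>, so that the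
    iteration acts on the complete space of bounded continuous functions on the whole line.\<close>
  define cl where "cl t = max a (min b t)" for t :: real
  have cl: "cl t \<in> {a..b}" for t using t0 by (auto simp: cl_def)
  have cl_id: "cl t = t" if "t \<in> {a..b}" for t using that by (auto simp: cl_def)
  have cl_cont: "continuous_on UNIV cl" unfolding cl_def by (intro continuous_intros)
  define S where "S = PiC UNIV (\<lambda>_::real. cball x0 r)"
  define J where "J \<phi> t = integral {a..t} (\<lambda>s. F s (apply_bcontfun \<phi> s))" for \<phi> t
  \<comment> \<open>Subtracting \<open>J \<phi> t0\<close> moves the base point of the integral from
    \<open>a\<close> to \<open>t0\<close>.\<close>
  define T where "T \<phi> = Bcontfun (\<lambda>t. x0 + J \<phi> (cl t) - J \<phi> t0)" for \<phi>
  have in_ball: "apply_bcontfun \<phi> t \<in> cball x0 r" if "\<phi> \<in> S" for \<phi> t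
    using that by (auto simp: S_def mem_PiC_iff)
  have gcont: "continuous_on {a..b} (\<lambda>s. F s (apply_bcontfun \<phi> s))" if "\<phi> \<in> S" for \<phi>
  proof -
    have "continuous_on {a..b} (\<lambda>s. (s, apply_bcontfun \<phi> s))"
      by (intro continuous_intros continuous_on_apply_bcontfun)
    from continuous_on_compose2[OF cont this] show ?thesis using in_ball[OF that] by fastforce
  qed
  have Jd: "(J \<phi> has_vector_derivative F t (apply_bcontfun \<phi> t)) (at t within {a..b})"
    if "\<phi> \<in> S" "t \<in> {a..b}" for \<phi> t
    unfolding J_def using integral_has_vector_derivative[OF gcont[OF that(1)] that(2)] .
  have Jb: "norm (J \<phi> u - J \<phi> v) \<le> r" if "\<phi> \<in> S" "u \<in> {a..b}" "v \<in> {a..b}" for \<phi> u v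
  proof -
    have "norm (J \<phi> u - J \<phi> v) \<le> M * \<bar>u - v\<bar>"
      by (rule vector_derivative_bound[of "{a..b}" _ "\<lambda>t. F t (apply_bcontfun \<phi> t)"])
        (use that Jd bound in_ball in auto)
    also have "\<dots> \<le> M * (b - a)" using that \<open>0 \<le> M\<close> by (intro mult_left_mono) auto
    finally show ?thesis using assms(5) by (simp add: mult.commute)
  qed
  have Tapp: "apply_bcontfun (T \<phi>) t = x0 + J \<phi> (cl t) - J \<phi> t0" if "\<phi> \<in> S" for \<phi> t
  proof -
    have "continuous_on {a..b} (J \<phi>)"
      using Jd[OF that] by (intro continuous_on_vector_derivative)
    then have "continuous_on UNIV (\<lambda>t. x0 + J \<phi> (cl t) - J \<phi> t0)"
      using cl by (intro continuous_intros continuous_on_compose2[OF _ cl_cont, of "{a..b}" "J \<phi>"]) auto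
    moreover have "norm (x0 + J \<phi> (cl t) - J \<phi> t0) \<le> norm x0 + r" for t
      using norm_triangle_ineq[of x0 "J \<phi> (cl t) - J \<phi> t0"] Jb[OF that cl t0, of t] by (simp add: add_diff_eq)
    ultimately have "(\<lambda>t. x0 + J \<phi> (cl t) - J \<phi> t0) \<in> bcontfun" by (rule bcontfun_normI)
    then show ?thesis by (simp add: T_def Bcontfun_inverse)
  qed
  have "\<exists>!\<phi>\<in>S. T \<phi> = \<phi>"
  proof (rule Banach_fix[of S "(b - a) * K"])
    show "complete S" unfolding S_def complete_eq_closed by (rule closed_PiC) auto
    have "const_bcontfun x0 \<in> S" using \<open>0 \<le> r\<close> by (auto simp: S_def mem_PiC_iff)
    then show "S \<noteq> {}" by blast
    show "T ` S \<subseteq> S"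
    proof safe
      fix \<phi> assume "\<phi> \<in> S"
      have "dist x0 (apply_bcontfun (T \<phi>) t) \<le> r" for t
        unfolding dist_norm Tapp[OF \<open>\<phi> \<in> S\<close>]
        using Jb[OF \<open>\<phi> \<in> S\<close> t0 cl, of t] by (simp add: algebra_simps)
      then show "T \<phi> \<in> S"
        unfolding S_def mem_PiC_iff by auto
    qed
    fix \<phi> \<psi> assume *: "\<phi> \<in> S" "\<psi> \<in> S"
    show "dist (T \<phi>) (T \<psi>) \<le> (b - a) * K * dist \<phi> \<psi>"
    proof (rule dist_bound)
      fix t
      have "norm ((J \<phi> (cl t) - J \<psi> (cl t)) - (J \<phi> t0 - J \<psi> t0)) \<le> (K * dist \<phi> \<psi>) * \<bar>cl t - t0\<bar>"
      proof (rule vector_derivative_bound[of "{a..b}"])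
        fix s assume s: "s \<in> {a..b}"
        show "((\<lambda>t. J \<phi> t - J \<psi> t) has_vector_derivative
          F s (apply_bcontfun \<phi> s) - F s (apply_bcontfun \<psi> s)) (at s within {a..b})"
          using * s by (intro has_vector_derivative_diff Jd)
        have "norm (F s (apply_bcontfun \<phi> s) - F s (apply_bcontfun \<psi> s)) \<le>
            K * norm (apply_bcontfun \<phi> s - apply_bcontfun \<psi> s)"
          using * s by (intro lip in_ball)
        also have "\<dots> \<le> K * dist \<phi> \<psi>"
          using dist_bounded[of \<phi> s \<psi>] \<open>0 \<le> K\<close> by (intro mult_left_mono) (auto simp: dist_norm)
        finally show "norm (F s (apply_bcontfun \<phi> s) - F s (apply_bcontfun \<psi> s)) \<le> K * dist \<phi> \<psi>" .
      qed (use cl t0 in auto)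
      also have "\<dots> \<le> (K * dist \<phi> \<psi>) * (b - a)"
        using cl[of t] t0 \<open>0 \<le> K\<close> by (intro mult_left_mono) auto
      finally show "dist (apply_bcontfun (T \<phi>) t) (apply_bcontfun (T \<psi>) t) \<le> (b - a) * K * dist \<phi> \<psi>"
        using * by (simp add: Tapp dist_norm algebra_simps)
    qed
  qed (use assms t0 in auto)
  then obtain \<phi> where \<phi>: "\<phi> \<in> S" "T \<phi> = \<phi>" by blast
  show ?thesis
  proof (intro exI[of _ "apply_bcontfun \<phi>"] conjI ballI)
    show "apply_bcontfun \<phi> t0 = x0" using Tapp[OF \<phi>(1), of t0] \<phi>(2) cl_id[OF t0] by simp
    fix t assume t: "t \<in> {a..b}"
    show "apply_bcontfun \<phi> t \<in> cball x0 r" using in_ball[OF \<phi>(1)] .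
    have "((\<lambda>t. x0 + J \<phi> t - J \<phi> t0) has_vector_derivative F t (apply_bcontfun \<phi> t)) (at t within {a..b})"
      using Jd[OF \<phi>(1) t] by (auto intro!: derivative_eq_intros)
    then show "(apply_bcontfun \<phi> has_vector_derivative F t (apply_bcontfun \<phi> t)) (at t within {a..b})"
      by (rule has_vector_derivative_transform[OF t, rotated])
        (use Tapp[OF \<phi>(1)] \<phi>(2) cl_id in auto)
  qed
qed

section \<open>Derivatives known off a countable set of times\<close>

text \<open>If \<open>f b < f a\<close>, uncountably many levels lie in between, so one of them,
  \<open>y\<close>, is not attained on \<open>E\<close>. At the last time where \<open>f\<close> is
  at least \<open>y\<close> the value is exactly \<open>y\<close>; the derivative there is positive,
  hence \<open>f\<close> exceeds \<open>y\<close> a little later, a contradiction.\<close>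

lemma nondecreasing_off_countable:
  fixes f :: "real \<Rightarrow> real"
  assumes cont: "continuous_on {a..b} f" and "a \<le> b" "countable E"
    and pos: "\<And>t. t \<in> {a..<b} - E \<Longrightarrow> \<exists>D>0. (f has_real_derivative D) (at t within {a..b})"
  shows "f a \<le> f b"
proof (rule ccontr)
  assume "\<not> f a \<le> f b"
  then have "uncountable {f b<..<f a}" by (simp add: uncountable_open_interval)
  moreover have "countable (f ` E)" using assms(3) by simp
  ultimately obtain y where y: "f b < y" "y < f a" "y \<notin> f ` E"
    by (metis countable_subset greaterThanLessThan_iff subsetI)
  define S where "S = {a..b} \<inter> f -` {y..}"
  have "closed S" unfolding S_def by (intro continuous_closed_preimage cont) auto
  moreover have "bounded S" unfolding S_def by (metis Int_lower1 bounded_closed_interval bounded_subset)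
  ultimately have "compact S" by (simp add: compact_eq_bounded_closed)
  moreover have "a \<in> S" using y assms(2) by (auto simp: S_def)
  ultimately obtain t0 where t0: "t0 \<in> S" "\<And>t. t \<in> S \<Longrightarrow> t \<le> t0"
    using compact_attains_sup[of S] by blast
  have t0b: "t0 < b" "a \<le> t0" using t0(1) y(1) by (auto simp: S_def order_less_le)
  have ft0: "f t0 = y"
  proof -
    obtain t where t: "t0 \<le> t" "t \<le> b" "f t = y"
      using IVT2'[of f b y t0] y t0(1) t0b continuous_on_subset[OF cont, of "{t0..b}"]
      by (auto simp: S_def)
    then have "t \<in> S" using t0b by (auto simp: S_def)
    then have "t = t0" using t0(2) t(1) by force
    then show ?thesis using t by simp
  qed
  then obtain D where D: "D > 0" "(f has_real_derivative D) (at t0 within {a..b})"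
    using pos[of t0] t0b y(3) by auto
  obtain d where d: "d > 0" "\<And>h. 0 < h \<Longrightarrow> t0 + h \<in> {a..b} \<Longrightarrow> h < d \<Longrightarrow> f t0 < f (t0 + h)"
    using has_real_derivative_pos_inc_right[OF D(2,1)] by blast
  define h where "h = min (d / 2) (b - t0)"
  have "h > 0" "t0 + h \<in> {a..b}" "h < d" using d(1) t0b by (auto simp: h_def)
  then have "t0 + h \<in> S" using d(2)[of h] ft0 by (auto simp: S_def)
  then show False using t0(2) \<open>h > 0\<close> by force
qed

text \<open>Suppose the derivative at \<open>t0\<close> is below a slope \<open>c < F t0\<close>. To
  the right of \<open>t0\<close> the continuous \<open>F\<close> stays above \<open>c\<close>, so
  \<open>f t - c * t\<close> is nondecreasing there by the countable-exception criterion, although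
  its derivative at \<open>t0\<close> is negative. The opposite inequality comes from the same
  statement for \<open>- f\<close>.\<close>

lemma real_derivative_eq_off_countable:
  fixes f :: "real \<Rightarrow> real"
  assumes deriv: "\<And>t. t \<in> {a..<b} \<Longrightarrow> (f has_real_derivative f' t) (at t within {a..<b})"
    and cont: "continuous_on {a..<b} F" and "countable E"
    and eq: "\<And>t. t \<in> {a..<b} - E \<Longrightarrow> f' t = F t" and t0: "t0 \<in> {a..<b}"
  shows "F t0 \<le> f' t0"
proof (rule ccontr)
  assume "\<not> F t0 \<le> f' t0"
  then obtain c where c: "f' t0 < c" "c < F t0" using dense by (metis not_le)
  obtain e where e: "e > 0" "\<And>s. s \<in> {a..<b} \<Longrightarrow> dist s t0 < e \<Longrightarrow> dist (F s) (F t0) < F t0 - c"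
    using cont t0 c(2) unfolding continuous_on_iff by (metis diff_gt_0_iff_gt)
  have "((\<lambda>t. f t - c * t) has_real_derivative f' t0 - c) (at t0 within {a..<b})"
    using deriv[OF t0] by (auto intro!: derivative_eq_intros)
  from has_real_derivative_neg_dec_right[OF this]
  obtain d where d: "d > 0" "\<And>h. 0 < h \<Longrightarrow> t0 + h \<in> {a..<b} \<Longrightarrow> h < d \<Longrightarrow> f (t0 + h) - c * (t0 + h) < f t0 - c * t0"
    using c(1) by auto
  define h where "h = min (min (d / 2) (e / 2)) ((b - t0) / 2)"
  have h: "h > 0" "h < d" "h < e" "t0 + h < b" using d(1) e(1) t0 by (auto simp: h_def min_def field_simps)
  have sub: "{t0..t0 + h} \<subseteq> {a..<b}" using h t0 by auto
  have "continuous_on {a..<b} f" using deriv by (intro DERIV_continuous_on) auto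
  then have "f t0 - c * t0 \<le> f (t0 + h) - c * (t0 + h)"
  proof (intro nondecreasing_off_countable[where f = "\<lambda>t. f t - c * t" and E = E])
    fix t assume t: "t \<in> {t0..<t0 + h} - E"
    then have tI: "t \<in> {a..<b}" using h t0 by auto
    have "F t > c" using e(2)[OF tI] t h by (auto simp: dist_real_def)
    moreover have "((\<lambda>t. f t - c * t) has_real_derivative f' t - c) (at t within {t0..t0 + h})"
      using DERIV_subset[OF deriv[OF tI] sub] by (auto intro!: derivative_eq_intros)
    ultimately show "\<exists>D>0. ((\<lambda>t. f t - c * t) has_real_derivative D) (at t within {t0..t0 + h})"
      using eq[of t] t tI by (intro exI[of _ "f' t - c"]) auto
  qed (use h assms(3) continuous_on_subset[OF _ sub] in \<open>auto intro!: continuous_intros\<close>)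
  moreover have "t0 + h \<in> {a..<b}" using h t0 by auto
  ultimately show False using d(2)[of h] h by force
qed

lemma vector_derivative_eq_off_countable:
  fixes f :: "real \<Rightarrow> complex"
  assumes deriv: "\<And>t. t \<in> {a..<b} \<Longrightarrow> (f has_vector_derivative f' t) (at t within {a..<b})"
    and cont: "continuous_on {a..<b} F" and "countable E"
    and eq: "\<And>t. t \<in> {a..<b} - E \<Longrightarrow> f' t = F t" and t0: "t0 \<in> {a..<b}"
  shows "f' t0 = F t0"
proof -
  have *: "u (F t0) \<le> u (f' t0)" if u: "bounded_linear u" for u :: "complex \<Rightarrow> real"
  proof (rule real_derivative_eq_off_countable[of a b "\<lambda>t. u (f t)" "\<lambda>t. u (f' t)" "\<lambda>t. u (F t)" E])
    fix t assume "t \<in> {a..<b}"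
    then show "((\<lambda>t. u (f t)) has_real_derivative u (f' t)) (at t within {a..<b})"
      using bounded_linear.has_vector_derivative[OF u deriv]
      by (simp add: has_real_derivative_iff_has_vector_derivative)
  qed (use assms in \<open>auto intro: bounded_linear.continuous_on[OF u]\<close>)
  show ?thesis
    using *[OF bounded_linear_Re] *[OF bounded_linear_Im]
      *[OF bounded_linear_minus[OF bounded_linear_Re]] *[OF bounded_linear_minus[OF bounded_linear_Im]]
    by (auto simp: complex_eq_iff)
qed

text \<open>Every point is cut out by an interval with rational end points, and different points
  have different intervals.\<close>

lemma countable_if_all_isolated:
  fixes E :: "real set"
  assumes "\<And>x. x \<in> E \<Longrightarrow> \<not> x islimpt E"
  shows "countable E"
proof -
  have "\<exists>a b. a \<in> \<rat> \<and> b \<in> \<rat> \<and> a < x \<and> x < b \<and> E \<inter> {a<..<b} = {x}" if "x \<in> E" for x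
  proof -
    obtain e where e: "e > 0" "\<And>y. y \<in> E \<Longrightarrow> dist y x < e \<Longrightarrow> y = x"
      using assms[OF \<open>x \<in> E\<close>] unfolding islimpt_approachable by blast
    obtain a where a: "a \<in> \<rat>" "x - e < a" "a < x" using Rats_dense_in_real[of "x - e" x] e(1) by auto
    obtain b where b: "b \<in> \<rat>" "x < b" "b < x + e" using Rats_dense_in_real[of x "x + e"] e(1) by auto
    have "E \<inter> {a<..<b} = {x}" using a b e(2) that by (auto simp: dist_real_def)
    then show ?thesis using a b by blast
  qed
  then obtain \<alpha> \<beta> where ab: "\<And>x. x \<in> E \<Longrightarrow> \<alpha> x \<in> \<rat> \<and> \<beta> x \<in> \<rat> \<and> E \<inter> {\<alpha> x<..<\<beta> x} = {x}"
    by metis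
  have "inj_on (\<lambda>x. (\<alpha> x, \<beta> x)) E"
    using ab by (intro inj_onI) (metis Pair_inject singleton_inject)
  moreover have "countable ((\<lambda>x. (\<alpha> x, \<beta> x)) ` E)"
    by (rule countable_subset[of _ "\<rat> \<times> \<rat>"]) (use ab in \<open>auto simp: countable_rat\<close>)
  ultimately show ?thesis using countable_image_inj_on by blast
qed

section \<open>Paths of polynomials\<close>

definition pcont :: "(real \<Rightarrow> complex poly) \<Rightarrow> real set \<Rightarrow> bool" where
  "pcont P I \<longleftrightarrow> (\<forall>i. continuous_on I (\<lambda>t. coeff (P t) i))"

definition has_pder :: "(real \<Rightarrow> complex poly) \<Rightarrow> complex poly \<Rightarrow> real filter \<Rightarrow> bool" where
  "has_pder P P' F \<longleftrightarrow> (\<forall>i. ((\<lambda>t. coeff (P t) i) has_vector_derivative coeff P' i) F)"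

lemma pcont_const: "pcont (\<lambda>_. p) I"
  by (simp add: pcont_def)

lemma pcont_mult: "pcont P I \<Longrightarrow> pcont Q I \<Longrightarrow> pcont (\<lambda>t. P t * Q t) I"
  by (auto simp: pcont_def coeff_mult intro!: continuous_intros)

lemma pcont_smult: "continuous_on I c \<Longrightarrow> pcont P I \<Longrightarrow> pcont (\<lambda>t. smult (c t) (P t)) I"
  by (auto simp: pcont_def intro!: continuous_intros)

lemma pcont_linear: "continuous_on I c \<Longrightarrow> pcont (\<lambda>t. [:- c t, 1:]) I"
  unfolding pcont_def
proof
  fix i assume *: "continuous_on I c"
  consider "i = 0" | "i = 1" | j where "i = Suc (Suc j)" by (metis One_nat_def not0_implies_Suc)
  then show "continuous_on I (\<lambda>t. coeff [:- c t, 1:] i)"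
    using * by cases (auto intro!: continuous_intros)
qed

lemma pcont_prod: "(\<And>k. k \<in> A \<Longrightarrow> pcont (P k) I) \<Longrightarrow> pcont (\<lambda>t. \<Prod>k\<in>A. P k t) I"
  by (induction A rule: infinite_finite_induct) (auto intro: pcont_mult pcont_const)

lemma pcont_rc: "pcont P I \<Longrightarrow> pcont (\<lambda>t. rc N (P t)) I"
  unfolding pcont_def coeff_rc
proof
  fix i assume "\<forall>i. continuous_on I (\<lambda>t. coeff (P t) i)"
  then show "continuous_on I (\<lambda>t. if i \<le> N then cnj (coeff (P t) (N - i)) else 0)"
    by (cases "i \<le> N") (auto intro!: continuous_intros)
qed

lemma pcont_pderiv: "pcont P I \<Longrightarrow> pcont (\<lambda>t. pderiv (P t)) I"
  by (auto simp: pcont_def coeff_pderiv intro!: continuous_intros)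

lemma pcont_subset: "pcont P I \<Longrightarrow> J \<subseteq> I \<Longrightarrow> pcont P J"
  by (auto simp: pcont_def intro: continuous_on_subset)

lemma poly_eq_sum_le:
  fixes p :: "complex poly"
  shows "degree p \<le> N \<Longrightarrow> poly p z = (\<Sum>i\<le>N. coeff p i * z ^ i)"
  unfolding poly_altdef by (intro sum.mono_neutral_left) (auto simp: coeff_eq_0)

lemma continuous_on_poly_path:
  assumes "pcont P I" "\<And>t. t \<in> I \<Longrightarrow> degree (P t) \<le> N"
    and "continuous_on X f" "continuous_on X g" "\<And>x. x \<in> X \<Longrightarrow> f x \<in> I"
  shows "continuous_on X (\<lambda>x. poly (P (f x)) (g x))"
proof -
  have "continuous_on X (\<lambda>x. \<Sum>i\<le>N. coeff (P (f x)) i * g x ^ i)"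
    using assms(1,5) unfolding pcont_def
    by (intro continuous_intros assms(4)) (auto intro!: continuous_on_compose2[OF _ assms(3)])
  then show ?thesis
    by (rule continuous_on_eq) (use assms(2,5) in \<open>simp add: poly_eq_sum_le[of _ N]\<close>)
qed

lemma has_pder_const: "has_pder (\<lambda>_. p) 0 F"
  by (simp add: has_pder_def)

lemma has_pder_diff: "has_pder P P' F \<Longrightarrow> has_pder Q Q' F \<Longrightarrow> has_pder (\<lambda>t. P t - Q t) (P' - Q') F"
  by (auto simp: has_pder_def intro!: derivative_eq_intros)

lemma has_pder_mult:
  assumes "has_pder P P' (at t within I)" "has_pder Q Q' (at t within I)"
  shows "has_pder (\<lambda>t. P t * Q t) (P t * Q' + P' * Q t) (at t within I)"
proof -
  have "((\<lambda>t. \<Sum>i\<le>k. coeff (P t) i * coeff (Q t) (k - i)) has_vector_derivative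
      (\<Sum>i\<le>k. coeff (P t) i * coeff Q' (k - i) + coeff P' i * coeff (Q t) (k - i))) (at t within I)" for k
    using assms unfolding has_pder_def
    by (intro has_vector_derivative_sum has_vector_derivative_mult) auto
  then show ?thesis unfolding has_pder_def by (simp add: coeff_mult sum.distrib)
qed

lemma has_pder_linear:
  "(c has_vector_derivative c') F \<Longrightarrow> has_pder (\<lambda>t. [:- c t, 1:]) [:- c':] F"
  unfolding has_pder_def
proof
  fix i assume *: "(c has_vector_derivative c') F"
  consider "i = 0" | "i = 1" | j where "i = Suc (Suc j)" by (metis One_nat_def not0_implies_Suc)
  then show "((\<lambda>t. coeff [:- c t, 1:] i) has_vector_derivative coeff [:- c':] i) F"
    using * by cases (auto intro!: derivative_eq_intros)
qed

lemma has_pder_pderiv: "has_pder P P' F \<Longrightarrow> has_pder (\<lambda>t. pderiv (P t)) (pderiv P') F"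
  unfolding has_pder_def coeff_pderiv
  by (auto intro!: bounded_linear.has_vector_derivative[OF bounded_linear_mult_right] simp del: of_nat_Suc)

lemma has_pder_prod:
  assumes "\<And>k. k \<in> A \<Longrightarrow> (c k has_vector_derivative c' k) (at t within I)" "finite A"
  shows "has_pder (\<lambda>t. \<Prod>k\<in>A. [:- c k t, 1:])
    (\<Sum>k\<in>A. smult (- c' k) (\<Prod>j\<in>A - {k}. [:- c j t, 1:])) (at t within I)"
  using assms(2,1)
proof (induction A rule: finite_induct)
  case (insert x A)
  have "has_pder (\<lambda>t. [:- c x t, 1:] * (\<Prod>k\<in>A. [:- c k t, 1:]))
      ([:- c x t, 1:] * (\<Sum>k\<in>A. smult (- c' k) (\<Prod>j\<in>A - {k}. [:- c j t, 1:])) +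
       [:- c' x:] * (\<Prod>k\<in>A. [:- c k t, 1:])) (at t within I)"
    using insert by (intro has_pder_mult has_pder_linear insert.IH) auto
  also have "[:- c x t, 1:] * (\<Sum>k\<in>A. smult (- c' k) (\<Prod>j\<in>A - {k}. [:- c j t, 1:])) =
      (\<Sum>k\<in>A. smult (- c' k) (\<Prod>j\<in>insert x A - {k}. [:- c j t, 1:]))"
    unfolding sum_distrib_left
  proof (rule sum.cong[OF refl])
    fix k assume k: "k \<in> A"
    then have "insert x A - {k} = insert x (A - {k})" using insert by auto
    then have "(\<Prod>j\<in>insert x A - {k}. [:- c j t, 1:]) = [:- c x t, 1:] * (\<Prod>j\<in>A - {k}. [:- c j t, 1:])"
      using insert by simp
    then show "[:- c x t, 1:] * smult (- c' k) (\<Prod>j\<in>A - {k}. [:- c j t, 1:]) =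
      smult (- c' k) (\<Prod>j\<in>insert x A - {k}. [:- c j t, 1:])" by (simp only: mult_smult_right)
  qed
  finally show ?case using insert by (simp add: add.commute insert_Diff_if)
qed (simp add: has_pder_const)

lemma has_vector_derivative_poly_path:
  assumes "has_pder P P' (at t within I)" "\<And>s. degree (P s) \<le> N" "degree P' \<le> N"
    and z: "(z has_vector_derivative z') (at t within I)"
  shows "((\<lambda>s. poly (P s) (z s)) has_vector_derivative
    poly P' (z t) + poly (pderiv (P t)) (z t) * z') (at t within I)"
proof -
  have pw: "((\<lambda>s. z s ^ i) has_vector_derivative z' * (of_nat i * z t ^ (i - 1))) (at t within I)" for i
  proof -
    have "((\<lambda>x. x ^ i) has_field_derivative of_nat i * z t ^ (i - 1)) (at (z t) within z ` I)"
      by (auto intro!: derivative_eq_intros)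
    from field_vector_diff_chain_within[OF z this] show ?thesis by (simp add: o_def mult_ac)
  qed
  have "((\<lambda>s. \<Sum>i\<le>N. coeff (P s) i * z s ^ i) has_vector_derivative
    (\<Sum>i\<le>N. coeff (P t) i * (z' * (of_nat i * z t ^ (i - 1))) + coeff P' i * z t ^ i)) (at t within I)"
    using assms(1) unfolding has_pder_def
    by (intro has_vector_derivative_sum has_vector_derivative_mult pw) auto
  also have "(\<Sum>i\<le>N. coeff (P t) i * (z' * (of_nat i * z t ^ (i - 1))) + coeff P' i * z t ^ i) =
    (\<Sum>i\<le>N. of_nat i * coeff (P t) i * z t ^ (i - 1)) * z' + poly P' (z t)"
    by (simp add: sum.distrib sum_distrib_left poly_eq_sum_le[OF assms(3)] mult_ac)
  also have "(\<Sum>i\<le>N. of_nat i * coeff (P t) i * z t ^ (i - 1)) = poly (pderiv (P t)) (z t)"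
  proof -
    have "((\<lambda>x. \<Sum>i\<le>N. coeff (P t) i * x ^ i) has_field_derivative
      (\<Sum>i\<le>N. coeff (P t) i * (of_nat i * z t ^ (i - 1)))) (at (z t))"
      by (auto intro!: derivative_eq_intros simp: mult.commute)
    then have "(poly (P t) has_field_derivative
      (\<Sum>i\<le>N. coeff (P t) i * (of_nat i * z t ^ (i - 1)))) (at (z t))"
      by (subst (asm) poly_eq_sum_le[OF assms(2), symmetric])
    from DERIV_unique[OF this poly_DERIV] show ?thesis by (simp add: mult_ac)
  qed
  finally show ?thesis
    by (simp add: poly_eq_sum_le[OF assms(2)] add.commute)
qed

lemma has_pder_imp_pcont:
  assumes "\<And>t. t \<in> I \<Longrightarrow> has_pder P (P' t) (at t within I)"
  shows "pcont P I"
  unfolding pcont_def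
proof
  fix i show "continuous_on I (\<lambda>t. coeff (P t) i)"
    by (rule continuous_on_vector_derivative[where f' = "\<lambda>t. coeff (P' t) i"])
      (use assms in \<open>auto simp: has_pder_def\<close>)
qed

section \<open>Coefficient vectors\<close>

text \<open>The bounded sequences form one Banach space for all degrees, so \<open>m\<close> and
  \<open>n\<close> can remain variables instead of entering a type.\<close>

definition pvec :: "complex poly \<Rightarrow> nat \<Rightarrow>\<^sub>C complex" where
  "pvec p = Bcontfun (coeff p)"

definition unvec :: "nat \<Rightarrow> (nat \<Rightarrow>\<^sub>C complex) \<Rightarrow> complex poly" where
  "unvec N x = (\<Sum>i<N. monom (apply_bcontfun x i) i)"

lemma apply_pvec [simp]: "apply_bcontfun (pvec p) i = coeff p i"
proof -
  have "coeff p \<in> bcontfun"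
    by (rule bcontfun_normI[of _ "pn p"]) (auto simp: norm_coeff_le_pn)
  then show ?thesis by (simp add: pvec_def Bcontfun_inverse)
qed

lemma norm_pvec_le: "norm (pvec p) \<le> pn p"
  by (rule norm_bound) (simp add: norm_coeff_le_pn)

lemma pvec_add: "pvec (p + q) = pvec p + pvec q"
  and pvec_diff: "pvec (p - q) = pvec p - pvec q"
  and pvec_scaleR: "pvec (smult (of_real r) p) = r *\<^sub>R pvec p"
  and pvec_0 [simp]: "pvec 0 = 0"
  by (auto intro!: bcontfun_eqI simp: plus_bcontfun.rep_eq minus_bcontfun.rep_eq
      scaleR_bcontfun.rep_eq zero_bcontfun.rep_eq scaleR_conv_of_real)

lemma pvec_sum: "pvec (\<Sum>i\<in>A. f i) = (\<Sum>i\<in>A. pvec (f i))"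
  by (induction A rule: infinite_finite_induct) (auto simp: pvec_add)

lemma pvec_eq_0_iff [simp]: "pvec p = 0 \<longleftrightarrow> p = 0"
  by (metis apply_pvec poly_eqI pvec_0)

lemma bounded_linear_apply_bcontfun: "bounded_linear (\<lambda>x::nat \<Rightarrow>\<^sub>C complex. apply_bcontfun x i)"
  by (rule bounded_linear_intro[of _ 1])
    (auto simp: plus_bcontfun.rep_eq scaleR_bcontfun.rep_eq norm_bounded)

lemma bounded_linear_pvec_monom: "bounded_linear (\<lambda>c. pvec (monom c i))"
proof (rule bounded_linear_intro[of _ 1])
  show "pvec (monom (x + y) i) = pvec (monom x i) + pvec (monom y i)" for x y
    by (simp add: add_monom flip: pvec_add)
  show "pvec (monom (r *\<^sub>R x) i) = r *\<^sub>R pvec (monom x i)" for r x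
    by (simp add: smult_monom scaleR_conv_of_real flip: pvec_scaleR)
  show "norm (pvec (monom x i)) \<le> norm x * 1" for x
    using norm_pvec_le[of "monom x i"] by simp
qed

lemma pvec_eq_sum: "degree p \<le> N \<Longrightarrow> pvec p = (\<Sum>i\<le>N. pvec (monom (coeff p i) i))"
  using poly_as_sum_le[of p N] by (metis pvec_sum)

lemma has_vector_derivative_pvec:
  assumes "has_pder P P' F" "\<And>s. degree (P s) \<le> N" "degree P' \<le> N"
  shows "((\<lambda>s. pvec (P s)) has_vector_derivative pvec P') F"
proof -
  have "((\<lambda>s. \<Sum>i\<le>N. pvec (monom (coeff (P s) i) i)) has_vector_derivative
      (\<Sum>i\<le>N. pvec (monom (coeff P' i) i))) F"
    using assms(1) unfolding has_pder_def
    by (intro has_vector_derivative_sum bounded_linear.has_vector_derivative[OF bounded_linear_pvec_monom]) auto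
  then show ?thesis by (simp flip: pvec_eq_sum[OF assms(2)] pvec_eq_sum[OF assms(3)])
qed

lemma continuous_on_pvec:
  assumes "pcont P I" "\<And>s. s \<in> I \<Longrightarrow> degree (P s) \<le> N"
  shows "continuous_on I (\<lambda>s. pvec (P s))"
proof -
  have "continuous_on I (\<lambda>s. \<Sum>i\<le>N. pvec (monom (coeff (P s) i) i))"
    using assms(1) unfolding pcont_def
    by (intro continuous_on_sum bounded_linear.continuous_on[OF bounded_linear_pvec_monom]) auto
  then show ?thesis
    by (rule continuous_on_eq) (simp add: pvec_eq_sum[OF assms(2)])
qed

lemma coeff_unvec: "coeff (unvec N x) i = (if i < N then apply_bcontfun x i else 0)"
proof -
  have "coeff (unvec N x) i = (\<Sum>j<N. if j = i then apply_bcontfun x j else 0)"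
    by (simp add: unvec_def coeff_sum)
  then show ?thesis by simp
qed

lemma degree_unvec_le: "degree (unvec (Suc N) x) \<le> N"
  by (rule degree_le) (simp add: coeff_unvec)

lemma pn_unvec_diff: "pn (unvec N x - unvec N y) \<le> real N * dist x y"
proof -
  have "unvec N x - unvec N y = (\<Sum>i<N. monom (apply_bcontfun x i - apply_bcontfun y i) i)"
    by (simp add: unvec_def diff_monom flip: sum_subtractf)
  then have "pn (unvec N x - unvec N y) \<le> (\<Sum>i<N. norm (apply_bcontfun x i - apply_bcontfun y i))"
    using pn_sum[of "\<lambda>i. monom (apply_bcontfun x i - apply_bcontfun y i) i" "{..<N}"] by simp
  also have "\<dots> \<le> (\<Sum>i<N. dist x y)"
    by (intro sum_mono) (metis dist_norm dist_bounded)
  finally show ?thesis by simp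
qed

lemma unvec_pvec: "deg_less p N \<Longrightarrow> unvec N (pvec p) = p"
  by (rule poly_eqI) (auto simp: coeff_unvec deg_less_def coeff_eq_0)

lemma loc_lip_coeff_tendsto:
  assumes "loc_lip f (x t0)" "(x \<longlongrightarrow> x t0) F"
  shows "((\<lambda>t. coeff (f (x t)) i) \<longlongrightarrow> coeff (f (x t0)) i) F"
proof (rule tendstoI)
  fix e :: real assume "0 < e"
  have "\<forall>\<^sub>F t in F. pn (f (x t) - f (x t0)) < e"
    using assms(2) loc_lip_close[OF assms(1) \<open>0 < e\<close>]
    unfolding filterlim_def le_filter_def eventually_filtermap by blast
  then show "\<forall>\<^sub>F t in F. dist (coeff (f (x t)) i) (coeff (f (x t0)) i) < e"
  proof eventually_elim
    case (elim t)
    then show ?case using norm_coeff_le_pn[of "f (x t) - f (x t0)" i] by (simp add: dist_norm)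
  qed
qed

section \<open>The vector field on numerators and denominators\<close>

text \<open>The last clause combines two conditions: \<open>G\<close> does not vanish at the origin,
  and no root of \<open>G\<close> is the reflection of a root, itself included. As absence of common
  roots they are open in the coefficients and feed the Bezout equation for
  \<open>Lp\<close>.\<close>

definition good :: "nat \<Rightarrow> nat \<Rightarrow> complex poly \<Rightarrow> complex poly \<Rightarrow> bool" where
  "good m n G S \<longleftrightarrow> n \<le> m \<and> G \<noteq> 0 \<and> degree G = m \<and> degree S = n \<and> lead_coeff S = 1 \<and>
    no_common_root S G \<and> no_common_root G (pCons 0 (rc m G))"

definition Hp :: "nat \<Rightarrow> nat \<Rightarrow> complex poly \<Rightarrow> complex poly" where
  "Hp m n S = smult 2 (monom 1 (m - n) * S * rc n S)"

lemma goodD: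
  assumes "good m n G S"
  shows "n \<le> m" "G \<noteq> 0" "degree G = m" "degree S = n" "lead_coeff S = 1"
    "no_common_root S G" "no_common_root G (pCons 0 (rc m G))" "S \<noteq> 0"
  using assms by (auto simp: good_def)

lemma no_common_root_minus [simp]: "no_common_root A (- B) = no_common_root A B"
  by (simp add: no_common_root_def)

text \<open>\<open>Lp / G\<close> is \<open>P + R\<close> for \<open>q = 1\<close> and \<open>B = A\<close>. Taking the Bezout coefficient divisible by \<open>z\<close>
  makes \<open>Lp / G\<close> real at the origin, see \<open>Lp_normalised\<close>.\<close>

definition Lp :: "nat \<Rightarrow> nat \<Rightarrow> complex poly \<Rightarrow> complex poly \<Rightarrow> complex poly" where
  "Lp m n G S = (let UV = bez (2 * m) G (pCons 0 (rc m G)) (Hp m n S)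
    in smult (1 / 2) (pCons 0 (fst UV) + rc m (snd UV)))"

text \<open>\<open>S\<^sup>2\<close> times the derivative of the flux
  \<open>z L / S\<close>.\<close>

definition transport :: "complex poly \<Rightarrow> complex poly \<Rightarrow> complex poly" where
  "transport L S = pderiv (pCons 0 L) * S - pCons 0 L * pderiv S"

lemma poly_transport:
  "poly (transport L S) z =
    (poly L z + z * poly (pderiv L) z) * poly S z - z * poly L z * poly (pderiv S) z"
  by (simp add: transport_def pderiv_pCons del: mult_pCons_left)

text \<open>Velocity of the denominator for \<open>q = 1\<close>, and \<open>Gv\<close> that of the
  numerator. Taking \<open>S\<close> as the modulus of the Bezout equation gives \<open>Sv\<close>
  degree below \<open>n\<close>, so that the denominator stays monic.\<close>

definition Sv :: "nat \<Rightarrow> nat \<Rightarrow> complex poly \<Rightarrow> complex poly \<Rightarrow> complex poly" where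
  "Sv m n G S = fst (bez (m + n) S (- G) (transport (Lp m n G S) S))"

definition Gv :: "nat \<Rightarrow> nat \<Rightarrow> complex poly \<Rightarrow> complex poly \<Rightarrow> complex poly" where
  "Gv m n G S = snd (bez (m + n) S (- G) (transport (Lp m n G S) S))"

lemma degree_pCons_le': "degree p \<le> N \<Longrightarrow> degree (pCons a p) \<le> Suc N"
  using degree_pCons_le[of a p] by linarith

lemma degree_mult_le': "degree p \<le> a \<Longrightarrow> degree q \<le> b \<Longrightarrow> degree (p * q) \<le> a + b"
  for p q :: "complex poly"
  using degree_mult_le[of p q] by linarith

lemma degree_Hp:
  assumes "n \<le> m" "degree S \<le> n"
  shows "degree (Hp m n S) \<le> 2 * m"
proof -
  have "degree (monom 1 (m - n) * S * rc n S) \<le> (m - n) + n + n"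
    by (intro degree_mult_le' degree_monom_le assms degree_rc)
  then show ?thesis using assms(1) degree_smult_le[of 2 "monom 1 (m - n) * S * rc n S"]
    unfolding Hp_def by linarith
qed

lemma rc_monom: "k \<le> N \<Longrightarrow> rc N (monom c k) = monom (cnj c) (N - k)"
  by (rule poly_eqI) (auto simp: coeff_rc)

lemma rc_monom_half: "rc (2 * k) (monom 1 k) = monom 1 k"
  by (simp add: rc_monom)

text \<open>The monomial sits at the middle exponent and \<open>S * rc n S\<close> is its own
  conjugate reciprocal. Since the right-hand side is invariant, the reciprocal of a solution of the
  Bezout equation solves the reciprocal equation with the same right-hand side.\<close>

lemma rc_Hp:
  assumes "n \<le> m" "degree S \<le> n"
  shows "rc (2 * m) (Hp m n S) = Hp m n S"
proof -
  have "rc (2 * (m - n) + (n + n)) (monom 1 (m - n) * (S * rc n S)) =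
      rc (2 * (m - n)) (monom 1 (m - n)) * (rc n S * rc n (rc n S))"
    by (subst rc_mult) (auto simp: rc_mult assms degree_rc degree_monom_eq degree_mult_le')
  also have "\<dots> = monom 1 (m - n) * (S * rc n S)"
    by (simp only: rc_rc[OF assms(2)] rc_monom_half mult.commute[of "rc n S"])
  also have "2 * (m - n) + (n + n) = 2 * m" using assms(1) by simp
  finally show ?thesis by (simp add: Hp_def rc_smult mult.assoc)
qed

lemma degree_transport:
  assumes "degree L \<le> m" "degree S \<le> n"
  shows "degree (transport L S) \<le> m + n"
proof -
  have "degree (pderiv (pCons 0 L)) \<le> m"
    using degree_pCons_le'[OF assms(1), of 0] by (simp add: degree_pderiv)
  then have 1: "degree (pderiv (pCons 0 L) * S) \<le> m + n"
    using assms(2) by (intro degree_mult_le')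
  have "degree (pCons 0 L * pderiv S) \<le> m + n"
  proof (cases n)
    case 0
    then have "pderiv S = 0" using assms(2) by (simp add: pderiv_eq_0_iff)
    then show ?thesis by simp
  next
    case (Suc k)
    have "degree (pCons 0 L * pderiv S) \<le> Suc m + k"
      using assms Suc by (intro degree_mult_le' degree_pCons_le') (auto simp: degree_pderiv)
    then show ?thesis using Suc by simp
  qed
  with 1 show ?thesis unfolding transport_def by (intro degree_diff_le)
qed

lemma good_nonzero:
  assumes "good m n G S"
  shows "poly G 0 \<noteq> 0" "S \<noteq> 0"
proof -
  show "poly G 0 \<noteq> 0"
    using goodD(7)[OF assms] unfolding no_common_root_def by (metis poly_pCons mult_zero_left add_0)
  show "S \<noteq> 0" using goodD[OF assms] by simp
qed

lemma bez_Lp_spec: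
  assumes "good m n G S"
  defines "U \<equiv> pCons 0 (fst (bez (2 * m) G (pCons 0 (rc m G)) (Hp m n S)))"
    and "V \<equiv> snd (bez (2 * m) G (pCons 0 (rc m G)) (Hp m n S))"
  shows "U * rc m G + V * G = Hp m n S" "degree U \<le> m" "degree V \<le> m"
proof -
  have g: "no_common_root G (pCons 0 (rc m G))" "G \<noteq> 0" "degree G \<le> 2 * m"
    "degree (pCons 0 (rc m G)) + degree G \<le> 2 * m + 1" "degree (Hp m n S) \<le> 2 * m"
    using degree_pCons_le'[OF degree_rc[of m G], of 0] by (simp_all add: goodD[OF assms(1)] degree_Hp)
  note sp = bez_spec[OF g]
  show "U * rc m G + V * G = Hp m n S"
    using sp(1) by (simp add: U_def V_def)
  show "degree U \<le> m"
    using sp(2) by (auto simp: U_def deg_less_def goodD[OF assms(1)])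
  show "degree V \<le> m" using sp(3) by (simp add: V_def goodD[OF assms(1)])
qed

text \<open>The equation for \<open>U\<close> and \<open>V\<close> and its conjugate reciprocal have
  the same right-hand side; their average is the identity for \<open>L = (U + rc m V) / 2\<close>.
  Their difference, by coprimality of \<open>G\<close> and \<open>rc m G\<close> and by degrees,
  yields \<open>U - rc m V = smult a G\<close> with a constant \<open>a\<close>, and comparison with
  the reciprocal makes \<open>a\<close> real. As \<open>U\<close> vanishes at the origin,
  \<open>L / G\<close> equals \<open>- a / 2\<close> there.\<close>

lemma Lp_spec:
  assumes "good m n G S"
  shows "degree (Lp m n G S) \<le> m"
    and "Lp m n G S * rc m G + rc m (Lp m n G S) * G = Hp m n S"
    and Lp_normalised: "Im (poly (Lp m n G S) 0 / poly G 0) = 0"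
proof -
  define U where "U = pCons 0 (fst (bez (2 * m) G (pCons 0 (rc m G)) (Hp m n S)))"
  define V where "V = snd (bez (2 * m) G (pCons 0 (rc m G)) (Hp m n S))"
  note sp = bez_Lp_spec[OF assms, folded U_def V_def]
  have L: "Lp m n G S = smult (1 / 2) (U + rc m V)"
    by (simp add: Lp_def U_def V_def Let_def)
  show "degree (Lp m n G S) \<le> m"
    unfolding L using sp(2) degree_rc[of m V] by (intro order_trans[OF degree_smult_le] degree_add_le)
  have g: "n \<le> m" "degree G \<le> m" "degree S \<le> n" "G \<noteq> 0" "degree G = m"
    by (simp_all add: goodD[OF assms])
  have "rc (m + m) (U * rc m G + V * G) = rc m U * rc m (rc m G) + rc m V * rc m G"
    by (simp only: rc_add rc_mult[OF sp(2) degree_rc] rc_mult[OF sp(3) g(2)])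
  also have "rc m (rc m G) = G" by (rule rc_rc[OF g(2)])
  finally have E2: "rc m U * G + rc m V * rc m G = Hp m n S"
    using rc_Hp[OF g(1,3)] by (simp add: sp(1) mult_2)
  have rL: "rc m (Lp m n G S) = smult (1 / 2) (rc m U + V)"
    unfolding L by (simp add: rc_smult rc_add rc_rc sp)
  have "Lp m n G S * rc m G + rc m (Lp m n G S) * G =
      smult (1 / 2) ((U * rc m G + V * G) + (rc m U * G + rc m V * rc m G))"
    unfolding rL unfolding L by (simp add: algebra_simps smult_add_right)
  also have "\<dots> = smult (1 / 2) (Hp m n S + Hp m n S)" by (simp only: sp(1) E2)
  also have "\<dots> = Hp m n S" by (rule poly_eqI) (simp only: coeff_smult coeff_add, simp)
  finally show "Lp m n G S * rc m G + rc m (Lp m n G S) * G = Hp m n S" .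
  have "(U - rc m V) * rc m G = (rc m U - V) * G"
    using sp(1) E2 by (simp add: algebra_simps)
  then have dv: "G dvd (U - rc m V) * rc m G" by (metis dvd_triv_right)
  have "no_common_root G (rc m G)"
    using goodD(7)[OF assms] unfolding no_common_root_def by (metis poly_pCons mult_zero_right add_0)
  then have "G dvd U - rc m V"
    using no_common_root_imp_coprime dv by (simp add: coprime_dvd_mult_left_iff)
  then obtain c where c: "U - rc m V = G * c" by (auto simp: dvd_def)
  have "degree (U - rc m V) \<le> m" using sp(2) degree_rc[of m V] by (intro degree_diff_le)
  then have "degree c = 0"
    using c g by (cases "c = 0") (auto simp: degree_mult_eq)
  then obtain a where a: "c = [:a:]" by (rule degree_eq_zeroE)
  then have UV: "U - rc m V = smult a G" using c by simp
  from arg_cong[OF this, of "rc m"]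
  have "rc m U - V = smult (cnj a) (rc m G)"
    by (simp add: rc_diff rc_rc sp rc_smult)
  with UV \<open>(U - rc m V) * rc m G = (rc m U - V) * G\<close>
  have "smult a (G * rc m G) = smult (cnj a) (G * rc m G)"
    by (simp add: mult.commute)
  moreover have "rc m G \<noteq> 0"
    using good_nonzero(1)[OF assms] by (metis degree_0 g(2) order_refl poly_0 poly_0_coeff_0 rc_rc rc_diff diff_self)
  ultimately have "a = cnj a"
    using g(4) by (metis mult_eq_0_iff smult_diff_left right_minus_eq smult_eq_0_iff)
  then have "Im a = 0" by (simp add: complex_eq_iff)
  have "poly U 0 = 0" by (simp add: U_def)
  then have "poly (rc m V) 0 = - a * poly G 0"
    using arg_cong[OF UV, of "\<lambda>p. poly p 0"] by (simp add: algebra_simps) (metis add.commute add_eq_0_iff)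
  then have "poly (Lp m n G S) 0 / poly G 0 = - a / 2"
    using \<open>poly U 0 = 0\<close> good_nonzero(1)[OF assms] by (simp add: L)
  then show "Im (poly (Lp m n G S) 0 / poly G 0) = 0"
    using \<open>Im a = 0\<close> by simp
qed

lemma field_spec:
  assumes "good m n G S"
  shows "Gv m n G S * S - G * Sv m n G S = transport (Lp m n G S) S"
    and "degree (Gv m n G S) \<le> m" "deg_less (Sv m n G S) n" "degree (Sv m n G S) \<le> n"
proof -
  have g: "no_common_root S (- G)" "S \<noteq> 0" "degree S \<le> m + n" "degree (- G) + degree S \<le> m + n + 1"
    "degree (transport (Lp m n G S) S) \<le> m + n"
    by (simp_all add: goodD[OF assms] degree_transport Lp_spec(1)[OF assms])
  note sp = bez_spec[OF g]
  show "Gv m n G S * S - G * Sv m n G S = transport (Lp m n G S) S"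
    using sp(1) by (simp add: Gv_def Sv_def algebra_simps)
  show "degree (Gv m n G S) \<le> m" using sp(3) by (simp add: Gv_def goodD[OF assms])
  show 1: "deg_less (Sv m n G S) n" using sp(2) by (simp add: Sv_def goodD[OF assms])
  show "degree (Sv m n G S) \<le> n" using 1 by (auto simp: deg_less_def)
qed

lemma field_unique:
  assumes "good m n G S" "G' * S - G * S' = smult c (transport (Lp m n G S) S)"
    "deg_less S' n"
  shows "G' = smult c (Gv m n G S)" "S' = smult c (Sv m n G S)"
proof -
  have "no_common_root S (- G)" "S \<noteq> 0"
    by (simp_all add: goodD[OF assms(1)])
  moreover have "(S' - smult c (Sv m n G S)) * (- G) + (G' - smult c (Gv m n G S)) * S =
      G' * S - G * S' - smult c (Gv m n G S * S - G * Sv m n G S)"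
    by (simp add: algebra_simps smult_diff_right)
  then have "(S' - smult c (Sv m n G S)) * (- G) + (G' - smult c (Gv m n G S)) * S = 0"
    by (simp add: field_spec(1)[OF assms(1)] assms(2))
  moreover have "deg_less (S' - smult c (Sv m n G S)) (degree S)"
    using assms(3) field_spec(3)[OF assms(1)] by (simp add: goodD[OF assms(1)] deg_less_diff deg_less_smult)
  ultimately show "G' = smult c (Gv m n G S)" "S' = smult c (Sv m n G S)"
    using bezout_unique by (metis eq_iff_diff_eq_0)+
qed

section \<open>Phase space and regularity of the field\<close>

type_synonym state = "(nat \<Rightarrow>\<^sub>C complex) \<times> (nat \<Rightarrow>\<^sub>C complex)"

definition num :: "nat \<Rightarrow> state \<Rightarrow> complex poly" where
  "num m x = unvec (Suc m) (fst x)"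

text \<open>The leading term is built in and the entries from index \<open>n\<close> on are ignored,
  so every state has a monic denominator of degree \<open>n\<close>, also outside the range of
  \<open>encode\<close>.\<close>

definition den :: "nat \<Rightarrow> state \<Rightarrow> complex poly" where
  "den n x = monom 1 n + unvec n (snd x)"

definition encode :: "complex poly \<Rightarrow> complex poly \<Rightarrow> state" where
  "encode G S = (pvec G, pvec S)"

lemma degree_num_le: "degree (num m x) \<le> m"
  by (simp add: num_def degree_unvec_le)

lemma degree_den: "degree (den n x) = n" and lead_coeff_den: "lead_coeff (den n x) = 1"
proof -
  have c: "coeff (den n x) n = 1" by (simp add: den_def coeff_unvec)
  have "degree (den n x) \<le> n"
    by (rule degree_le) (simp add: den_def coeff_unvec)
  moreover have "n \<le> degree (den n x)" using c by (intro le_degree) simp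
  ultimately show "degree (den n x) = n" by simp
  then show "lead_coeff (den n x) = 1" using c by simp
qed

lemma num_encode: "degree G \<le> m \<Longrightarrow> num m (encode G S) = G"
  by (simp add: num_def encode_def unvec_pvec deg_less_def)

lemma den_encode:
  assumes "degree S = n" "lead_coeff S = 1"
  shows "den n (encode G S) = S"
  by (rule poly_eqI) (use assms in \<open>auto simp: den_def encode_def coeff_unvec coeff_eq_0\<close>)

lemma good_encode: "good m n G S \<Longrightarrow> num m (encode G S) = G \<and> den n (encode G S) = S"
  using goodD[of m n G S] num_encode[of G m S] den_encode[of S n G] by simp

lemma loc_lip_num: "loc_lip (num m) x0"
proof (rule loc_lipI[where C = "real (Suc m)"], rule always_eventually, safe)
  fix a b c d :: "nat \<Rightarrow>\<^sub>C complex"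
  have "pn (num m (a, b) - num m (c, d)) \<le> real (Suc m) * dist a c"
    unfolding num_def fst_conv by (rule pn_unvec_diff)
  also have "\<dots> \<le> real (Suc m) * dist (a, b) (c, d)"
    using dist_fst_le[of "(a, b)" "(c, d)"] by (intro mult_left_mono) auto
  finally show "pn (num m (a, b) - num m (c, d)) \<le> real (Suc m) * dist (a, b) (c, d)" .
qed

lemma loc_lip_den: "loc_lip (den n) x0"
proof (rule loc_lipI[where C = "real n"], rule always_eventually, safe)
  fix a b c d :: "nat \<Rightarrow>\<^sub>C complex"
  have "pn (den n (a, b) - den n (c, d)) \<le> real n * dist b d"
    unfolding den_def using pn_unvec_diff by simp
  also have "\<dots> \<le> real n * dist (a, b) (c, d)"
    using dist_snd_le[of "(a, b)" "(c, d)"] by (intro mult_left_mono) auto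
  finally show "pn (den n (a, b) - den n (c, d)) \<le> real n * dist (a, b) (c, d)" .
qed

lemma loc_lip_pCons_0:
  assumes "loc_lip f x0"
  shows "loc_lip (\<lambda>x. pCons 0 (f x)) x0"
  using loc_lip_mult[OF loc_lip_const[of "[:0, 1:]"] assms] by simp

text \<open>The field is composed of Bezout solution operators and polynomial operations, and
  goodness at \<open>x0\<close> supplies their conditions on common roots. The numerator keeps its
  exact degree nearby because its leading coefficient moves by less than its own modulus.\<close>

lemma field_loc_lip:
  fixes x0 :: state
  assumes good0: "good m n (num m x0) (den n x0)"
  shows "\<forall>\<^sub>F x in nhds x0. good m n (num m x) (den n x)" (is ?near)
    and "loc_lip (\<lambda>x. Lp m n (num m x) (den n x)) x0"
    and "loc_lip (\<lambda>x. Gv m n (num m x) (den n x)) x0"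
    and "loc_lip (\<lambda>x. Sv m n (num m x) (den n x)) x0"
proof -
  let ?G = "\<lambda>x. num m x" and ?S = "\<lambda>x. den n x"
  have nm: "n \<le> m" using goodD[OF good0] by simp
  note G = loc_lip_num[of m x0] and S = loc_lip_den[of n x0]
  have "coeff (num m x0) m \<noteq> 0" using goodD[OF good0] by (metis leading_coeff_0_iff)
  then have "0 < norm (coeff (num m x0) m)" by simp
  from loc_lip_close[OF G this] have degG: "\<forall>\<^sub>F x in nhds x0. num m x \<noteq> 0 \<and> degree (num m x) = m"
  proof eventually_elim
    case (elim x)
    have "norm (coeff (num m x - num m x0) m) < norm (coeff (num m x0) m)"
      using elim norm_coeff_le_pn[of "num m x - num m x0" m] by linarith
    then have "coeff (num m x) m \<noteq> 0" by (auto simp: norm_minus_commute)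
    then show ?case using degree_num_le[of m x] le_degree[of "num m x" m] by auto
  qed
  have rcG: "loc_lip (\<lambda>x. pCons 0 (rc m (num m x))) x0"
    by (intro loc_lip_pCons_0 loc_lip_rc G)
  have H: "loc_lip (\<lambda>x. Hp m n (den n x)) x0"
    unfolding Hp_def by (intro loc_lip_smult loc_lip_mult loc_lip_rc loc_lip_const S)
  have deg1: "\<forall>\<^sub>F x in nhds x0. num m x \<noteq> 0 \<and> degree (num m x) = m \<and>
      degree (pCons 0 (rc m (num m x))) + m \<le> 2 * m + 1 \<and> degree (Hp m n (den n x)) \<le> 2 * m"
    using degG
  proof eventually_elim
    case (elim x)
    then show ?case using degree_pCons_le'[OF degree_rc[of m "num m x"], of 0] degree_Hp[OF nm, of "den n x"]
      by (simp add: degree_den)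
  qed
  have nc1: "no_common_root (num m x0) (pCons 0 (rc m (num m x0)))" using goodD[OF good0] by simp
  note b1 = loc_lip_bez[OF G rcG H nc1 deg1]
  have nc_rc: "\<forall>\<^sub>F x in nhds x0. no_common_root (num m x) (pCons 0 (rc m (num m x)))"
    by (rule b1(1)) simp
  show L: "loc_lip (\<lambda>x. Lp m n (num m x) (den n x)) x0"
    unfolding Lp_def Let_def
    by (intro loc_lip_smult loc_lip_add loc_lip_pCons_0 loc_lip_rc b1(2,3)) auto
  have nc2: "no_common_root (den n x0) (- num m x0)" by (simp add: goodD[OF good0])
  \<comment> \<open>Only the openness conclusion of \<open>loc_lip_bez\<close> is wanted here, hence
    the right-hand side \<open>0\<close>; the degree of the true one is controlled only after
    goodness nearby is known.\<close>
  have deg2: "\<forall>\<^sub>F x in nhds x0. den n x \<noteq> 0 \<and> degree (den n x) = n \<and>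
      degree (- num m x) + n \<le> m + n + 1 \<and> degree (0 :: complex poly) \<le> m + n"
  proof (intro always_eventually allI)
    fix x
    have "den n x \<noteq> 0" using lead_coeff_den[of n x] by auto
    then show "den n x \<noteq> 0 \<and> degree (den n x) = n \<and>
      degree (- num m x) + n \<le> m + n + 1 \<and> degree (0 :: complex poly) \<le> m + n"
      using degree_num_le[of m x] by (simp add: degree_den)
  qed
  have "\<forall>\<^sub>F x in nhds x0. no_common_root (den n x) (- num m x)"
    using loc_lip_bez(1)[OF S loc_lip_minus[OF G] loc_lip_const nc2 deg2] by simp
  then show near: ?near
    using degG nc_rc
  proof eventually_elim
    case (elim x)
    then show ?case using nm lead_coeff_den[of n x] degree_den[of n x] by (simp add: good_def)
  qed
  have degL: "\<forall>\<^sub>F x in nhds x0. degree (Lp m n (num m x) (den n x)) \<le> m"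
    using near by eventually_elim (rule Lp_spec)
  have X: "loc_lip (\<lambda>x. transport (Lp m n (num m x) (den n x)) (den n x)) x0"
    unfolding transport_def
  proof (intro loc_lip_diff loc_lip_mult loc_lip_pCons_0 L S loc_lip_pderiv[where N = "Suc m"] loc_lip_pderiv[OF S, of n])
    show "\<forall>\<^sub>F x in nhds x0. degree (pCons 0 (Lp m n (num m x) (den n x))) \<le> Suc m"
      using degL by eventually_elim (rule degree_pCons_le')
  qed (use nm in \<open>simp_all add: degree_den\<close>)
  have deg3: "\<forall>\<^sub>F x in nhds x0. den n x \<noteq> 0 \<and> degree (den n x) = n \<and>
      degree (- num m x) + n \<le> m + n + 1 \<and>
      degree (transport (Lp m n (num m x) (den n x)) (den n x)) \<le> m + n"
    using deg2 degL by eventually_elim (auto intro!: degree_transport simp: degree_den)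
  note b3 = loc_lip_bez[OF S loc_lip_minus[OF G] X nc2 deg3]
  show "loc_lip (\<lambda>x. Gv m n (num m x) (den n x)) x0"
    unfolding Gv_def by (rule b3(3)) simp
  show "loc_lip (\<lambda>x. Sv m n (num m x) (den n x)) x0"
    unfolding Sv_def by (rule b3(2)) simp
qed

section \<open>Uniqueness and local existence for the coefficient equation\<close>

definition solves_field ::
  "(real \<Rightarrow> real) \<Rightarrow> nat \<Rightarrow> nat \<Rightarrow> (real \<Rightarrow> complex poly) \<Rightarrow> (real \<Rightarrow> complex poly) \<Rightarrow> real set \<Rightarrow> bool" where
  "solves_field q m n G S I \<longleftrightarrow> (\<forall>t\<in>I. good m n (G t) (S t) \<and>
    has_pder G (smult (of_real (q t)) (Gv m n (G t) (S t))) (at t within I) \<and>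
    has_pder S (smult (of_real (q t)) (Sv m n (G t) (S t))) (at t within I))"

lemma continuous_on_encode:
  assumes "pcont G I" "pcont S I" "\<And>t. t \<in> I \<Longrightarrow> good m n (G t) (S t)"
  shows "continuous_on I (\<lambda>t. encode (G t) (S t))"
  unfolding encode_def
  by (intro continuous_on_Pair continuous_on_pvec[of _ _ m] continuous_on_pvec[of _ _ n] assms(1,2))
    (simp_all add: goodD[OF assms(3)])

lemma pcont_field:
  assumes "pcont G I" "pcont S I" "\<And>t. t \<in> I \<Longrightarrow> good m n (G t) (S t)"
  shows "pcont (\<lambda>t. Lp m n (G t) (S t)) I" "pcont (\<lambda>t. Gv m n (G t) (S t)) I"
    "pcont (\<lambda>t. Sv m n (G t) (S t)) I"
proof -
  define x where "x t = encode (G t) (S t)" for t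
  have x: "num m (x t) = G t" "den n (x t) = S t" if "t \<in> I" for t
    using good_encode[OF assms(3)[OF that]] by (auto simp: x_def)
  have cx: "(x \<longlongrightarrow> x t) (at t within I)" if "t \<in> I" for t
    using continuous_on_encode[OF assms] that unfolding x_def continuous_on_def by blast
  have main: "pcont (\<lambda>t. f (G t) (S t)) I"
    if f: "\<And>x0. good m n (num m x0) (den n x0) \<Longrightarrow> loc_lip (\<lambda>x. f (num m x) (den n x)) x0" for f
    unfolding pcont_def continuous_on_def
  proof safe
    fix i t assume t: "t \<in> I"
    have "good m n (num m (x t)) (den n (x t))" using assms(3)[OF t] x[OF t] by simp
    from loc_lip_coeff_tendsto[OF f[OF this] cx[OF t], of i]
    have "((\<lambda>s. coeff (f (num m (x s)) (den n (x s))) i) \<longlongrightarrow> coeff (f (G t) (S t)) i) (at t within I)"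
      using x[OF t] by simp
    then show "((\<lambda>s. coeff (f (G s) (S s)) i) \<longlongrightarrow> coeff (f (G t) (S t)) i) (at t within I)"
      by (rule Lim_transform_eventually) (auto simp: eventually_at_filter x)
  qed
  show "pcont (\<lambda>t. Lp m n (G t) (S t)) I" "pcont (\<lambda>t. Gv m n (G t) (S t)) I"
    "pcont (\<lambda>t. Sv m n (G t) (S t)) I"
    by (rule main, erule field_loc_lip)+
qed

lemma degree_smult_le': "degree p \<le> N \<Longrightarrow> degree (smult c p) \<le> N"
  using degree_smult_le[of c p] by linarith

text \<open>Where two solutions meet, the local Lipschitz constants of the field and a local bound
  for \<open>q\<close> give a linear bound for the derivative of the difference of the coefficient
  vectors; \<open>linear_bound_imp_zero\<close> spreads the coincidence over the interval.\<close>

lemma solves_field_unique: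
  assumes q: "continuous_on {0..<T} q"
    and sol: "solves_field q m n G S {0..<T}" "solves_field q m n G' S' {0..<T}"
    and deg: "\<And>t. degree (G t) \<le> m" "\<And>t. degree (S t) \<le> n"
      "\<And>t. degree (G' t) \<le> m" "\<And>t. degree (S' t) \<le> n"
    and init: "G 0 = G' 0" "S 0 = S' 0" and t: "t \<in> {0..<T}"
  shows "G t = G' t \<and> S t = S' t"
proof -
  let ?I = "{0..<T}"
  define x where "x t = encode (G t) (S t)" for t
  define x' where "x' t = encode (G' t) (S' t)" for t
  have good: "good m n (G t) (S t)" "good m n (G' t) (S' t)" if "t \<in> ?I" for t
    using sol that by (auto simp: solves_field_def)
  have x: "num m (x t) = G t" "den n (x t) = S t" "num m (x' t) = G' t" "den n (x' t) = S' t"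
    if "t \<in> ?I" for t
    using good_encode[OF good(1)[OF that]] good_encode[OF good(2)[OF that]] by (auto simp: x_def x'_def)
  define y where "y t = (pvec (G t - G' t), pvec (S t - S' t))" for t
  define dG where "dG t = smult (of_real (q t)) (Gv m n (G t) (S t)) - smult (of_real (q t)) (Gv m n (G' t) (S' t))" for t
  define dS where "dS t = smult (of_real (q t)) (Sv m n (G t) (S t)) - smult (of_real (q t)) (Sv m n (G' t) (S' t))" for t
  have yx: "y t = x t - x' t" for t by (simp add: y_def x_def x'_def encode_def pvec_diff)
  have cx: "continuous_on ?I x" "continuous_on ?I x'"
    unfolding x_def x'_def
    by (rule continuous_on_encode[where m = m and n = n];
      use sol good has_pder_imp_pcont in \<open>fastforce simp: solves_field_def\<close>)+
  have "y t = 0"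
  proof (rule linear_bound_imp_zero[of ?I y "\<lambda>t. (pvec (dG t), pvec (dS t))" 0])
    fix t assume t: "t \<in> ?I"
    show "(y has_vector_derivative (pvec (dG t), pvec (dS t))) (at t within ?I)"
      unfolding y_def dG_def dS_def
      using sol t field_spec(2,4)[OF good(1)[OF t]] field_spec(2,4)[OF good(2)[OF t]]
      by (intro has_vector_derivative_Pair has_vector_derivative_pvec[of _ _ _ m]
          has_vector_derivative_pvec[of _ _ _ n] has_pder_diff degree_diff_le deg degree_smult_le')
        (auto simp: solves_field_def)
    assume "y t = 0"
    then have xx: "x t = x' t" by (simp add: yx)
    have gd: "good m n (num m (x t)) (den n (x t))" using x[OF t] good(1)[OF t] by simp
    obtain C where C: "0 \<le> C" "\<forall>\<^sub>F (x, y) in nhds (x t) \<times>\<^sub>F nhds (x t).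
        pn (Gv m n (num m x) (den n x) - Gv m n (num m y) (den n y)) \<le> C * dist x y"
      using loc_lipE[OF field_loc_lip(3)[OF gd]] .
    obtain D where D: "0 \<le> D" "\<forall>\<^sub>F (x, y) in nhds (x t) \<times>\<^sub>F nhds (x t).
        pn (Sv m n (num m x) (den n x) - Sv m n (num m y) (den n y)) \<le> D * dist x y"
      using loc_lipE[OF field_loc_lip(4)[OF gd]] .
    have lim: "filterlim (\<lambda>s. (x s, x' s)) (nhds (x t) \<times>\<^sub>F nhds (x t)) (at t within ?I)"
    proof (rule filterlim_Pair)
      show "(x \<longlongrightarrow> x t) (at t within ?I)" using cx(1) t by (simp add: continuous_on_def)
      show "(x' \<longlongrightarrow> x t) (at t within ?I)" using cx(2) t unfolding xx by (simp add: continuous_on_def)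
    qed
    have qb: "\<forall>\<^sub>F s in at t within ?I. \<bar>q s\<bar> < \<bar>q t\<bar> + 1"
      using q t by (intro order_tendstoD(2)[of _ "\<bar>q t\<bar>"] tendsto_rabs) (auto simp: continuous_on_def)
    have "\<forall>\<^sub>F s in at t within ?I. s \<in> ?I \<longrightarrow>
        norm (pvec (dG s), pvec (dS s)) \<le> (\<bar>q t\<bar> + 1) * (C + D) * norm (y s)"
      using qb eventually_compose_filterlim[OF C(2) lim] eventually_compose_filterlim[OF D(2) lim]
    proof eventually_elim
      case (elim s)
      show ?case
      proof
        assume s: "s \<in> ?I"
        have "norm (pvec (dG s), pvec (dS s)) \<le> pn (dG s) + pn (dS s)"
          using norm_Pair_le[of "pvec (dG s)" "pvec (dS s)"] norm_pvec_le[of "dG s"] norm_pvec_le[of "dS s"]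
          by linarith
        also have "\<dots> = \<bar>q s\<bar> * (pn (Gv m n (G s) (S s) - Gv m n (G' s) (S' s)) + pn (Sv m n (G s) (S s) - Sv m n (G' s) (S' s)))"
          by (simp add: dG_def dS_def distrib_left flip: smult_diff_right)
        also have "\<dots> \<le> (\<bar>q t\<bar> + 1) * (C * dist (x s) (x' s) + D * dist (x s) (x' s))"
          using elim by (intro mult_mono add_mono) (auto simp: x[OF s])
        finally show "norm (pvec (dG s), pvec (dS s)) \<le> (\<bar>q t\<bar> + 1) * (C + D) * norm (y s)"
          by (simp add: yx dist_norm algebra_simps)
      qed
    qed
    then obtain e where e: "e > 0" "\<And>s. s \<in> ?I \<Longrightarrow> s \<noteq> t \<Longrightarrow> dist s t < e \<Longrightarrow>
        norm (pvec (dG s), pvec (dS s)) \<le> (\<bar>q t\<bar> + 1) * (C + D) * norm (y s)"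
      unfolding eventually_at by auto
    have "G t = G' t" "S t = S' t" using x[OF t] xx by auto
    then have "norm (pvec (dG t), pvec (dS t)) = 0" by (simp add: dG_def dS_def)
    then show "\<exists>e>0. \<exists>C. \<forall>s\<in>?I. dist s t < e \<longrightarrow> norm (pvec (dG s), pvec (dS s)) \<le> C * norm (y s)"
      using e C(1) D(1) by (intro exI[of _ e] conjI exI[of _ "(\<bar>q t\<bar> + 1) * (C + D)"]) force+
  qed (use t init in \<open>auto simp: y_def zero_prod_def\<close>)
  then show ?thesis by (simp add: y_def zero_prod_def)
qed

lemma loc_lip_ball:
  assumes "loc_lip f x0"
  shows "\<exists>C\<ge>0. \<forall>\<^sub>F r in at_right 0. \<forall>x\<in>cball x0 r. \<forall>y\<in>cball x0 r. pn (f x - f y) \<le> C * dist x y"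
proof -
  obtain C where C: "0 \<le> C" "\<forall>\<^sub>F (x, y) in nhds x0 \<times>\<^sub>F nhds x0. pn (f x - f y) \<le> C * dist x y"
    using loc_lipE[OF assms] .
  obtain P Q where PQ: "eventually P (nhds x0)" "eventually Q (nhds x0)"
    "\<And>x y. P x \<Longrightarrow> Q y \<Longrightarrow> pn (f x - f y) \<le> C * dist x y"
    using C(2) unfolding eventually_prod_filter by auto
  have "\<forall>\<^sub>F x in nhds x0. P x \<and> Q x" using PQ(1,2) by (rule eventually_conj)
  then obtain e where e: "e > 0" "\<And>x. dist x x0 < e \<Longrightarrow> P x \<and> Q x"
    unfolding eventually_nhds_metric by blast
  have "\<forall>\<^sub>F r in at_right 0. r < e"
    using e(1) by (auto simp: eventually_at_right_field intro: exI[of _ e])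
  then have "\<forall>\<^sub>F r in at_right 0. \<forall>x\<in>cball x0 r. \<forall>y\<in>cball x0 r. pn (f x - f y) \<le> C * dist x y"
  proof eventually_elim
    case (elim r)
    then show ?case using e(2) PQ(3) by (auto simp: dist_commute)
  qed
  then show ?thesis using C(1) by blast
qed

text \<open>Only needed for the completeness of \<open>nat \<Rightarrow>\<^sub>C complex\<close>, whose library instance asks for a metric
  on the domain.\<close>

instantiation nat :: metric_space
begin

definition dist_nat :: "nat \<Rightarrow> nat \<Rightarrow> real" where
  "dist_nat k l = (if k = l then 0 else 1)"

definition uniformity_nat :: "(nat \<times> nat) filter" where
  "uniformity_nat = (INF e\<in>{0<..}. principal {(x, y). dist x y < e})"

instance
proof
  show "open U \<longleftrightarrow> (\<forall>x\<in>U. \<forall>\<^sub>F (x', y) in uniformity. x' = x \<longrightarrow> y \<in> U)" for U :: "nat set"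
  proof -
    have "\<forall>\<^sub>F (x', y) in uniformity. x' = x \<longrightarrow> y \<in> U" if "x \<in> U" for x
    proof -
      have "\<forall>\<^sub>F (x', y) in principal {(x :: nat, y). dist x y < 1}. x' = x \<longrightarrow> y \<in> U"
        using that by (auto simp: eventually_principal dist_nat_def)
      moreover have "uniformity \<le> principal {(x :: nat, y). dist x y < 1}"
        unfolding uniformity_nat_def by (rule INF_lower) simp
      ultimately show ?thesis using filter_leD by blast
    qed
    then show ?thesis by (simp add: open_discrete)
  qed
qed (auto simp: dist_nat_def uniformity_nat_def)

end

instance bcontfun :: (metric_space, banach) banach ..

lemma solves_field_exists:
  fixes q :: "real \<Rightarrow> real"
  assumes q: "continuous_on {0..} q" and init: "good m n G0 S0"
  shows "\<exists>T>0. \<exists>G S. solves_field q m n G S {0..<T} \<and> G 0 = G0 \<and> S 0 = S0 \<and>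
    (\<forall>t. degree (G t) \<le> m \<and> degree (S t) = n \<and> lead_coeff (S t) = 1)"
proof -
  define x0 where "x0 = encode G0 S0"
  have x0: "num m x0 = G0" "den n x0 = S0" using good_encode[OF init] by (auto simp: x0_def)
  have gd: "good m n (num m x0) (den n x0)" using init by (simp add: x0)
  define \<Phi> where "\<Phi> x = (pvec (Gv m n (num m x) (den n x)), pvec (Sv m n (num m x) (den n x)))" for x
  obtain C where C: "C \<ge> 0" "\<forall>\<^sub>F r in at_right 0. \<forall>x\<in>cball x0 r. \<forall>y\<in>cball x0 r.
      pn (Gv m n (num m x) (den n x) - Gv m n (num m y) (den n y)) \<le> C * dist x y"
    using loc_lip_ball[OF field_loc_lip(3)[OF gd]] by blast
  obtain D where D: "D \<ge> 0" "\<forall>\<^sub>F r in at_right 0. \<forall>x\<in>cball x0 r. \<forall>y\<in>cball x0 r.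
      pn (Sv m n (num m x) (den n x) - Sv m n (num m y) (den n y)) \<le> D * dist x y"
    using loc_lip_ball[OF field_loc_lip(4)[OF gd]] by blast
  obtain e where e: "e > 0" "\<And>x. dist x x0 < e \<Longrightarrow> good m n (num m x) (den n x)"
    using field_loc_lip(1)[OF gd] unfolding eventually_nhds_metric by blast
  have "\<forall>\<^sub>F r in at_right (0::real). 0 < r \<and> r < e"
    using e(1) by (auto simp: eventually_at_right_field intro: exI[of _ e])
  from eventually_conj[OF this eventually_conj[OF C(2) D(2)]]
  obtain r where r: "0 < r" "r < e"
    "\<And>x y. x \<in> cball x0 r \<Longrightarrow> y \<in> cball x0 r \<Longrightarrow>
      pn (Gv m n (num m x) (den n x) - Gv m n (num m y) (den n y)) \<le> C * dist x y"
    "\<And>x y. x \<in> cball x0 r \<Longrightarrow> y \<in> cball x0 r \<Longrightarrow>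
      pn (Sv m n (num m x) (den n x) - Sv m n (num m y) (den n y)) \<le> D * dist x y"
    using eventually_happens[of _ "at_right (0::real)"] by (metis (mono_tags, lifting) trivial_limit_at_right_real)
  have \<Phi>lip: "norm (\<Phi> x - \<Phi> y) \<le> (C + D) * norm (x - y)" if "x \<in> cball x0 r" "y \<in> cball x0 r" for x y
  proof -
    have "norm (\<Phi> x - \<Phi> y) \<le> norm (pvec (Gv m n (num m x) (den n x) - Gv m n (num m y) (den n y))) +
        norm (pvec (Sv m n (num m x) (den n x) - Sv m n (num m y) (den n y)))"
      unfolding \<Phi>_def by (simp only: pvec_diff diff_Pair norm_Pair_le)
    also have "\<dots> \<le> C * dist x y + D * dist x y"
      by (intro add_mono order_trans[OF norm_pvec_le] r that)
    finally show ?thesis by (simp add: dist_norm algebra_simps)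
  qed
  have \<Phi>cont: "continuous_on (cball x0 r) \<Phi>"
  proof (rule lipschitz_on_continuous_on[of "C + D"], rule lipschitz_onI)
    show "dist (\<Phi> x) (\<Phi> y) \<le> (C + D) * dist x y" if "x \<in> cball x0 r" "y \<in> cball x0 r" for x y
      using \<Phi>lip[OF that] by (simp add: dist_norm)
  qed (use C(1) D(1) in simp)
  define M0 where "M0 = norm (\<Phi> x0) + (C + D) * r"
  have \<Phi>b: "norm (\<Phi> x) \<le> M0" if "x \<in> cball x0 r" for x
  proof -
    have "norm (\<Phi> x) \<le> norm (\<Phi> x0) + norm (\<Phi> x - \<Phi> x0)" using norm_triangle_ineq[of "\<Phi> x0" "\<Phi> x - \<Phi> x0"] by simp
    also have "norm (\<Phi> x - \<Phi> x0) \<le> (C + D) * norm (x - x0)" using that r(1) by (intro \<Phi>lip) auto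
    also have "\<dots> \<le> (C + D) * r" using that C(1) D(1)
      by (intro mult_left_mono) (auto simp: dist_norm norm_minus_commute)
    finally show ?thesis by (simp add: M0_def)
  qed
  have M0: "M0 \<ge> 0" using C(1) D(1) r(1) by (simp add: M0_def)
  have "compact (q ` {0..1})"
    by (intro compact_continuous_image continuous_on_subset[OF q]) auto
  then obtain Q where Q: "Q > 0" "\<And>t. t \<in> {0..1} \<Longrightarrow> \<bar>q t\<bar> \<le> Q"
    using compact_imp_bounded[of "q ` {0..1}"] unfolding bounded_pos by (auto simp: real_norm_def)
  \<comment> \<open>\<open>Q * M0\<close> bounds the field on the ball of radius \<open>r\<close>
    and \<open>Q * (C + D)\<close> is its Lipschitz constant. The length makes the first times
    \<open>b\<close> at most \<open>r\<close> and the second times \<open>b\<close> at most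
    \<open>1 / 2\<close>; the added \<open>1\<close> keeps the denominators positive, and
    \<open>b \<le> 1\<close> stays where \<open>Q\<close> bounds \<open>q\<close>.\<close>
  define b where "b = min 1 (min (r / (Q * M0 + 1)) (1 / (2 * (Q * (C + D) + 1))))"
  have pos: "Q * M0 + 1 > 0" "Q * (C + D) + 1 > 0"
    using Q(1) M0 C(1) D(1) by (auto intro!: add_nonneg_pos mult_nonneg_nonneg)
  have b: "b > 0" "b \<le> 1" "b * (Q * M0) \<le> r" "b * (Q * (C + D)) < 1"
  proof -
    show "b > 0" "b \<le> 1" using r(1) pos by (auto simp: b_def)
    have "b * (Q * M0) \<le> b * (Q * M0 + 1)" using \<open>b > 0\<close> by simp
    also have "\<dots> \<le> r / (Q * M0 + 1) * (Q * M0 + 1)" using pos by (intro mult_right_mono) (auto simp: b_def)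
    finally show "b * (Q * M0) \<le> r" using pos by simp
    have "b * (Q * (C + D)) \<le> b * (Q * (C + D) + 1)" using \<open>b > 0\<close> by simp
    also have "\<dots> \<le> 1 / (2 * (Q * (C + D) + 1)) * (Q * (C + D) + 1)"
      using pos by (intro mult_right_mono) (auto simp: b_def)
    also have "\<dots> = 1 / 2" using pos(2) by (simp add: field_simps)
    finally show "b * (Q * (C + D)) < 1" by simp
  qed
  define F where "F t x = q t *\<^sub>R \<Phi> x" for t x
  have "\<exists>x. x 0 = x0 \<and> (\<forall>t\<in>{0..b}. x t \<in> cball x0 r \<and> (x has_vector_derivative F t (x t)) (at t within {0..b}))"
  proof (rule picard_lindelof[where F = F and M = "Q * M0" and K = "Q * (C + D)"])
    show "continuous_on ({0..b} \<times> cball x0 r) (\<lambda>(t, x). F t x)"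
      unfolding F_def case_prod_unfold
      by (intro continuous_on_scaleR continuous_on_compose2[OF q] continuous_on_compose2[OF \<Phi>cont] continuous_intros) auto
    fix t x assume t: "t \<in> {0..b}" and x: "x \<in> cball x0 r"
    then have qt: "\<bar>q t\<bar> \<le> Q" using b(2) by (intro Q(2)) auto
    show "norm (F t x) \<le> Q * M0"
      using mult_mono[OF qt \<Phi>b[OF x]] Q(1) by (simp add: F_def)
    fix y assume y: "y \<in> cball x0 r"
    show "norm (F t x - F t y) \<le> Q * (C + D) * norm (x - y)"
      using mult_mono[OF qt \<Phi>lip[OF x y]] Q(1) by (simp add: F_def mult.assoc flip: scaleR_diff_right)
  qed (use b r Q M0 C D in auto)
  then obtain x where x: "x 0 = x0" "\<And>t. t \<in> {0..b} \<Longrightarrow> x t \<in> cball x0 r"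
    "\<And>t. t \<in> {0..b} \<Longrightarrow> (x has_vector_derivative F t (x t)) (at t within {0..b})" by blast
  have "solves_field q m n (\<lambda>t. num m (x t)) (\<lambda>t. den n (x t)) {0..<b}"
    unfolding solves_field_def
  proof (intro ballI conjI)
    fix t assume t: "t \<in> {0..<b}"
    let ?F = "at t within {0..<b}"
    show gt: "good m n (num m (x t)) (den n (x t))"
    proof (rule e(2))
      have "x t \<in> cball x0 r" using t by (intro x(2)) auto
      then show "dist (x t) x0 < e" using r(2) by (simp add: dist_commute)
    qed
    have d: "(x has_vector_derivative F t (x t)) ?F"
    proof (rule has_vector_derivative_within_subset[OF x(3)])
      show "t \<in> {0..b}" "{0..<b} \<subseteq> {0..b}" using t by auto
    qed
    have d1: "((\<lambda>t. apply_bcontfun (fst (x t)) i) has_vector_derivative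
        of_real (q t) * coeff (Gv m n (num m (x t)) (den n (x t))) i) ?F" for i
      using bounded_linear.has_vector_derivative[OF bounded_linear_compose[OF bounded_linear_apply_bcontfun bounded_linear_fst] d, of i]
      by (simp add: F_def \<Phi>_def scaleR_bcontfun.rep_eq scaleR_conv_of_real)
    have d2: "((\<lambda>t. apply_bcontfun (snd (x t)) i) has_vector_derivative
        of_real (q t) * coeff (Sv m n (num m (x t)) (den n (x t))) i) ?F" for i
      using bounded_linear.has_vector_derivative[OF bounded_linear_compose[OF bounded_linear_apply_bcontfun bounded_linear_snd] d, of i]
      by (simp add: F_def \<Phi>_def scaleR_bcontfun.rep_eq scaleR_conv_of_real)
    note fs = field_spec(2,3)[OF gt]
    show "has_pder (\<lambda>t. num m (x t)) (smult (complex_of_real (q t)) (Gv m n (num m (x t)) (den n (x t)))) ?F"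
      unfolding has_pder_def
    proof
      fix i
      show "((\<lambda>t. coeff (num m (x t)) i) has_vector_derivative
          coeff (smult (complex_of_real (q t)) (Gv m n (num m (x t)) (den n (x t)))) i) ?F"
        using d1[of i] fs(1) by (cases "i < Suc m") (auto simp: num_def coeff_unvec coeff_eq_0)
    qed
    show "has_pder (\<lambda>t. den n (x t)) (smult (complex_of_real (q t)) (Sv m n (num m (x t)) (den n (x t)))) ?F"
      unfolding has_pder_def
    proof
      fix i
      have "coeff (den n (x t)) i = (if i < n then apply_bcontfun (snd (x t)) i else if i = n then 1 else 0)" for t
        by (simp add: den_def coeff_unvec)
      moreover have "coeff (Sv m n (num m (x t)) (den n (x t))) i = 0" if "\<not> i < n"
        using fs(2) that by (auto simp: deg_less_def coeff_eq_0)
      ultimately show "((\<lambda>t. coeff (den n (x t)) i) has_vector_derivative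
          coeff (smult (complex_of_real (q t)) (Sv m n (num m (x t)) (den n (x t)))) i) ?F"
        using d2[of i] by (cases "i < n") auto
    qed
  qed
  moreover have "num m (x 0) = G0" "den n (x 0) = S0" using x0 x(1) by auto
  moreover have "\<forall>t. degree (num m (x t)) \<le> m \<and> degree (den n (x t)) = n \<and> lead_coeff (den n (x t)) = 1"
    using degree_num_le degree_den lead_coeff_den by blast
  ultimately show ?thesis using b(1) by blast
qed

section \<open>Continuous choice of roots\<close>

definition of_roots :: "nat \<Rightarrow> (nat \<Rightarrow> complex) \<Rightarrow> complex poly" where
  "of_roots m w = (\<Prod>k<m. [:- w k, 1:])"

lemma poly_of_roots: "poly (of_roots m w) z = (\<Prod>k<m. z - w k)"
  by (simp add: of_roots_def poly_prod)

lemma degree_of_roots [simp]: "degree (of_roots m w) = m"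
  by (simp add: of_roots_def degree_prod_eq_sum_degree)

lemma lead_coeff_of_roots [simp]: "coeff (of_roots m w) m = 1"
  using lead_coeff_prod[of "\<lambda>k. [:- w k, 1:]" "{..<m}"] degree_of_roots[of m w]
  by (simp add: of_roots_def)

lemma of_roots_nonzero [simp]: "of_roots m w \<noteq> 0"
  by (simp add: of_roots_def)

lemma of_roots_permute: "\<sigma> permutes {..<m} \<Longrightarrow> of_roots m (\<lambda>k. w (\<sigma> k)) = of_roots m w"
  unfolding of_roots_def by (rule prod.permute[symmetric, unfolded o_def])

lemma of_roots_cong: "(\<And>k. k < m \<Longrightarrow> w k = v k) \<Longrightarrow> of_roots m w = of_roots m v"
  unfolding of_roots_def by (rule prod.cong) auto

lemma proots_of_roots: "proots (of_roots m w) = image_mset w (mset_set {..<m})"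
proof -
  have "proots (of_roots m w) = (\<Sum>k<m. {#w k#})"
    unfolding of_roots_def by (subst proots_prod) auto
  also have "\<dots> = image_mset w (mset_set {..<m})"
    by (induction m) (auto simp: lessThan_Suc)
  finally show ?thesis .
qed

lemma of_roots_eq_imp_permutes:
  assumes "of_roots m w = of_roots m v"
  obtains \<sigma> where "\<sigma> permutes {..<m}" "\<And>k. k < m \<Longrightarrow> w k = v (\<sigma> k)"
proof -
  have "image_mset w (mset_set {..<m}) = image_mset v (mset_set {..<m})"
    using assms by (metis proots_of_roots)
  then show ?thesis using that by (rule image_mset_eq_implies_permutes[rotated]) auto
qed

lemma of_roots_exists:
  assumes "degree p = m" "lead_coeff p = (1::complex)"
  shows "\<exists>w. p = of_roots m w"
proof -
  have "p \<noteq> 0" using assms by auto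
  then obtain A where A: "size A = degree p" "p = smult (lead_coeff p) (\<Prod>x\<in>#A. [:- x, 1:])"
    using alg_closed_imp_factorization by blast
  obtain xs where xs: "mset xs = A" using ex_mset by blast
  have "p = prod_list (map (\<lambda>x. [:- x, 1:]) xs)"
    using A(2) assms(2) by (simp flip: xs mset_map add: prod_mset_prod_list)
  also have "\<dots> = of_roots m (\<lambda>k. xs ! k)"
  proof -
    have "length xs = m" using A(1) xs assms(1) by (metis size_mset)
    then show ?thesis unfolding of_roots_def by (simp add: prod.list_conv_set_nth lessThan_atLeast0)
  qed
  finally show ?thesis by blast
qed

section \<open>Root lists along a path, by compactness\<close>

text \<open>The finite intersection property yields a point satisfying every closed condition that
  holds eventually. This replaces convergent subsequences, which a product over the uncountable set
  of times need not provide.\<close>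

lemma compact_cluster_point:
  fixes f :: "nat \<Rightarrow> 'a::topological_space"
  assumes "compact K" "closed K" "\<And>n. f n \<in> K"
  shows "\<exists>x. \<forall>C. closed C \<longrightarrow> (\<forall>\<^sub>F n in sequentially. f n \<in> C) \<longrightarrow> x \<in> C"
proof -
  define \<C> where "\<C> = {C. closed C \<and> (\<forall>\<^sub>F n in sequentially. f n \<in> C)}"
  have "K \<inter> \<Inter>\<C> \<noteq> {}"
  proof (rule compact_imp_fip[OF assms(1)])
    fix F assume F: "finite F" "F \<subseteq> \<C>"
    have "\<forall>\<^sub>F n in sequentially. \<forall>C\<in>F. f n \<in> C"
      using F by (intro eventually_ball_finite) (auto simp: \<C>_def)
    from eventually_happens'[OF sequentially_bot this] obtain n where "\<forall>C\<in>F. f n \<in> C" ..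
    then show "K \<inter> \<Inter>F \<noteq> {}" using assms(3) by blast
  qed (auto simp: \<C>_def)
  then show ?thesis by (auto simp: \<C>_def)
qed

lemma compact_cube: "compact {w :: 'i \<Rightarrow> complex. \<forall>k. w k \<in> cball 0 R}"
proof -
  have "compactin (product_topology (\<lambda>_::'i. euclidean :: complex topology) UNIV) (PiE UNIV (\<lambda>_. cball 0 R))"
    unfolding compactin_PiE by simp
  then show ?thesis
    by (simp add: euclidean_product_topology PiE_UNIV_domain Pi_def)
qed

lemma closed_cube: "closed {w :: 'i \<Rightarrow> complex. \<forall>k. w k \<in> cball 0 R}"
proof -
  have "{w :: 'i \<Rightarrow> complex. \<forall>k. w k \<in> cball 0 R} = (\<Inter>k. {w. norm (w k) \<le> R})" by auto
  then show ?thesis by (auto intro!: closed_INT closed_Collect_le continuous_intros)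
qed

text \<open>Cauchy's bound: the leading power is isolated in the equation and
  \<open>norm (w k) ^ l\<close> is divided out. Roots of modulus at most \<open>1\<close> are
  covered by the leading coefficient, which \<open>pn\<close> counts.\<close>

lemma of_roots_bound:
  assumes "k < m"
  shows "norm (w k) \<le> pn (of_roots m w)"
proof (cases "norm (w k) \<le> 1")
  case True
  have "norm (coeff (of_roots m w) m) \<le> pn (of_roots m w)" by (rule norm_coeff_le_pn)
  then show ?thesis using True by simp
next
  case False
  let ?p = "of_roots m w" and ?r = "norm (w k)"
  obtain l where l: "m = Suc l" using assms by (cases m) auto
  have pn: "pn ?p = (\<Sum>i\<le>l. norm (coeff ?p i)) + 1"
    using pn_eq[of ?p m] by (simp add: l)
  have "poly ?p (w k) = 0" using assms by (auto simp: poly_of_roots)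
  then have "(\<Sum>i\<le>l. coeff ?p i * w k ^ i) + w k ^ Suc l = 0"
    using poly_eq_sum_le[of ?p m "w k"] by (simp add: l)
  then have "w k ^ Suc l = - (\<Sum>i\<le>l. coeff ?p i * w k ^ i)" by (simp add: add_eq_0_iff add.commute)
  then have "?r ^ Suc l = norm (\<Sum>i\<le>l. coeff ?p i * w k ^ i)"
    by (metis norm_minus_cancel norm_power)
  also have "\<dots> \<le> (\<Sum>i\<le>l. norm (coeff ?p i) * ?r ^ l)"
  proof (rule order_trans[OF norm_sum], rule sum_mono)
    fix i assume "i \<in> {..l}"
    then have "?r ^ i \<le> ?r ^ l" using False by (intro power_increasing) auto
    then show "norm (coeff ?p i * w k ^ i) \<le> norm (coeff ?p i) * ?r ^ l"
      by (simp add: norm_mult norm_power mult_left_mono)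
  qed
  finally have "?r * ?r ^ l \<le> (\<Sum>i\<le>l. norm (coeff ?p i)) * ?r ^ l"
    by (simp add: sum_distrib_right)
  moreover have "0 < ?r ^ l" using False by (intro zero_less_power) linarith
  ultimately have "?r \<le> (\<Sum>i\<le>l. norm (coeff ?p i))" by (rule mult_right_le_imp_le)
  then show ?thesis using pn by simp
qed

text \<open>Uniform continuity of the multiset of roots. Otherwise there are pairs of times ever
  closer together with root lists that no reordering brings within \<open>\<epsilon>\<close>. At a
  cluster point the two times coincide, so the limiting lists differ by a permutation
  \<open>\<sigma>\<close>; reordering by \<open>\<sigma>\<close> throughout the sequence contradicts
  the separation.\<close>

lemma roots_match:
  assumes M: "pcont M UNIV" and deg: "\<And>t. degree (M t) = m" "\<And>t. lead_coeff (M t) = 1"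
    and "0 < (\<epsilon>::real)"
  shows "\<exists>\<delta>>0. \<forall>s\<in>{a..b}. \<forall>t\<in>{a..b}. \<bar>s - t\<bar> < \<delta> \<longrightarrow> (\<forall>w. M s = of_roots m w \<longrightarrow>
    (\<exists>w'. M t = of_roots m w' \<and> (\<forall>k<m. norm (w k - w' k) < \<epsilon>)))"
proof (rule ccontr)
  assume contra: "\<not> ?thesis"
  have "\<exists>s\<in>{a..b}. \<exists>t\<in>{a..b}. \<exists>w. \<bar>s - t\<bar> < 1 / real (Suc N) \<and> M s = of_roots m w \<and>
      \<not> (\<exists>w'. M t = of_roots m w' \<and> (\<forall>k<m. norm (w k - w' k) < \<epsilon>))" for N
  proof -
    have "0 < 1 / real (Suc N)" by simp
    then show ?thesis using contra by blast
  qed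
  then obtain s t w where stw: "\<And>N. s N \<in> {a..b}" "\<And>N. t N \<in> {a..b}"
    "\<And>N. \<bar>s N - t N\<bar> < 1 / real (Suc N)" "\<And>N. M (s N) = of_roots m (w N)"
    "\<And>N w'. M (t N) = of_roots m w' \<Longrightarrow> \<exists>k<m. \<epsilon> \<le> norm (w N k - w' k)"
    by (metis not_le)
  obtain v where v: "\<And>N. M (t N) = of_roots m (v N)"
    using of_roots_exists[OF deg(1) deg(2)] choice[of "\<lambda>N v. M (t N) = of_roots m v"] by auto
  have "continuous_on {a..b} (\<lambda>t. \<Sum>i\<le>m. norm (coeff (M t) i))"
    using M by (auto simp: pcont_def intro!: continuous_intros intro: continuous_on_subset)
  then have "continuous_on {a..b} (\<lambda>t. pn (M t))" by (simp add: pn_eq[of _ m] deg)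
  then have "bounded ((\<lambda>t. pn (M t)) ` {a..b})"
    by (intro compact_imp_bounded compact_continuous_image) auto
  then obtain R where R: "R > 0" "\<And>t. t \<in> {a..b} \<Longrightarrow> pn (M t) \<le> R"
    unfolding bounded_pos by auto
  \<comment> \<open>Entries beyond \<open>m\<close> do not affect the polynomial; setting them to
    \<open>0\<close> puts all lists into one compact cube.\<close>
  define w' where "w' N k = (if k < m then w N k else 0)" for N k
  define v' where "v' N k = (if k < m then v N k else 0)" for N k
  have w': "M (s N) = of_roots m (w' N)" for N
    unfolding stw(4) by (rule of_roots_cong) (simp add: w'_def)
  have v': "M (t N) = of_roots m (v' N)" for N
    unfolding v by (rule of_roots_cong) (simp add: v'_def)
  let ?Q = "{w :: nat \<Rightarrow> complex. \<forall>k. w k \<in> cball 0 R}"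
  have "w' N k \<in> cball 0 R" "v' N k \<in> cball 0 R" for N k
    using of_roots_bound[of k m "w' N"] of_roots_bound[of k m "v' N"] R(1) R(2)[OF stw(1), of N] R(2)[OF stw(2), of N]
    by (auto simp flip: w' v' simp: w'_def v'_def)
  then have inK: "(s N, t N, w' N, v' N) \<in> {a..b} \<times> {a..b} \<times> ?Q \<times> ?Q" for N
    using stw by simp
  have "\<exists>x. \<forall>C. closed C \<longrightarrow> (\<forall>\<^sub>F N in sequentially. (s N, t N, w' N, v' N) \<in> C) \<longrightarrow> x \<in> C"
    by (rule compact_cluster_point[OF _ _ inK])
      (intro compact_Times compact_cube closed_Times closed_cube compact_Icc closed_atLeastAtMost)+
  then obtain x where x: "\<forall>C. closed C \<longrightarrow> (\<forall>\<^sub>F N in sequentially. (s N, t N, w' N, v' N) \<in> C) \<longrightarrow> x \<in> C"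
    by blast
  obtain s0 t0 w0 v0 where x_eq: "x = (s0, t0, w0, v0)" by (cases x)
  have lim: "(s0, t0, w0, v0) \<in> C"
    if "closed C" "\<forall>\<^sub>F N in sequentially. (s N, t N, w' N, v' N) \<in> C" for C
    using x that unfolding x_eq by blast
  have cM: "continuous_on UNIV (\<lambda>x::real \<times> real \<times> (nat \<Rightarrow> complex) \<times> (nat \<Rightarrow> complex). poly (M (f x)) z)"
    if "continuous_on UNIV f" for f z
    using continuous_on_poly_path[OF M _ that continuous_on_const, of m z] deg(1) by simp
  have cc: "continuous_on UNIV (\<lambda>x. g x k)"
    if "continuous_on UNIV g" for g :: "real \<times> real \<times> (nat \<Rightarrow> complex) \<times> (nat \<Rightarrow> complex) \<Rightarrow> nat \<Rightarrow> complex" and k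
    using continuous_on_product_then_coordinatewise[OF that] .
  have "poly (M s0) z = poly (of_roots m w0) z" for z
  proof -
    have "(s0, t0, w0, v0) \<in> {x. poly (M (fst x)) z = (\<Prod>k<m. z - fst (snd (snd x)) k)}"
    proof (rule lim)
      show "closed {x :: real \<times> real \<times> (nat \<Rightarrow> complex) \<times> (nat \<Rightarrow> complex).
          poly (M (fst x)) z = (\<Prod>k<m. z - fst (snd (snd x)) k)}"
        by (intro closed_Collect_eq cM continuous_intros cc)
      show "\<forall>\<^sub>F N in sequentially. (s N, t N, w' N, v' N) \<in> {x. poly (M (fst x)) z = (\<Prod>k<m. z - fst (snd (snd x)) k)}"
        by (simp add: w' poly_of_roots)
    qed
    then show ?thesis by (simp add: poly_of_roots)
  qed
  then have Mw: "M s0 = of_roots m w0" by (intro poly_eq_poly_eq_iff[THEN iffD1] ext)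
  have "poly (M t0) z = poly (of_roots m v0) z" for z
  proof -
    have "(s0, t0, w0, v0) \<in> {x. poly (M (fst (snd x))) z = (\<Prod>k<m. z - snd (snd (snd x)) k)}"
    proof (rule lim)
      show "closed {x :: real \<times> real \<times> (nat \<Rightarrow> complex) \<times> (nat \<Rightarrow> complex).
          poly (M (fst (snd x))) z = (\<Prod>k<m. z - snd (snd (snd x)) k)}"
        by (intro closed_Collect_eq cM continuous_intros cc)
      show "\<forall>\<^sub>F N in sequentially. (s N, t N, w' N, v' N) \<in> {x. poly (M (fst (snd x))) z = (\<Prod>k<m. z - snd (snd (snd x)) k)}"
        by (simp add: v' poly_of_roots)
    qed
    then show ?thesis by (simp add: poly_of_roots)
  qed
  then have Mv: "M t0 = of_roots m v0" by (intro poly_eq_poly_eq_iff[THEN iffD1] ext)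
  have "\<bar>s0 - t0\<bar> \<le> e" if "e > 0" for e
  proof -
    have "(s0, t0, w0, v0) \<in> {x. \<bar>fst x - fst (snd x)\<bar> \<le> e}"
    proof (rule lim)
      have "\<forall>\<^sub>F N in sequentially. 1 / real (Suc N) < e"
        using order_tendstoD(2)[OF LIMSEQ_inverse_real_of_nat that] by (simp add: inverse_eq_divide)
      then show "\<forall>\<^sub>F N in sequentially. (s N, t N, w' N, v' N) \<in> {x. \<bar>fst x - fst (snd x)\<bar> \<le> e}"
        by eventually_elim (use stw(3) in \<open>auto intro: order_trans less_imp_le\<close>)
    qed (auto intro!: closed_Collect_le continuous_intros)
    then show ?thesis by simp
  qed
  then have "s0 = t0" by (metis abs_le_zero_iff dense_ge eq_iff_diff_eq_0)
  then obtain \<sigma> where \<sigma>: "\<sigma> permutes {..<m}" "\<And>k. k < m \<Longrightarrow> w0 k = v0 (\<sigma> k)"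
    using of_roots_eq_imp_permutes[of m w0 v0] Mw Mv by metis
  \<comment> \<open>For each reordered pair some entry is separated by \<open>\<epsilon>\<close>;
    the entry may vary, but a finite union of closed conditions is closed and passes to the cluster
    point.\<close>
  have "(s0, t0, w0, v0) \<in> (\<Union>k<m. {x. \<epsilon> \<le> norm (fst (snd (snd x)) k - snd (snd (snd x)) (\<sigma> k))})"
  proof (rule lim)
    show "closed (\<Union>k<m. {x :: real \<times> real \<times> (nat \<Rightarrow> complex) \<times> (nat \<Rightarrow> complex).
        \<epsilon> \<le> norm (fst (snd (snd x)) k - snd (snd (snd x)) (\<sigma> k))})"
      by (intro closed_UN finite_lessThan ballI closed_Collect_le continuous_intros cc)
    have "\<exists>k<m. \<epsilon> \<le> norm (w' N k - v' N (\<sigma> k))" for N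
    proof -
      have "M (t N) = of_roots m (\<lambda>k. v' N (\<sigma> k))" using v' of_roots_permute[OF \<sigma>(1)] by simp
      from stw(5)[OF this] show ?thesis by (auto simp: w'_def)
    qed
    then show "\<forall>\<^sub>F N in sequentially. (s N, t N, w' N, v' N) \<in>
        (\<Union>k<m. {x. \<epsilon> \<le> norm (fst (snd (snd x)) k - snd (snd (snd x)) (\<sigma> k))})"
      by (simp add: Bex_def)
  qed
  then show False using \<sigma>(2) \<open>0 < \<epsilon>\<close> by auto
qed

text \<open>A chain with steps below \<open>d\<close> that stays \<open>d\<close>-close to \<open>m\<close> values cannot travel further than
  \<open>4 m d\<close>: it would meet \<open>m + 1\<close> levels at mutual distance \<open>4 d\<close>.\<close>

lemma chain_bound:
  fixes f :: "nat \<Rightarrow> real"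
  assumes "i1 \<le> i2" "f i1 = 0" "0 < d"
    and step: "\<And>i. i1 \<le> i \<Longrightarrow> i < i2 \<Longrightarrow> \<bar>f (Suc i) - f i\<bar> < d"
    and near: "\<And>i. i1 \<le> i \<Longrightarrow> i \<le> i2 \<Longrightarrow> \<exists>l<m. \<bar>f i - \<rho> l\<bar> < d"
  shows "f i2 < 4 * d * real m"
proof (rule ccontr)
  assume "\<not> f i2 < 4 * d * real m"
  then have big: "4 * d * real m \<le> f i2" by simp
  have "\<exists>l<m. \<bar>\<rho> l - 4 * d * real c\<bar> < 2 * d" if "c \<le> m" for c
  proof -
    have "4 * d * real c \<le> 4 * d * real m" using that assms(3) by simp
    then have ex: "i1 \<le> i2 \<and> 4 * d * real c \<le> f i2" using big assms(1) by linarith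
    define i where "i = (LEAST i. i1 \<le> i \<and> 4 * d * real c \<le> f i)"
    have i: "i1 \<le> i" "4 * d * real c \<le> f i" "i \<le> i2"
      using LeastI[of "\<lambda>i. i1 \<le> i \<and> 4 * d * real c \<le> f i", OF ex] Least_le[of "\<lambda>i. i1 \<le> i \<and> 4 * d * real c \<le> f i", OF ex]
      by (auto simp: i_def)
    have "f i < 4 * d * real c + d"
    proof (cases "i = i1")
      case True
      have "0 \<le> 4 * d * real c" using assms(3) by simp
      then show ?thesis unfolding True assms(2) using assms(3) by linarith
    next
      case False
      then obtain j where j: "i = Suc j" "i1 \<le> j" using i(1) by (cases i) auto
      have "\<not> (i1 \<le> j \<and> 4 * d * real c \<le> f j)"
        using not_less_Least[of j "\<lambda>i. i1 \<le> i \<and> 4 * d * real c \<le> f i"] j(1) by (simp flip: i_def)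
      then show ?thesis using j step[of j] i(3) by (auto simp: abs_less_iff)
    qed
    moreover obtain l where "l < m" "\<bar>f i - \<rho> l\<bar> < d" using near i by blast
    ultimately show ?thesis using i(2) by (intro exI[of _ l]) (auto simp: abs_less_iff)
  qed
  then obtain l where l: "\<And>c. c \<le> m \<Longrightarrow> l c < m" "\<And>c. c \<le> m \<Longrightarrow> \<bar>\<rho> (l c) - 4 * d * real c\<bar> < 2 * d"
    by metis
  have "inj_on l {..m}"
  proof (rule inj_onI)
    fix c c' assume c: "c \<in> {..m}" "c' \<in> {..m}" "l c = l c'"
    then have "\<bar>4 * d * real c - 4 * d * real c'\<bar> < 4 * d"
      using l(2)[of c] l(2)[of c'] by (auto simp: abs_less_iff)
    then have "4 * d * \<bar>real c - real c'\<bar> < 4 * d * 1"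
      using assms(3) by (simp add: abs_mult flip: right_diff_distrib)
    then have "\<bar>real c - real c'\<bar> < 1" using assms(3) by (simp add: mult_less_cancel_left_pos)
    then show "c = c'" by linarith
  qed
  moreover have "l ` {..m} \<subseteq> {..<m}" using l(1) by auto
  ultimately have "card {..m} \<le> card {..<m}" by (meson card_inj_on_le finite_lessThan)
  then show False by simp
qed

text \<open>On finer and finer grids root lists are matched from one grid point to the next. The
  steps alone do not bound the drift of an entry, since their number grows;
  \<open>chain_bound\<close> does, because near a given time every entry stays close to one of the
  \<open>m\<close> roots at that time. The resulting modulus of continuity is the same for all fine
  grids, so a cluster point of the step functions is a continuous choice of roots.\<close>

lemma continuous_roots_on_Icc:
  fixes M :: "real \<Rightarrow> complex poly"
  assumes M: "pcont M UNIV" and deg: "\<And>t. degree (M t) = m" "\<And>t. lead_coeff (M t) = 1" and "a < b"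
  shows "\<exists>w. (\<forall>k<m. continuous_on {a..b} (\<lambda>t. w t k)) \<and> (\<forall>t\<in>{a..b}. M t = of_roots m (w t))"
proof -
  define h where "h = b - a"
  have h: "h > 0" using assms(4) by (simp add: h_def)
  have "\<forall>j. \<exists>\<delta>>0. \<forall>s\<in>{a..b}. \<forall>t\<in>{a..b}. \<bar>s - t\<bar> < \<delta> \<longrightarrow> (\<forall>w. M s = of_roots m w \<longrightarrow>
      (\<exists>w'. M t = of_roots m w' \<and> (\<forall>k<m. norm (w k - w' k) < 1 / real (Suc j))))"
    using roots_match[OF M deg] by simp
  then obtain \<delta> where \<delta>: "\<And>j::nat. \<delta> j > 0" "\<And>j s t w. s \<in> {a..b} \<Longrightarrow> t \<in> {a..b} \<Longrightarrow> \<bar>s - t\<bar> < \<delta> j \<Longrightarrow>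
      M s = of_roots m w \<Longrightarrow> \<exists>w'. M t = of_roots m w' \<and> (\<forall>k<m. norm (w k - w' k) < 1 / real (Suc j))"
    by metis
  have "\<exists>N::nat. N > 0 \<and> h / real N < \<delta> j \<and> h / real N < 1 / real (Suc j)" for j
  proof -
    obtain N where N: "h / min (\<delta> j) (1 / real (Suc j)) < real N" using reals_Archimedean2 by blast
    have p: "min (\<delta> j) (1 / real (Suc j)) > 0" using \<delta>(1) by simp
    then have "h < real N * min (\<delta> j) (1 / real (Suc j))" using N by (simp only: pos_divide_less_eq)
    moreover have "N > 0" using N h p by (metis divide_pos_pos less_trans of_nat_0_less_iff)
    ultimately have "h / real N < min (\<delta> j) (1 / real (Suc j))"
      by (simp only: pos_divide_less_eq of_nat_0_less_iff mult.commute)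
    then show ?thesis using \<open>N > 0\<close> by auto
  qed
  then obtain N where N: "\<And>j::nat. N j > (0::nat)" "\<And>j. h / real (N j) < \<delta> j" "\<And>j. h / real (N j) < 1 / real (Suc j)"
    by metis
  \<comment> \<open>The minimum keeps the grid at \<open>b\<close> after \<open>N j\<close> steps,
    so the dependent choice can run over all natural numbers.\<close>
  define \<tau> where "\<tau> j i = a + h * real (min i (N j)) / real (N j)" for j i
  have \<tau>I: "\<tau> j i \<in> {a..b}" for j i
  proof -
    have "h * real (min i (N j)) / real (N j) \<le> h * 1"
      unfolding times_divide_eq_right[symmetric] using N(1)[of j] h by (intro mult_left_mono) auto
    then show ?thesis using h N(1)[of j] by (simp add: \<tau>_def h_def)
  qed
  have \<tau>step: "\<bar>\<tau> j i - \<tau> j (Suc i)\<bar> \<le> h / real (N j)" for j i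
  proof -
    have "\<tau> j (Suc i) - \<tau> j i = h / real (N j) * (real (min (Suc i) (N j)) - real (min i (N j)))"
      by (simp add: \<tau>_def right_diff_distrib diff_divide_distrib)
    moreover have "\<bar>real (min (Suc i) (N j)) - real (min i (N j))\<bar> \<le> 1" by (simp add: min_def)
    ultimately have "\<bar>\<tau> j (Suc i) - \<tau> j i\<bar> \<le> h / real (N j) * 1"
      unfolding \<open>\<tau> j (Suc i) - \<tau> j i = _\<close> abs_mult using h by (intro mult_mono) auto
    then show ?thesis by (simp add: abs_minus_commute)
  qed
  have "\<exists>u. \<forall>i. M (\<tau> j i) = of_roots m (u i) \<and> (\<forall>k<m. norm (u i k - u (Suc i) k) < 1 / real (Suc j))" for j
  proof -
    have "\<exists>u. \<forall>i. M (\<tau> j i) = of_roots m (u i) \<and> (\<forall>k<m. norm (u i k - u (Suc i) k) < 1 / real (Suc j))"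
    proof (rule dependent_nat_choice)
      show "\<exists>w. M (\<tau> j 0) = of_roots m w" using of_roots_exists deg by blast
      fix w i assume "M (\<tau> j i) = of_roots m w"
      then show "\<exists>w'. M (\<tau> j (Suc i)) = of_roots m w' \<and> (\<forall>k<m. norm (w k - w' k) < 1 / real (Suc j))"
        using \<delta>(2)[OF \<tau>I \<tau>I] \<tau>step[of j i] N(2)[of j] by (meson le_less_trans)
    qed
    then show ?thesis .
  qed
  then obtain u where u: "\<And>j i. M (\<tau> j i) = of_roots m (u j i)"
    "\<And>j i k. k < m \<Longrightarrow> norm (u j i k - u j (Suc i) k) < 1 / real (Suc j)"
    by metis
  define fl where "fl j t = nat \<lfloor>(t - a) * real (N j) / h\<rfloor>" for j t
  have fl: "\<bar>\<tau> j (fl j t) - t\<bar> \<le> h / real (N j)" if t: "t \<in> {a..b}" for j t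
  proof -
    define y where "y = (t - a) * real (N j) / h"
    have y: "0 \<le> y" "y \<le> real (N j)"
      using t h N(1)[of j] by (auto simp: y_def h_def pos_divide_le_eq mult.commute intro!: mult_left_mono)
    have fly: "fl j t = nat \<lfloor>y\<rfloor>" by (simp add: fl_def y_def)
    have "fl j t \<le> N j" using y by (simp add: fly nat_le_iff floor_le_iff)
    then have "\<tau> j (fl j t) = a + h / real (N j) * of_int \<lfloor>y\<rfloor>"
      using y(1) by (simp add: \<tau>_def min_absorb1) (simp add: fly)
    moreover have "t = a + h / real (N j) * y" using h N(1)[of j] by (simp add: y_def)
    ultimately have "\<tau> j (fl j t) - t = h / real (N j) * (of_int \<lfloor>y\<rfloor> - y)" by (simp add: right_diff_distrib diff_divide_distrib)
    moreover have "\<bar>of_int \<lfloor>y\<rfloor> - y\<bar> \<le> 1" by linarith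
    ultimately have "\<bar>\<tau> j (fl j t) - t\<bar> \<le> h / real (N j) * 1"
      unfolding \<open>\<tau> j (fl j t) - t = _\<close> abs_mult using h by (intro mult_mono) auto
    then show ?thesis by simp
  qed
  have fl_mono: "fl j s \<le> fl j t" if "s \<le> t" for j s t
    unfolding fl_def using that h by (intro nat_mono floor_mono divide_right_mono mult_right_mono) auto
  have \<tau>mono: "\<tau> j i \<le> \<tau> j i'" if "i \<le> i'" for j i i'
    unfolding \<tau>_def using that h by (intro add_left_mono divide_right_mono mult_left_mono) auto
  have small: "\<forall>\<^sub>F j in sequentially. 1 / real (Suc j) < e" if "e > 0" for e
    using order_tendstoD(2)[OF LIMSEQ_inverse_real_of_nat that] by (simp add: inverse_eq_divide)
  define F where "F j = (\<lambda>(t, k). if t \<in> {a..b} \<and> k < m then u j (fl j t) k else 0)" for j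
  have equi: "\<exists>\<gamma>>0. \<forall>s\<in>{a..b}. \<forall>t\<in>{a..b}. \<bar>s - t\<bar> < \<gamma> \<longrightarrow> (\<forall>k<m.
      \<forall>\<^sub>F j in sequentially. norm (F j (s, k) - F j (t, k)) \<le> \<epsilon>)" if "\<epsilon> > 0" for \<epsilon>
  proof -
    \<comment> \<open>With this \<open>d\<close> the total drift \<open>4 * d * m\<close> of a chain
      is at most \<open>\<epsilon>\<close>.\<close>
    define d where "d = \<epsilon> / (4 * real (Suc m))"
    have d: "d > 0" "4 * d * real m \<le> \<epsilon>" using that by (auto simp: d_def field_simps)
    obtain \<delta>1 where \<delta>1: "\<delta>1 > 0" "\<And>s t w. s \<in> {a..b} \<Longrightarrow> t \<in> {a..b} \<Longrightarrow> \<bar>s - t\<bar> < \<delta>1 \<Longrightarrow>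
      M s = of_roots m w \<Longrightarrow> \<exists>w'. M t = of_roots m w' \<and> (\<forall>k<m. norm (w k - w' k) < d)"
      using roots_match[OF M deg d(1)] by metis
    have main: "\<forall>\<^sub>F j in sequentially. norm (F j (t, k) - F j (s, k)) \<le> \<epsilon>"
      if st: "s \<in> {a..b}" "t \<in> {a..b}" "s \<le> t" "t - s < \<delta>1 / 2" and k: "k < m" for s t k
    proof -
      \<comment> \<open>Rounding each of the two times to the grid costs less than
        \<open>\<delta>1 / 4\<close>; together with \<open>t - s < \<delta>1 / 2\<close> all grid
        points concerned lie within \<open>\<delta>1\<close> of the first.\<close>
      have "\<delta>1 / 4 > 0" using \<delta>1(1) by simp
      from small[OF d(1)] small[OF this] show ?thesis
      proof eventually_elim
        case (elim j)
        let ?i1 = "fl j s" and ?i2 = "fl j t"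
        let ?x = "\<lambda>i. u j i k"
        have hN: "h / real (N j) < \<delta>1 / 4" using N(3)[of j] elim(2) by linarith
        have "norm (?x ?i2 - ?x ?i1) < 4 * d * real m"
        \<comment> \<open>The chain records the distance of the moving entry from its start, and the
          \<open>m\<close> values are the distances of the roots at the first grid point from that
          start.\<close>
        proof (rule chain_bound[of ?i1 ?i2 "\<lambda>i. norm (?x i - ?x ?i1)" d m "\<lambda>l. norm (u j ?i1 l - ?x ?i1)"])
          show "?i1 \<le> ?i2" using fl_mono st by simp
          fix i
          show "\<bar>norm (?x (Suc i) - ?x ?i1) - norm (?x i - ?x ?i1)\<bar> < d"
          proof -
            have "\<bar>norm (?x (Suc i) - ?x ?i1) - norm (?x i - ?x ?i1)\<bar> \<le> norm (?x (Suc i) - ?x i)"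
              using norm_triangle_ineq3[of "?x (Suc i) - ?x ?i1" "?x i - ?x ?i1"] by simp
            then show ?thesis using u(2)[OF k, of j i] elim(1) by (simp add: norm_minus_commute)
          qed
          assume i: "?i1 \<le> i" "i \<le> ?i2"
          have "\<bar>\<tau> j i - \<tau> j ?i1\<bar> < \<delta>1"
            using \<tau>mono[OF i(1), of j] \<tau>mono[OF i(2), of j] fl[OF st(1), of j] fl[OF st(2), of j] hN st(4)
            by arith
          from \<delta>1(2)[OF \<tau>I \<tau>I this u(1)] obtain w' where w': "M (\<tau> j ?i1) = of_roots m w'"
            "\<forall>k<m. norm (u j i k - w' k) < d" by blast
          then obtain \<sigma> where \<sigma>: "\<sigma> permutes {..<m}" "\<And>k. k < m \<Longrightarrow> w' k = u j ?i1 (\<sigma> k)"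
            using of_roots_eq_imp_permutes[of m w' "u j ?i1"] u(1) by metis
          have "\<sigma> k < m" using \<sigma>(1) k permutes_in_image[of \<sigma> "{..<m}" k] by simp
          moreover have "\<bar>norm (?x i - ?x ?i1) - norm (u j ?i1 (\<sigma> k) - ?x ?i1)\<bar> \<le> norm (?x i - u j ?i1 (\<sigma> k))"
            using norm_triangle_ineq3[of "?x i - ?x ?i1" "u j ?i1 (\<sigma> k) - ?x ?i1"] by simp
          ultimately show "\<exists>l<m. \<bar>norm (?x i - ?x ?i1) - norm (u j ?i1 l - ?x ?i1)\<bar> < d"
            using w'(2) k \<sigma>(2)[OF k] by force
        qed (use d in auto)
        then show ?case using d(2) st k by (simp add: F_def)
      qed
    qed
    show ?thesis
    proof (intro exI[of _ "\<delta>1 / 2"] conjI ballI impI allI)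
      fix s t k assume st: "s \<in> {a..b}" "t \<in> {a..b}" "\<bar>s - t\<bar> < \<delta>1 / 2" and k: "k < m"
      show "\<forall>\<^sub>F j in sequentially. norm (F j (s, k) - F j (t, k)) \<le> \<epsilon>"
      proof (cases "s \<le> t")
        case True
        then show ?thesis using main[of s t k] st k by (simp add: norm_minus_commute)
      next
        case False
        then show ?thesis using main[of t s k] st k by simp
      qed
    qed (use \<delta>1 in simp)
  qed
  have "continuous_on {a..b} (\<lambda>t. \<Sum>i\<le>m. norm (coeff (M t) i))"
    using M by (auto simp: pcont_def intro!: continuous_intros intro: continuous_on_subset)
  then have "continuous_on {a..b} (\<lambda>t. pn (M t))" by (simp add: pn_eq[of _ m] deg)
  then have "bounded ((\<lambda>t. pn (M t)) ` {a..b})"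
    by (intro compact_imp_bounded compact_continuous_image) auto
  then obtain R where R: "R > 0" "\<And>t. t \<in> {a..b} \<Longrightarrow> pn (M t) \<le> R"
    unfolding bounded_pos by auto
  have "F j x \<in> cball 0 R" for j x
  proof (cases x)
    case (Pair t k)
    then show ?thesis
      using of_roots_bound[of k m "u j (fl j t)"] R(1) R(2)[OF \<tau>I, of j "fl j t"] by (auto simp: F_def u(1))
  qed
  then have inK: "F j \<in> {w. \<forall>k. w k \<in> cball 0 R}" for j by simp
  from compact_cluster_point[OF compact_cube closed_cube inK]
  obtain W where W': "\<forall>C. closed C \<longrightarrow> (\<forall>\<^sub>F j in sequentially. F j \<in> C) \<longrightarrow> W \<in> C" by (rule exE)
  have W: "W \<in> C" if "closed C" "\<forall>\<^sub>F j in sequentially. F j \<in> C" for C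
    using W' that by blast
  have coord: "continuous_on UNIV (\<lambda>w :: real \<times> nat \<Rightarrow> complex. w x)" for x
    by (rule continuous_on_product_coordinates)
  show ?thesis
  proof (intro exI[of _ "\<lambda>t k. W (t, k)"] conjI allI impI ballI)
    fix k assume k: "k < m"
    show "continuous_on {a..b} (\<lambda>t. W (t, k))"
      unfolding continuous_on_iff
    proof (intro ballI allI impI)
      fix t and \<epsilon> :: real assume t: "t \<in> {a..b}" and "\<epsilon> > 0"
      then obtain \<gamma> where \<gamma>: "\<gamma> > 0" "\<forall>s\<in>{a..b}. \<forall>t\<in>{a..b}. \<bar>s - t\<bar> < \<gamma> \<longrightarrow> (\<forall>k<m.
        \<forall>\<^sub>F j in sequentially. norm (F j (s, k) - F j (t, k)) \<le> \<epsilon> / 2)"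
        using equi[of "\<epsilon> / 2"] by auto
      have "dist (W (s, k)) (W (t, k)) < \<epsilon>" if "s \<in> {a..b}" "dist s t < \<gamma>" for s
      proof -
        have "W \<in> {w. norm (w (s, k) - w (t, k)) \<le> \<epsilon> / 2}"
        proof (rule W)
          show "closed {w :: real \<times> nat \<Rightarrow> complex. norm (w (s, k) - w (t, k)) \<le> \<epsilon> / 2}"
            by (intro closed_Collect_le continuous_intros coord)
          show "\<forall>\<^sub>F j in sequentially. F j \<in> {w. norm (w (s, k) - w (t, k)) \<le> \<epsilon> / 2}"
            using \<gamma>(2) that t k by (simp add: dist_real_def)
        qed
        then show ?thesis using \<open>\<epsilon> > 0\<close> by (simp add: dist_norm)
      qed
      then show "\<exists>d>0. \<forall>x'\<in>{a..b}. dist x' t < d \<longrightarrow> dist (W (x', k)) (W (t, k)) < \<epsilon>"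
        using \<gamma>(1) by blast
    qed
  next
    fix t assume t: "t \<in> {a..b}"
    have "poly (M t) z = poly (of_roots m (\<lambda>k. W (t, k))) z" for z
    proof -
      have cz: "continuous_on UNIV (\<lambda>t. poly (M t) z)"
        by (rule continuous_on_poly_path[OF M, of m]) (use deg in \<open>auto intro!: continuous_intros\<close>)
      have "(\<lambda>j. \<tau> j (fl j t)) \<longlonglongrightarrow> t"
      proof (rule tendstoI)
        fix e :: real assume "e > 0"
        from small[OF this] show "\<forall>\<^sub>F j in sequentially. dist (\<tau> j (fl j t)) t < e"
        proof eventually_elim
          case (elim j)
          then show ?case using fl[OF t, of j] N(3)[of j] by (simp add: dist_real_def)
        qed
      qed
      then have lim: "(\<lambda>j. poly (M (\<tau> j (fl j t))) z) \<longlonglongrightarrow> poly (M t) z"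
        using continuous_on_tendsto_compose[OF cz, of "\<lambda>j. \<tau> j (fl j t)" t sequentially] by simp
      have "norm ((\<Prod>k<m. z - W (t, k)) - poly (M t) z) \<le> e" if "e > 0" for e
      proof -
        have "W \<in> {w. norm ((\<Prod>k<m. z - w (t, k)) - poly (M t) z) \<le> e}"
        proof (rule W)
          show "closed {w :: real \<times> nat \<Rightarrow> complex. norm ((\<Prod>k<m. z - w (t, k)) - poly (M t) z) \<le> e}"
            by (intro closed_Collect_le continuous_intros coord)
          have "\<forall>\<^sub>F j in sequentially. dist (poly (M (\<tau> j (fl j t))) z) (poly (M t) z) < e"
            using tendstoD[OF lim that] .
          then show "\<forall>\<^sub>F j in sequentially. F j \<in> {w. norm ((\<Prod>k<m. z - w (t, k)) - poly (M t) z) \<le> e}"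
          proof eventually_elim
            case (elim j)
            have "(\<Prod>k<m. z - F j (t, k)) = poly (M (\<tau> j (fl j t))) z"
              unfolding u(1) poly_of_roots using t by (intro prod.cong) (auto simp: F_def)
            then show ?case using elim by (simp add: dist_norm)
          qed
        qed
        then show ?thesis by simp
      qed
      then have "norm ((\<Prod>k<m. z - W (t, k)) - poly (M t) z) \<le> 0" by (rule field_le_epsilon[of _ 0, simplified])
      then show ?thesis by (simp add: poly_of_roots)
    qed
    then show "M t = of_roots m (\<lambda>k. W (t, k))" by (intro poly_eq_poly_eq_iff[THEN iffD1] ext)
  qed
qed

lemma continuous_roots:
  fixes M :: "real \<Rightarrow> complex poly"
  assumes "pcont M {a..b}" "\<And>t. t \<in> {a..b} \<Longrightarrow> degree (M t) = m" "\<And>t. t \<in> {a..b} \<Longrightarrow> lead_coeff (M t) = 1"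
    and "a < b"
  shows "\<exists>w. (\<forall>k<m. continuous_on {a..b} (\<lambda>t. w t k)) \<and> (\<forall>t\<in>{a..b}. M t = of_roots m (w t))"
proof -
  define cl where "cl t = max a (min b t)" for t :: real
  have cl: "cl t \<in> {a..b}" "t \<in> {a..b} \<Longrightarrow> cl t = t" for t
    using assms(4) by (auto simp: cl_def)
  have "continuous_on UNIV cl" unfolding cl_def by (intro continuous_intros)
  then have "pcont (\<lambda>t. M (cl t)) UNIV"
    using assms(1) unfolding pcont_def
    using cl(1) by (auto intro!: continuous_on_compose2[of "{a..b}" "\<lambda>t. coeff (M t) _" UNIV cl])
  from continuous_roots_on_Icc[OF this _ _ assms(4), of m] show ?thesis
    using assms(2,3) cl by auto
qed

section \<open>The Schwarz integral of a rational function\<close>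

text \<open>On the unit circle \<open>dz / z\<close> is \<open>\<i>\<close> times the real angle
  element, so conjugation changes its sign.\<close>

lemma has_contour_integral_unit_circle_cnj:
  assumes "((\<lambda>z. h z / z) has_contour_integral I) (circlepath 0 1)"
  shows "((\<lambda>z. cnj (h z) / z) has_contour_integral - cnj I) (circlepath 0 1)"
proof -
  let ?\<gamma> = "circlepath 0 1" and ?c = "2 * complex_of_real pi * \<i>"
  have vd: "vector_derivative ?\<gamma> (at t within {0..1}) = ?c * ?\<gamma> t" "?\<gamma> t \<noteq> 0" if "t \<in> {0..1}" for t
    using vector_derivative_circlepath01[of t 0 1] that by (auto simp: circlepath)
  have "((\<lambda>t. h (?\<gamma> t) / ?\<gamma> t * vector_derivative ?\<gamma> (at t within {0..1})) has_integral I) {0..1}"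
    using assms unfolding has_contour_integral_def .
  then have "((\<lambda>t. h (?\<gamma> t) * ?c) has_integral I) {0..1}"
    by (rule has_integral_eq[rotated]) (simp add: vd)
  from has_integral_linear[OF this bounded_linear_cnj]
  have "((\<lambda>t. cnj (h (?\<gamma> t) * ?c)) has_integral cnj I) {0..1}"
    by (simp only: o_def)
  then have "((\<lambda>t. - cnj (h (?\<gamma> t) * ?c)) has_integral - cnj I) {0..1}"
    by (rule has_integral_neg)
  then have "((\<lambda>t. cnj (h (?\<gamma> t)) / ?\<gamma> t * vector_derivative ?\<gamma> (at t within {0..1}))
      has_integral - cnj I) {0..1}"
    by (rule has_integral_eq[rotated]) (simp add: vd)
  then show ?thesis unfolding has_contour_integral_def .
qed

text \<open>The kernel is \<open>2 / (z - \<zeta>) - 1 / z\<close>, and Cauchy's formula evaluates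
  the half of \<open>Re V\<close> belonging to \<open>V\<close>. The half belonging to
  \<open>cnj V\<close> is, on the circle, the conjugate of \<open>h\<close>, a function holomorphic
  in the disk because \<open>1 - cnj \<zeta> * z\<close> does not vanish there; so it contributes
  only the conjugate of \<open>h 0 = V 0\<close>.\<close>

lemma schwarz_integral:
  assumes cont: "continuous_on (cball 0 1) V" and hol: "V holomorphic_on ball 0 1"
    and \<zeta>: "norm \<zeta> < 1"
  shows "((\<lambda>z. of_real (Re (V z)) * ((z + \<zeta>) / (z - \<zeta>)) / z) has_contour_integral
    2 * of_real pi * \<i> * (V \<zeta> - \<i> * of_real (Im (V 0)))) (circlepath 0 1)"
proof -
  have on_circle: "norm z = 1" if "z \<in> path_image (circlepath 0 1)" for z
    using that by simp
  have int: "((\<lambda>u. f u / (u - a)) has_contour_integral 2 * of_real pi * \<i> * f a) (circlepath 0 1)"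
    if "continuous_on (cball 0 1) f" "f holomorphic_on ball 0 1" "norm a < 1" for f a
    using Cauchy_integral_circlepath[OF that(1,2), of a] that(3) by simp
  have I1: "((\<lambda>z. 2 * (V z / (z - \<zeta>)) - V z / (z - 0)) has_contour_integral
      2 * (2 * of_real pi * \<i> * V \<zeta>) - 2 * of_real pi * \<i> * V 0) (circlepath 0 1)"
    by (intro has_contour_integral_diff has_contour_integral_lmul int cont hol) (use \<zeta> in auto)
  have nz: "1 - cnj \<zeta> * z \<noteq> 0" if "norm z \<le> 1" for z
  proof
    assume "1 - cnj \<zeta> * z = 0"
    then have "norm (cnj \<zeta> * z) = 1" by (metis eq_iff_diff_eq_0 norm_one)
    moreover have "norm \<zeta> * norm z \<le> norm \<zeta> * 1" using that by (intro mult_left_mono) auto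
    ultimately show False using \<zeta> by (simp add: norm_mult)
  qed
  define h where "h z = V z * ((1 + cnj \<zeta> * z) / (1 - cnj \<zeta> * z))" for z
  have "((\<lambda>z. h z / (z - 0)) has_contour_integral 2 * of_real pi * \<i> * h 0) (circlepath 0 1)"
    unfolding h_def
    by (intro int continuous_intros holomorphic_intros cont hol) (use nz in auto)
  then have "((\<lambda>z. cnj (h z) / z) has_contour_integral - cnj (2 * of_real pi * \<i> * h 0)) (circlepath 0 1)"
    by (intro has_contour_integral_unit_circle_cnj) simp
  then have I2: "((\<lambda>z. cnj (h z) / z) has_contour_integral 2 * of_real pi * \<i> * cnj (V 0)) (circlepath 0 1)"
    by (simp add: h_def)
  have "((\<lambda>z. (1 / 2) * ((2 * (V z / (z - \<zeta>)) - V z / (z - 0)) + cnj (h z) / z)) has_contour_integral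
      (1 / 2) * ((2 * (2 * of_real pi * \<i> * V \<zeta>) - 2 * of_real pi * \<i> * V 0) + 2 * of_real pi * \<i> * cnj (V 0)))
      (circlepath 0 1)"
    by (intro has_contour_integral_lmul has_contour_integral_add I1 I2)
  also have "(1 / 2) * ((2 * (2 * of_real pi * \<i> * V \<zeta>) - 2 * of_real pi * \<i> * V 0) + 2 * of_real pi * \<i> * cnj (V 0)) =
      2 * of_real pi * \<i> * (V \<zeta> - (V 0 - cnj (V 0)) / 2)" by (simp add: algebra_simps)
  also have "(V 0 - cnj (V 0)) / 2 = \<i> * of_real (Im (V 0))" by (simp add: complex_eq_iff)
  finally show ?thesis
  proof (rule has_contour_integral_eq)
    fix z assume "z \<in> path_image (circlepath 0 1)"
    then have z: "norm z = 1" by (rule on_circle)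
    then have zn: "z \<noteq> 0" "z - \<zeta> \<noteq> 0" using \<zeta> by auto
    have zc: "z * cnj z = 1" using z by (simp add: complex_norm_square[symmetric])
    have "cnj ((1 + cnj \<zeta> * z) / (1 - cnj \<zeta> * z)) = (z + \<zeta>) / (z - \<zeta>)"
    proof -
      have "1 - \<zeta> * cnj z \<noteq> 0" using nz[of z] z by (metis complex_cnj_cancel_iff complex_cnj_cnj complex_cnj_diff complex_cnj_mult complex_cnj_one complex_cnj_zero order_refl)
      moreover have "(1 + \<zeta> * cnj z) * (z - \<zeta>) = (z + \<zeta>) * (1 - \<zeta> * cnj z)"
        using zc by (simp add: algebra_simps)
      ultimately show ?thesis using zn(2) by (simp add: frac_eq_eq)
    qed
    then have hz: "cnj (h z) = cnj (V z) * ((z + \<zeta>) / (z - \<zeta>))" by (simp only: h_def complex_cnj_mult)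
    have e1: "2 * (V z / (z - \<zeta>)) - V z / (z - 0) = V z * ((z + \<zeta>) / (z - \<zeta>)) / z"
      using zn by (simp add: field_simps)
    have e2: "(1 / 2) * (u * K / z + v * K / z) = ((u + v) / 2) * K / z" for u v K
      by (simp add: add_divide_distrib ring_distribs)
    have "(1 / 2) * ((2 * (V z / (z - \<zeta>)) - V z / (z - 0)) + cnj (h z) / z) =
        ((V z + cnj (V z)) / 2) * ((z + \<zeta>) / (z - \<zeta>)) / z"
      unfolding hz e1 by (rule e2)
    also have "(V z + cnj (V z)) / 2 = of_real (Re (V z))" by (simp add: complex_eq_iff)
    finally show "(1 / 2) * ((2 * (V z / (z - \<zeta>)) - V z / (z - 0)) + cnj (h z) / z) =
        of_real (Re (V z)) * ((z + \<zeta>) / (z - \<zeta>)) / z" .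
  qed
qed

text \<open>Maximum modulus principle for \<open>exp (- V)\<close>, whose modulus is
  \<open>exp (- Re V)\<close>; compactness of the circle provides a bound strictly below
  \<open>1\<close>.\<close>

lemma Re_pos_of_boundary:
  assumes cont: "continuous_on (cball 0 1) V" and hol: "V holomorphic_on ball 0 1"
    and pos: "\<And>z. norm z = 1 \<Longrightarrow> 0 < Re (V z)" and \<zeta>: "norm \<zeta> < 1"
  shows "0 < Re (V \<zeta>)"
proof -
  have cs: "continuous_on (sphere 0 1) (\<lambda>z. norm (exp (- V z)))"
    by (intro continuous_intros continuous_on_subset[OF cont]) auto
  have "(1 :: complex) \<in> sphere 0 1" by simp
  then obtain z0 where "z0 \<in> sphere 0 1" "\<forall>z\<in>sphere 0 1. norm (exp (- V z)) \<le> norm (exp (- V z0))"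
    using continuous_attains_sup[OF compact_sphere _ cs] by blast
  then have z0: "norm z0 = 1" "\<And>z. norm z = 1 \<Longrightarrow> norm (exp (- V z)) \<le> norm (exp (- V z0))"
    by auto
  have "norm (exp (- V \<zeta>)) \<le> norm (exp (- V z0))"
  proof (rule maximum_modulus_frontier[of "\<lambda>z. exp (- V z)" "ball 0 1"])
    show "(\<lambda>z. exp (- V z)) holomorphic_on interior (ball 0 1)"
      using hol by (auto intro!: holomorphic_intros)
    show "continuous_on (closure (ball 0 1)) (\<lambda>z. exp (- V z))"
      using cont by (auto intro!: continuous_intros)
  qed (use z0 \<zeta> in \<open>auto simp: frontier_ball\<close>)
  also have "\<dots> < 1" using pos[OF z0(1)] by (simp add: norm_exp_eq_Re)
  finally show ?thesis by (simp add: norm_exp_eq_Re)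
qed

section \<open>Rational functions of admissible form\<close>

lemma prod_linear_dvd:
  fixes K :: "complex poly"
  assumes "finite J" "inj_on w J" "\<And>j. j \<in> J \<Longrightarrow> poly K (w j) = 0"
  shows "(\<Prod>j\<in>J. [:- w j, 1:]) dvd K"
  using assms
proof (induction J rule: finite_induct)
  case (insert i J)
  have "coprime [:- w i, 1:] (\<Prod>j\<in>J. [:- w j, 1:])"
  proof (rule no_common_root_imp_coprime)
    show "no_common_root [:- w i, 1:] (\<Prod>j\<in>J. [:- w j, 1:])"
      unfolding no_common_root_def
    proof
      fix z
      have "poly (\<Prod>j\<in>J. [:- w j, 1:]) (w i) \<noteq> 0"
        using insert.hyps insert.prems(1) by (auto simp: poly_prod inj_on_def)
      then show "poly [:- w i, 1:] z \<noteq> 0 \<or> poly (\<Prod>j\<in>J. [:- w j, 1:]) z \<noteq> 0"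
        by (cases "z = w i") auto
    qed
  qed
  moreover have "[:- w i, 1:] dvd K" using insert.prems(2) by (simp add: poly_eq_0_iff_dvd[symmetric])
  moreover have "(\<Prod>j\<in>J. [:- w j, 1:]) dvd K" using insert by (auto simp: inj_on_def)
  ultimately show ?case using insert.hyps by (simp add: divides_mult del: mult_pCons_left)
qed simp

lemma rat_fun_eq: "rat_fun m n b w p z = poly (smult b (of_roots m w)) z / poly (of_roots n p) z"
  by (simp add: rat_fun_def poly_of_roots)

text \<open>A rational path at one instant, with \<open>c\<close> for the value of \<open>q\<close>.
  Where only the algebra of zeros and poles matters, the locale is entered with
  \<open>c = 1\<close>.\<close>

locale admissible_data =
  fixes m n :: nat and b :: complex and w p :: "nat \<Rightarrow> complex" and c :: real
  assumes adm: "admissible m n b w p" and c_pos: "0 < c"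
begin

abbreviation g :: "complex \<Rightarrow> complex" where "g \<equiv> rat_fun m n b w p"
definition G :: "complex poly" where "G = smult b (of_roots m w)"
definition S :: "complex poly" where "S = of_roots n p"
definition L :: "complex poly" where "L = smult (of_real c) (Lp m n G S)"
abbreviation J :: "nat set" where "J \<equiv> disk_zeros m w"
abbreviation A :: "nat \<Rightarrow> complex" where "A j \<equiv> A_coef c g (w j)"

lemma g_eq: "g z = poly G z / poly S z"
  by (simp add: rat_fun_eq G_def S_def)

lemma nm: "n \<le> m"
  using adm by (simp add: admissible_def rational_form_def)

lemma g0_nonzero: "g 0 \<noteq> 0"
  using adm by (auto simp: admissible_def rational_form_def)

lemma b_nonzero: "b \<noteq> 0"
  using g0_nonzero by (auto simp: g_eq G_def)

lemma poly_G: "poly G z = b * (\<Prod>k<m. z - w k)"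
  by (simp add: G_def poly_of_roots)

lemma poly_S: "poly S z = (\<Prod>j<n. z - p j)"
  by (simp add: S_def poly_of_roots)

lemma G_root: "poly G z = 0 \<longleftrightarrow> (\<exists>k<m. z = w k)"
  using b_nonzero by (auto simp: poly_G)

lemma S_root: "poly S z = 0 \<longleftrightarrow> (\<exists>j<n. z = p j)"
  by (auto simp: poly_S)

lemma G0_nonzero: "poly G 0 \<noteq> 0"
  using g0_nonzero by (auto simp: g_eq)

lemma w_nonzero: "k < m \<Longrightarrow> w k \<noteq> 0"
  using G0_nonzero G_root by metis

lemma pole_norm: "j < n \<Longrightarrow> 1 < norm (p j)"
  using adm by (simp add: admissible_def rational_form_def)

lemma S_nonzero: "norm z \<le> 1 \<Longrightarrow> poly S z \<noteq> 0"
  using pole_norm by (force simp: S_root)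

lemma no_common: "poly G z \<noteq> 0 \<or> poly S z \<noteq> 0"
  using adm unfolding admissible_def rational_form_def by (metis G_root S_root)

lemma w_reflect: "j < m \<Longrightarrow> k < m \<Longrightarrow> w k \<noteq> 1 / cnj (w j)"
  using adm by (simp add: admissible_def no_reflected_zeros_def reflect_def)

lemma G_reflect: "k < m \<Longrightarrow> poly G (1 / cnj (w k)) \<noteq> 0"
  using w_reflect by (metis G_root)

lemma w_norm: "k < m \<Longrightarrow> norm (w k) \<noteq> 1"
proof
  assume k: "k < m" "norm (w k) = 1"
  then have "w k * cnj (w k) = 1" by (simp add: complex_norm_square[symmetric])
  then have "w k = 1 / cnj (w k)" using w_nonzero[OF k(1)] by (simp add: field_simps)
  then show False using w_reflect[OF k(1,1)] by simp
qed

lemma degree_G: "degree G = m"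
  using b_nonzero by (simp add: G_def)

lemma degree_S: "degree S = n"
  by (simp add: S_def)

lemma good: "good m n G S"
  unfolding good_def
proof (intro conjI)
  show "G \<noteq> 0" "lead_coeff S = 1" using b_nonzero by (auto simp: G_def S_def)
  show "no_common_root S G" using no_common by (auto simp: no_common_root_def)
  show "no_common_root G (pCons 0 (rc m G))"
    unfolding no_common_root_def
  proof
    fix z
    show "poly G z \<noteq> 0 \<or> poly (pCons 0 (rc m G)) z \<noteq> 0"
    proof (cases "poly G z = 0")
      case True
      then obtain k where "k < m" "z = w k" by (auto simp: G_root)
      then show ?thesis using w_nonzero[of k] G_reflect[of k] by (simp add: poly_rc degree_G)
    qed simp
  qed
qed (use nm degree_G degree_S in auto)

lemma degree_L: "degree L \<le> m"
  using Lp_spec(1)[OF good] degree_smult_le unfolding L_def by (rule order_trans[rotated])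

lemma L_identity: "L * rc m G + rc m L * G = smult (of_real c) (Hp m n S)"
  using Lp_spec(2)[OF good] by (simp add: L_def rc_smult flip: smult_add_right)

lemma L_normalised: "Im (poly L 0 / poly G 0) = 0"
proof -
  have "poly L 0 / poly G 0 = of_real c * (poly (Lp m n G S) 0 / poly G 0)" by (simp add: L_def)
  then show ?thesis
    by (simp only: times_complex.sel Re_complex_of_real Im_complex_of_real Lp_normalised[OF good])
qed

lemma finite_J: "finite J"
  by (simp add: disk_zeros_def)

lemma J_iff: "j \<in> J \<longleftrightarrow> j < m \<and> norm (w j) < 1"
  by (simp add: disk_zeros_def)

lemma inj_J: "inj_on w J"
  using adm by (auto simp: admissible_def simple_disk_zeros_def inj_on_def J_iff)

lemma J_simple: "j \<in> J \<Longrightarrow> k < m \<Longrightarrow> w k = w j \<Longrightarrow> k = j"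
  using adm by (auto simp: admissible_def simple_disk_zeros_def)

definition Gq :: "nat \<Rightarrow> complex poly" where
  "Gq j = smult b (\<Prod>k\<in>{..<m} - {j}. [:- w k, 1:])"

lemma G_factor: "j < m \<Longrightarrow> G = [:- w j, 1:] * Gq j"
  unfolding G_def Gq_def of_roots_def mult_smult_right
  by (subst prod.remove[of "{..<m}" j]) auto

lemma pderiv_G: "j < m \<Longrightarrow> poly (pderiv G) (w j) = poly (Gq j) (w j)"
  by (subst G_factor) (auto simp: pderiv_mult pderiv_pCons simp del: mult_pCons_left)

lemma poly_Gq: "poly (Gq j) z = b * (\<Prod>k\<in>{..<m} - {j}. z - w k)"
  by (simp add: Gq_def poly_prod)

lemma pderiv_G_nonzero: "j \<in> J \<Longrightarrow> poly (pderiv G) (w j) \<noteq> 0"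
  using J_simple b_nonzero by (auto simp: pderiv_G J_iff poly_Gq)

lemma g_deriv:
  assumes "poly S z \<noteq> 0"
  shows "(g has_field_derivative
    (poly (pderiv G) z * poly S z - poly G z * poly (pderiv S) z) / (poly S z * poly S z)) (at z)"
  unfolding g_eq using assms by (intro DERIV_divide poly_DERIV)

lemma star_fun_g: "star_fun g z = cnj (poly G (1 / cnj z) / poly S (1 / cnj z))"
  by (simp add: star_fun_def g_eq)

lemma J_S_nonzero: "j \<in> J \<Longrightarrow> poly S (w j) \<noteq> 0"
  by (rule S_nonzero) (simp add: J_iff less_imp_le)

lemma deriv_g_at_zero: "j \<in> J \<Longrightarrow> deriv g (w j) = poly (pderiv G) (w j) / poly S (w j)"
proof -
  assume j: "j \<in> J"
  have "poly G (w j) = 0" using j by (auto simp: G_root J_iff)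
  then show ?thesis using DERIV_imp_deriv[OF g_deriv[OF J_S_nonzero[OF j]]] J_S_nonzero[OF j] by simp
qed

lemma A_zero_iff: "j \<in> J \<Longrightarrow> A j = 0 \<longleftrightarrow> poly S (1 / cnj (w j)) = 0"
  using c_pos pderiv_G_nonzero[of j] J_S_nonzero[of j] G_reflect[of j]
  by (auto simp: A_coef_def deriv_g_at_zero star_fun_g J_iff)

lemma poly_Hp: "z \<noteq> 0 \<Longrightarrow> poly (Hp m n S) z = 2 * z ^ m * poly S z * cnj (poly S (1 / cnj z))"
  using nm degree_S by (simp add: Hp_def poly_monom poly_rc power_add[symmetric] mult_ac)

text \<open>At a zero of \<open>G\<close> only the first term of \<open>L_identity\<close> survives,
  and \<open>rc m G\<close> does not vanish there. Consequently \<open>2 * A j\<close> is the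
  residue of \<open>L / G\<close> at the simple zero \<open>w j\<close>, which is where the
  coefficient \<open>A_coef\<close> comes from.\<close>

lemma L_at_zero:
  assumes j: "j \<in> J"
  shows "poly L (w j) = 2 * A j * poly (pderiv G) (w j)"
proof -
  have k: "j < m" "w j \<noteq> 0" "poly G (w j) = 0" using j w_nonzero by (auto simp: J_iff G_root)
  have "poly L (w j) * poly (rc m G) (w j) = of_real c * poly (Hp m n S) (w j)"
    using arg_cong[OF L_identity, of "\<lambda>q. poly q (w j)"] k by simp
  then have "poly L (w j) * cnj (poly G (1 / cnj (w j))) = 2 * of_real c * poly S (w j) * cnj (poly S (1 / cnj (w j)))"
    using k by (simp add: poly_rc degree_G poly_Hp)
  then have "poly L (w j) = 2 * of_real c * poly S (w j) * cnj (poly S (1 / cnj (w j))) / cnj (poly G (1 / cnj (w j)))"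
    using G_reflect[OF k(1)] by (simp add: field_simps)
  also have "\<dots> = 2 * A j * poly (pderiv G) (w j)"
    using pderiv_G_nonzero[OF j] J_S_nonzero[OF j]
    by (simp add: A_coef_def deriv_g_at_zero[OF j] star_fun_g)
  finally show ?thesis .
qed

text \<open>On the unit circle \<open>rc\<close> is conjugation up to a power of \<open>z\<close>,
  and after division by \<open>z ^ m\<close> the identity for \<open>L\<close> says that
  \<open>Re (L * cnj G)\<close> is \<open>c\<close> times the squared modulus of
  \<open>S\<close>.\<close>

lemma Re_L_div_G:
  assumes "norm z = 1"
  shows "Re (poly L z / poly G z) = c / (norm (g z))\<^sup>2"
proof -
  have "z \<noteq> 0" using assms by auto
  moreover have "z * cnj z = 1" using assms by (simp add: complex_norm_square[symmetric])
  ultimately have z: "z \<noteq> 0" "1 / cnj z = z" by (auto simp: field_simps)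
  have Gz: "poly G z \<noteq> 0" using w_norm assms by (auto simp: G_root)
  have Sz: "poly S z \<noteq> 0" using S_nonzero assms by simp
  have "z ^ m * (poly L z * cnj (poly G z) + cnj (poly L z) * poly G z) =
      z ^ m * (2 * of_real c * (poly S z * cnj (poly S z)))"
    using arg_cong[OF L_identity, of "\<lambda>q. poly q z"] z(1)
    by (simp add: poly_rc degree_G degree_L poly_Hp z(2) algebra_simps)
  then have "poly L z * cnj (poly G z) + cnj (poly L z) * poly G z = 2 * of_real c * (poly S z * cnj (poly S z))"
    using z(1) by simp
  then have "poly L z * cnj (poly G z) + cnj (poly L z * cnj (poly G z)) =
      2 * of_real c * of_real ((norm (poly S z))\<^sup>2)"
    unfolding complex_norm_square by (simp only: complex_cnj_mult complex_cnj_cnj)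
  then have "of_real (2 * Re (poly L z * cnj (poly G z))) = (of_real (2 * c * (norm (poly S z))\<^sup>2) :: complex)"
    unfolding complex_add_cnj by (simp only: of_real_mult of_real_numeral)
  then have "2 * Re (poly L z * cnj (poly G z)) = 2 * c * (norm (poly S z))\<^sup>2"
    by (simp only: of_real_eq_iff)
  moreover have "poly L z / poly G z = poly L z * cnj (poly G z) / of_real ((norm (poly G z))\<^sup>2)"
    by (subst complex_div_cnj) simp
  ultimately have "Re (poly L z / poly G z) = c * (norm (poly S z))\<^sup>2 / (norm (poly G z))\<^sup>2"
    by (simp only: Re_divide_of_real) simp
  also have "\<dots> = c / (norm (g z))\<^sup>2" using Sz by (simp add: g_eq norm_divide power_divide)
  finally show ?thesis .
qed

lemma w_norm_le: "j \<in> J \<Longrightarrow> norm z \<le> 1 \<Longrightarrow> 1 - cnj (w j) * z \<noteq> 0"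
proof
  assume j: "j \<in> J" and z: "norm z \<le> 1" and "1 - cnj (w j) * z = 0"
  then have "norm (cnj (w j) * z) = 1" by (metis eq_iff_diff_eq_0 norm_one)
  moreover have "norm (w j) * norm z \<le> norm (w j) * 1" using z by (intro mult_left_mono) auto
  ultimately show False using j by (simp add: norm_mult J_iff)
qed

lemma R_fun_diff: "R_fun m w B z - R_fun m w B' z = R_fun m w (\<lambda>j. B j - B' j) z"
proof -
  have "(\<Sum>j\<in>J. 2 * (B j - B' j) / w j) = (\<Sum>j\<in>J. 2 * B j / w j) - (\<Sum>j\<in>J. 2 * B' j / w j)"
    by (simp add: right_diff_distrib diff_divide_distrib sum_subtractf)
  moreover have "(\<Sum>j\<in>J. 2 * (B j - B' j) / (z - w j) - 2 * cnj (B j - B' j) * z / (1 - cnj (w j) * z)) =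
      (\<Sum>j\<in>J. 2 * B j / (z - w j) - 2 * cnj (B j) * z / (1 - cnj (w j) * z)) -
      (\<Sum>j\<in>J. 2 * B' j / (z - w j) - 2 * cnj (B' j) * z / (1 - cnj (w j) * z))"
    unfolding sum_subtractf[symmetric]
    by (intro sum.cong) (simp_all add: right_diff_distrib left_diff_distrib diff_divide_distrib)
  ultimately show ?thesis
    unfolding R_fun_def by (simp only: minus_complex.sel of_real_diff right_diff_distrib) (simp add: algebra_simps)
qed

text \<open>On the circle the second term of each summand is the conjugate of the first, so
  \<open>R\<close> contributes poles in the disk without changing the boundary values of the real
  part.\<close>

lemma Re_R_fun_circle:
  assumes "norm z = 1"
  shows "Re (R_fun m w B z) = 0"
proof -
  have zc: "z * cnj z = 1" using assms by (simp add: complex_norm_square[symmetric])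
  have "Re (2 * B j / (z - w j) - 2 * cnj (B j) * z / (1 - cnj (w j) * z)) = 0" if j: "j \<in> J" for j
  proof -
    have "z - w j \<noteq> 0" using j assms by (auto simp: J_iff)
    then have "cnj (z - w j) \<noteq> 0" by (simp only: complex_cnj_zero_iff not_False_eq_True)
    moreover have "1 - cnj (w j) * z = z * cnj (z - w j)" using zc by (simp add: algebra_simps)
    moreover have "z \<noteq> 0" using assms by auto
    ultimately have "2 * cnj (B j) * z / (1 - cnj (w j) * z) = cnj (2 * B j / (z - w j))" by simp
    then show ?thesis by (simp only: minus_complex.sel cnj.sel diff_self)
  qed
  then show ?thesis by (simp add: R_fun_def Re_sum)
qed

lemma Im_R_fun_0: "Im (R_fun m w B 0) = 0"
  by (simp add: R_fun_def Im_sum sum_negf)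

text \<open>\<open>V\<close> is \<open>P\<close>, written as \<open>L / G\<close> with the poles in the disk moved outside.\<close>

lemma V_exists:
  obtains V where "continuous_on (cball 0 1) V" "V holomorphic_on ball 0 1"
    "\<And>z. norm z \<le> 1 \<Longrightarrow> poly G z \<noteq> 0 \<Longrightarrow> poly L z / poly G z = V z + R_fun m w A z"
proof -
  \<comment> \<open>The numerator over \<open>G\<close> of \<open>L / G\<close> minus its principal
    parts \<open>2 * A j / (z - w j)\<close>; it vanishes at all disk zeros, so their linear factors
    cancel.\<close>
  define K where "K = L - (\<Sum>j\<in>J. smult (2 * A j) (Gq j))"
  define D1 where "D1 = (\<Prod>j\<in>J. [:- w j, 1:])"
  define G2 where "G2 = smult b (\<Prod>k\<in>{..<m} - J. [:- w k, 1:])"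
  have Jm: "J \<subseteq> {..<m}" by (auto simp: J_iff)
  have GD: "G = D1 * G2"
    unfolding G_def of_roots_def D1_def G2_def mult_smult_right using Jm
    by (subst prod.subset_diff[of J "{..<m}"]) (auto simp: mult.commute)
  have "poly K (w i) = 0" if i: "i \<in> J" for i
  proof -
    have "poly (Gq j) (w i) = 0" if "j \<in> J" "j \<noteq> i" for j
      using i that by (auto simp: poly_Gq J_iff)
    then have "(\<Sum>j\<in>J. 2 * A j * poly (Gq j) (w i)) = (\<Sum>j\<in>{i}. 2 * A j * poly (Gq j) (w i))"
      using i by (intro sum.mono_neutral_right finite_J) auto
    then show ?thesis
      using L_at_zero[OF i] pderiv_G[of i] i by (simp add: K_def poly_sum J_iff)
  qed
  then have "D1 dvd K" unfolding D1_def by (intro prod_linear_dvd finite_J inj_J)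
  then obtain T where T: "K = D1 * T" by (auto simp: dvd_def)
  define \<kappa> where "\<kappa> = Im (\<Sum>j\<in>J. 2 * A j / w j)"
  \<comment> \<open>This is \<open>L / G\<close> minus \<open>R\<close>. The terms of
    \<open>R\<close> that remain have their poles at reflected points, outside the closed
    disk.\<close>
  define V where "V z = poly T z / poly G2 z + (\<Sum>j\<in>J. 2 * cnj (A j) * z / (1 - cnj (w j) * z)) - \<i> * of_real \<kappa>" for z
  have G2: "poly G2 z \<noteq> 0" if "norm z \<le> 1" for z
  proof
    assume "poly G2 z = 0"
    then obtain k where k: "k < m" "k \<notin> J" "z = w k" using b_nonzero by (auto simp: G2_def poly_prod)
    then show False using that w_norm[OF k(1)] by (auto simp: J_iff)
  qed
  show ?thesis
  proof (rule that[of V])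
    show "continuous_on (cball 0 1) V"
      unfolding V_def by (intro continuous_intros) (use G2 w_norm_le in auto)
    show "V holomorphic_on ball 0 1"
      unfolding V_def by (intro holomorphic_intros) (use G2 w_norm_le in auto)
    fix z :: complex assume z: "norm z \<le> 1" "poly G z \<noteq> 0"
    have D1z: "poly D1 z \<noteq> 0" using z(2) by (simp add: GD)
    have quot: "poly (Gq j) z / poly G z = 1 / (z - w j)" if "j \<in> J" for j
    proof -
      have "poly G z = (z - w j) * poly (Gq j) z" using G_factor[of j] that by (simp add: J_iff left_diff_distrib)
      then show ?thesis using z(2) by simp
    qed
    have "2 * A j * poly (Gq j) z / poly G z = 2 * A j / (z - w j)" if "j \<in> J" for j
      unfolding times_divide_eq_right[symmetric] quot[OF that] by simp
    then have "(\<Sum>j\<in>J. 2 * A j * poly (Gq j) z) / poly G z = (\<Sum>j\<in>J. 2 * A j / (z - w j))"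
      unfolding sum_divide_distrib by (intro sum.cong) auto
    moreover have "poly K z / poly G z = poly T z / poly G2 z"
      using D1z by (simp add: T GD)
    moreover have "poly L z = poly K z + (\<Sum>j\<in>J. 2 * A j * poly (Gq j) z)"
      by (simp add: K_def poly_sum)
    ultimately have "poly L z / poly G z = poly T z / poly G2 z + (\<Sum>j\<in>J. 2 * A j / (z - w j))"
      by (simp add: add_divide_distrib)
    then show "poly L z / poly G z = V z + R_fun m w A z"
      by (simp add: V_def R_fun_def \<kappa>_def sum_subtractf)
  qed
qed

text \<open>\<open>V\<close> from \<open>V_exists\<close> has real part
  \<open>c / (norm (g z))\<^sup>2\<close> on the circle, as \<open>R\<close> is imaginary there, and
  is real at the origin, as both \<open>L / G\<close> and \<open>R\<close> are. The Schwarz formula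
  therefore identifies it with the integral \<open>P_fun\<close>.\<close>

lemma P_fun_properties:
  shows P_plus_R: "norm z < 1 \<Longrightarrow> poly G z \<noteq> 0 \<Longrightarrow> P_fun c g z + R_fun m w A z = poly L z / poly G z"
    and Re_P_pos: "norm z < 1 \<Longrightarrow> 0 < Re (P_fun c g z)"
    and P_holomorphic: "P_fun c g holomorphic_on ball 0 1"
proof -
  obtain V where V: "continuous_on (cball 0 1) V" "V holomorphic_on ball 0 1"
    "\<And>z. norm z \<le> 1 \<Longrightarrow> poly G z \<noteq> 0 \<Longrightarrow> poly L z / poly G z = V z + R_fun m w A z"
    using V_exists by blast
  have G_circle: "poly G z \<noteq> 0" if "norm z = 1" for z using w_norm that by (auto simp: G_root)
  have S_circle: "poly S z \<noteq> 0" if "norm z = 1" for z using S_nonzero that by simp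
  have ReV: "Re (V z) = c / (norm (g z))\<^sup>2" if "norm z = 1" for z
    using arg_cong[OF V(3)[of z], of Re] Re_L_div_G[OF that] Re_R_fun_circle[OF that] G_circle[OF that] that by simp
  have "Im (V 0) = 0"
    using arg_cong[OF V(3)[of 0], of Im] L_normalised Im_R_fun_0 G0_nonzero by simp
  have PV: "P_fun c g z = V z" if z: "norm z < 1" for z
  proof -
    have "((\<lambda>u. of_real (c / (norm (g u))\<^sup>2) * ((u + z) / (u - z)) / u) has_contour_integral
        2 * of_real pi * \<i> * (V z - \<i> * of_real (Im (V 0)))) (circlepath 0 1)"
      by (rule has_contour_integral_eq[OF schwarz_integral[OF V(1,2) z]]) (simp add: ReV)
    from contour_integral_unique[OF this] show ?thesis
      unfolding P_fun_def using \<open>Im (V 0) = 0\<close> by simp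
  qed
  show "P_fun c g z + R_fun m w A z = poly L z / poly G z" if "norm z < 1" "poly G z \<noteq> 0"
    using PV V(3) that by simp
  show "0 < Re (P_fun c g z)" if "norm z < 1"
    unfolding PV[OF that]
  proof (rule Re_pos_of_boundary[OF V(1,2) _ that])
    fix z :: complex assume z: "norm z = 1"
    then have "g z \<noteq> 0" using G_circle S_circle by (simp add: g_eq)
    then show "0 < Re (V z)" using ReV[OF z] c_pos by simp
  qed
  show "P_fun c g holomorphic_on ball 0 1"
    by (rule holomorphic_transform[OF V(2)]) (simp add: PV)
qed

text \<open>\<open>f\<close> is \<open>(z - w j) * R\<close> with the singularity at
  \<open>w j\<close> removed; its value \<open>2 * C j\<close> there is a limit of zeros. The point
  \<open>0\<close> is exempt because the equations supplying the hypothesis contain \<open>R\<close>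
  with a factor \<open>z\<close>.\<close>

lemma R_fun_zero_imp:
  assumes zero: "\<And>z. norm z < 1 \<Longrightarrow> poly G z \<noteq> 0 \<Longrightarrow> z \<noteq> 0 \<Longrightarrow> R_fun m w C z = 0" and j: "j \<in> J"
  shows "C j = 0"
proof -
  define f where "f z = (z - w j) * (\<i> * of_real (Im (\<Sum>j\<in>J. 2 * C j / w j)) +
    (\<Sum>i\<in>J - {j}. 2 * C i / (z - w i)) - (\<Sum>i\<in>J. 2 * cnj (C i) * z / (1 - cnj (w i) * z))) + 2 * C j" for z
  have jn: "norm (w j) < 1" "j < m" using j by (auto simp: J_iff)
  have fR: "f z = (z - w j) * R_fun m w C z" if "z \<noteq> w j" for z
  proof -
    have "u * (k + s1 - s2) + x = u * (k + (y + s1 - s2))" if "u * y = x" for u k s1 s2 x y :: complex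
      using that by (simp add: algebra_simps)
    moreover have "(z - w j) * (2 * C j / (z - w j)) = 2 * C j" using that by simp
    ultimately show ?thesis
      unfolding R_fun_def f_def sum_subtractf sum.remove[OF finite_J j, of "\<lambda>i. 2 * C i / (z - w i)"]
      by blast
  qed
  have "closed (insert 0 {z. poly G z = 0} - {w j})"
    using poly_roots_finite[of G] good by (intro finite_imp_closed) (auto simp: good_def)
  then have "\<forall>\<^sub>F z in at (w j). z \<in> - (insert 0 {z. poly G z = 0} - {w j})"
    by (intro eventually_at_in_open' open_Compl) (assumption | simp)+
  moreover have "\<forall>\<^sub>F z in at (w j). z \<in> ball 0 1"
    using jn by (intro eventually_at_in_open') auto
  ultimately have zero_near: "\<forall>\<^sub>F z in at (w j). f z = 0"
    using eventually_neq_at_within[of "w j"]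
    by eventually_elim (auto simp: fR zero)
  have "isCont f (w j)"
    unfolding f_def using jn w_norm_le[of _ "w j"] inj_J j
    by (intro continuous_intros) (auto simp: inj_on_def)
  then have "f (w j) = 0"
    using tendsto_unique[OF _ _ tendsto_eventually[OF zero_near], of "f (w j)"] by (simp add: isCont_def)
  then show ?thesis by (simp add: f_def)
qed

end

section \<open>Order of poles and differentiability of coefficients\<close>

lemma has_vector_derivative_iff_quotient:
  "(f has_vector_derivative f') (at x within I) \<longleftrightarrow>
    ((\<lambda>y. (f y - f x) /\<^sub>R (y - x)) \<longlongrightarrow> f') (at x within I)"
proof -
  have "((\<lambda>y. (f y - f x) /\<^sub>R (y - x)) \<longlongrightarrow> f') (at x within I) \<longleftrightarrow>
      ((\<lambda>y. norm ((f y - f x) /\<^sub>R (y - x) - f')) \<longlongrightarrow> 0) (at x within I)"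
    by (subst Lim_null) (simp add: tendsto_norm_zero_iff)
  also have "\<dots> \<longleftrightarrow> ((\<lambda>y. norm ((1 / norm (y - x)) *\<^sub>R (f y - (f x + (y - x) *\<^sub>R f')))) \<longlongrightarrow> 0) (at x within I)"
  proof (rule filterlim_cong[OF refl refl])
    show "\<forall>\<^sub>F y in at x within I. norm ((f y - f x) /\<^sub>R (y - x) - f') =
        norm ((1 / norm (y - x)) *\<^sub>R (f y - (f x + (y - x) *\<^sub>R f')))"
      using eventually_neq_at_within[of x x I]
    proof eventually_elim
      case (elim y)
      have "(f y - f x) /\<^sub>R (y - x) - f' = (1 / (y - x)) *\<^sub>R (f y - (f x + (y - x) *\<^sub>R f'))"
        using elim by (simp add: scaleR_diff_right scaleR_add_right divide_inverse)
      then show ?case by simp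
    qed
  qed
  also have "\<dots> \<longleftrightarrow> (f has_vector_derivative f') (at x within I)"
    unfolding has_vector_derivative_def has_derivative_within tendsto_norm_zero_iff
    by (simp add: bounded_linear_scaleR_left)
  finally show ?thesis by simp
qed

text \<open>Only continuity of the root and differentiability of \<open>P\<close> at the one time
  \<open>t\<close> are known. Factoring \<open>P t = [:- \<omega> t, 1:] * Q\<close> turns
  \<open>poly (P s) (\<omega> s) = 0\<close> into an exact formula for the difference quotient of
  \<open>\<omega>\<close>, in which only difference quotients of coefficients and the value of
  \<open>Q\<close> at \<open>\<omega> s\<close> occur.\<close>

lemma root_has_vector_derivative:
  assumes P: "has_pder P P' (at t within I)" "\<And>s. degree (P s) \<le> N" "degree P' \<le> N"
    and \<omega>: "(\<omega> \<longlongrightarrow> \<omega> t) (at t within I)" "\<And>s. s \<in> I \<Longrightarrow> poly (P s) (\<omega> s) = 0" "t \<in> I"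
    and simple: "poly (pderiv (P t)) (\<omega> t) \<noteq> 0"
  shows "(\<omega> has_vector_derivative - poly P' (\<omega> t) / poly (pderiv (P t)) (\<omega> t)) (at t within I)"
proof -
  obtain Q where Q: "P t = [:- \<omega> t, 1:] * Q" using \<omega>(2,3) by (auto simp: poly_eq_0_iff_dvd dvd_def)
  have Q0: "poly (pderiv (P t)) (\<omega> t) = poly Q (\<omega> t)"
    unfolding Q by (simp add: pderiv_mult pderiv_pCons del: mult_pCons_left)
  define D where "D s = (\<Sum>i\<le>N. (coeff (P s) i - coeff (P t) i) /\<^sub>R (s - t) * \<omega> s ^ i)" for s
  have "(D \<longlongrightarrow> (\<Sum>i\<le>N. coeff P' i * \<omega> t ^ i)) (at t within I)"
    unfolding D_def using P(1)[unfolded has_pder_def has_vector_derivative_iff_quotient]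
    by (intro tendsto_sum tendsto_mult tendsto_power \<omega>(1)) auto
  then have D: "(D \<longlongrightarrow> poly P' (\<omega> t)) (at t within I)"
    by (simp add: poly_eq_sum_le[OF P(3)])
  have Qs: "((\<lambda>s. poly Q (\<omega> s)) \<longlongrightarrow> poly Q (\<omega> t)) (at t within I)"
    by (intro tendsto_poly \<omega>(1))
  have Qn: "poly Q (\<omega> t) \<noteq> 0" using simple Q0 by simp
  have lim: "((\<lambda>s. - D s / poly Q (\<omega> s)) \<longlongrightarrow> - poly P' (\<omega> t) / poly Q (\<omega> t)) (at t within I)"
    by (intro tendsto_divide tendsto_minus D Qs Qn)
  have "\<forall>\<^sub>F s in at t within I. - D s / poly Q (\<omega> s) = (\<omega> s - \<omega> t) /\<^sub>R (s - t)"
  proof -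
    have quot: "- D s / poly Q (\<omega> s) = (\<omega> s - \<omega> t) /\<^sub>R (s - t)"
      if s: "s \<in> I" "s \<noteq> t" "poly Q (\<omega> s) \<noteq> 0" for s
    proof -
      have "D s = (poly (P s) (\<omega> s) - poly (P t) (\<omega> s)) /\<^sub>R (s - t)"
        by (simp add: D_def poly_eq_sum_le[OF P(2)] scaleR_right.sum left_diff_distrib flip: sum_subtractf)
      also have "\<dots> = - ((\<omega> s - \<omega> t) * poly Q (\<omega> s)) /\<^sub>R (s - t)"
        using \<omega>(2)[OF s(1)] by (simp add: Q left_diff_distrib)
      finally show ?thesis using s(3) by (simp add: scaleR_conv_of_real)
    qed
    show ?thesis
      using tendsto_imp_eventually_ne[OF Qs Qn] eventually_neq_at_within[of t t I]
      unfolding eventually_at_filter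
    proof eventually_elim
      case (elim s)
      then show ?case using quot[of s] by blast
    qed
  qed
  with lim show ?thesis unfolding has_vector_derivative_iff_quotient Q0
    by (rule Lim_transform_eventually)
qed

text \<open>Multiplicity is expressed by vanishing derivatives because these can be differentiated
  in time along a moving point.\<close>

lemma linear_power_dvd_iff:
  fixes P :: "complex poly"
  shows "[:- a, 1:] ^ k dvd P \<longleftrightarrow> (\<forall>l<k. poly ((pderiv ^^ l) P) a = 0)"
proof (induction k arbitrary: P)
  case (Suc k)
  have "[:- a, 1:] ^ Suc k dvd P \<longleftrightarrow> poly P a = 0 \<and> [:- a, 1:] ^ k dvd pderiv P"
  proof (cases "P = 0")
    case False
    show ?thesis
    proof (cases "poly P a = 0")
      case True
      have "pderiv P \<noteq> 0"
      proof
        assume "pderiv P = 0"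
        then obtain x where "P = [:x:]" by (metis degree_eq_zeroE pderiv_eq_0_iff)
        then show False using True False by simp
      qed
      then have "order a P = Suc (order a (pderiv P))" using order_pderiv[of P a] False True by simp
      then show ?thesis using True False \<open>pderiv P \<noteq> 0\<close> by (simp only: order_divides) simp
    next
      case F: False
      then show ?thesis by (metis dvd_mult_left poly_eq_0_iff_dvd power_Suc)
    qed
  qed simp
  also have "\<dots> \<longleftrightarrow> poly P a = 0 \<and> (\<forall>l<k. poly ((pderiv ^^ l) (pderiv P)) a = 0)"
    by (simp add: Suc.IH)
  also have "\<dots> \<longleftrightarrow> (\<forall>l<Suc k. poly ((pderiv ^^ l) P) a = 0)"
    by (auto simp: less_Suc_eq_0_disj funpow_swap1)
  finally show ?case .
qed simp

context admissible_data
begin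

text \<open>At the reflected point \<open>\<pi>\<close> the numerator \<open>G\<close> does not
  vanish, so the term of \<open>R\<close> with coefficient \<open>C j\<close> raises the pole of
  \<open>g\<close>, of order \<open>s\<close>, to order \<open>s + 1\<close>, and differentiation
  raises it to \<open>s + 2\<close>. If \<open>Z\<close> contained the factor to the power
  \<open>s - 1\<close>, the left-hand side would have a pole of order at most \<open>s + 1\<close>.
  For \<open>s \<le> 1\<close> the power is trivial, and the assumptions contradict each other
  outright.\<close>

lemma pole_order_obstruction:
  assumes eq: "\<And>z. norm z < 1 \<Longrightarrow> poly G z \<noteq> 0 \<Longrightarrow>
      poly Z z / (poly S z)\<^sup>2 = deriv (\<lambda>z. z * R_fun m w C z * g z) z"
    and j: "j \<in> J" "C j \<noteq> 0"
  shows "\<not> [:- (1 / cnj (w j)), 1:] ^ (order (1 / cnj (w j)) S - 1) dvd Z"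
proof
  define \<pi> where "\<pi> = 1 / cnj (w j)"
  define s where "s = order \<pi> S"
  assume "[:- (1 / cnj (w j)), 1:] ^ (order (1 / cnj (w j)) S - 1) dvd Z"
  then obtain Z1 where Z1: "Z = [:- \<pi>, 1:] ^ (s - 1) * Z1" by (auto simp: dvd_def \<pi>_def s_def)
  have wj: "w j \<noteq> 0" "j < m" "norm (w j) < 1" using j(1) w_nonzero by (auto simp: J_iff)
  have \<pi>0: "\<pi> \<noteq> 0" using wj by (simp add: \<pi>_def)
  have S0: "S \<noteq> 0" by (simp add: S_def)
  obtain S1 where S1: "S = [:- \<pi>, 1:] ^ s * S1" "poly S1 \<pi> \<noteq> 0"
    using order_decomp[OF S0, of \<pi>] by (auto simp: s_def poly_eq_0_iff_dvd)
  define h where "h z = z * R_fun m w C z * g z" for z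
  define F where "F = w ` J \<union> (\<lambda>i. 1 / cnj (w i)) ` J \<union> {z. poly S z = 0}"
  have finF: "finite F" unfolding F_def using S0 by (intro finite_UnI finite_imageI finite_J poly_roots_finite)
  have openF: "open (- F)" using finF by (intro open_Compl finite_imp_closed)
  have nz: "z - w i \<noteq> 0" "1 - cnj (w i) * z \<noteq> 0" if "z \<in> - F" "i \<in> J" for z i
  proof -
    show "z - w i \<noteq> 0" using that by (auto simp: F_def)
    have "z \<noteq> 1 / cnj (w i)" using that by (auto simp: F_def)
    moreover have "w i \<noteq> 0" using that w_nonzero by (auto simp: J_iff)
    ultimately show "1 - cnj (w i) * z \<noteq> 0" by (auto simp: field_simps)
  qed
  have hol_h: "h holomorphic_on - F"
    unfolding h_def R_fun_def g_eq by (intro holomorphic_intros) (use nz in \<open>auto simp: F_def\<close>)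
  \<comment> \<open>The equation is known in the disk, while \<open>\<pi>\<close> lies outside;
    analytic continuation over the plane without finitely many points brings it there.\<close>
  have on_F: "deriv h z = poly Z z / (poly S z)\<^sup>2" if "z \<in> - F" for z
  proof (rule analytic_continuation_open[of "ball 0 1 - {z. poly G z = 0} - F" "- F" "deriv h" "\<lambda>z. poly Z z / (poly S z)\<^sup>2"])
    have finG: "finite {z. poly G z = 0}" using good by (intro poly_roots_finite) (auto simp: good_def)
    show "open (ball 0 1 - {z. poly G z = 0} - F)"
      using finG finF by (intro open_Diff finite_imp_closed) auto
    have "infinite (ball (0::complex) 1)" using uncountable_ball[of 1 "0::complex"] countable_finite by auto
    then have "infinite (ball 0 1 - {z. poly G z = 0} - F)" using finG finF by simp
    then show "ball 0 1 - {z. poly G z = 0} - F \<noteq> {}" by (metis finite.emptyI)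
    show "connected (- F)"
      using connected_open_delete_finite[OF open_UNIV connected_UNIV _ finF] by (simp add: Compl_eq_Diff_UNIV)
    show "deriv h holomorphic_on - F" by (rule holomorphic_deriv[OF hol_h openF])
    show "(\<lambda>z. poly Z z / (poly S z)\<^sup>2) holomorphic_on - F"
      by (intro holomorphic_intros) (auto simp: F_def)
    show "deriv h z = poly Z z / (poly S z)\<^sup>2" if "z \<in> ball 0 1 - {z. poly G z = 0} - F" for z
      using eq[of z] that by (simp add: h_def[abs_def])
  qed (use that openF in auto)
  define rest where "rest z = \<i> * of_real (Im (\<Sum>j\<in>J. 2 * C j / w j)) + (\<Sum>i\<in>J. 2 * C i / (z - w i)) -
      (\<Sum>i\<in>J - {j}. 2 * cnj (C i) * z / (1 - cnj (w i) * z))" for z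
  \<comment> \<open>The numerator of \<open>h\<close> over \<open>(z - \<pi>) ^ (s + 1)\<close>,
    obtained from \<open>1 - cnj (w j) * z = - (z - \<pi>) / \<pi>\<close>. It is holomorphic near
    \<open>\<pi>\<close> and does not vanish there.\<close>
  define u where "u z = z * poly G z / poly S1 z * (2 * cnj (C j) * z * \<pi> + (z - \<pi>) * rest z)" for z
  define O' where "O' = - (w ` J \<union> (\<lambda>i. 1 / cnj (w i)) ` (J - {j}) \<union> {z. poly S1 z = 0})"
  have openO: "open O'"
    unfolding O'_def using S1(1) S0
    by (intro open_Compl finite_imp_closed finite_UnI finite_imageI finite_Diff finite_J poly_roots_finite) auto
  have nzO: "z - w i \<noteq> 0" if "z \<in> O'" "i \<in> J" for z i using that by (auto simp: O'_def)
  have nzO': "1 - cnj (w i) * z \<noteq> 0" if "z \<in> O'" "i \<in> J - {j}" for z i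
  proof -
    have "z \<noteq> 1 / cnj (w i)" using that by (auto simp: O'_def)
    moreover have "w i \<noteq> 0" using that w_nonzero by (auto simp: J_iff)
    ultimately show ?thesis by (auto simp: field_simps)
  qed
  have hol_u: "u holomorphic_on O'"
    unfolding u_def rest_def by (intro holomorphic_intros) (use nzO nzO' in \<open>auto simp: O'_def\<close>)
  have \<pi>O: "\<pi> \<in> O'"
  proof -
    have "\<pi> \<noteq> w i" if "i \<in> J" for i using w_reflect[of j i] that wj by (auto simp: \<pi>_def J_iff)
    moreover have "\<pi> \<noteq> 1 / cnj (w i)" if "i \<in> J - {j}" for i
      using inj_J that j(1) wj w_nonzero[of i] by (auto simp: \<pi>_def inj_on_def J_iff)
    ultimately show ?thesis using S1(2) by (auto simp: O'_def)
  qed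
  have u\<pi>: "u \<pi> \<noteq> 0"
    using \<pi>0 j(2) S1(2) G_reflect[OF wj(2)] by (simp add: u_def \<pi>_def)
  have h_u: "h z = u z / (z - \<pi>) ^ (s + 1)" if z: "z \<in> O'" "z \<noteq> \<pi>" for z
  proof -
    have "1 - cnj (w j) * z = - (z - \<pi>) / \<pi>" using \<pi>0 wj by (simp add: \<pi>_def field_simps)
    then have "2 * cnj (C j) * z / (1 - cnj (w j) * z) = - (2 * cnj (C j) * z * \<pi> / (z - \<pi>))"
      using \<pi>0 by (simp add: minus_divide_right)
    then have "R_fun m w C z = 2 * cnj (C j) * z * \<pi> / (z - \<pi>) + rest z"
      unfolding R_fun_def rest_def sum_subtractf
        sum.remove[OF finite_J j(1), of "\<lambda>i. 2 * cnj (C i) * z / (1 - cnj (w i) * z)"]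
      by simp
    also have "\<dots> = (2 * cnj (C j) * z * \<pi> + (z - \<pi>) * rest z) / (z - \<pi>)"
      using z(2) by (simp add: add_divide_distrib)
    finally have R: "R_fun m w C z = (2 * cnj (C j) * z * \<pi> + (z - \<pi>) * rest z) / (z - \<pi>)" .
    show ?thesis
      unfolding h_def g_eq R u_def S1(1) by (simp add: mult_ac)
  qed
  have S1O: "poly S1 z \<noteq> 0" if "z \<in> O'" for z using that by (auto simp: O'_def)
  \<comment> \<open>With subtraction of natural numbers the exponent is \<open>1\<close> for
    \<open>s \<ge> 1\<close> and \<open>2\<close> for \<open>s = 0\<close>; it is positive in both
    cases, so \<open>lhs\<close> vanishes at \<open>\<pi>\<close>.\<close>
  define lhs where "lhs z = (z - \<pi>) ^ (s - 1 + 2 - s) * poly Z1 z" for z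
  define rhs where "rhs z = (poly S1 z)\<^sup>2 * (deriv u z * (z - \<pi>) - of_nat (s + 1) * u z)" for z
  have eqn: "lhs z = rhs z" if z: "z \<in> O'" "z \<noteq> \<pi>" "z \<in> - F" for z
  proof -
    let ?d = "z - \<pi>"
    have d0: "?d \<noteq> 0" using z(2) by simp
    have du: "(u has_field_derivative deriv u z) (at z)"
      using hol_u openO z(1) by (rule holomorphic_derivI)
    have "((\<lambda>z. z - \<pi>) has_field_derivative 1) (at z)"
      by (auto intro!: derivative_eq_intros)
    from DERIV_power[OF this, of "s + 1"]
    have dp: "((\<lambda>z. (z - \<pi>) ^ (s + 1)) has_field_derivative of_nat (s + 1) * ?d ^ s) (at z)"
      by simp
    have "((\<lambda>z. u z / (z - \<pi>) ^ (s + 1)) has_field_derivative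
        (deriv u z * ?d ^ (s + 1) - u z * (of_nat (s + 1) * ?d ^ s)) / (?d ^ (s + 1) * ?d ^ (s + 1))) (at z)"
      using d0 by (intro DERIV_divide[OF du dp]) simp
    then have "(h has_field_derivative
        (deriv u z * ?d ^ (s + 1) - u z * (of_nat (s + 1) * ?d ^ s)) / (?d ^ (s + 1) * ?d ^ (s + 1))) (at z)"
      by (rule has_field_derivative_transform_within_open[of _ _ _ "O' - {\<pi>}"])
        (use z openO h_u in auto)
    then have "deriv h z = (deriv u z * ?d ^ (s + 1) - u z * (of_nat (s + 1) * ?d ^ s)) / (?d ^ (s + 1) * ?d ^ (s + 1))"
      by (rule DERIV_imp_deriv)
    also have "\<dots> = (?d ^ s * (deriv u z * ?d - of_nat (s + 1) * u z)) / (?d ^ s * ?d ^ (s + 2))"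
      by (simp add: algebra_simps)
    also have "\<dots> = (deriv u z * ?d - of_nat (s + 1) * u z) / ?d ^ (s + 2)" using d0 by simp
    finally have "poly Z z / (poly S z)\<^sup>2 = (deriv u z * ?d - of_nat (s + 1) * u z) / ?d ^ (s + 2)"
      using on_F[OF z(3)] by simp
    moreover have "poly S z = ?d ^ s * poly S1 z" "poly Z z = ?d ^ (s - 1) * poly Z1 z"
      by (simp_all add: S1(1) Z1)
    ultimately have "?d ^ (s - 1) * poly Z1 z / (?d ^ s * poly S1 z)\<^sup>2 =
        (deriv u z * ?d - of_nat (s + 1) * u z) / ?d ^ (s + 2)" by simp
    then have "?d ^ (s - 1) * poly Z1 z * ?d ^ (s + 2) =
        (deriv u z * ?d - of_nat (s + 1) * u z) * (?d ^ s * poly S1 z)\<^sup>2"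
      using d0 S1O[OF z(1)] by (simp add: frac_eq_eq)
    then have "(?d ^ s * ?d ^ s) * (lhs z) = (?d ^ s * ?d ^ s) * (rhs z)"
    proof -
      have "s - 1 + (s + 2) = s + s + (s - 1 + 2 - s)" by arith
      then have e: "?d ^ (s - 1) * ?d ^ (s + 2) = (?d ^ s * ?d ^ s) * ?d ^ (s - 1 + 2 - s)"
        by (simp only: power_add[symmetric])
      have "(P * P) * (E * Z) = (P * P) * (Q\<^sup>2 * R)" if "X * W = (P * P) * E" "X * Z * W = R * (P * Q)\<^sup>2"
        for P E Q R X W Z :: complex
        using that by algebra
      from this[OF e \<open>?d ^ (s - 1) * poly Z1 z * ?d ^ (s + 2) = _\<close>]
      show ?thesis unfolding lhs_def rhs_def .
    qed
    then show ?thesis using d0 by simp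
  qed
  have "isCont lhs \<pi>" unfolding lhs_def by (intro continuous_intros)
  moreover have "isCont rhs \<pi>"
  proof -
    have "isCont (deriv u) \<pi>" "isCont u \<pi>"
      using holomorphic_on_imp_continuous_on[OF holomorphic_deriv[OF hol_u openO]]
        holomorphic_on_imp_continuous_on[OF hol_u] openO \<pi>O by (auto simp: continuous_on_eq_continuous_at)
    then show ?thesis unfolding rhs_def by (intro continuous_intros)
  qed
  moreover have "\<forall>\<^sub>F z in at \<pi>. lhs z = rhs z"
  proof -
    have "\<forall>\<^sub>F z in at \<pi>. z \<in> O'" using openO \<pi>O by (intro eventually_at_in_open')
    moreover have "\<forall>\<^sub>F z in at \<pi>. z \<in> - (F - {\<pi>})"
      using finF by (intro eventually_at_in_open' open_Compl finite_imp_closed) auto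
    ultimately show ?thesis using eventually_neq_at_within[of \<pi>]
      by eventually_elim (auto intro: eqn)
  qed
  ultimately have "lhs \<pi> = rhs \<pi>"
    using tendsto_unique[of "at \<pi>" lhs "rhs \<pi>" "lhs \<pi>"] tendsto_cong[of lhs rhs "at \<pi>" "rhs \<pi>"]
    by (simp add: isCont_def)
  moreover have "lhs \<pi> = 0"
  proof -
    have "0 < s - 1 + 2 - s" by arith
    then show ?thesis by (simp add: lhs_def)
  qed
  moreover have "rhs \<pi> = - ((poly S1 \<pi>)\<^sup>2 * (of_nat (s + 1) * u \<pi>))" by (simp add: rhs_def)
  moreover have "of_nat (s + 1) \<noteq> (0 :: complex)" by (simp only: of_nat_eq_0_iff)
  ultimately show False using u\<pi> S1(2) by simp
qed

end

section \<open>From pointwise differentiability to differentiability of coefficients\<close>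

lemma lagrange_coefficients:
  assumes "inj_on \<zeta> {..K}"
  shows "\<exists>\<Lambda>. \<forall>Y. degree Y \<le> K \<longrightarrow> (\<forall>i. coeff Y i = (\<Sum>j\<le>K. \<Lambda> i j * poly Y (\<zeta> j :: complex)))"
proof -
  define \<phi> where "\<phi> j = smult (inverse (\<Prod>k\<in>{..K} - {j}. \<zeta> j - \<zeta> k)) (\<Prod>k\<in>{..K} - {j}. [:- \<zeta> k, 1:])" for j
  have \<phi>: "poly (\<phi> j) (\<zeta> i) = (if i = j then 1 else 0)" if "i \<le> K" "j \<le> K" for i j
  proof -
    have "(\<Prod>k\<in>{..K} - {j}. \<zeta> j - \<zeta> k) \<noteq> 0" using assms that by (auto simp: inj_on_def)
    then show ?thesis using that by (auto simp: \<phi>_def poly_prod)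
  qed
  have deg: "degree (\<phi> j) \<le> K" if "j \<le> K" for j
  proof -
    have "degree (\<Prod>k\<in>{..K} - {j}. [:- \<zeta> k, 1:]) = K"
      using that by (subst degree_prod_eq_sum_degree) auto
    then show ?thesis unfolding \<phi>_def by (metis degree_smult_le)
  qed
  have "coeff Y i = (\<Sum>j\<le>K. coeff (\<phi> j) i * poly Y (\<zeta> j))" if Y: "degree Y \<le> K" for Y i
  proof -
    have "Y = (\<Sum>j\<le>K. smult (poly Y (\<zeta> j)) (\<phi> j))"
    proof (rule poly_eqI_degree[of "\<zeta> ` {..K}"])
      show "poly Y x = poly (\<Sum>j\<le>K. smult (poly Y (\<zeta> j)) (\<phi> j)) x" if x: "x \<in> \<zeta> ` {..K}" for x
      proof -
        obtain i where i: "i \<le> K" "x = \<zeta> i" using x by auto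
        have "(\<Sum>j\<le>K. poly Y (\<zeta> j) * poly (\<phi> j) (\<zeta> i)) = (\<Sum>j\<le>K. if j = i then poly Y (\<zeta> j) else 0)"
          using i by (intro sum.cong) (auto simp: \<phi>)
        then show ?thesis using i by (simp add: poly_sum)
      qed
      have "degree (\<Sum>j\<le>K. smult (poly Y (\<zeta> j)) (\<phi> j)) \<le> K"
        by (intro degree_sum_le order_trans[OF degree_smult_le] deg) auto
      then show "degree (\<Sum>j\<le>K. smult (poly Y (\<zeta> j)) (\<phi> j)) < card (\<zeta> ` {..K})"
        "degree Y < card (\<zeta> ` {..K})"
        using Y card_image[OF assms] by auto
    qed
    then have "coeff Y i = coeff (\<Sum>j\<le>K. smult (poly Y (\<zeta> j)) (\<phi> j)) i" by simp
    then show ?thesis by (simp add: coeff_sum mult.commute)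
  qed
  then show ?thesis by (intro exI[of _ "\<lambda>i j. coeff (\<phi> j) i"]) auto
qed

text \<open>If a quotient of coprime polynomials is differentiable in time at sufficiently many points, then
  so are its coefficients: interpolation gives the derivative of \<open>G S(t0) - G(t0) S\<close>, from which the
  Bezout equation recovers those of \<open>G\<close> and \<open>S\<close>.\<close>

lemma coefficients_differentiable:
  fixes G S :: "real \<Rightarrow> complex poly"
  assumes deg: "\<And>t. degree (G t) \<le> m" "\<And>t. degree (S t) = n" "\<And>t. lead_coeff (S t) = 1"
    and nc: "no_common_root (S t0) (G t0)" and S_cont: "pcont S I" and "t0 \<in> I"
    and D: "infinite D" "\<And>z t. z \<in> D \<Longrightarrow> t \<in> I \<Longrightarrow> poly (S t) z \<noteq> 0"
    and diff: "\<And>z. z \<in> D \<Longrightarrow> ((\<lambda>t. poly (G t) z / poly (S t) z) has_vector_derivative g' z) (at t0 within I)"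
  shows "\<exists>G' S'. has_pder G G' (at t0 within I) \<and> has_pder S S' (at t0 within I) \<and>
    degree G' \<le> m \<and> deg_less S' n"
proof -
  let ?F = "at t0 within I"
  obtain \<zeta> :: "nat \<Rightarrow> complex" where \<zeta>: "inj \<zeta>" "range \<zeta> \<subseteq> D"
    using infinite_countable_subset[OF D(1)] by blast
  define K where "K = m + n"
  have "inj_on \<zeta> {..K}" using \<zeta>(1) by (rule inj_on_subset) auto
  from lagrange_coefficients[OF this] obtain \<Lambda> where \<Lambda>:
    "\<And>Y i. degree Y \<le> K \<Longrightarrow> coeff Y i = (\<Sum>j\<le>K. \<Lambda> i j * poly Y (\<zeta> j))" by blast
  \<comment> \<open>In terms of the difference quotients \<open>dG\<close> and \<open>dS\<close>
    introduced below this is \<open>dG t * S t0 - G t0 * dS t\<close>, a Bezout expression with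
    coefficients frozen at \<open>t0\<close>. Its values at the points of \<open>D\<close> converge
    because those of the quotient do.\<close>
  define Y where "Y t = smult (of_real (inverse (t - t0))) (G t * S t0 - G t0 * S t)" for t
  have degY: "degree (Y t) \<le> K" for t
    unfolding Y_def K_def
    by (intro degree_smult_le' degree_diff_le degree_mult_le') (simp_all add: deg)
  have Ylim: "((\<lambda>t. poly (Y t) z) \<longlongrightarrow> g' z * (poly (S t0) z)\<^sup>2) ?F" if z: "z \<in> D" for z
  proof -
    have "continuous_on I (\<lambda>t. poly (S t) z)"
      by (rule continuous_on_poly_path[OF S_cont, of n]) (auto simp: deg intro: continuous_intros)
    then have "((\<lambda>t. poly (S t) z) \<longlongrightarrow> poly (S t0) z) ?F"
      using \<open>t0 \<in> I\<close> by (simp add: continuous_on_def)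
    with diff[OF z, unfolded has_vector_derivative_iff_quotient]
    have lim: "((\<lambda>t. ((poly (G t) z / poly (S t) z - poly (G t0) z / poly (S t0) z) /\<^sub>R (t - t0)) *
        (poly (S t) z * poly (S t0) z)) \<longlongrightarrow> g' z * (poly (S t0) z * poly (S t0) z)) ?F"
      by (intro tendsto_mult tendsto_const) auto
    have ev: "\<forall>\<^sub>F t in ?F. ((poly (G t) z / poly (S t) z - poly (G t0) z / poly (S t0) z) /\<^sub>R (t - t0)) *
        (poly (S t) z * poly (S t0) z) = poly (Y t) z"
      unfolding eventually_at_filter
    proof (intro always_eventually allI impI)
      fix t assume t: "t \<in> I"
      have "(poly (G t) z / poly (S t) z - poly (G t0) z / poly (S t0) z) * (poly (S t) z * poly (S t0) z) =
          poly (G t) z * poly (S t0) z - poly (G t0) z * poly (S t) z"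
        using D(2)[OF z t] D(2)[OF z \<open>t0 \<in> I\<close>] by (simp add: field_simps)
      then show "((poly (G t) z / poly (S t) z - poly (G t0) z / poly (S t0) z) /\<^sub>R (t - t0)) *
          (poly (S t) z * poly (S t0) z) = poly (Y t) z"
        by (simp add: Y_def scaleR_conv_of_real mult.assoc)
    qed
    show ?thesis using Lim_transform_eventually[OF lim ev] by (simp add: power2_eq_square)
  qed
  define c where "c i = (\<Sum>j\<le>K. \<Lambda> i j * (g' (\<zeta> j) * (poly (S t0) (\<zeta> j))\<^sup>2))" for i
  have clim: "((\<lambda>t. coeff (Y t) i) \<longlongrightarrow> c i) ?F" for i
    unfolding \<Lambda>[OF degY] c_def using \<zeta>(2) by (intro tendsto_sum tendsto_mult tendsto_const Ylim) auto
  define Y0 where "Y0 = (\<Sum>i\<le>K. monom (c i) i)"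
  have coeffY0: "coeff Y0 i = (if i \<le> K then c i else 0)" for i
    unfolding Y0_def coeff_sum coeff_monom by (simp add: if_distrib[of "\<lambda>x. _ = x"] sum.delta')
  have degY0: "degree Y0 \<le> K" by (rule degree_le) (simp add: coeffY0)
  have Y0lim: "((\<lambda>t. pn (Y t - Y0)) \<longlongrightarrow> 0) ?F"
  proof -
    have "((\<lambda>t. \<Sum>i\<le>K. norm (coeff (Y t) i - c i)) \<longlongrightarrow> (\<Sum>i\<le>K. 0)) ?F"
      by (intro tendsto_sum tendsto_norm_zero) (simp add: LIM_zero clim)
    moreover have "pn (Y t - Y0) = (\<Sum>i\<le>K. norm (coeff (Y t) i - c i))" for t
      using pn_eq[of "Y t - Y0" K] degY degY0 by (simp add: degree_diff_le coeffY0)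
    ultimately show ?thesis by simp
  qed
  have S0: "S t0 \<noteq> 0" using deg(3)[of t0] by auto
  have bz: "no_common_root (S t0) (- G t0)" "degree (S t0) \<le> K" "degree (- G t0) + degree (S t0) \<le> K + 1"
    using nc deg(1)[of t0] by (simp_all add: deg(2) K_def)
  define U where "U = fst (bez K (S t0) (- G t0) Y0)"
  define V where "V = snd (bez K (S t0) (- G t0) Y0)"
  note sp = bez_spec[OF bz(1) S0 bz(2,3) degY0, folded U_def V_def]
  obtain C where C: "C > 0" "\<And>U V. deg_less U (degree (S t0)) \<Longrightarrow> degree V \<le> K - degree (S t0) \<Longrightarrow>
    pn U + pn V \<le> C * pn (U * - G t0 + V * S t0)"
    using bezout_bound_at[OF bz(1) S0 bz(2,3)] by blast
  define dS where "dS t = smult (of_real (inverse (t - t0))) (S t - S t0)" for t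
  define dG where "dG t = smult (of_real (inverse (t - t0))) (G t - G t0)" for t
  \<comment> \<open>Both denominators are monic of degree \<open>n\<close>, so the leading terms
    cancel; this is the degree bound under which the Bezout solution is controlled.\<close>
  have dSless: "deg_less (dS t) n" for t
  proof -
    have "coeff (S t - S t0) i = 0" if "n \<le> i" for i
      using deg(2,3)[of t] deg(2,3)[of t0] that by (cases "i = n") (auto simp: coeff_eq_0)
    then have "deg_less (S t - S t0) n"
      unfolding deg_less_def by (metis leading_coeff_0_iff not_le)
    then show ?thesis unfolding dS_def by (rule deg_less_smult)
  qed
  have bound: "pn (dS t - U) + pn (dG t - V) \<le> C * pn (Y t - Y0)" for t
  proof -
    have "pn (dS t - U) + pn (dG t - V) \<le> C * pn ((dS t - U) * - G t0 + (dG t - V) * S t0)"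
    proof (rule C(2))
      show "deg_less (dS t - U) (degree (S t0))"
        using dSless[of t] sp(2) by (auto intro!: deg_less_diff simp: deg(2))
      have "degree (dG t) \<le> m" unfolding dG_def by (intro degree_smult_le' degree_diff_le deg)
      then show "degree (dG t - V) \<le> K - degree (S t0)"
        using sp(3) by (auto intro!: degree_diff_le simp: deg(2) K_def)
    qed
    also have "(dS t - U) * - G t0 + (dG t - V) * S t0 = (dG t * S t0 - G t0 * dS t) - (U * - G t0 + V * S t0)"
      by (simp add: algebra_simps)
    also have "dG t * S t0 - G t0 * dS t = Y t"
      unfolding dG_def dS_def Y_def by (simp add: smult_diff_right algebra_simps)
    finally show ?thesis unfolding sp(1) .
  qed
  have lim: "((\<lambda>t. coeff (dS t) i) \<longlongrightarrow> coeff U i) ?F" "((\<lambda>t. coeff (dG t) i) \<longlongrightarrow> coeff V i) ?F" for i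
  proof -
    have Clim: "((\<lambda>t. C * pn (Y t - Y0)) \<longlongrightarrow> 0) ?F" using tendsto_mult_right_zero[OF Y0lim] .
    have "norm (coeff (dS t) i - coeff U i) \<le> C * pn (Y t - Y0)" for t
      using bound[of t] norm_coeff_le_pn[of "dS t - U" i] pn_nonneg[of "dG t - V"] unfolding coeff_diff by linarith
    then have "((\<lambda>t. coeff (dS t) i - coeff U i) \<longlongrightarrow> 0) ?F"
      by (intro Lim_null_comparison[OF _ Clim] always_eventually allI)
    then show "((\<lambda>t. coeff (dS t) i) \<longlongrightarrow> coeff U i) ?F" by (simp add: LIM_zero_iff)
    have "norm (coeff (dG t) i - coeff V i) \<le> C * pn (Y t - Y0)" for t
      using bound[of t] norm_coeff_le_pn[of "dG t - V" i] pn_nonneg[of "dS t - U"] unfolding coeff_diff by linarith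
    then have "((\<lambda>t. coeff (dG t) i - coeff V i) \<longlongrightarrow> 0) ?F"
      by (intro Lim_null_comparison[OF _ Clim] always_eventually allI)
    then show "((\<lambda>t. coeff (dG t) i) \<longlongrightarrow> coeff V i) ?F" by (simp add: LIM_zero_iff)
  qed
  have "has_pder G V ?F" "has_pder S U ?F"
    using lim unfolding has_pder_def has_vector_derivative_iff_quotient
    by (simp_all add: dS_def dG_def scaleR_conv_of_real)
  moreover have "degree V \<le> m" "deg_less U n" using sp(2,3) by (simp_all add: deg(2) K_def)
  ultimately show ?thesis by blast
qed

lemma has_vector_derivative_divide_complex:
  fixes f h :: "real \<Rightarrow> complex"
  assumes f: "(f has_vector_derivative f') (at x within I)" and h: "(h has_vector_derivative h') (at x within I)"
    and "h x \<noteq> 0"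
  shows "((\<lambda>t. f t / h t) has_vector_derivative (f' * h x - f x * h') / (h x)\<^sup>2) (at x within I)"
proof -
  have "(inverse has_field_derivative - (inverse (h x) * inverse (h x))) (at (h x) within h ` I)"
    using assms(3) by (auto intro!: derivative_eq_intros)
  from has_vector_derivative_mult[OF f field_vector_diff_chain_within[OF h this]]
  show ?thesis
    using assms(3) by (simp add: o_def divide_inverse[symmetric] divide_simps power2_eq_square algebra_simps)
qed

section \<open>Rational paths and the defect caused by an arbitrary choice of coefficients\<close>

text \<open>A rational solution without its initial condition. The coefficients \<open>B\<close>
  enter only through \<open>log_eq\<close>; no regularity in time is available for them.\<close>

locale rational_path =
  fixes q :: "real \<Rightarrow> real" and m n :: nat and T :: real and b :: "real \<Rightarrow> complex"
    and w p B :: "real \<Rightarrow> nat \<Rightarrow> complex"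
  assumes T_pos: "0 < T" and q_pos: "\<And>t. 0 \<le> t \<Longrightarrow> 0 < q t" and q_cont: "continuous_on {0..} q"
    and b_cont: "continuous_on {0..<T} b"
    and w_cont: "\<And>k. k < m \<Longrightarrow> continuous_on {0..<T} (\<lambda>t. w t k)"
    and p_cont: "\<And>j. j < n \<Longrightarrow> continuous_on {0..<T} (\<lambda>t. p t j)"
    and adm: "\<And>t. t \<in> {0..<T} \<Longrightarrow> admissible m n (b t) (w t) (p t)"
    and log_eq: "solves_log_eq T q (\<lambda>t. rat_fun m n (b t) (w t) (p t)) (\<lambda>t. R_fun m (w t) (B t))"
begin

abbreviation I :: "real set" where "I \<equiv> {0..<T}"
definition GG :: "real \<Rightarrow> complex poly" where "GG t = smult (b t) (of_roots m (w t))"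
definition SS :: "real \<Rightarrow> complex poly" where "SS t = of_roots n (p t)"
definition LL :: "real \<Rightarrow> complex poly" where "LL t = smult (of_real (q t)) (Lp m n (GG t) (SS t))"
abbreviation J :: "nat set" where "J \<equiv> disk_zeros m (w 0)"

lemma data: "t \<in> I \<Longrightarrow> admissible_data m n (b t) (w t) (p t) (q t)"
  using adm q_pos by (simp add: admissible_data_def)

lemma admissible_data_G: "t \<in> I \<Longrightarrow> admissible_data.G m (b t) (w t) = GG t"
  and admissible_data_S: "t \<in> I \<Longrightarrow> admissible_data.S n (p t) = SS t"
  using admissible_data.G_def[OF data] admissible_data.S_def[OF data] by (simp_all add: GG_def SS_def)

lemma admissible_data_L: "t \<in> I \<Longrightarrow> admissible_data.L m n (b t) (w t) (p t) (q t) = LL t"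
  using admissible_data.L_def[OF data] by (simp add: LL_def admissible_data_G admissible_data_S)

lemmas admissible_data_simps = admissible_data_G admissible_data_S admissible_data_L

lemma good: "t \<in> I \<Longrightarrow> good m n (GG t) (SS t)"
  using admissible_data.good[OF data] by (simp add: admissible_data_simps)

lemma degree_GG: "degree (GG t) \<le> m"
  by (simp add: GG_def degree_smult_le')

lemma degree_SS [simp]: "degree (SS t) = n" and lead_coeff_SS [simp]: "coeff (SS t) n = 1"
  by (simp_all add: SS_def)

lemma pcont_GG: "pcont GG I"
  unfolding GG_def of_roots_def by (intro pcont_smult b_cont pcont_prod pcont_linear w_cont) auto

lemma pcont_SS: "pcont SS I"
  unfolding SS_def of_roots_def by (intro pcont_prod pcont_linear p_cont) auto

lemma pcont_field_path:
  "pcont (\<lambda>t. Lp m n (GG t) (SS t)) I" "pcont (\<lambda>t. Gv m n (GG t) (SS t)) I"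
  "pcont (\<lambda>t. Sv m n (GG t) (SS t)) I"
  using pcont_field[OF pcont_GG pcont_SS good] by auto

text \<open>Admissible zeros never lie on the unit circle, so by continuity each of them stays on
  its side; the index set at time \<open>0\<close> can be used throughout.\<close>

lemma disk_zeros_const: "t \<in> I \<Longrightarrow> disk_zeros m (w t) = J"
proof -
  assume t: "t \<in> I"
  have "norm (w t k) < 1 \<longleftrightarrow> norm (w 0 k) < 1" if k: "k < m" for k
  proof -
    have "(norm (w t k) < 1 \<longleftrightarrow> norm (w 0 k) < 1)"
    proof (rule connected_local_iff[of I "\<lambda>t. norm (w t k) < 1 \<longleftrightarrow> norm (w 0 k) < 1" 0])
      fix s assume s: "s \<in> I"
      have ne: "norm (w s k) \<noteq> 1" using admissible_data.w_norm[OF data[OF s] k] .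
      have "((\<lambda>t. norm (w t k)) \<longlongrightarrow> norm (w s k)) (at s within I)"
        using w_cont[OF k] s by (intro tendsto_norm) (simp add: continuous_on_def)
      then have "\<forall>\<^sub>F t in at s within I. dist (norm (w t k)) (norm (w s k)) < \<bar>norm (w s k) - 1\<bar>"
        using ne by (intro tendstoD) auto
      then obtain e where e: "e > 0" "\<And>t. t \<in> I \<Longrightarrow> t \<noteq> s \<Longrightarrow> dist t s < e \<Longrightarrow>
          dist (norm (w t k)) (norm (w s k)) < \<bar>norm (w s k) - 1\<bar>"
        unfolding eventually_at by blast
      have "norm (w t k) < 1 \<longleftrightarrow> norm (w s k) < 1" if "t \<in> I" "dist t s < e" for t
      proof (cases "t = s")
        case False
        show ?thesis using e(2)[OF that(1) False that(2)] unfolding dist_real_def by arith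
      qed simp
      then show "\<exists>e>0. \<forall>t\<in>I. dist t s < e \<longrightarrow>
          ((norm (w t k) < 1 \<longleftrightarrow> norm (w 0 k) < 1) \<longleftrightarrow> (norm (w s k) < 1 \<longleftrightarrow> norm (w 0 k) < 1))"
        using e(1) by blast
    qed (use T_pos t in \<open>auto intro: convex_connected\<close>)
    then show ?thesis .
  qed
  then show ?thesis by (auto simp: disk_zeros_def)
qed

definition dG :: "real \<Rightarrow> complex poly" where
  "dG t = (SOME G'. \<exists>S'. has_pder GG G' (at t within I) \<and> has_pder SS S' (at t within I) \<and>
    degree G' \<le> m \<and> deg_less S' n)"

definition dS :: "real \<Rightarrow> complex poly" where
  "dS t = (SOME S'. has_pder GG (dG t) (at t within I) \<and> has_pder SS S' (at t within I) \<and>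
    degree (dG t) \<le> m \<and> deg_less S' n)"

lemma log_eq_at:
  assumes "t \<in> I" "norm z < 1" "poly (GG t) z \<noteq> 0"
  shows "\<exists>gdot. ((\<lambda>s. poly (GG s) z / poly (SS s) z) has_vector_derivative gdot) (at t within I) \<and>
    gdot / rat_fun m n (b t) (w t) (p t) z =
      z * (P_fun (q t) (rat_fun m n (b t) (w t) (p t)) z + R_fun m (w t) (B t) z) *
        (deriv (rat_fun m n (b t) (w t) (p t)) z / rat_fun m n (b t) (w t) (p t) z) +
      deriv (\<lambda>z. z * (P_fun (q t) (rat_fun m n (b t) (w t) (p t)) z + R_fun m (w t) (B t) z)) z"
proof -
  have "rat_fun m n (b t) (w t) (p t) z \<noteq> 0"
    using assms admissible_data.g_eq[OF data[OF assms(1)], of z]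
      admissible_data.S_nonzero[OF data[OF assms(1)], of z] by (simp add: admissible_data_simps)
  moreover have "(\<lambda>s. poly (GG s) z / poly (SS s) z) = (\<lambda>s. rat_fun m n (b s) (w s) (p s) z)"
    by (simp add: rat_fun_eq GG_def SS_def)
  ultimately show ?thesis
    using log_eq[unfolded solves_log_eq_def, rule_format, of t z] assms by simp
qed

lemma dG_dS:
  assumes t: "t \<in> I"
  shows "has_pder GG (dG t) (at t within I)" "has_pder SS (dS t) (at t within I)"
    "degree (dG t) \<le> m" "deg_less (dS t) n"
proof -
  define D where "D = ball 0 1 - {z. poly (GG t) z = 0}"
  have "infinite D"
  proof -
    have "finite {z. poly (GG t) z = 0}"
      using good[OF t] by (intro poly_roots_finite) (auto simp: good_def)
    moreover have "infinite (ball (0::complex) 1)" using uncountable_ball[of 1 "0::complex"] countable_finite by auto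
    ultimately show ?thesis by (simp add: D_def)
  qed
  moreover have "\<forall>z\<in>D. \<exists>g'. ((\<lambda>s. poly (GG s) z / poly (SS s) z) has_vector_derivative g') (at t within I)"
    using log_eq_at[OF t] by (fastforce simp: D_def dist_norm)
  then obtain g' where "\<And>z. z \<in> D \<Longrightarrow> ((\<lambda>s. poly (GG s) z / poly (SS s) z) has_vector_derivative g' z) (at t within I)"
    by metis
  moreover have "poly (SS s) z \<noteq> 0" if "z \<in> D" "s \<in> I" for z s
    using admissible_data.S_nonzero[OF data[OF that(2)], of z] that by (simp add: admissible_data_simps D_def)
  moreover have "no_common_root (SS t) (GG t)" using good[OF t] by (simp add: good_def)
  ultimately have ex: "\<exists>G' S'. has_pder GG G' (at t within I) \<and> has_pder SS S' (at t within I) \<and>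
      degree G' \<le> m \<and> deg_less S' n"
    using degree_GG pcont_SS t by (intro coefficients_differentiable[where D = D and g' = g' and n = n]) auto
  from someI_ex[OF ex, folded dG_def]
  have "\<exists>S'. has_pder GG (dG t) (at t within I) \<and> has_pder SS S' (at t within I) \<and>
    degree (dG t) \<le> m \<and> deg_less S' n" .
  from someI_ex[OF this, folded dS_def]
  show "has_pder GG (dG t) (at t within I)" "has_pder SS (dS t) (at t within I)"
    "degree (dG t) \<le> m" "deg_less (dS t) n" by auto
qed

lemma degree_dS: "t \<in> I \<Longrightarrow> degree (dS t) \<le> n"
  using dG_dS(4)[of t] by (auto simp: deg_less_def)

lemma at_within_I: "t \<in> I \<Longrightarrow> at t within I \<noteq> bot"
proof -
  assume t: "t \<in> I"
  then have "t islimpt {t<..<T}" by (intro islimpt_greaterThanLessThan1) auto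
  then have "t islimpt I" by (rule islimpt_subset) (use t in auto)
  then show ?thesis by (simp add: trivial_limit_within)
qed

abbreviation g :: "real \<Rightarrow> complex \<Rightarrow> complex" where "g t \<equiv> rat_fun m n (b t) (w t) (p t)"

definition Cc :: "real \<Rightarrow> nat \<Rightarrow> complex" where
  "Cc t j = B t j - A_coef (q t) (g t) (w t j)"

text \<open>The defect of the polynomial evolution equation. By \<open>log_eq_Z\<close> it carries
  the whole effect of the deviation \<open>Cc\<close> of \<open>B\<close> from
  \<open>A\<close>.\<close>

definition Zp :: "real \<Rightarrow> complex poly" where
  "Zp t = dG t * SS t - GG t * dS t - transport (LL t) (SS t)"

lemma g_path_derivative:
  assumes "has_pder GG G' (at t within I)" "has_pder SS S' (at t within I)" "degree G' \<le> m" "degree S' \<le> n"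
    and "poly (SS t) z \<noteq> 0"
  shows "((\<lambda>s. poly (GG s) z / poly (SS s) z) has_vector_derivative
    poly (G' * SS t - GG t * S') z / (poly (SS t) z)\<^sup>2) (at t within I)"
proof -
  have "((\<lambda>s. poly (GG s) z) has_vector_derivative poly G' z) (at t within I)"
    using has_vector_derivative_poly_path[OF assms(1) degree_GG assms(3), of "\<lambda>_. z" 0] by simp
  moreover have "((\<lambda>s. poly (SS s) z) has_vector_derivative poly S' z) (at t within I)"
    using has_vector_derivative_poly_path[OF assms(2) _ assms(4), of "\<lambda>_. z" 0] by simp
  ultimately show ?thesis
    using has_vector_derivative_divide_complex assms(5) by (simp add: mult.commute)
qed

text \<open>Multiplication of the logarithmic equation by \<open>G / S\<close>, with
  \<open>Y\<close> for the numerator of the time derivative and \<open>r\<close> for the derivative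
  of \<open>R\<close>; the part of the flux free of \<open>R\<close> is moved to the left.\<close>

lemma log_eq_algebra:
  fixes G S L R Y z r g' G' S' L' :: complex
  assumes nz: "G \<noteq> 0" "S \<noteq> 0" and g': "g' = (G' * S - G * S') / (S * S)"
    and eq: "Y / S\<^sup>2 / (G / S) = z * (L / G + R) * (g' / (G / S)) +
      ((L / G + R) + z * ((L' * G - L * G') / (G * G) + r))"
  shows "(Y - ((L + z * L') * S - z * L * S')) / S\<^sup>2 = R * (G / S) + z * r * (G / S) + z * R * g'"
proof -
  have "Y / S\<^sup>2 = (Y / S\<^sup>2 / (G / S)) * (G / S)" using nz by simp
  also have "\<dots> = z * (L / G + R) * g' + ((L / G + R) + z * ((L' * G - L * G') / (G * G) + r)) * (G / S)"
  proof -
    have *: "(a * (g' / k) + e) * k = a * g' + e * k" if "k \<noteq> 0" for a e k :: complex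
      using that by (simp add: distrib_right)
    show ?thesis unfolding eq by (rule *) (use nz in simp)
  qed
  also have "\<dots> = z * R * g' + R * (G / S) + z * r * (G / S) +
      (z * (L / G) * g' + (L / G + z * ((L' * G - L * G') / (G * G))) * (G / S))"
  proof -
    have "z * (a + R) * g' + ((a + R) + z * (D + r)) * k =
        z * R * g' + R * k + z * r * k + (z * a * g' + (a + z * D) * k)" for a D k
      by (simp add: algebra_simps)
    then show ?thesis by blast
  qed
  also have "z * (L / G) * g' + (L / G + z * ((L' * G - L * G') / (G * G))) * (G / S) =
      ((L + z * L') * S - z * L * S') / S\<^sup>2"
    unfolding g' using nz by (simp add: field_simps power2_eq_square)
  finally show ?thesis by (simp add: diff_divide_distrib)
qed

text \<open>In conserved form the flux is \<open>z (L / G + R) g\<close> with \<open>R\<close>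
  formed from \<open>Cc\<close>, by \<open>P_plus_R\<close> and linearity of \<open>R\<close> in its
  coefficients. The derivative of the \<open>L\<close> part is \<open>transport\<close> over the
  square of the denominator, and the rest is the right-hand side.\<close>

lemma log_eq_Z:
  assumes t: "t \<in> I" and z: "norm z < 1" "poly (GG t) z \<noteq> 0"
  shows "poly (Zp t) z / (poly (SS t) z)\<^sup>2 = deriv (\<lambda>z. z * R_fun m (w t) (Cc t) z * g t z) z"
proof -
  interpret D: admissible_data m n "b t" "w t" "p t" "q t" by (rule data[OF t])
  note DG = admissible_data_simps[OF t]
  have Sz: "poly (SS t) z \<noteq> 0" using D.S_nonzero[of z] z(1) by (simp add: DG)
  let ?G = "poly (GG t)" and ?S = "poly (SS t)" and ?L = "poly (LL t)" and ?R = "R_fun m (w t) (Cc t)"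
  let ?PR = "\<lambda>z. P_fun (q t) (g t) z + R_fun m (w t) (B t) z"
  define Y where "Y = dG t * SS t - GG t * dS t"
  obtain gdot where gdot: "((\<lambda>s. poly (GG s) z / poly (SS s) z) has_vector_derivative gdot) (at t within I)"
    "gdot / g t z = z * ?PR z * (deriv (g t) z / g t z) + deriv (\<lambda>z. z * ?PR z) z"
    using log_eq_at[OF t z] by blast
  have "gdot = poly Y z / (?S z)\<^sup>2"
    using vector_derivative_unique_within[OF at_within_I[OF t] gdot(1)
        g_path_derivative[OF dG_dS(1,2)[OF t] dG_dS(3)[OF t] degree_dS[OF t] Sz]] by (simp add: Y_def)
  define N where "N = {z. norm z < 1 \<and> ?G z \<noteq> 0}"
  have openN: "open N" unfolding N_def
    by (intro open_Collect_conj open_Collect_less open_Collect_neq continuous_intros)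
  have zN: "z \<in> N" using z by (simp add: N_def)
  have PR: "?PR u = ?L u / ?G u + ?R u" if "u \<in> N" for u
    using D.P_plus_R[of u] D.R_fun_diff[of "B t" u "\<lambda>j. A_coef (q t) (g t) (w t j)"] that
    by (simp add: DG N_def Cc_def[abs_def] algebra_simps)
  have holR: "?R holomorphic_on N"
    unfolding R_fun_def
  proof (intro holomorphic_intros)
    fix u j assume u: "u \<in> N" and j: "j \<in> disk_zeros m (w t)"
    show "u - w t j \<noteq> 0" using u j D.G_root[of u] by (auto simp: N_def DG D.J_iff)
    show "1 - cnj (w t j) * u \<noteq> 0" using D.w_norm_le[OF j, of u] u by (simp add: N_def)
  qed
  define r where "r = deriv ?R z"
  have dR: "(?R has_field_derivative r) (at z)"
    unfolding r_def by (rule holomorphic_derivI[OF holR openN zN])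
  have "deriv (\<lambda>z. z * ?PR z) z = deriv (\<lambda>z. z * (?L z / ?G z + ?R z)) z"
    using eventually_nhds_in_open[OF openN zN] by (intro deriv_cong_ev) (auto elim!: eventually_mono simp: PR)
  also have "\<dots> = (?L z / ?G z + ?R z) + z * ((poly (pderiv (LL t)) z * ?G z - ?L z * poly (pderiv (GG t)) z) / (?G z * ?G z) + r)"
    by (rule DERIV_imp_deriv) (use z dR in \<open>auto intro!: derivative_eq_intros\<close>)
  finally have d1: "deriv (\<lambda>z. z * ?PR z) z = (?L z / ?G z + ?R z) +
      z * ((poly (pderiv (LL t)) z * ?G z - ?L z * poly (pderiv (GG t)) z) / (?G z * ?G z) + r)" .
  define g' where "g' = (poly (pderiv (GG t)) z * ?S z - ?G z * poly (pderiv (SS t)) z) / (?S z * ?S z)"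
  have dg: "(g t has_field_derivative g') (at z)"
    using D.g_deriv[of z] Sz by (simp add: DG g'_def)
  have gz: "g t z = ?G z / ?S z" using D.g_eq by (simp add: DG)
  have "deriv (\<lambda>z. z * ?R z * g t z) z = ?R z * (?G z / ?S z) + z * r * (?G z / ?S z) + z * ?R z * g'"
    by (rule DERIV_imp_deriv) (use dR dg in \<open>auto intro!: derivative_eq_intros simp: gz algebra_simps\<close>)
  moreover have "poly Y z / (?S z)\<^sup>2 / (?G z / ?S z) = z * (?L z / ?G z + ?R z) * (g' / (?G z / ?S z)) +
      ((?L z / ?G z + ?R z) + z * ((poly (pderiv (LL t)) z * ?G z - ?L z * poly (pderiv (GG t)) z) / (?G z * ?G z) + r))"
    using gdot(2) DERIV_imp_deriv[OF dg] unfolding \<open>gdot = _\<close> PR[OF zN] d1 gz by simp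
  note log_eq_algebra[OF z(2) Sz g'_def this]
  moreover have "poly (Zp t) z =
      poly Y z - ((?L z + z * poly (pderiv (LL t)) z) * ?S z - z * ?L z * poly (pderiv (SS t)) z)"
    by (simp add: Zp_def Y_def transport_def pderiv_pCons algebra_simps)
  ultimately show ?thesis by simp
qed

lemma transport_LL: "transport (LL t) (SS t) = smult (of_real (q t)) (transport (Lp m n (GG t) (SS t)) (SS t))"
proof -
  have "pCons 0 (LL t) = smult (of_real (q t)) (pCons 0 (Lp m n (GG t) (SS t)))" by (simp add: LL_def)
  then show ?thesis by (simp only: transport_def pderiv_smult mult_smult_left smult_diff_right)
qed

lemma velocity_if_Cc_zero:
  assumes t: "t \<in> I" and C: "\<forall>j\<in>J. Cc t j = 0"
  shows "dG t = smult (of_real (q t)) (Gv m n (GG t) (SS t))" "dS t = smult (of_real (q t)) (Sv m n (GG t) (SS t))"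
proof -
  interpret D: admissible_data m n "b t" "w t" "p t" "q t" by (rule data[OF t])
  note DG = admissible_data_simps[OF t]
  have R0: "R_fun m (w t) (Cc t) z = 0" for z
    using C by (simp add: R_fun_def disk_zeros_const[OF t])
  have "Zp t = 0"
  proof (rule poly_eqI_infinite)
    have "finite {z. poly (GG t) z = 0}"
      using good[OF t] by (intro poly_roots_finite) (auto simp: good_def)
    moreover have "infinite (ball (0::complex) 1)" using uncountable_ball[of 1 "0::complex"] countable_finite by auto
    ultimately have "infinite (ball 0 1 - {z. poly (GG t) z = 0})" by simp
    moreover have "ball 0 1 - {z. poly (GG t) z = 0} \<subseteq> {z. poly (Zp t) z = poly 0 z}"
    proof
      fix z assume z: "z \<in> ball 0 1 - {z. poly (GG t) z = 0}"
      then have "poly (Zp t) z / (poly (SS t) z)\<^sup>2 = 0"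
        using log_eq_Z[OF t, of z] by (simp add: R0)
      then show "z \<in> {z. poly (Zp t) z = poly 0 z}" using D.S_nonzero[of z] z by (simp add: DG)
    qed
    ultimately show "infinite {z. poly (Zp t) z = poly 0 z}" using finite_subset by blast
  qed
  then have "dG t * SS t - GG t * dS t = smult (of_real (q t)) (transport (Lp m n (GG t) (SS t)) (SS t))"
    by (simp add: Zp_def transport_LL)
  then show "dG t = smult (of_real (q t)) (Gv m n (GG t) (SS t))" "dS t = smult (of_real (q t)) (Sv m n (GG t) (SS t))"
    using field_unique[OF good[OF t] _ dG_dS(4)[OF t]] by auto
qed

text \<open>\<open>SS t\<close> and its derivative contain the linear factor to the power one below
  the order, so every term of \<open>Zp t\<close> other than \<open>GG t * dS t\<close> does. The
  defect version therefore passes to \<open>dS t\<close>, a time derivative that can be computed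
  along the moving reflected point.\<close>

lemma Cc_nonzero_obstruction:
  assumes t: "t \<in> I" and j: "j \<in> J" "Cc t j \<noteq> 0"
  defines "\<pi> \<equiv> 1 / cnj (w t j)"
  shows "\<not> [:- \<pi>, 1:] ^ (order \<pi> (SS t) - 1) dvd Zp t" "\<not> [:- \<pi>, 1:] ^ (order \<pi> (SS t) - 1) dvd dS t"
proof -
  interpret D: admissible_data m n "b t" "w t" "p t" "q t" by (rule data[OF t])
  note DG = admissible_data_simps[OF t]
  show Z: "\<not> [:- \<pi>, 1:] ^ (order \<pi> (SS t) - 1) dvd Zp t"
    unfolding \<pi>_def
    using D.pole_order_obstruction[of "Zp t" "Cc t" j] j log_eq_Z[OF t]
    by (simp add: DG disk_zeros_const[OF t])
  have S1: "[:- \<pi>, 1:] ^ (order \<pi> (SS t) - 1) dvd SS t"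
    by (rule dvd_trans[OF _ order_1[of \<pi>]]) (simp add: le_imp_power_dvd)
  have S2: "[:- \<pi>, 1:] ^ (order \<pi> (SS t) - 1) dvd pderiv (SS t)"
    unfolding linear_power_dvd_iff
  proof (intro allI impI)
    fix l assume "l < order \<pi> (SS t) - 1"
    then have "Suc l < order \<pi> (SS t)" by simp
    then have "poly ((pderiv ^^ Suc l) (SS t)) \<pi> = 0"
      using order_1[of \<pi> "SS t"] unfolding linear_power_dvd_iff by blast
    then show "poly ((pderiv ^^ l) (pderiv (SS t))) \<pi> = 0" by (simp add: funpow_swap1)
  qed
  show "\<not> [:- \<pi>, 1:] ^ (order \<pi> (SS t) - 1) dvd dS t"
  proof
    assume "[:- \<pi>, 1:] ^ (order \<pi> (SS t) - 1) dvd dS t"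
    then have "[:- \<pi>, 1:] ^ (order \<pi> (SS t) - 1) dvd Zp t"
      unfolding Zp_def transport_def using S1 S2 by (intro dvd_diff dvd_mult)
    then show False using Z by simp
  qed
qed

lemma disk_zero_derivative:
  assumes t: "t \<in> I" and j: "j \<in> J"
  shows "((\<lambda>s. w s j) has_vector_derivative - poly (dG t) (w t j) / poly (pderiv (GG t)) (w t j)) (at t within I)"
proof (rule root_has_vector_derivative[OF dG_dS(1)[OF t] degree_GG dG_dS(3)[OF t]])
  have jm: "j < m" using j by (simp add: disk_zeros_def)
  show "((\<lambda>s. w s j) \<longlongrightarrow> w t j) (at t within I)"
    using w_cont[OF jm] t by (simp add: continuous_on_def)
  show "poly (GG s) (w s j) = 0" for s using jm by (auto simp: GG_def poly_of_roots)
  have "j \<in> disk_zeros m (w t)" using j disk_zeros_const[OF t] by simp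
  then show "poly (pderiv (GG t)) (w t j) \<noteq> 0"
    using admissible_data.pderiv_G_nonzero[OF data[OF t]] by (simp add: admissible_data_simps[OF t])
qed (rule t)

lemma w_nonzero: "t \<in> I \<Longrightarrow> k < m \<Longrightarrow> w t k \<noteq> 0"
  using admissible_data.w_nonzero[OF data] .

lemma reflected_derivative:
  assumes t: "t \<in> I" and j: "j \<in> J"
  shows "((\<lambda>s. 1 / cnj (w s j)) has_vector_derivative
    cnj (poly (dG t) (w t j) / poly (pderiv (GG t)) (w t j)) / (cnj (w t j))\<^sup>2) (at t within I)"
proof -
  have n: "cnj (w t j) \<noteq> 0" using w_nonzero[OF t] j by (simp add: disk_zeros_def)
  have d: "((\<lambda>s. cnj (w s j)) has_vector_derivative cnj (- poly (dG t) (w t j) / poly (pderiv (GG t)) (w t j))) (at t within I)"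
    using bounded_linear.has_vector_derivative[OF bounded_linear_cnj disk_zero_derivative[OF t j]] .
  have "((\<lambda>s. 1 / cnj (w s j)) has_vector_derivative
      (0 * cnj (w t j) - 1 * cnj (- poly (dG t) (w t j) / poly (pderiv (GG t)) (w t j))) / (cnj (w t j))\<^sup>2) (at t within I)"
    by (rule has_vector_derivative_divide_complex[OF _ d n]) (auto intro: derivative_eq_intros)
  then show ?thesis by simp
qed

lemma has_pder_SS_iterated:
  assumes t: "t \<in> I"
  shows "has_pder (\<lambda>s. (pderiv ^^ l) (SS s)) ((pderiv ^^ l) (dS t)) (at t within I)"
  by (induction l) (auto intro: has_pder_pderiv dG_dS(2)[OF t])

lemma degree_iterated: "degree ((pderiv ^^ l) P) \<le> degree (P :: complex poly)"
  by (induction l) (auto simp: degree_pderiv)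

text \<open>On \<open>E\<close> the derivatives of \<open>SS\<close> of order below \<open>s\<close>
  vanish at the moving reflected point. If times of \<open>E\<close> accumulated at
  \<open>t0\<close>, differentiating these relations along \<open>E\<close> would make the
  derivatives of \<open>dS t0\<close> of order below \<open>s - 1\<close> vanish as well: the term
  due to the motion of the point contains a derivative of \<open>SS t0\<close> of order still below
  \<open>s\<close>. That is the divisibility which \<open>Cc_nonzero_obstruction\<close>
  forbids.\<close>

lemma bad_times_isolated:
  fixes s :: nat
  assumes j: "j \<in> J"
  defines "E \<equiv> {t\<in>I. Cc t j \<noteq> 0 \<and> order (1 / cnj (w t j)) (SS t) = s}"
  assumes t0: "t0 \<in> E"
  shows "\<not> t0 islimpt E"
proof
  assume lim: "t0 islimpt E"
  have t: "t0 \<in> I" using t0 by (simp add: E_def)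
  define \<pi> where "\<pi> s = 1 / cnj (w s j)" for s
  have ord: "order (\<pi> t) (SS t) = s" if "t \<in> E" for t using that by (simp add: E_def \<pi>_def)
  have zero: "poly ((pderiv ^^ l) (SS t)) (\<pi> t) = 0" if "t \<in> E" "l < s" for t l
    using order_1[of "\<pi> t" "SS t"] that ord[OF that(1)] unfolding linear_power_dvd_iff by blast
  obtain \<pi>' where \<pi>': "(\<pi> has_vector_derivative \<pi>') (at t0 within I)"
    using reflected_derivative[OF t j] unfolding \<pi>_def by blast
  have "poly ((pderiv ^^ l) (dS t0)) (\<pi> t0) = 0" if l: "l < s - 1" for l
  proof -
    have "((\<lambda>t. poly ((pderiv ^^ l) (SS t)) (\<pi> t)) has_vector_derivative
        poly ((pderiv ^^ l) (dS t0)) (\<pi> t0) + poly (pderiv ((pderiv ^^ l) (SS t0))) (\<pi> t0) * \<pi>') (at t0 within I)"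
    proof (rule has_vector_derivative_poly_path[OF has_pder_SS_iterated[OF t] _ _ \<pi>'])
      show "degree ((pderiv ^^ l) (SS s)) \<le> n" for s using degree_iterated[of l "SS s"] by simp
      show "degree ((pderiv ^^ l) (dS t0)) \<le> n" using degree_iterated[of l "dS t0"] degree_dS[OF t] by linarith
    qed
    moreover have "poly (pderiv ((pderiv ^^ l) (SS t0))) (\<pi> t0) = 0"
      using zero[OF t0, of "Suc l"] l by simp
    ultimately have "((\<lambda>t. poly ((pderiv ^^ l) (SS t)) (\<pi> t)) has_vector_derivative
        poly ((pderiv ^^ l) (dS t0)) (\<pi> t0)) (at t0 within E)"
      by (auto intro: has_vector_derivative_within_subset simp: E_def)
    then have "((\<lambda>t. (poly ((pderiv ^^ l) (SS t)) (\<pi> t) - poly ((pderiv ^^ l) (SS t0)) (\<pi> t0)) /\<^sub>R (t - t0))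
        \<longlongrightarrow> poly ((pderiv ^^ l) (dS t0)) (\<pi> t0)) (at t0 within E)"
      by (simp only: has_vector_derivative_iff_quotient)
    moreover have "((\<lambda>t. (poly ((pderiv ^^ l) (SS t)) (\<pi> t) - poly ((pderiv ^^ l) (SS t0)) (\<pi> t0)) /\<^sub>R (t - t0))
        \<longlongrightarrow> 0) (at t0 within E)"
      using zero t0 l by (intro tendsto_eventually) (auto simp: eventually_at_filter)
    moreover have "at t0 within E \<noteq> bot" using lim by (simp add: trivial_limit_within)
    ultimately show ?thesis using tendsto_unique by blast
  qed
  then have "[:- \<pi> t0, 1:] ^ (s - 1) dvd dS t0" unfolding linear_power_dvd_iff by blast
  then show False
    using Cc_nonzero_obstruction(2)[OF t j] t0 by (simp add: E_def \<pi>_def)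
qed

lemma velocity:
  assumes t: "t \<in> I"
  shows "dG t = smult (of_real (q t)) (Gv m n (GG t) (SS t))" "dS t = smult (of_real (q t)) (Sv m n (GG t) (SS t))"
proof -
  define E where "E = {t\<in>I. \<exists>j\<in>J. Cc t j \<noteq> 0}"
  \<comment> \<open>Isolation holds only among bad times of the same zero and the same order, hence
    the finite decomposition.\<close>
  have "E \<subseteq> (\<Union>j\<in>J. \<Union>s\<in>{..n}. {t\<in>I. Cc t j \<noteq> 0 \<and> order (1 / cnj (w t j)) (SS t) = s})"
  proof
    fix t assume "t \<in> E"
    then obtain j where "t \<in> I" "j \<in> J" "Cc t j \<noteq> 0" by (auto simp: E_def)
    moreover have "order (1 / cnj (w t j)) (SS t) \<le> n"
      using order_degree[of "SS t" "1 / cnj (w t j)"] by (simp add: SS_def)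
    ultimately show "t \<in> (\<Union>j\<in>J. \<Union>s\<in>{..n}. {t\<in>I. Cc t j \<noteq> 0 \<and> order (1 / cnj (w t j)) (SS t) = s})" by blast
  qed
  moreover have "countable (\<Union>j\<in>J. \<Union>s\<in>{..n}. {t\<in>I. Cc t j \<noteq> 0 \<and> order (1 / cnj (w t j)) (SS t) = s})"
    by (intro countable_UN countable_if_all_isolated bad_times_isolated)
      (auto simp: disk_zeros_def intro: countable_finite)
  ultimately have E: "countable E" by (rule countable_subset)
  have off: "\<forall>j\<in>J. Cc t j = 0" if "t \<in> I - E" for t using that by (auto simp: E_def)
  have q: "continuous_on I (\<lambda>t. complex_of_real (q t))"
    by (intro continuous_intros continuous_on_subset[OF q_cont]) auto
  have "coeff (dG t) i = coeff (smult (of_real (q t)) (Gv m n (GG t) (SS t))) i" for i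
  proof (rule vector_derivative_eq_off_countable[of 0 T "\<lambda>t. coeff (GG t) i" "\<lambda>t. coeff (dG t) i" _ E])
    show "continuous_on I (\<lambda>t. coeff (smult (of_real (q t)) (Gv m n (GG t) (SS t))) i)"
      using pcont_smult[OF q pcont_field_path(2)] by (simp only: pcont_def)
  qed (use dG_dS(1) velocity_if_Cc_zero(1) off E t in \<open>auto simp: has_pder_def\<close>)
  then show "dG t = smult (of_real (q t)) (Gv m n (GG t) (SS t))" by (rule poly_eqI)
  have "coeff (dS t) i = coeff (smult (of_real (q t)) (Sv m n (GG t) (SS t))) i" for i
  proof (rule vector_derivative_eq_off_countable[of 0 T "\<lambda>t. coeff (SS t) i" "\<lambda>t. coeff (dS t) i" _ E])
    show "continuous_on I (\<lambda>t. coeff (smult (of_real (q t)) (Sv m n (GG t) (SS t))) i)"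
      using pcont_smult[OF q pcont_field_path(3)] by (simp only: pcont_def)
  qed (use dG_dS(2) velocity_if_Cc_zero(2) off E t in \<open>auto simp: has_pder_def\<close>)
  then show "dS t = smult (of_real (q t)) (Sv m n (GG t) (SS t))" by (rule poly_eqI)
qed

lemma solves_field_path: "solves_field q m n GG SS I"
  unfolding solves_field_def using good dG_dS(1,2) velocity by auto

lemma transport_velocity: "t \<in> I \<Longrightarrow> dG t * SS t - GG t * dS t = transport (LL t) (SS t)"
  unfolding velocity transport_LL by (simp add: field_spec(1)[OF good, symmetric] smult_diff_right)

text \<open>With the velocity equation valid at every time the defect is zero, and zero is divisible
  by every power; the obstruction then works at each single time.\<close>

lemma B_eq_A:
  assumes t: "t \<in> I" and j: "j \<in> J"
  shows "B t j = A_data q m n b w p t j"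
proof (rule ccontr)
  assume "B t j \<noteq> A_data q m n b w p t j"
  then have "Cc t j \<noteq> 0" by (simp add: Cc_def A_data_def)
  moreover have "Zp t = 0" using transport_velocity[OF t] by (simp add: Zp_def)
  ultimately show False using Cc_nonzero_obstruction(1)[OF t j] by simp
qed

end

section \<open>Poles move along characteristics\<close>

lemma pn_le_norm_pvec: "degree p \<le> N \<Longrightarrow> pn p \<le> real (Suc N) * norm (pvec p)"
proof -
  assume "degree p \<le> N"
  then have "pn p = (\<Sum>i\<le>N. norm (coeff p i))" by (rule pn_eq)
  also have "\<dots> \<le> (\<Sum>i\<le>N. norm (pvec p))"
    by (intro sum_mono) (metis apply_pvec norm_bounded)
  finally show ?thesis by simp
qed

lemma pcont_pn_close:
  assumes "pcont P I" "\<And>s. s \<in> I \<Longrightarrow> degree (P s) \<le> N" "t \<in> I" "0 < e"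
  shows "\<forall>\<^sub>F s in at t within I. pn (P s - P t) < e"
proof -
  have "((\<lambda>s. \<Sum>i\<le>N. norm (coeff (P s) i - coeff (P t) i)) \<longlongrightarrow> (\<Sum>i\<le>N. 0)) (at t within I)"
    using assms(1,3) unfolding pcont_def continuous_on_def
    by (intro tendsto_sum tendsto_norm_zero LIM_zero) auto
  then have "\<forall>\<^sub>F s in at t within I. (\<Sum>i\<le>N. norm (coeff (P s) i - coeff (P t) i)) < e"
    using order_tendstoD(2)[of _ 0] assms(4) by simp
  moreover have "\<forall>\<^sub>F s in at t within I. s \<in> I" by (simp add: eventually_at_filter)
  ultimately show ?thesis
  proof eventually_elim
    case (elim s)
    then show ?case
      using pn_eq[of "P s - P t" N] assms(2)[of s] assms(2)[OF assms(3)] by (simp add: degree_diff_le)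
  qed
qed

text \<open>Both \<open>S\<close> and \<open>\<Prod> (x - z k)\<close> solve the transport equation with velocity \<open>- x L / G\<close>, hence their
  difference satisfies a linear differential inequality.\<close>

lemma product_of_characteristics_derivative:
  fixes G L :: "complex poly" and z z' :: "nat \<Rightarrow> complex"
  assumes deg: "degree G \<le> m" "degree L \<le> m"
    and char: "\<And>k. k < n \<Longrightarrow> z' k * poly G (z k) = - z k * poly L (z k)"
  shows "\<exists>K. degree K \<le> m \<and>
    G * (\<Sum>k<n. smult (- z' k) (\<Prod>j\<in>{..<n} - {k}. [:- z j, 1:])) - pCons 0 L * pderiv (of_roots n z) =
    of_roots n z * K"
proof -
  let ?P = "\<lambda>k. \<Prod>j\<in>{..<n} - {k}. [:- z j, 1:]"
  have "\<exists>K. smult (- z' k) G - pCons 0 L = [:- z k, 1:] * K" if "k < n" for k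
  proof -
    have "poly (smult (- z' k) G - pCons 0 L) (z k) = 0" using char[OF that] by simp
    then show ?thesis by (simp only: poly_eq_0_iff_dvd dvd_def)
  qed
  then obtain Kk where Kk: "\<And>k. k < n \<Longrightarrow> smult (- z' k) G - pCons 0 L = [:- z k, 1:] * Kk k" by metis
  have pd: "pderiv (of_roots n z) = (\<Sum>k<n. ?P k)"
    unfolding of_roots_def by (simp add: pderiv_prod pderiv_pCons)
  have "G * (\<Sum>k<n. smult (- z' k) (?P k)) - pCons 0 L * pderiv (of_roots n z) =
      (\<Sum>k<n. (smult (- z' k) G - pCons 0 L) * ?P k)"
    unfolding pd sum_distrib_left sum_subtractf[symmetric]
    by (intro sum.cong) (simp_all add: algebra_simps)
  also have "\<dots> = (\<Sum>k<n. of_roots n z * Kk k)"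
  proof (intro sum.cong refl)
    fix k assume "k \<in> {..<n}"
    then have "of_roots n z = [:- z k, 1:] * ?P k"
      unfolding of_roots_def by (subst prod.remove[of "{..<n}" k]) auto
    then show "(smult (- z' k) G - pCons 0 L) * ?P k = of_roots n z * Kk k"
      using Kk \<open>k \<in> {..<n}\<close> by (simp only: lessThan_iff mult_ac)
  qed
  finally have eq: "G * (\<Sum>k<n. smult (- z' k) (?P k)) - pCons 0 L * pderiv (of_roots n z) =
      of_roots n z * (\<Sum>k<n. Kk k)" by (simp add: sum_distrib_left)
  have "degree (\<Sum>k<n. Kk k) \<le> m"
  proof (cases "(\<Sum>k<n. Kk k) = 0")
    case False
    then have npos: "n > 0" by (cases n) auto
    have "degree (\<Sum>k<n. smult (- z' k) (?P k)) \<le> n - 1"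
    proof (intro degree_sum_le degree_smult_le')
      fix k assume "k \<in> {..<n}"
      then show "degree (?P k) \<le> n - 1" by (subst degree_prod_eq_sum_degree) auto
    qed auto
    then have "degree (G * (\<Sum>k<n. smult (- z' k) (?P k))) \<le> m + (n - 1)"
      by (intro degree_mult_le' deg)
    moreover have "degree (pCons 0 L * pderiv (of_roots n z)) \<le> Suc m + (n - 1)"
      by (intro degree_mult_le' degree_pCons_le' deg) (simp add: degree_pderiv)
    ultimately have "degree (of_roots n z * (\<Sum>k<n. Kk k)) \<le> m + n"
      unfolding eq[symmetric] using npos by (intro degree_diff_le) auto
    then show ?thesis using False by (simp add: degree_mult_eq)
  qed simp
  then show ?thesis using eq by blast
qed

context rational_path
begin

lemma LL_props:
  assumes t: "t \<in> I"
  shows "degree (LL t) \<le> m"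
    "LL t * rc m (GG t) + rc m (LL t) * GG t = smult (of_real (q t)) (Hp m n (SS t))"
  using admissible_data.degree_L[OF data[OF t]] admissible_data.L_identity[OF data[OF t]]
  by (simp_all add: admissible_data_simps[OF t])

lemma of_real_q_cont: "continuous_on I (\<lambda>t. complex_of_real (q t))"
  by (intro continuous_intros continuous_on_subset[OF q_cont]) auto

lemma pcont_LL: "pcont LL I"
  unfolding LL_def by (intro pcont_smult of_real_q_cont pcont_field_path)

lemma pcont_dG: "pcont dG I" and pcont_dS: "pcont dS I"
proof -
  have 1: "pcont (\<lambda>t. smult (of_real (q t)) (Gv m n (GG t) (SS t))) I"
    and 2: "pcont (\<lambda>t. smult (of_real (q t)) (Sv m n (GG t) (SS t))) I"
    by (intro pcont_smult of_real_q_cont pcont_field_path)+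
  show "pcont dG I"
    unfolding pcont_def
  proof
    show "continuous_on I (\<lambda>t. coeff (dG t) i)" for i
      by (rule continuous_on_eq[OF 1[unfolded pcont_def, rule_format]]) (simp only: velocity)
  qed
  show "pcont dS I"
    unfolding pcont_def
  proof
    show "continuous_on I (\<lambda>t. coeff (dS t) i)" for i
      by (rule continuous_on_eq[OF 2[unfolded pcont_def, rule_format]]) (simp only: velocity)
  qed
qed

lemma continuous_on_path_poly:
  assumes "X \<subseteq> I" "continuous_on X z"
  shows "continuous_on X (\<lambda>t. poly (GG t) (z t))" "continuous_on X (\<lambda>t. poly (SS t) (z t))"
    "continuous_on X (\<lambda>t. poly (LL t) (z t))" "continuous_on X (\<lambda>t. poly (dG t) (z t))"
    "continuous_on X (\<lambda>t. poly (dS t) (z t))"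
  using assms
  by (intro continuous_on_poly_path[OF pcont_GG, of m] continuous_on_poly_path[OF pcont_SS, of n]
      continuous_on_poly_path[OF pcont_LL, of m] continuous_on_poly_path[OF pcont_dG, of m]
      continuous_on_poly_path[OF pcont_dS, of n] continuous_on_id;
      auto simp: degree_GG degree_dS LL_props dG_dS)+

text \<open>The speed forced on a simple root of the denominator: at a root the transport equation
  reduces to \<open>G * dS = z * L * S'\<close>.\<close>

definition vf :: "real \<Rightarrow> complex \<Rightarrow> complex" where
  "vf t z = - z * poly (LL t) z / poly (GG t) z"

text \<open>Near the starting point \<open>G\<close> stays away from zero, so \<open>vf\<close> and
  its complex derivative \<open>v'\<close> are bounded on a compact box; these bounds are the
  constants for \<open>picard_lindelof\<close>. The solution extends to both sides of
  \<open>t0\<close> as far as \<open>I\<close> permits, since poles are followed backwards in time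
  as well.\<close>

lemma characteristic_exists:
  assumes t0: "t0 \<in> I" and a: "poly (GG t0) a \<noteq> 0"
  shows "\<exists>\<epsilon>>0. \<exists>z. z t0 = a \<and> (\<forall>t\<in>I \<inter> cball t0 \<epsilon>. poly (GG t) (z t) \<noteq> 0 \<and>
    (z has_vector_derivative vf t (z t)) (at t within I \<inter> cball t0 \<epsilon>))"
proof -
  define c where "c = norm (poly (GG t0) a) / 2"
  have c: "c > 0" using a by (simp add: c_def)
  have contG: "continuous_on (I \<times> UNIV) (\<lambda>x. poly (GG (fst x)) (snd x))"
    by (rule continuous_on_poly_path[OF pcont_GG, of m]) (auto simp: degree_GG intro!: continuous_intros)
  have contL: "continuous_on (I \<times> UNIV) (\<lambda>x. poly (LL (fst x)) (snd x))"
    by (rule continuous_on_poly_path[OF pcont_LL, of m]) (auto simp: LL_props intro!: continuous_intros)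
  have contG': "continuous_on (I \<times> UNIV) (\<lambda>x. poly (pderiv (GG (fst x))) (snd x))"
    by (rule continuous_on_poly_path[OF pcont_pderiv[OF pcont_GG], of m])
      (auto simp: degree_pderiv intro!: continuous_intros order_trans[OF diff_le_self degree_GG])
  have contL': "continuous_on (I \<times> UNIV) (\<lambda>x. poly (pderiv (LL (fst x))) (snd x))"
    by (rule continuous_on_poly_path[OF pcont_pderiv[OF pcont_LL], of m])
      (auto simp: degree_pderiv intro!: continuous_intros order_trans[OF diff_le_self LL_props(1)])
  obtain \<delta> where \<delta>: "\<delta> > 0" "\<And>x. x \<in> I \<times> UNIV \<Longrightarrow> dist x (t0, a) < \<delta> \<Longrightarrow>
      dist (poly (GG (fst x)) (snd x)) (poly (GG t0) a) < c"
    using contG[unfolded continuous_on_iff, rule_format, of "(t0, a)" c] t0 c by auto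
  define r where "r = \<delta> / 3"
  define \<epsilon>1 where "\<epsilon>1 = min r ((T - t0) / 2)"
  have r: "r > 0" "\<epsilon>1 > 0" using \<delta>(1) t0 by (auto simp: r_def \<epsilon>1_def)
  define R where "R = {max 0 (t0 - \<epsilon>1)..t0 + \<epsilon>1} \<times> cball a r"
  have T': "t0 + \<epsilon>1 < T" using t0 by (auto simp: \<epsilon>1_def min_def field_simps)
  have RI: "R \<subseteq> I \<times> UNIV" using T' by (auto simp: R_def)
  have Gc: "c \<le> norm (poly (GG (fst x)) (snd x))" if x: "x \<in> R" for x
  proof -
    have "dist (fst x) t0 \<le> r" "dist (snd x) a \<le> r"
      using x by (auto simp: R_def \<epsilon>1_def dist_real_def dist_commute)
    moreover have "dist x (t0, a) \<le> dist (fst x) t0 + dist (snd x) a"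
      unfolding dist_prod_def by (simp add: sqrt_sum_squares_le_sum)
    ultimately have "dist x (t0, a) < \<delta>" using \<delta>(1) by (simp add: r_def)
    then have "dist (poly (GG (fst x)) (snd x)) (poly (GG t0) a) < c" using \<delta>(2) x RI by blast
    then have "norm (poly (GG t0) a) - norm (poly (GG (fst x)) (snd x)) < c"
      using norm_triangle_ineq3[of "poly (GG t0) a" "poly (GG (fst x)) (snd x)"] by (simp add: dist_norm norm_minus_commute)
    then show ?thesis by (simp add: c_def)
  qed
  then have Gn: "poly (GG (fst x)) (snd x) \<noteq> 0" if "x \<in> R" for x using that c by fastforce
  define v' where "v' t z = (z * poly (LL t) z * poly (pderiv (GG t)) z -
      (poly (LL t) z + z * poly (pderiv (LL t)) z) * poly (GG t) z) / (poly (GG t) z * poly (GG t) z)" for t z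
  have cv: "continuous_on R (\<lambda>x. vf (fst x) (snd x))"
    unfolding vf_def using Gn
    by (intro continuous_intros continuous_on_subset[OF contG RI] continuous_on_subset[OF contL RI]) auto
  have cv': "continuous_on R (\<lambda>x. v' (fst x) (snd x))"
    unfolding v'_def using Gn
    by (intro continuous_intros continuous_on_subset[OF contG RI] continuous_on_subset[OF contL RI]
        continuous_on_subset[OF contG' RI] continuous_on_subset[OF contL' RI]) auto
  have cR: "compact R" unfolding R_def by (intro compact_Times compact_Icc compact_cball)
  obtain M where M: "M > 0" "\<And>x. x \<in> R \<Longrightarrow> norm (vf (fst x) (snd x)) \<le> M"
    using compact_imp_bounded[OF compact_continuous_image[OF cv cR]] unfolding bounded_pos by auto
  obtain K where K: "K > 0" "\<And>x. x \<in> R \<Longrightarrow> norm (v' (fst x) (snd x)) \<le> K"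
    using compact_imp_bounded[OF compact_continuous_image[OF cv' cR]] unfolding bounded_pos by auto
  \<comment> \<open>The interval around \<open>t0\<close> has length up to
    \<open>2 * \<epsilon>\<close>, hence the factors \<open>2\<close> and \<open>4\<close>: they
    give \<open>2 * \<epsilon> * M \<le> r\<close> and
    \<open>2 * \<epsilon> * K \<le> 1 / 2\<close>.\<close>
  define \<epsilon> where "\<epsilon> = min \<epsilon>1 (min (r / (2 * M)) (1 / (4 * K)))"
  have \<epsilon>: "0 < \<epsilon>" "\<epsilon> \<le> \<epsilon>1" "2 * \<epsilon> * M \<le> r" "2 * \<epsilon> * K < 1"
  proof -
    show "0 < \<epsilon>" "\<epsilon> \<le> \<epsilon>1" using r M(1) K(1) by (auto simp: \<epsilon>_def)
    have "2 * \<epsilon> * M \<le> 2 * (r / (2 * M)) * M" using M(1) by (intro mult_right_mono mult_left_mono) (auto simp: \<epsilon>_def)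
    then show "2 * \<epsilon> * M \<le> r" using M(1) by simp
    have "2 * \<epsilon> * K \<le> 2 * (1 / (4 * K)) * K" using K(1) by (intro mult_right_mono mult_left_mono) (auto simp: \<epsilon>_def)
    then show "2 * \<epsilon> * K < 1" using K(1) by simp
  qed
  let ?a = "max 0 (t0 - \<epsilon>)" and ?b = "t0 + \<epsilon>"
  have Icc: "I \<inter> cball t0 \<epsilon> = {?a..?b}"
    using T' \<epsilon>(2) by (auto simp: dist_real_def)
  have inR: "(t, x) \<in> R" if "t \<in> {?a..?b}" "x \<in> cball a r" for t x
    using that \<epsilon>(2) by (auto simp: R_def)
  have len: "?b - ?a \<le> 2 * \<epsilon>" by simp
  have "\<exists>z. z t0 = a \<and> (\<forall>t\<in>{?a..?b}. z t \<in> cball a r \<and> (z has_vector_derivative vf t (z t)) (at t within {?a..?b}))"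
  proof (rule picard_lindelof[where M = M and K = K])
    show "continuous_on ({?a..?b} \<times> cball a r) (\<lambda>(t, x). vf t x)"
      unfolding case_prod_unfold by (rule continuous_on_subset[OF cv]) (use inR in auto)
    fix t assume t: "t \<in> {?a..?b}"
    show "norm (vf t x) \<le> M" if "x \<in> cball a r" for x using M(2)[OF inR[OF t that]] by simp
    fix x y assume xy: "x \<in> cball a r" "y \<in> cball a r"
    show "norm (vf t x - vf t y) \<le> K * norm (x - y)"
    proof (rule field_differentiable_bound[of "cball a r" "vf t" "v' t"])
      fix z assume z: "z \<in> cball a r"
      have "poly (GG t) z \<noteq> 0" using Gn[OF inR[OF t z]] by simp
      have "((\<lambda>z. - z * poly (LL t) z) has_field_derivative
          - (poly (LL t) z + z * poly (pderiv (LL t)) z)) (at z)"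
        by (auto intro!: derivative_eq_intros)
      from DERIV_divide[OF this poly_DERIV \<open>poly (GG t) z \<noteq> 0\<close>]
      have "(vf t has_field_derivative v' t z) (at z)"
        unfolding vf_def[abs_def] v'_def by (simp add: algebra_simps)
      then show "(vf t has_field_derivative v' t z) (at z within cball a r)"
        by (rule has_field_derivative_at_within)
      show "norm (v' t z) \<le> K" using K(2)[OF inR[OF t z]] by simp
    qed (use xy in auto)
  next
    show "(?b - ?a) * M \<le> r" using mult_right_mono[OF len, of M] M(1) \<epsilon>(3) by linarith
    show "(?b - ?a) * K < 1" using mult_right_mono[OF len, of K] K(1) \<epsilon>(4) by linarith
    show "t0 \<in> {?a..?b}" using t0 \<epsilon>(1) by auto
  qed (use r M K in auto)
  then obtain z where z: "z t0 = a" "\<And>t. t \<in> {?a..?b} \<Longrightarrow> z t \<in> cball a r"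
    "\<And>t. t \<in> {?a..?b} \<Longrightarrow> (z has_vector_derivative vf t (z t)) (at t within {?a..?b})" by blast
  have "\<forall>t\<in>I \<inter> cball t0 \<epsilon>. poly (GG t) (z t) \<noteq> 0 \<and>
      (z has_vector_derivative vf t (z t)) (at t within I \<inter> cball t0 \<epsilon>)"
    unfolding Icc using z(3) Gn[OF inR[OF _ z(2)]] by auto
  then show ?thesis using \<epsilon>(1) z(1) by blast
qed

text \<open>\<open>\<zeta>\<close> is indexed by the starting point and not by the pole, so poles
  that coincide at \<open>t0\<close> share one characteristic; equality of poles propagates in this
  way. The denominator and the product over the characteristics agree at \<open>t0\<close> and near
  it, so each pole runs on some characteristic, and by continuity on the one from its own starting
  point.\<close>

lemma poles_follow_characteristics:
  assumes t0: "t0 \<in> I"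
  shows "\<exists>\<zeta>. (\<forall>l<n. \<exists>e>0. \<forall>t\<in>I. dist t t0 < e \<longrightarrow> p t l = \<zeta> (p t0 l) t) \<and>
    (\<forall>l<n. (\<zeta> (p t0 l) has_vector_derivative vf t0 (p t0 l)) (at t0 within I))"
proof -
  have S_root: "poly (SS t) z = 0 \<longleftrightarrow> (\<exists>l<n. z = p t l)" for t z
    by (auto simp: SS_def poly_of_roots)
  have GS: "poly (GG t0) (p t0 l) \<noteq> 0" if "l < n" for l
    using good[OF t0] S_root[of t0 "p t0 l"] that unfolding good_def no_common_root_def by blast
  have "\<forall>l\<in>{..<n}. \<exists>\<epsilon>>0. \<exists>z. z t0 = p t0 l \<and> (\<forall>t\<in>I \<inter> cball t0 \<epsilon>. poly (GG t) (z t) \<noteq> 0 \<and>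
      (z has_vector_derivative vf t (z t)) (at t within I \<inter> cball t0 \<epsilon>))"
    using characteristic_exists[OF t0 GS] by blast
  then have "\<forall>a\<in>p t0 ` {..<n}. \<exists>\<epsilon>>0. \<exists>z. z t0 = a \<and> (\<forall>t\<in>I \<inter> cball t0 \<epsilon>. poly (GG t) (z t) \<noteq> 0 \<and>
      (z has_vector_derivative vf t (z t)) (at t within I \<inter> cball t0 \<epsilon>))" by blast
  then obtain \<epsilon>a \<zeta> where \<zeta>: "\<And>a. a \<in> p t0 ` {..<n} \<Longrightarrow> \<epsilon>a a > 0 \<and> \<zeta> a t0 = a \<and>
      (\<forall>t\<in>I \<inter> cball t0 (\<epsilon>a a). poly (GG t) (\<zeta> a t) \<noteq> 0 \<and>
      (\<zeta> a has_vector_derivative vf t (\<zeta> a t)) (at t within I \<inter> cball t0 (\<epsilon>a a)))"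
    unfolding bchoice_iff by (metis (lifting))
  define \<epsilon> where "\<epsilon> = Min (insert (1::real) (\<epsilon>a ` p t0 ` {..<n}))"
  have \<epsilon>: "\<epsilon> > 0" unfolding \<epsilon>_def using \<zeta> by (subst Min_gr_iff) auto
  have \<epsilon>le: "\<epsilon> \<le> \<epsilon>a (p t0 l)" if "l < n" for l
    unfolding \<epsilon>_def using that by (intro Min_le) auto
  define N where "N = I \<inter> cball t0 \<epsilon>"
  define z where "z t l = \<zeta> (p t0 l) t" for t l
  have z0: "z t0 l = p t0 l" if "l < n" for l using \<zeta>[of "p t0 l"] that by (auto simp: z_def)
  have zG: "poly (GG t) (z t l) \<noteq> 0" if "l < n" "t \<in> N" for l t
    using \<zeta>[of "p t0 l"] that \<epsilon>le[OF that(1)] by (auto simp: z_def N_def)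
  have zd: "((\<lambda>t. z t l) has_vector_derivative vf t (z t l)) (at t within N)" if "l < n" "t \<in> N" for l t
  proof -
    have "((\<lambda>t. z t l) has_vector_derivative vf t (z t l)) (at t within I \<inter> cball t0 (\<epsilon>a (p t0 l)))"
      using \<zeta>[of "p t0 l"] that \<epsilon>le[OF that(1)] by (auto simp: z_def[abs_def] N_def)
    then show ?thesis
      by (rule has_vector_derivative_within_subset) (use \<epsilon>le[OF that(1)] in \<open>auto simp: N_def\<close>)
  qed
  have t0N: "t0 \<in> N" using t0 \<epsilon> by (simp add: N_def)
  have convN: "convex N" unfolding N_def by (intro convex_Int) auto
  define St where "St t = of_roots n (z t)" for t
  define dSt where "dSt t = (\<Sum>k<n. smult (- vf t (z t k)) (\<Prod>j\<in>{..<n} - {k}. [:- z t j, 1:]))" for t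
  have St_der: "has_pder St (dSt t) (at t within N)" if "t \<in> N" for t
    unfolding St_def of_roots_def dSt_def using zd that by (intro has_pder_prod) auto
  have dSt_less: "deg_less (dSt t) n" for t
    unfolding dSt_def
  proof (intro deg_less_sum deg_less_smult)
    fix k assume k: "k \<in> {..<n}"
    then have "degree (\<Prod>j\<in>{..<n} - {k}. [:- z t j, 1:]) = n - 1"
      by (subst degree_prod_eq_sum_degree) auto
    then show "deg_less (\<Prod>j\<in>{..<n} - {k}. [:- z t j, 1:]) n" using k by (simp add: deg_less_def)
  qed
  have SS_der: "has_pder SS (dS t) (at t within N)" if "t \<in> N" for t
    using dG_dS(2)[of t] that by (auto simp: N_def has_pder_def intro: has_vector_derivative_within_subset)
  define \<Delta> where "\<Delta> t = SS t - St t" for t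
  have degSt [simp]: "degree (St t) = n" for t by (simp add: St_def)
  have deg\<Delta>: "degree (\<Delta> t) \<le> n" for t unfolding \<Delta>_def by (intro degree_diff_le) auto
  \<comment> \<open>With it the transport equation becomes
    \<open>GG t * dS t = K1 t * SS t + z * LL t * SS'\<close>: a multiple of the denominator plus a
    term in its derivative, the same shape as for the product of characteristics.\<close>
  define K1 where "K1 t = dG t - pderiv (pCons 0 (LL t))" for t
  have GdS: "GG t * dS t = K1 t * SS t + pCons 0 (LL t) * pderiv (SS t)" if "t \<in> I" for t
    using transport_velocity[OF that] by (simp add: K1_def transport_def algebra_simps)
  have degK1: "degree (K1 t) \<le> m" if "t \<in> I" for t
    unfolding K1_def using dG_dS(3)[OF that] degree_pCons_le'[OF LL_props(1)[OF that], of 0]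
    by (intro degree_diff_le) (auto simp: degree_pderiv)
  have pcontK1: "pcont K1 I"
    unfolding K1_def pcont_def coeff_diff coeff_pderiv coeff_pCons_Suc
    using pcont_dG pcont_LL unfolding pcont_def by (auto intro!: continuous_intros)
  have zero: "pvec (\<Delta> t) = 0" if t: "t \<in> N" for t
  proof (rule linear_bound_imp_zero[OF convN, of "\<lambda>t. pvec (\<Delta> t)" "\<lambda>t. pvec (dS t - dSt t)" t0])
    fix t assume t: "t \<in> N"
    then have tI: "t \<in> I" by (simp add: N_def)
    show "((\<lambda>t. pvec (\<Delta> t)) has_vector_derivative pvec (dS t - dSt t)) (at t within N)"
      unfolding \<Delta>_def
    proof (rule has_vector_derivative_pvec[OF has_pder_diff[OF SS_der[OF t] St_der[OF t]], of n])
      show "degree (SS s - St s) \<le> n" for s using deg\<Delta>[of s] by (simp add: \<Delta>_def)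
      show "degree (dS t - dSt t) \<le> n"
        using deg_less_diff[OF dG_dS(4)[OF tI] dSt_less[of t]] by (auto simp: deg_less_def)
    qed
    assume "pvec (\<Delta> t) = 0"
    then have eq: "SS t = St t" by (simp add: \<Delta>_def)
    have bz: "no_common_root (SS t) (GG t)" "SS t \<noteq> 0" "degree (SS t) \<le> m + n" "degree (GG t) + degree (SS t) \<le> m + n + 1"
      using goodD[OF good[OF tI]] by simp_all
    obtain e C where e: "e > 0" "C > 0" "\<And>A' B' U V. pn (A' - SS t) < e \<Longrightarrow> pn (B' - GG t) < e \<Longrightarrow>
        deg_less U (degree (SS t)) \<Longrightarrow> degree V \<le> m + n - degree (SS t) \<Longrightarrow> pn U + pn V \<le> C * pn (U * B' + V * A')"
      using bezout_bound[OF bz] by metis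
    have NI: "N \<subseteq> I" by (simp add: N_def)
    have e1: "\<forall>\<^sub>F s in at t within N. pn (St s - St t) < e"
      by (rule pcont_pn_close[OF has_pder_imp_pcont[OF St_der], where N = n]) (use t e(1) in auto)
    have e2: "\<forall>\<^sub>F s in at t within N. pn (GG s - GG t) < e"
      by (rule pcont_pn_close[OF pcont_subset[OF pcont_GG NI], where N = m]) (use t e(1) degree_GG in auto)
    have e3: "\<forall>\<^sub>F s in at t within N. pn (K1 s - K1 t) < 1"
      by (rule pcont_pn_close[OF pcont_subset[OF pcontK1 NI], where N = m]) (use t NI degK1 in auto)
    have e4: "\<forall>\<^sub>F s in at t within N. pn (LL s - LL t) < 1"
      by (rule pcont_pn_close[OF pcont_subset[OF pcont_LL NI], where N = m]) (use t NI LL_props in auto)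
    define D where "D = C * ((pn (LL t) + 1) * real n + (pn (K1 t) + 1)) * real (Suc n)"
    have bound: "norm (pvec (dS s - dSt s)) \<le> D * norm (pvec (\<Delta> s))"
      if s: "s \<in> N" "pn (St s - St t) < e" "pn (GG s - GG t) < e" "pn (K1 s - K1 t) < 1" "pn (LL s - LL t) < 1" for s
    proof -
      have sI: "s \<in> I" using s NI by blast
      have "vf s (z s k) * poly (GG s) (z s k) = - z s k * poly (LL s) (z s k)" if "k < n" for k
        using zG[OF that s(1)] by (simp add: vf_def)
      from product_of_characteristics_derivative[OF degree_GG LL_props(1)[OF sI], where z = "z s" and n = n, OF this]
      obtain K where K: "degree K \<le> m" "GG s * dSt s - pCons 0 (LL s) * pderiv (St s) = St s * K"
        unfolding St_def dSt_def by blast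
      \<comment> \<open>Subtracting the two equations gives a Bezout equation for
        \<open>dS s - dSt s\<close> and \<open>K - K1 s\<close> whose right-hand side is linear in
        \<open>\<Delta> s\<close>. Its solution is bounded by \<open>bezout_bound\<close>, so the
        unknown cofactor \<open>K\<close> needs no estimate of its own.\<close>
      define X where "X = pCons 0 (LL s) * pderiv (\<Delta> s) + \<Delta> s * K1 s"
      have X: "(dS s - dSt s) * GG s + (K - K1 s) * St s = X"
      proof -
        have "(dS s - dSt s) * GG s = GG s * dS s - GG s * dSt s" by (simp add: algebra_simps)
        also have "GG s * dSt s = pCons 0 (LL s) * pderiv (St s) + St s * K" using K(2) by (simp add: algebra_simps)
        finally have "(dS s - dSt s) * GG s = K1 s * SS s + pCons 0 (LL s) * pderiv (SS s) -
            (pCons 0 (LL s) * pderiv (St s) + St s * K)"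
          unfolding GdS[OF sI] .
        moreover have "(k1 * a + l * a' - (l * c' + c * k)) + (k - k1) * c = l * (a' - c') + (a - c) * k1"
          for a a' c c' k k1 l :: "complex poly"
          by (simp add: algebra_simps)
        ultimately show ?thesis
          unfolding X_def \<Delta>_def pderiv_diff by (simp only:)
      qed
      have "pn (dS s - dSt s) + pn (K - K1 s) \<le> C * pn X"
        unfolding X[symmetric]
      proof (rule e(3))
        show "pn (St s - SS t) < e" using s(2) by (simp add: eq)
        show "deg_less (dS s - dSt s) (degree (SS t))"
          using deg_less_diff[OF dG_dS(4)[OF sI] dSt_less[of s]] by simp
        show "degree (K - K1 s) \<le> m + n - degree (SS t)" using K(1) degK1[OF sI] by (simp add: degree_diff_le)
      qed (rule s(3))
      moreover have "pn X \<le> pn (LL s) * (real n * pn (\<Delta> s)) + pn (\<Delta> s) * pn (K1 s)"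
      proof -
        have "pn X \<le> pn (pCons 0 (LL s)) * pn (pderiv (\<Delta> s)) + pn (\<Delta> s) * pn (K1 s)"
          unfolding X_def by (rule order_trans[OF pn_add add_mono[OF pn_mult pn_mult]])
        also have "\<dots> \<le> pn (LL s) * (real n * pn (\<Delta> s)) + pn (\<Delta> s) * pn (K1 s)"
          using pn_pderiv[OF deg\<Delta>, of s] by (intro add_right_mono mult_mono) (auto simp: pn_pCons)
        finally show ?thesis .
      qed
      moreover have "pn (LL s) \<le> pn (LL t) + 1" "pn (K1 s) \<le> pn (K1 t) + 1"
        using pn_le_diff[of "LL s" "LL t"] pn_le_diff[of "K1 s" "K1 t"] s(4,5) by linarith+
      then have "pn (LL s) * (real n * pn (\<Delta> s)) + pn (\<Delta> s) * pn (K1 s) \<le>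
          (pn (LL t) + 1) * (real n * pn (\<Delta> s)) + pn (\<Delta> s) * (pn (K1 t) + 1)"
        by (intro add_mono mult_right_mono mult_left_mono) auto
      ultimately have "C * pn X \<le> C * (((pn (LL t) + 1) * real n + (pn (K1 t) + 1)) * pn (\<Delta> s))"
        using e(2) by (intro mult_left_mono) (auto simp: algebra_simps)
      also have "\<dots> \<le> C * (((pn (LL t) + 1) * real n + (pn (K1 t) + 1)) * (real (Suc n) * norm (pvec (\<Delta> s))))"
        using e(2) pn_le_norm_pvec[OF deg\<Delta>, of s] by (intro mult_left_mono) (auto intro!: add_nonneg_nonneg mult_nonneg_nonneg)
      finally have "C * pn X \<le> D * norm (pvec (\<Delta> s))" by (simp add: D_def mult_ac)
      moreover have "pn (dS s - dSt s) \<le> C * pn X"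
        using \<open>pn (dS s - dSt s) + pn (K - K1 s) \<le> C * pn X\<close> pn_nonneg[of "K - K1 s"] by linarith
      ultimately show ?thesis using norm_pvec_le[of "dS s - dSt s"] by linarith
    qed
    have "\<forall>\<^sub>F s in at t within N. s \<in> N \<longrightarrow> norm (pvec (dS s - dSt s)) \<le> D * norm (pvec (\<Delta> s))"
      using e1 e2 e3 e4 by eventually_elim (blast intro: bound)
    then obtain d where d: "d > 0" "\<And>s. s \<in> N \<Longrightarrow> s \<noteq> t \<Longrightarrow> dist s t < d \<Longrightarrow>
        norm (pvec (dS s - dSt s)) \<le> D * norm (pvec (\<Delta> s))"
      unfolding eventually_at by blast
    moreover have "norm (pvec (dS t - dSt t)) \<le> D * norm (pvec (\<Delta> t))"
      by (rule bound) (use t e(1) in auto)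
    ultimately have "\<forall>s\<in>N. dist s t < d \<longrightarrow> norm (pvec (dS s - dSt s)) \<le> D * norm (pvec (\<Delta> s))" by metis
    then show "\<exists>e>0. \<exists>C. \<forall>s\<in>N. dist s t < e \<longrightarrow> norm (pvec (dS s - dSt s)) \<le> C * norm (pvec (\<Delta> s))"
      using d(1) by blast
  next
    have "SS t0 = St t0" unfolding SS_def St_def by (rule of_roots_cong) (simp add: z0)
    then show "pvec (\<Delta> t0) = 0" by (simp add: \<Delta>_def)
  qed (use t0N t in auto)
  then have SSt: "SS t = St t" if "t \<in> N" for t using that by (simp add: \<Delta>_def)
  have near: "\<exists>e>0. \<forall>t\<in>I. dist t t0 < e \<longrightarrow> p t l = \<zeta> (p t0 l) t" if l: "l < n" for l
  proof -
    \<comment> \<open>Separation of the distinct poles at \<open>t0\<close>: a pole and a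
      characteristic that meet while each has moved by less than \<open>\<delta> / 2\<close> started
      at the same point.\<close>
    define \<delta> where "\<delta> = Min (insert 1 ((\<lambda>k. dist (p t0 l) (p t0 k)) ` {k. k < n \<and> p t0 k \<noteq> p t0 l}))"
    have \<delta>: "\<delta> > 0" unfolding \<delta>_def by (subst Min_gr_iff) auto
    have \<delta>le: "p t0 k = p t0 l" if "k < n" "dist (p t0 l) (p t0 k) < \<delta>" for k
    proof (rule ccontr)
      assume "p t0 k \<noteq> p t0 l"
      then have "\<delta> \<le> dist (p t0 l) (p t0 k)" unfolding \<delta>_def using that(1) by (intro Min_le) auto
      then show False using that(2) by simp
    qed
    have pl: "\<forall>\<^sub>F t in at t0 within N. dist (p t l) (p t0 l) < \<delta> / 2"
      using continuous_on_subset[OF p_cont[OF l], of N] t0N \<delta> unfolding continuous_on_def N_def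
      by (intro tendstoD) auto
    have "\<forall>k\<in>{..<n}. \<forall>\<^sub>F t in at t0 within N. dist (z t k) (z t0 k) < \<delta> / 2"
    proof
      fix k assume "k \<in> {..<n}"
      then have "continuous_on N (\<lambda>t. z t k)" using zd by (intro continuous_on_vector_derivative) auto
      then show "\<forall>\<^sub>F t in at t0 within N. dist (z t k) (z t0 k) < \<delta> / 2"
        using t0N \<delta> unfolding continuous_on_def by (intro tendstoD) auto
    qed
    then have "\<forall>\<^sub>F t in at t0 within N. \<forall>k\<in>{..<n}. dist (z t k) (z t0 k) < \<delta> / 2"
      by (intro eventually_ball_finite) auto
    with pl have "\<forall>\<^sub>F t in at t0 within N. t \<in> N \<longrightarrow> p t l = z t l"
    proof eventually_elim
      case (elim t)
      show ?case
      proof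
        assume "t \<in> N"
        then have "poly (St t) (p t l) = 0" using SSt S_root[of t "p t l"] l by auto
        then obtain k where k: "k < n" "p t l = z t k" by (auto simp: St_def poly_of_roots)
        have "dist (p t0 l) (p t0 k) \<le> dist (p t l) (p t0 l) + dist (z t k) (p t0 k)"
          using dist_triangle[of "p t0 l" "p t0 k" "p t l"] by (simp add: k(2) dist_commute)
        also have "\<dots> < \<delta>" using elim(1) elim(2) k(1) z0[OF k(1)] by force
        finally have "p t0 k = p t0 l" using \<delta>le[OF k(1)] by simp
        then show "p t l = z t l" using k(2) by (simp add: z_def)
      qed
    qed
    then obtain d where d: "d > 0" "\<And>t. t \<in> N \<Longrightarrow> t \<noteq> t0 \<Longrightarrow> dist t t0 < d \<Longrightarrow> p t l = z t l"
      unfolding eventually_at by blast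
    have "p t l = \<zeta> (p t0 l) t" if "t \<in> I" "dist t t0 < min d \<epsilon>" for t
    proof (cases "t = t0")
      case True
      then show ?thesis using z0[OF l] by (simp add: z_def)
    next
      case False
      then show ?thesis using d(2)[of t] that by (auto simp: N_def z_def dist_commute)
    qed
    then show ?thesis using d(1) \<epsilon> by (intro exI[of _ "min d \<epsilon>"]) auto
  qed
  have "(\<zeta> (p t0 l) has_vector_derivative vf t0 (p t0 l)) (at t0 within I)" if l: "l < n" for l
  proof -
    have "at t0 within N = at t0 within I"
      by (rule at_within_nhd[of _ "ball t0 \<epsilon>"]) (use \<epsilon> in \<open>auto simp: N_def\<close>)
    then show ?thesis using zd[OF l t0N] z0[OF l] by (simp add: z_def[abs_def])
  qed
  then show ?thesis using near by blast
qed

lemma pole_derivative: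
  assumes t: "t \<in> I" and l: "l < n"
  shows "((\<lambda>s. p s l) has_vector_derivative vf t (p t l)) (at t within I)"
proof -
  obtain \<zeta> where \<zeta>: "\<forall>l<n. \<exists>e>0. \<forall>s\<in>I. dist s t < e \<longrightarrow> p s l = \<zeta> (p t l) s"
    "\<forall>l<n. (\<zeta> (p t l) has_vector_derivative vf t (p t l)) (at t within I)"
    using poles_follow_characteristics[OF t] by blast
  obtain e where e: "e > 0" "\<And>s. s \<in> I \<Longrightarrow> dist s t < e \<Longrightarrow> p s l = \<zeta> (p t l) s" using \<zeta>(1) l by blast
  show ?thesis
  proof (rule has_vector_derivative_transform_within)
    show "(\<zeta> (p t l) has_vector_derivative vf t (p t l)) (at t within I)" using \<zeta>(2) l by blast
    show "\<zeta> (p t l) s = p s l" if "s \<in> I" "dist s t < e" for s using e(2)[OF that] by (rule sym)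
  qed (rule e t)+
qed

lemma poles_stay_equal:
  assumes "s \<in> I" "t \<in> I" and lk: "l < n" "k < n" and eq: "p s l = p s k"
  shows "p t l = p t k"
proof (rule connected_local_iff[of I "\<lambda>t. p t l = p t k" s])
  fix t assume t: "t \<in> I"
  show "\<exists>e>0. \<forall>s\<in>I. dist s t < e \<longrightarrow> ((p s l = p s k) \<longleftrightarrow> (p t l = p t k))"
  proof (cases "p t l = p t k")
    case True
    obtain \<zeta> where \<zeta>: "\<forall>l<n. \<exists>e>0. \<forall>s\<in>I. dist s t < e \<longrightarrow> p s l = \<zeta> (p t l) s"
      using poles_follow_characteristics[OF t] by blast
    obtain e1 e2 where "e1 > 0" "\<forall>s\<in>I. dist s t < e1 \<longrightarrow> p s l = \<zeta> (p t l) s"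
      "e2 > 0" "\<forall>s\<in>I. dist s t < e2 \<longrightarrow> p s k = \<zeta> (p t k) s" using \<zeta> lk by blast
    then have "p s l = p s k" if "s \<in> I" "dist s t < min e1 e2" for s
      using that True by (metis min_less_iff_conj)
    moreover have "min e1 e2 > 0" using \<open>e1 > 0\<close> \<open>e2 > 0\<close> by simp
    ultimately show ?thesis using True by blast
  next
    case False
    have "continuous_on I (\<lambda>t. dist (p t l) (p t k))" using p_cont lk by (intro continuous_intros)
    then have "\<forall>\<^sub>F s in at t within I. 0 < dist (p s l) (p s k)"
      using t False by (intro order_tendstoD(1)[of _ "dist (p t l) (p t k)"]) (auto simp: continuous_on_def)
    then obtain e where "e > 0" "\<forall>s\<in>I. s \<noteq> t \<and> dist s t < e \<longrightarrow> 0 < dist (p s l) (p s k)"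
      unfolding eventually_at by blast
    then show ?thesis using False by (intro exI[of _ e]) auto
  qed
qed (use assms in \<open>auto intro: convex_connected\<close>)

end

section \<open>Monotonicity of the moduli of zeros and poles\<close>

text \<open>The squared modulus has logarithmic derivative \<open>2 * Re (h t)\<close>.\<close>

lemma norm_increasing:
  fixes f h :: "real \<Rightarrow> complex"
  assumes deriv: "\<And>t. t \<in> {0..<T} \<Longrightarrow> (f has_vector_derivative f t * h t) (at t within {0..<T})"
    and nz: "\<And>t. t \<in> {0..<T} \<Longrightarrow> f t \<noteq> 0" and pos: "\<And>t. t \<in> {0..<T} \<Longrightarrow> 0 < Re (h t)"
    and st: "0 \<le> s" "s < t" "t < T"
  shows "norm (f s) < norm (f t)"
proof -
  let ?N = "\<lambda>t. (Re (f t))\<^sup>2 + (Im (f t))\<^sup>2"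
  have "?N s < ?N t"
  proof (rule DERIV_pos_imp_increasing_open[OF st(2)])
    fix x assume x: "s < x" "x < t"
    then have xI: "x \<in> {0..<T}" using st by auto
    have "at x within {0..<T} = at x"
      by (rule at_within_nhd[of x "{0<..<T}"]) (use x st in auto)
    then have d: "(f has_vector_derivative f x * h x) (at x)" using deriv[OF xI] by simp
    have "((\<lambda>t. Re (f t)) has_real_derivative Re (f x * h x)) (at x)"
      "((\<lambda>t. Im (f t)) has_real_derivative Im (f x * h x)) (at x)"
      using bounded_linear.has_vector_derivative[OF bounded_linear_Re d]
        bounded_linear.has_vector_derivative[OF bounded_linear_Im d]
      by (simp_all add: has_real_derivative_iff_has_vector_derivative)
    from DERIV_add[OF DERIV_power[OF this(1), of 2] DERIV_power[OF this(2), of 2]]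
    have "(?N has_real_derivative 2 * Re (h x) * ((Re (f x))\<^sup>2 + (Im (f x))\<^sup>2)) (at x)"
      by (simp add: power2_eq_square algebra_simps)
    moreover have "0 < (Re (f x))\<^sup>2 + (Im (f x))\<^sup>2"
      using nz[OF xI] by (simp add: sum_power2_gt_zero_iff complex_eq_iff)
    ultimately show "\<exists>y. (?N has_real_derivative y) (at x) \<and> 0 < y"
      using pos[OF xI] by (intro exI[of _ "2 * Re (h x) * ((Re (f x))\<^sup>2 + (Im (f x))\<^sup>2)"]) auto
  next
    have "continuous_on {0..<T} f" using deriv by (intro continuous_on_vector_derivative)
    then have "continuous_on {s..t} f" using st by (elim continuous_on_subset) auto
    then show "continuous_on {s..t} ?N" by (intro continuous_intros)
  qed
  then show ?thesis by (simp add: cmod_def)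
qed

lemma norm_decreasing:
  fixes f h :: "real \<Rightarrow> complex"
  assumes deriv: "\<And>t. t \<in> {0..<T} \<Longrightarrow> (f has_vector_derivative f t * h t) (at t within {0..<T})"
    and nz: "\<And>t. t \<in> {0..<T} \<Longrightarrow> f t \<noteq> 0" and neg: "\<And>t. t \<in> {0..<T} \<Longrightarrow> Re (h t) < 0"
    and st: "0 \<le> s" "s < t" "t < T"
  shows "norm (f t) < norm (f s)"
proof -
  have "norm (1 / f s) < norm (1 / f t)"
  proof (rule norm_increasing[where h = "\<lambda>t. - h t" and T = T])
    fix t assume t: "t \<in> {0..<T}"
    have "((\<lambda>t. 1 / f t) has_vector_derivative (0 * f t - 1 * (f t * h t)) / (f t)\<^sup>2) (at t within {0..<T})"
      by (rule has_vector_derivative_divide_complex[OF _ deriv[OF t] nz[OF t]]) (auto intro: derivative_eq_intros)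
    then show "((\<lambda>t. 1 / f t) has_vector_derivative 1 / f t * - h t) (at t within {0..<T})"
      using nz[OF t] by (simp add: power2_eq_square)
  qed (use nz neg st in auto)
  then show ?thesis
    using nz[of s] nz[of t] st by (simp add: norm_divide field_simps)
qed

section \<open>Reflected poles and the vanishing of \<open>R\<close>\<close>

context admissible_data
begin

text \<open>At a listed pole the derivative of \<open>S\<close> is the product of the differences
  from the other listed poles, so a double root means a repeated entry. In this form equality of
  poles over time transfers double poles.\<close>

lemma double_pole_iff:
  "poly S z = 0 \<and> poly (pderiv S) z = 0 \<longleftrightarrow> (\<exists>l<n. \<exists>k<n. l \<noteq> k \<and> p l = z \<and> p k = z)"
proof -
  have fac: "S = [:- p l, 1:] * (\<Prod>k\<in>{..<n} - {l}. [:- p k, 1:])" if "l < n" for l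
    unfolding S_def of_roots_def using that by (subst prod.remove[of "{..<n}" l]) auto
  have pd: "poly (pderiv S) (p l) = (\<Prod>k\<in>{..<n} - {l}. p l - p k)" if "l < n" for l
    by (subst fac[OF that]) (simp add: pderiv_mult pderiv_pCons poly_prod del: mult_pCons_left)
  show ?thesis
  proof
    assume z: "poly S z = 0 \<and> poly (pderiv S) z = 0"
    then obtain l where l: "l < n" "z = p l" by (auto simp: S_root)
    then have "(\<Prod>k\<in>{..<n} - {l}. p l - p k) = 0" using z pd by simp
    then obtain k where "k < n" "k \<noteq> l" "p l = p k" by auto
    then show "\<exists>l<n. \<exists>k<n. l \<noteq> k \<and> p l = z \<and> p k = z" using l by metis
  next
    assume "\<exists>l<n. \<exists>k<n. l \<noteq> k \<and> p l = z \<and> p k = z"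
    then obtain l k where lk: "l < n" "k < n" "l \<noteq> k" "p l = z" "p k = z" by blast
    then have "(\<Prod>i\<in>{..<n} - {l}. p l - p i) = 0" by (intro prod_zero bexI[of _ k]) auto
    then show "poly S z = 0 \<and> poly (pderiv S) z = 0" using pd[OF lk(1)] lk by (auto simp: S_root)
  qed
qed

lemma zorder_zero:
  assumes j: "j \<in> J"
  shows "zorder g (w j) = 1"
proof (rule zorder_eqI[of "- {z. poly S z = 0}" _ "\<lambda>z. poly (Gq j) z / poly S z"])
  have "finite {z. poly S z = 0}" by (intro poly_roots_finite) (simp add: S_def)
  then show "open (- {z. poly S z = 0})" by (intro open_Compl finite_imp_closed)
  show "w j \<in> - {z. poly S z = 0}" using J_S_nonzero[OF j] by simp
  show "(\<lambda>z. poly (Gq j) z / poly S z) holomorphic_on - {z. poly S z = 0}"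
    by (intro holomorphic_intros) auto
  show "poly (Gq j) (w j) / poly S (w j) \<noteq> 0"
    using pderiv_G_nonzero[OF j] pderiv_G[of j] J_S_nonzero[OF j] j by (simp add: J_iff)
  fix z
  have "poly G z = (z - w j) * poly (Gq j) z" using G_factor[of j] j by (simp add: J_iff left_diff_distrib)
  then show "g z = poly (Gq j) z / poly S z * (z - w j) powi 1" by (simp add: g_eq)
qed

lemma pole_order:
  assumes S0: "poly S \<pi> = 0"
  shows "is_pole g \<pi>" "zorder g \<pi> = - int (order \<pi> S)"
proof -
  have Snz: "S \<noteq> 0" by (simp add: S_def)
  obtain S1 where S1: "S = [:- \<pi>, 1:] ^ order \<pi> S * S1" "poly S1 \<pi> \<noteq> 0"
    using order_decomp[OF Snz, of \<pi>] by (auto simp: poly_eq_0_iff_dvd)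
  have s: "order \<pi> S > 0" using S0 Snz by (simp add: order_root)
  have G0: "poly G \<pi> \<noteq> 0" using no_common S0 by blast
  have "S1 \<noteq> 0" using S1(2) by auto
  then have fin: "finite {z. poly S1 z = 0}" by (rule poly_roots_finite)
  then have op: "open (- {z. poly S1 z = 0})" by (intro open_Compl finite_imp_closed)
  have hol: "(\<lambda>z. poly G z / poly S1 z) holomorphic_on - {z. poly S1 z = 0}"
    by (intro holomorphic_intros) auto
  have Sz: "poly S z = (z - \<pi>) ^ order \<pi> S * poly S1 z" for z
    by (subst S1(1)) simp
  have gz: "g z = poly G z / poly S1 z * (z - \<pi>) powi (- int (order \<pi> S))" if "z \<noteq> \<pi>" for z
    by (simp add: g_eq Sz power_int_minus divide_inverse)
  show "zorder g \<pi> = - int (order \<pi> S)"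
    by (rule zorder_eqI[OF op _ hol]) (use S1(2) G0 gz in auto)
  have "filterlim g at_infinity (at \<pi>)"
    unfolding g_eq
  proof (rule filterlim_divide_at_infinity)
    show "((\<lambda>z. poly G z) \<longlongrightarrow> poly G \<pi>) (at \<pi>)" by (intro tendsto_poly tendsto_ident_at)
    have "((\<lambda>z. poly S z) \<longlongrightarrow> poly S \<pi>) (at \<pi>)" by (intro tendsto_poly tendsto_ident_at)
    then show "filterlim (\<lambda>z. poly S z) (at 0) (at \<pi>)"
    proof (subst filterlim_at, intro conjI)
      have "\<forall>\<^sub>F z in at \<pi>. z \<in> - ({z. poly S z = 0} - {\<pi>})"
        by (intro eventually_at_in_open' open_Compl finite_imp_closed finite_Diff poly_roots_finite Snz) auto
      then show "\<forall>\<^sub>F z in at \<pi>. poly S z \<in> UNIV \<and> poly S z \<noteq> 0"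
        using eventually_neq_at_within[of \<pi>] by eventually_elim auto
    qed (simp add: S0)
  qed (rule G0)
  then show "is_pole g \<pi>" by (simp add: is_pole_def)
qed

text \<open>Disk zeros are simple, so strictly higher order means order at least two; since
  numerator and denominator have no common root, this is a double root of \<open>S\<close>.\<close>

lemma higher_poles_iff:
  "zeros_reflect_to_higher_poles g \<longleftrightarrow>
    (\<forall>j\<in>J. poly S (1 / cnj (w j)) = 0 \<and> poly (pderiv S) (1 / cnj (w j)) = 0)"
proof -
  have zeros: "(z \<in> ball 0 1 \<and> g z = 0) \<longleftrightarrow> (\<exists>j\<in>J. z = w j)" for z
    using S_nonzero[of z] by (auto simp: g_eq G_root J_iff)
  have "is_pole g \<pi> \<and> - zorder g \<pi> > 1 \<longleftrightarrow> poly S \<pi> = 0 \<and> poly (pderiv S) \<pi> = 0" for \<pi>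
  proof (cases "poly S \<pi> = 0")
    case True
    have Snz: "S \<noteq> 0" by (simp add: S_def)
    have "order \<pi> S > 1 \<longleftrightarrow> [:- \<pi>, 1:] ^ 2 dvd S" using Snz by (auto simp: order_divides)
    also have "\<dots> \<longleftrightarrow> poly S \<pi> = 0 \<and> poly (pderiv S) \<pi> = 0"
      unfolding linear_power_dvd_iff by (auto simp: numeral_2_eq_2 less_Suc_eq)
    finally show ?thesis using pole_order[OF True] by auto
  next
    case False
    have "isCont g \<pi>" using DERIV_isCont[OF g_deriv[OF False]] .
    then have "\<not> is_pole g \<pi>" using not_tendsto_and_filterlim_at_infinity[of "at \<pi>" g "g \<pi>"]
      by (auto simp: is_pole_def isCont_def)
    then show ?thesis using False by simp
  qed
  note eq = this
  show ?thesis
    unfolding zeros_reflect_to_higher_poles_def reflect_def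
    using zeros zorder_zero eq by (metis (no_types, lifting))
qed

text \<open>At a single time a simple pole at each reflected point already makes \<open>R\<close>
  vanish. The stronger condition on the order results from persistence in time, see
  \<open>double_if_always_zero\<close>.\<close>

lemma R_zero_iff: "(\<forall>z. R_fun m w A z = 0) \<longleftrightarrow> (\<forall>j\<in>J. poly S (1 / cnj (w j)) = 0)"
proof
  assume "\<forall>z. R_fun m w A z = 0"
  then have "A j = 0" if "j \<in> J" for j using R_fun_zero_imp[of A j] that by blast
  then show "\<forall>j\<in>J. poly S (1 / cnj (w j)) = 0" using A_zero_iff by blast
next
  assume "\<forall>j\<in>J. poly S (1 / cnj (w j)) = 0"
  then have "A j = 0" if "j \<in> J" for j using A_zero_iff that by blast
  then show "\<forall>z. R_fun m w A z = 0" by (simp add: R_fun_def)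
qed

text \<open>The identity for \<open>P + R\<close> holds only off the zeros of \<open>G\<close>; in
  product form it extends to them by continuation, so that it can be differentiated at disk
  zeros.\<close>

lemma P_times_G:
  assumes R0: "\<forall>z. R_fun m w A z = 0" and z: "norm z < 1"
  shows "P_fun c g z * poly G z = poly L z"
proof (rule analytic_continuation_open[of "ball 0 1 - {z. poly G z = 0}" "ball 0 1"
      "\<lambda>z. P_fun c g z * poly G z" "poly L"])
  have fin: "finite {z. poly G z = 0}" using good by (intro poly_roots_finite) (auto simp: good_def)
  then show "open (ball 0 1 - {z. poly G z = 0})" by (intro open_Diff finite_imp_closed) auto
  have "infinite (ball (0::complex) 1)" using uncountable_ball[of 1 "0::complex"] countable_finite by auto
  then have "infinite (ball 0 1 - {z. poly G z = 0})" using fin by simp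
  then show "ball 0 1 - {z. poly G z = 0} \<noteq> {}" by (metis finite.emptyI)
  show "(\<lambda>z. P_fun c g z * poly G z) holomorphic_on ball 0 1" by (intro holomorphic_intros P_holomorphic)
  show "P_fun c g z * poly G z = poly L z" if "z \<in> ball 0 1 - {z. poly G z = 0}" for z
    using P_plus_R[of z] R0 that by (simp add: field_simps)
qed (use z in \<open>auto intro!: holomorphic_intros\<close>)

lemma P_times_G_deriv:
  assumes R0: "\<forall>z. R_fun m w A z = 0" and j: "j \<in> J"
  shows "P_fun c g (w j) * poly (pderiv G) (w j) = poly (pderiv L) (w j)"
proof -
  have jn: "w j \<in> ball 0 1" "poly G (w j) = 0" using j by (auto simp: J_iff G_root)
  have "(P_fun c g has_field_derivative deriv (P_fun c g) (w j)) (at (w j))"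
    using P_holomorphic jn(1) by (intro holomorphic_derivI) auto
  from DERIV_mult[OF this poly_DERIV[of G]]
  have "((\<lambda>z. P_fun c g z * poly G z) has_field_derivative P_fun c g (w j) * poly (pderiv G) (w j)) (at (w j))"
    using jn(2) by (simp add: mult.commute)
  then have "(poly L has_field_derivative P_fun c g (w j) * poly (pderiv G) (w j)) (at (w j))"
    by (rule has_field_derivative_transform_within_open[of _ _ _ "ball 0 1"])
      (use jn P_times_G[OF R0] in auto)
  then show ?thesis using DERIV_unique[OF _ poly_DERIV] by blast
qed

lemma rc_S_root:
  assumes "z \<noteq> 0"
  shows "poly S (1 / cnj z) = 0 \<Longrightarrow> poly (rc n S) z = 0"
    and "poly S (1 / cnj z) = 0 \<Longrightarrow>
      z\<^sup>2 * poly (pderiv (rc n S)) z = - (z ^ n * cnj (poly (pderiv S) (1 / cnj z)))"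
  using assms poly_pderiv_rc[of S n z] by (simp_all add: poly_rc degree_S)

lemma pderiv_L_identity:
  "poly (pderiv L) z * poly (rc m G) z + poly L z * poly (pderiv (rc m G)) z +
    (poly (pderiv (rc m L)) z * poly G z + poly (rc m L) z * poly (pderiv G) z) =
    of_real c * poly (pderiv (Hp m n S)) z"
  using arg_cong[OF L_identity, of "\<lambda>q. poly (pderiv q) z"]
  by (simp add: pderiv_mult pderiv_add pderiv_smult algebra_simps)

lemma Hp_double:
  assumes "poly (rc n S) z = 0"
  shows "poly (Hp m n S) z = 0"
    "poly (pderiv (Hp m n S)) z = 2 * (z ^ (m - n) * poly S z * poly (pderiv (rc n S)) z)"
  using assms by (simp_all add: Hp_def pderiv_mult pderiv_smult poly_monom)

lemma rc_G_nonzero: "z \<noteq> 0 \<Longrightarrow> poly G (1 / cnj z) \<noteq> 0 \<Longrightarrow> poly (rc m G) z \<noteq> 0"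
  by (simp add: poly_rc degree_G)

lemma rc_quotient: "z \<noteq> 0 \<Longrightarrow> poly (rc m L) z / poly (rc m G) z = cnj (poly L (1 / cnj z) / poly G (1 / cnj z))"
  by (simp add: poly_rc degree_G degree_L)

text \<open>The reflection principle turns \<open>Re P > 0\<close> in the disk into \<open>Re (L / G) < 0\<close> at the poles.\<close>

lemma Re_velocity_at_pole:
  assumes R0: "\<forall>z. R_fun m w A z = 0" and higher: "zeros_reflect_to_higher_poles g" and l: "l < n"
  shows "Re (poly L (p l) / poly G (p l)) < 0"
proof -
  define y where "y = 1 / cnj (p l)"
  have pl: "norm (p l) > 1" "p l \<noteq> 0" using pole_norm[OF l] by auto
  have y: "y \<noteq> 0" "norm y < 1" "1 / cnj y = p l" using pl by (auto simp: y_def norm_divide)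
  have Sp: "poly S (p l) = 0" using l by (auto simp: S_root)
  have Gp: "poly G (p l) \<noteq> 0" using no_common Sp by blast
  have rS: "poly (rc n S) y = 0" using rc_S_root(1)[OF y(1)] Sp y(3) by simp
  have rG: "poly (rc m G) y \<noteq> 0" using rc_G_nonzero[OF y(1)] Gp y(3) by simp
  \<comment> \<open>At a reflected pole the right-hand side of \<open>L_identity\<close> vanishes,
    and with \<open>L = P * G\<close> a factor \<open>G\<close> cancels. If \<open>y\<close> is
    itself a disk zero this factor is \<open>0\<close>; then the differentiated identity is used,
    whose right-hand side vanishes because the pole is double.\<close>
  have "P_fun c g y * poly (rc m G) y + poly (rc m L) y = 0"
  proof (cases "poly G y = 0")
    case False
    have "poly L y * poly (rc m G) y + poly (rc m L) y * poly G y = 0"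
      using arg_cong[OF L_identity, of "\<lambda>q. poly q y"] Hp_double(1)[OF rS] by simp
    then have "P_fun c g y * poly G y * poly (rc m G) y + poly (rc m L) y * poly G y = 0"
      by (simp only: P_times_G[OF R0 y(2)])
    then have "(P_fun c g y * poly (rc m G) y + poly (rc m L) y) * poly G y = 0"
      by (simp only: distrib_left distrib_right mult.commute mult.left_commute)
    then show ?thesis using False by simp
  next
    case True
    then obtain j where j: "j \<in> J" "y = w j" using y(2) by (auto simp: G_root J_iff)
    have "poly (pderiv S) (p l) = 0" using higher j y(3) unfolding higher_poles_iff by metis
    then have "poly (pderiv (rc n S)) y = 0" using rc_S_root(2)[OF y(1)] Sp y(1,3) by simp
    then have "poly (pderiv (Hp m n S)) y = 0" using Hp_double(2)[OF rS] by simp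
    moreover have "poly L y = 0" using P_times_G[OF R0 y(2)] True by simp
    ultimately have "poly (pderiv L) y * poly (rc m G) y + poly (rc m L) y * poly (pderiv G) y = 0"
      using pderiv_L_identity[of y] True by simp
    then have "P_fun c g y * poly (pderiv G) y * poly (rc m G) y + poly (rc m L) y * poly (pderiv G) y = 0"
      using P_times_G_deriv[OF R0 j(1)] j(2) by simp
    then have "(P_fun c g y * poly (rc m G) y + poly (rc m L) y) * poly (pderiv G) y = 0"
      by (simp only: distrib_left distrib_right mult.commute mult.left_commute)
    then show ?thesis using pderiv_G_nonzero[OF j(1)] j(2) by simp
  qed
  then have "P_fun c g y * poly (rc m G) y = - poly (rc m L) y" by (simp add: eq_neg_iff_add_eq_0)
  then have "P_fun c g y = - poly (rc m L) y / poly (rc m G) y"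
    by (rule eq_divide_imp[OF rG])
  then have "P_fun c g y = - (poly (rc m L) y / poly (rc m G) y)" by simp
  then have "P_fun c g y = - cnj (poly L (p l) / poly G (p l))"
    using rc_quotient[OF y(1)] y(3) by simp
  then have "Re (P_fun c g y) = - Re (poly L (p l) / poly G (p l))" by (simp only: uminus_complex.sel cnj.sel)
  then show ?thesis using Re_P_pos[OF y(2)] by linarith
qed

end

section \<open>Reflected poles in the course of time\<close>

context rational_path
begin

lemma A_data_eq: "A_data q m n b w p t = (\<lambda>j. A_coef (q t) (g t) (w t j))"
  by (rule ext) (simp add: A_data_def)

lemma R_zero_iff:
  assumes t: "t \<in> I"
  shows "(\<forall>z. R_fun m (w t) (A_data q m n b w p t) z = 0) \<longleftrightarrow> (\<forall>j\<in>J. poly (SS t) (1 / cnj (w t j)) = 0)"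
  unfolding A_data_eq using admissible_data.R_zero_iff[OF data[OF t]]
  by (simp add: admissible_data_simps[OF t] disk_zeros_const[OF t])

lemma higher_poles_iff:
  assumes t: "t \<in> I"
  shows "zeros_reflect_to_higher_poles (g t) \<longleftrightarrow>
    (\<forall>j\<in>J. poly (SS t) (1 / cnj (w t j)) = 0 \<and> poly (pderiv (SS t)) (1 / cnj (w t j)) = 0)"
  using admissible_data.higher_poles_iff[OF data[OF t]]
  by (simp add: admissible_data_simps[OF t] disk_zeros_const[OF t])

lemma poly_transport_velocity:
  assumes t: "t \<in> I"
  shows "poly (dG t) z * poly (SS t) z - poly (GG t) z * poly (dS t) z =
    (poly (LL t) z + z * poly (pderiv (LL t)) z) * poly (SS t) z - z * poly (LL t) z * poly (pderiv (SS t)) z"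
  using arg_cong[OF transport_velocity[OF t], of "\<lambda>P. poly P z"]
  by (simp only: poly_diff poly_mult poly_transport)

lemma J_at: "t \<in> I \<Longrightarrow> j \<in> J \<Longrightarrow> j \<in> disk_zeros m (w t)"
  using disk_zeros_const[of t] by simp

text \<open>When the denominator vanishes at the reflected point, the right-hand side of the
  identity for \<open>LL\<close> vanishes at the disk zero. Thus \<open>LL\<close> shares the zero
  of \<open>GG\<close>, and one term of the transport equation is left.\<close>

lemma reflected_zero_velocity:
  assumes t: "t \<in> I" and j: "j \<in> J" and S0: "poly (SS t) (1 / cnj (w t j)) = 0"
  shows "poly (LL t) (w t j) = 0" "poly (dG t) (w t j) = w t j * poly (pderiv (LL t)) (w t j)"
    "poly (GG t) (w t j) = 0" "poly (rc m (GG t)) (w t j) \<noteq> 0" "poly (rc n (SS t)) (w t j) = 0"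
proof -
  interpret D: admissible_data m n "b t" "w t" "p t" "q t" by (rule data[OF t])
  note DG = admissible_data_simps[OF t]
  have jm: "j < m" "norm (w t j) < 1" and w0: "w t j \<noteq> 0"
    using J_at[OF t j] D.w_nonzero by (auto simp: D.J_iff)
  show G0: "poly (GG t) (w t j) = 0" using jm D.G_root by (auto simp: DG)
  show rG: "poly (rc m (GG t)) (w t j) \<noteq> 0"
    using D.rc_G_nonzero[OF w0 D.G_reflect[OF jm(1)]] by (simp add: DG)
  show rS: "poly (rc n (SS t)) (w t j) = 0" using D.rc_S_root(1)[OF w0] S0 by (simp add: DG)
  show L0: "poly (LL t) (w t j) = 0"
    using arg_cong[OF LL_props(2)[OF t], of "\<lambda>P. poly P (w t j)"] D.Hp_double(1)[of "w t j"] G0 rG rS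
    by (simp add: DG)
  have "poly (SS t) (w t j) \<noteq> 0" using D.S_nonzero[of "w t j"] jm by (simp add: DG)
  then show "poly (dG t) (w t j) = w t j * poly (pderiv (LL t)) (w t j)"
    using poly_transport_velocity[OF t, of "w t j"] G0 L0 by simp
qed

text \<open>If the reflected point remained a simple pole, differentiating \<open>SS\<close> along
  it and inserting both velocities would give \<open>rc m L * G' + rc m G * L' = 0\<close> at the
  disk zero. As \<open>G\<close> and \<open>L\<close> vanish there, this is the derivative of the
  left-hand side of the identity for \<open>L\<close>, so \<open>Hp\<close> has a double root. The
  denominator does not vanish in the disk, so the double root belongs to \<open>rc n (SS t)\<close>,
  and the pole is double after all.\<close>

lemma double_if_always_zero:
  assumes zero: "\<And>t. t \<in> I \<Longrightarrow> poly (SS t) (1 / cnj (w t j)) = 0" and t: "t \<in> I" and j: "j \<in> J"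
  shows "poly (pderiv (SS t)) (1 / cnj (w t j)) = 0"
proof (rule ccontr)
  interpret D: admissible_data m n "b t" "w t" "p t" "q t" by (rule data[OF t])
  note DG = admissible_data_simps[OF t]
  note v = reflected_zero_velocity[OF t j zero[OF t]]
  define \<omega> where "\<omega> = w t j"
  define \<pi> where "\<pi> = 1 / cnj \<omega>"
  let ?G' = "poly (pderiv (GG t)) \<omega>" and ?L' = "poly (pderiv (LL t)) \<omega>" and ?S' = "poly (pderiv (SS t)) \<pi>"
  assume "poly (pderiv (SS t)) (1 / cnj (w t j)) \<noteq> 0"
  then have ne: "?S' \<noteq> 0" by (simp add: \<pi>_def \<omega>_def)
  have w0: "\<omega> \<noteq> 0" "norm \<omega> < 1" using J_at[OF t j] D.w_nonzero by (auto simp: D.J_iff \<omega>_def)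
  have G': "?G' \<noteq> 0" using D.pderiv_G_nonzero[OF J_at[OF t j]] by (simp add: DG \<omega>_def)
  have "((\<lambda>s. poly (SS s) (1 / cnj (w s j))) has_vector_derivative poly (dS t) (1 / cnj (w t j)) +
      poly (pderiv (SS t)) (1 / cnj (w t j)) * (cnj (poly (dG t) (w t j) / poly (pderiv (GG t)) (w t j)) / (cnj (w t j))\<^sup>2))
      (at t within I)"
    by (rule has_vector_derivative_poly_path[OF dG_dS(2)[OF t] _ degree_dS[OF t] reflected_derivative[OF t j]]) simp
  moreover have "((\<lambda>s. poly (SS s) (1 / cnj (w s j))) has_vector_derivative 0) (at t within I)"
    by (rule has_vector_derivative_transform[OF t _ has_vector_derivative_const[of 0]]) (simp add: zero)
  ultimately have "poly (dS t) (1 / cnj (w t j)) +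
      poly (pderiv (SS t)) (1 / cnj (w t j)) * (cnj (poly (dG t) (w t j) / poly (pderiv (GG t)) (w t j)) / (cnj (w t j))\<^sup>2) = 0"
    using vector_derivative_unique_within[OF at_within_I[OF t]] by blast
  then have "poly (dS t) \<pi> + ?S' * (cnj (\<omega> * ?L' / ?G') / (cnj \<omega>)\<^sup>2) = 0"
    by (simp only: \<pi>_def \<omega>_def v(2))
  moreover have "cnj (\<omega> * ?L' / ?G') / (cnj \<omega>)\<^sup>2 = \<pi> * cnj (?L' / ?G')"
    using w0 by (simp add: \<pi>_def power2_eq_square)
  ultimately have "poly (dS t) \<pi> + ?S' * (\<pi> * cnj (?L' / ?G')) = 0" by (simp only:)
  then have dS: "poly (dS t) \<pi> = - (?S' * (\<pi> * cnj (?L' / ?G')))" by (simp only: eq_neg_iff_add_eq_0)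
  have "poly (SS t) \<pi> = 0" using zero[OF t] by (simp add: \<pi>_def \<omega>_def)
  with poly_transport_velocity[OF t, of \<pi>]
  have "poly (GG t) \<pi> * poly (dS t) \<pi> = \<pi> * poly (LL t) \<pi> * ?S'" by simp
  moreover have "G * - (S * (\<pi> * k)) = \<pi> * L * S \<Longrightarrow> (S * \<pi>) * (L + G * k) = 0" for G S L k :: complex by algebra
  ultimately have "(?S' * \<pi>) * (poly (LL t) \<pi> + poly (GG t) \<pi> * cnj (?L' / ?G')) = 0"
    unfolding dS by blast
  moreover have "\<pi> \<noteq> 0" using w0 by (simp add: \<pi>_def)
  ultimately have "poly (LL t) \<pi> + poly (GG t) \<pi> * cnj (?L' / ?G') = 0" using ne by simp
  then have "cnj (poly (LL t) \<pi> + poly (GG t) \<pi> * cnj (?L' / ?G')) = 0" by (simp only: complex_cnj_zero)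
  then have "cnj (poly (LL t) \<pi>) + cnj (poly (GG t) \<pi>) * (?L' / ?G') = 0" by simp
  moreover have "X * ?G' + Y * ?L' = (X + Y * (?L' / ?G')) * ?G'" for X Y
    using G' by (simp add: distrib_right)
  ultimately have "cnj (poly (LL t) \<pi>) * ?G' + cnj (poly (GG t) \<pi>) * ?L' = 0" by simp
  then have "\<omega> ^ m * (cnj (poly (LL t) \<pi>) * ?G' + cnj (poly (GG t) \<pi>) * ?L') = 0" by simp
  then have "poly (rc m (LL t)) \<omega> * ?G' + poly (rc m (GG t)) \<omega> * ?L' = 0"
    using w0 by (simp only: poly_rc[OF LL_props(1)[OF t] w0(1)] poly_rc[OF degree_GG w0(1)] \<pi>_def distrib_left mult.assoc)
  then have "poly (pderiv (Hp m n (SS t))) \<omega> = 0"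
    using D.pderiv_L_identity[of \<omega>] v(1,3) q_pos[of t] t by (simp add: DG \<omega>_def algebra_simps)
  then have "poly (pderiv (rc n (SS t))) \<omega> = 0"
    using D.Hp_double(2)[of \<omega>] v(5) D.S_nonzero[of \<omega>] w0 by (simp add: DG \<omega>_def)
  then show False
    using D.rc_S_root(2)[OF w0(1)] zero[OF t] ne w0 by (simp add: DG \<omega>_def \<pi>_def)
qed

lemma reflected_pole_algebra:
  fixes G :: complex
  assumes "rG \<noteq> 0" "S \<noteq> 0"
  shows "(G * ds + (- (\<mu> * G) + y * ((\<mu> * G * rG' - rL' * G - rL * G') / rG)) * S - y * - (\<mu> * G) * S') / S +
      G' * (y * (rL / rG)) =
    (ds / S - \<mu> + y * (\<mu> * rG' - rL') / rG + y * \<mu> * S' / S) * G"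
proof -
  have "(G * ds + (- (\<mu> * G) + y * ((\<mu> * G * rG' - rL' * G - rL * G') * i)) * S - y * - (\<mu> * G) * S') * k +
      G' * (y * (rL * i)) =
    (ds * k - \<mu> + y * (\<mu> * rG' - rL') * i + y * \<mu> * S' * k) * G" if "S * k = 1" for i k
    using that by algebra
  from this[of "inverse S" "inverse rG"] show ?thesis using assms by (simp only: divide_inverse right_inverse not_False_eq_True)
qed

text \<open>At the reflection \<open>y\<close> of a double pole \<open>Hp\<close> has a double root,
  so the identity for \<open>LL\<close> and its derivative express \<open>L\<close> and
  \<open>L'\<close> at \<open>y\<close> by \<open>G\<close> and \<open>G'\<close>, with coefficients
  taken from the reciprocal polynomials. In the derivative of \<open>G\<close> along
  \<open>y\<close> the terms with \<open>G'\<close> cancel against the motion of \<open>y\<close>,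
  leaving a linear equation with the continuous coefficient \<open>\<kappa>\<close>.\<close>

lemma reflected_pole_stays_zero:
  assumes s: "s \<in> I" and lk: "l < n" "k < n" "l \<noteq> k" "p s l = p s k"
    and G0: "poly (GG s) (1 / cnj (p s l)) = 0" and t: "t \<in> I"
  shows "poly (GG t) (1 / cnj (p t l)) = 0"
proof -
  define y where "y t = 1 / cnj (p t l)" for t
  \<comment> \<open>By reflection this is the conjugate of \<open>L / G\<close> at the pole, so
    \<open>y\<close> moves with velocity \<open>y * \<mu>\<close>.\<close>
  define \<mu> where "\<mu> t = poly (rc m (LL t)) (y t) / poly (rc m (GG t)) (y t)" for t
  define \<kappa> where "\<kappa> t = poly (dS t) (y t) / poly (SS t) (y t) - \<mu> t +
    y t * (\<mu> t * poly (pderiv (rc m (GG t))) (y t) - poly (pderiv (rc m (LL t))) (y t)) / poly (rc m (GG t)) (y t) +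
    y t * \<mu> t * poly (pderiv (SS t)) (y t) / poly (SS t) (y t)" for t
  have *: "norm (p t l) > 1" "y t \<noteq> 0" "norm (y t) < 1" "poly (SS t) (y t) \<noteq> 0"
    "poly (rc m (GG t)) (y t) \<noteq> 0" "poly (GG t) (p t l) \<noteq> 0" "1 / cnj (y t) = p t l" if t: "t \<in> I" for t
  proof -
    interpret D: admissible_data m n "b t" "w t" "p t" "q t" by (rule data[OF t])
    note DG = admissible_data_simps[OF t]
    show pn: "norm (p t l) > 1" by (rule D.pole_norm[OF lk(1)])
    then have p0: "p t l \<noteq> 0" by auto
    show y: "y t \<noteq> 0" "norm (y t) < 1" "1 / cnj (y t) = p t l" using pn p0 by (auto simp: y_def norm_divide)
    show "poly (SS t) (y t) \<noteq> 0" using D.S_nonzero[of "y t"] y by (simp add: DG)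
    show Gp: "poly (GG t) (p t l) \<noteq> 0" using D.no_common[of "p t l"] D.S_root[of "p t l"] lk(1) by (auto simp: DG)
    show "poly (rc m (GG t)) (y t) \<noteq> 0" using D.rc_G_nonzero[OF y(1)] Gp y(3) by (simp add: DG)
  qed
  have y_der: "(y has_vector_derivative y t * \<mu> t) (at t within I)" if t: "t \<in> I" for t
  proof -
    interpret D: admissible_data m n "b t" "w t" "p t" "q t" by (rule data[OF t])
    note DG = admissible_data_simps[OF t]
    have "((\<lambda>s. cnj (p s l)) has_vector_derivative cnj (vf t (p t l))) (at t within I)"
      by (rule bounded_linear.has_vector_derivative[OF bounded_linear_cnj pole_derivative[OF t lk(1)]])
    then have "((\<lambda>s. 1 / cnj (p s l)) has_vector_derivative
        (0 * cnj (p t l) - 1 * cnj (vf t (p t l))) / (cnj (p t l))\<^sup>2) (at t within I)"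
      by (rule has_vector_derivative_divide_complex[rotated]) (use *(1)[OF t] in \<open>auto intro: derivative_eq_intros\<close>)
    moreover have "\<mu> t = cnj (poly (LL t) (p t l) / poly (GG t) (p t l))"
      using D.rc_quotient[OF *(2)[OF t]] *(7)[OF t] by (simp add: \<mu>_def DG)
    then have "(0 * cnj (p t l) - 1 * cnj (vf t (p t l))) / (cnj (p t l))\<^sup>2 = y t * \<mu> t"
      using *(1)[OF t] by (auto simp: vf_def y_def power2_eq_square)
    ultimately show ?thesis unfolding y_def by simp
  qed
  have cy: "continuous_on I y" using y_der by (intro continuous_on_vector_derivative)
  have "continuous_on I (\<lambda>t. poly (dS t) (y t))" "continuous_on I (\<lambda>t. poly (SS t) (y t))"
    by (intro continuous_on_path_poly cy subset_refl)+
  moreover have "continuous_on I (\<lambda>t. poly (rc m (LL t)) (y t))" "continuous_on I (\<lambda>t. poly (rc m (GG t)) (y t))"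
    by (rule continuous_on_poly_path[OF pcont_rc[OF pcont_LL] degree_rc continuous_on_id cy]
        continuous_on_poly_path[OF pcont_rc[OF pcont_GG] degree_rc continuous_on_id cy], simp)+
  moreover have "continuous_on I (\<lambda>t. poly (pderiv (rc m (LL t))) (y t))"
    by (rule continuous_on_poly_path[OF pcont_pderiv[OF pcont_rc[OF pcont_LL]] _ continuous_on_id cy, of m])
      (auto simp: degree_pderiv intro: order_trans[OF diff_le_self degree_rc])
  moreover have "continuous_on I (\<lambda>t. poly (pderiv (rc m (GG t))) (y t))"
    by (rule continuous_on_poly_path[OF pcont_pderiv[OF pcont_rc[OF pcont_GG]] _ continuous_on_id cy, of m])
      (auto simp: degree_pderiv intro: order_trans[OF diff_le_self degree_rc])
  moreover have "continuous_on I (\<lambda>t. poly (pderiv (SS t)) (y t))"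
    by (rule continuous_on_poly_path[OF pcont_pderiv[OF pcont_SS] _ continuous_on_id cy, of n])
      (auto simp: degree_pderiv)
  ultimately have c\<kappa>: "continuous_on I \<kappa>"
    unfolding \<kappa>_def \<mu>_def using * by (intro continuous_intros cy) auto
  have "poly (GG t) (y t) = 0"
  proof (rule linear_bound_imp_zero[where y' = "\<lambda>t. \<kappa> t * poly (GG t) (y t)" and I = I and ?t0.0 = s])
    fix t assume t: "t \<in> I"
    interpret D: admissible_data m n "b t" "w t" "p t" "q t" by (rule data[OF t])
    note DG = admissible_data_simps[OF t]
    have "p t l = p t k" by (rule poles_stay_equal[OF s t lk(1,2,4)])
    then have "poly (SS t) (p t l) = 0 \<and> poly (pderiv (SS t)) (p t l) = 0"
      using D.double_pole_iff[of "p t l"] lk(1-3) unfolding DG by metis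
    then have rS: "poly (rc n (SS t)) (y t) = 0" "poly (pderiv (rc n (SS t))) (y t) = 0"
      using D.rc_S_root[OF *(2)[OF t]] *(2,7)[OF t] by (simp_all add: DG)
    define L G S rL rG L' G' S' rL' rG' ds where defs: "L = poly (LL t) (y t)" "G = poly (GG t) (y t)"
      "S = poly (SS t) (y t)" "rL = poly (rc m (LL t)) (y t)" "rG = poly (rc m (GG t)) (y t)"
      "L' = poly (pderiv (LL t)) (y t)" "G' = poly (pderiv (GG t)) (y t)" "S' = poly (pderiv (SS t)) (y t)"
      "rL' = poly (pderiv (rc m (LL t))) (y t)" "rG' = poly (pderiv (rc m (GG t))) (y t)" "ds = poly (dS t) (y t)"
    have nz: "rG \<noteq> 0" "S \<noteq> 0" using *[OF t] by (simp_all add: defs)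
    have "L * rG + rL * G = 0"
      using arg_cong[OF LL_props(2)[OF t], of "\<lambda>P. poly P (y t)"] D.Hp_double(1)[of "y t"] rS by (simp add: DG defs)
    then have "L * rG = - (rL * G)" by (simp add: eq_neg_iff_add_eq_0)
    then have "L = - (rL * G) / rG" by (rule eq_divide_imp[OF nz(1)])
    then have L: "L = - (\<mu> t * G)" unfolding \<mu>_def defs[symmetric] by simp
    have "L' * rG + L * rG' + (rL' * G + rL * G') = 0"
      using D.pderiv_L_identity[of "y t"] D.Hp_double(2)[of "y t"] rS by (simp add: DG defs)
    then have "L' * rG = \<mu> t * G * rG' - rL' * G - rL * G'" unfolding L by (simp add: algebra_simps)
    then have L': "L' = (\<mu> t * G * rG' - rL' * G - rL * G') / rG" by (rule eq_divide_imp[OF nz(1)])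
    have "poly (dG t) (y t) * S = G * ds + (L + y t * L') * S - y t * L * S'"
      using poly_transport_velocity[OF t, of "y t"] unfolding defs by (simp add: algebra_simps)
    then have dG: "poly (dG t) (y t) = (G * ds + (L + y t * L') * S - y t * L * S') / S" by (rule eq_divide_imp[OF nz(2)])
    have "poly (dG t) (y t) + G' * (y t * (rL / rG)) = \<kappa> t * G"
      unfolding \<kappa>_def defs[symmetric] dG L L' by (simp only: reflected_pole_algebra[OF nz])
    then have "\<kappa> t * poly (GG t) (y t) = poly (dG t) (y t) + poly (pderiv (GG t)) (y t) * (y t * \<mu> t)"
      by (simp add: defs \<mu>_def)
    then show "((\<lambda>t. poly (GG t) (y t)) has_vector_derivative \<kappa> t * poly (GG t) (y t)) (at t within I)"
      using has_vector_derivative_poly_path[OF dG_dS(1)[OF t] degree_GG dG_dS(3)[OF t] y_der[OF t]] by simp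
    obtain e where e: "e > 0" "\<And>s. s \<in> I \<Longrightarrow> dist s t < e \<Longrightarrow> dist (\<kappa> s) (\<kappa> t) < 1"
      using c\<kappa>[unfolded continuous_on_iff, rule_format, OF t, of 1] by auto
    show "\<exists>e>0. \<exists>C. \<forall>s\<in>I. dist s t < e \<longrightarrow> norm (\<kappa> s * poly (GG s) (y s)) \<le> C * norm (poly (GG s) (y s))"
    proof (rule exI[of _ e], intro conjI e(1) exI[of _ "norm (\<kappa> t) + 1"] ballI impI)
      fix s assume "s \<in> I" "dist s t < e"
      then have "dist (\<kappa> s) (\<kappa> t) < 1" by (rule e(2))
      then have "norm (\<kappa> s) \<le> norm (\<kappa> t) + 1" using norm_triangle_ineq2[of "\<kappa> s" "\<kappa> t"] by (simp add: dist_norm)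
      then show "norm (\<kappa> s * poly (GG s) (y s)) \<le> (norm (\<kappa> t) + 1) * norm (poly (GG s) (y s))"
        by (simp add: norm_mult mult_right_mono)
    qed
  next
    show "convex I" by simp
    show "poly (GG s) (y s) = 0" using G0 by (simp add: y_def)
  qed (rule s, rule t)
  then show ?thesis by (simp add: y_def)
qed

text \<open>Double poles persist, and so does a zero of the numerator at their reflection, but only
  as some disk zero, with possibly another index \<open>\<sigma> j\<close>. Following the poles back
  to time \<open>s\<close> shows that \<open>\<sigma>\<close> is injective, hence maps the finite
  set \<open>J\<close> onto itself, and every disk zero is accounted for.\<close>

lemma higher_poles_conserved:
  assumes s: "s \<in> I" and t: "t \<in> I" and higher: "zeros_reflect_to_higher_poles (g s)"
  shows "zeros_reflect_to_higher_poles (g t)"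
proof -
  interpret Ds: admissible_data m n "b s" "w s" "p s" "q s" by (rule data[OF s])
  interpret Dt: admissible_data m n "b t" "w t" "p t" "q t" by (rule data[OF t])
  note DGs = admissible_data_simps[OF s] and DGt = admissible_data_simps[OF t]
  have Js: "disk_zeros m (w s) = J" and Jt: "disk_zeros m (w t) = J" by (rule disk_zeros_const[OF s], rule disk_zeros_const[OF t])
  have ex: "\<exists>l k. l < n \<and> k < n \<and> l \<noteq> k \<and> p s l = 1 / cnj (w s j) \<and> p s k = 1 / cnj (w s j)" if "j \<in> J" for j
    using higher that Ds.double_pole_iff[of "1 / cnj (w s j)"] unfolding higher_poles_iff[OF s] DGs by metis
  then obtain l k where lk: "\<And>j. j \<in> J \<Longrightarrow> l j < n \<and> k j < n \<and> l j \<noteq> k j \<and>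
      p s (l j) = 1 / cnj (w s j) \<and> p s (k j) = 1 / cnj (w s j)" by metis
  have tlk: "p t (l j) = p t (k j)" if "j \<in> J" for j
    using poles_stay_equal[OF s t] lk[OF that] by simp
  have "\<exists>i\<in>J. 1 / cnj (w t i) = p t (l j)" if j: "j \<in> J" for j
  proof -
    have "j < m" using j by (simp add: disk_zeros_def)
    then have "poly (GG s) (w s j) = 0" using Ds.G_root[of "w s j"] unfolding DGs by blast
    moreover have lkj: "l j < n" "k j < n" "l j \<noteq> k j" "p s (l j) = p s (k j)" "1 / cnj (p s (l j)) = w s j"
      using lk[OF j] by simp_all
    ultimately have "poly (GG t) (1 / cnj (p t (l j))) = 0"
      using reflected_pole_stays_zero[OF s lkj(1-4) _ t] by simp
    then obtain i where i: "i < m" "1 / cnj (p t (l j)) = w t i" using Dt.G_root by (auto simp: DGt)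
    moreover have "norm (p t (l j)) > 1" using Dt.pole_norm lk[OF j] by simp
    ultimately have "norm (w t i) < 1" unfolding i(2)[symmetric] by (auto simp: norm_divide divide_less_eq_1)
    moreover have "1 / cnj (w t i) = p t (l j)" by (simp flip: i(2))
    ultimately show ?thesis using i Dt.J_iff[of i] by (auto simp: Jt)
  qed
  then obtain \<sigma> where \<sigma>: "\<And>j. j \<in> J \<Longrightarrow> \<sigma> j \<in> J \<and> 1 / cnj (w t (\<sigma> j)) = p t (l j)" by metis
  have "inj_on \<sigma> J"
  proof (rule inj_onI)
    fix i j assume ij: "i \<in> J" "j \<in> J" "\<sigma> i = \<sigma> j"
    then have "p t (l i) = p t (l j)" using \<sigma> by metis
    then have "p s (l i) = p s (l j)" using lk ij by (intro poles_stay_equal[OF t s]) auto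
    then have "w s i = w s j" using lk ij by simp
    then show "i = j" using Ds.inj_J ij by (auto simp: inj_on_def Js)
  qed
  then have surj: "\<sigma> ` J = J" using \<sigma> Dt.finite_J by (intro endo_inj_surj) (auto simp: Jt)
  show ?thesis
    unfolding higher_poles_iff[OF t]
  proof
    fix i assume "i \<in> J"
    then obtain j where j: "j \<in> J" "i = \<sigma> j" using surj by blast
    then have "1 / cnj (w t i) = p t (l j)" using \<sigma> by simp
    then show "poly (SS t) (1 / cnj (w t i)) = 0 \<and> poly (pderiv (SS t)) (1 / cnj (w t i)) = 0"
      using lk[OF j(1)] tlk[OF j(1)] Dt.double_pole_iff[of "p t (l j)"] unfolding DGt by metis
  qed
qed

lemma R_zero_iff_higher_poles:
  "(\<forall>t\<in>I. \<forall>z. R_fun m (w t) (A_data q m n b w p t) z = 0) \<longleftrightarrow> (\<forall>t\<in>I. zeros_reflect_to_higher_poles (g t))"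
  using double_if_always_zero by (auto simp: R_zero_iff higher_poles_iff)

section \<open>The primitive and the Loewner-Kufarev equation\<close>

text \<open>The time derivative of \<open>g\<close> is the derivative in \<open>z\<close> of the
  flux \<open>z L / S\<close>. The flux vanishes at the origin, so differentiation under the
  integral leaves its value at \<open>z\<close>.\<close>

lemma primitive_fun_derivative:
  assumes t: "t \<in> I" and z: "z \<in> ball 0 1"
  shows "((\<lambda>s. primitive_fun (g s) z) has_vector_derivative z * poly (LL t) z / poly (SS t) z) (at t within I)"
proof -
  have Snz: "poly (SS s) u \<noteq> 0" if "s \<in> I" "u \<in> ball 0 1" for s u
    using admissible_data.S_nonzero[OF data[OF that(1)], of u] that by (simp add: admissible_data_simps)
  have lp: "linepath 0 z x \<in> ball 0 1" if "x \<in> {0..1}" for x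
    using z that mult_left_le_one_le[of "norm z" x] by (simp add: linepath_def norm_mult scaleR_conv_of_real)
  define F where "F s u = poly (dG s * SS s - GG s * dS s) u / (poly (SS s) u)\<^sup>2" for s u
  have eq: "g s u = poly (GG s) u / poly (SS s) u" for s u
    by (simp add: rat_fun_eq GG_def SS_def)
  have lc: "continuous_on X (\<lambda>x. linepath 0 z (f x))" if "continuous_on X f" for X and f :: "real \<times> real \<Rightarrow> real"
    using that unfolding linepath_def by (intro continuous_intros)
  have "((\<lambda>s. integral (cbox 0 1) (\<lambda>x. g s (linepath 0 z x) * z)) has_vector_derivative
      integral (cbox 0 1) (\<lambda>x. F t (linepath 0 z x) * z)) (at t within I)"
  proof (rule leibniz_rule_vector_derivative)
    fix s x :: real assume s: "s \<in> I" and x: "x \<in> cbox 0 1"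
    have "((\<lambda>s. g s (linepath 0 z x)) has_vector_derivative F s (linepath 0 z x)) (at s within I)"
      unfolding eq F_def using g_path_derivative[OF dG_dS(1,2)[OF s] dG_dS(3)[OF s] degree_dS[OF s] Snz[OF s lp]] x by simp
    from has_vector_derivative_mult_left[OF this]
    show "((\<lambda>s. g s (linepath 0 z x) * z) has_vector_derivative F s (linepath 0 z x) * z) (at s within I)" .
  next
    fix s assume s: "s \<in> I"
    have "continuous_on {0..1} (\<lambda>x. g s (linepath 0 z x) * z)"
      unfolding eq using Snz[OF s lp] by (intro continuous_intros) auto
    then show "(\<lambda>x. g s (linepath 0 z x) * z) integrable_on cbox 0 1" by (simp add: integrable_continuous_real)
  next
    have P: "continuous_on (I \<times> cbox 0 1) (\<lambda>x. poly (GG (fst x)) (linepath 0 z (snd x)))"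
      "continuous_on (I \<times> cbox 0 1) (\<lambda>x. poly (dG (fst x)) (linepath 0 z (snd x)))"
      "continuous_on (I \<times> cbox 0 1) (\<lambda>x. poly (SS (fst x)) (linepath 0 z (snd x)))"
      "continuous_on (I \<times> cbox 0 1) (\<lambda>x. poly (dS (fst x)) (linepath 0 z (snd x)))"
      by (rule continuous_on_poly_path[OF pcont_GG, of m] continuous_on_poly_path[OF pcont_dG, of m]
        continuous_on_poly_path[OF pcont_SS, of n] continuous_on_poly_path[OF pcont_dS, of n],
          auto intro!: continuous_intros lc dG_dS degree_dS degree_GG)+
    show "continuous_on (I \<times> cbox 0 1) (\<lambda>(s, x). F s (linepath 0 z x) * z)"
      unfolding case_prod_unfold F_def poly_diff poly_mult
      by (intro continuous_intros P) (use Snz lp in auto)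
  qed (use t in simp_all)
  moreover have "integral (cbox 0 1) (\<lambda>x. g s (linepath 0 z x) * z) = primitive_fun (g s) z" for s
    unfolding primitive_fun_def contour_integral_integral by simp
  moreover have "integral (cbox 0 1) (\<lambda>x. F t (linepath 0 z x) * z) = z * poly (LL t) z / poly (SS t) z"
  proof -
    have "((\<lambda>u. u * poly (LL t) u / poly (SS t) u) has_field_derivative F t u) (at u within ball 0 1)"
      if u: "u \<in> ball 0 1" for u
    proof -
      have "((\<lambda>u. u * poly (LL t) u) has_field_derivative poly (LL t) u + u * poly (pderiv (LL t)) u) (at u)"
        by (auto intro!: derivative_eq_intros)
      from DERIV_divide[OF this poly_DERIV Snz[OF t u]]
      have "((\<lambda>u. u * poly (LL t) u / poly (SS t) u) has_field_derivative F t u) (at u)"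
        unfolding F_def poly_diff poly_mult poly_transport_velocity[OF t] by (simp add: power2_eq_square)
      then show ?thesis by (rule has_field_derivative_at_within)
    qed
    moreover have "path_image (linepath 0 z) \<subseteq> ball 0 1" using lp unfolding path_image_def by blast
    ultimately have "(F t has_contour_integral z * poly (LL t) z / poly (SS t) z) (linepath 0 z)"
      using contour_integral_primitive[OF _ valid_path_linepath, of "ball 0 1" _ "F t" 0 z] by fastforce
    then have "contour_integral (linepath 0 z) (F t) = z * poly (LL t) z / poly (SS t) z"
      by (rule contour_integral_unique)
    then show ?thesis unfolding contour_integral_integral by simp
  qed
  ultimately show ?thesis by simp
qed

lemma deriv_primitive_fun:
  assumes t: "t \<in> I" and z: "z \<in> ball 0 1"
  shows "deriv (primitive_fun (g t)) z = g t z"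
proof -
  interpret D: admissible_data m n "b t" "w t" "p t" "q t" by (rule data[OF t])
  have "g t holomorphic_on ball 0 1"
    unfolding D.g_eq[abs_def] using D.S_nonzero by (intro holomorphic_intros) auto
  then obtain F where F: "\<And>x. x \<in> ball 0 1 \<Longrightarrow> (F has_field_derivative g t x) (at x within ball 0 1)"
    using holomorphic_convex_primitive'[of "ball 0 1" "g t"] by auto
  have prim: "primitive_fun (g t) u = F u - F 0" if u: "u \<in> ball 0 1" for u
  proof -
    have "closed_segment 0 u \<subseteq> ball 0 1" using u by (intro closed_segment_subset) auto
    then have "(g t has_contour_integral (F u - F 0)) (linepath 0 u)"
      using contour_integral_primitive[OF F valid_path_linepath, of 0 u] by simp
    then show ?thesis unfolding primitive_fun_def by (rule contour_integral_unique)
  qed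
  have "(F has_field_derivative g t z) (at z)" using F[OF z] unfolding at_within_open[OF z open_ball] .
  from DERIV_diff[OF this DERIV_const[of "F 0"]]
  have "((\<lambda>u. F u - F 0) has_field_derivative g t z) (at z)" by simp
  then have "(primitive_fun (g t) has_field_derivative g t z) (at z)"
    by (rule has_field_derivative_transform_within_open[OF _ _ z]) (auto simp: prim)
  then show ?thesis by (rule DERIV_imp_deriv)
qed

text \<open>The time derivative of the primitive is \<open>z L / S\<close> in every case, while the
  Loewner-Kufarev equation asks for \<open>z P G / S\<close>. The two agree exactly when
  \<open>P * G = L\<close>, and \<open>P + R = L / G\<close> for \<open>B = A\<close>.\<close>

lemma Loewner_Kufarev_iff:
  "solves_Loewner_Kufarev T q g \<longleftrightarrow> (\<forall>t\<in>I. \<forall>z. R_fun m (w t) (A_data q m n b w p t) z = 0)"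
proof
  assume LK: "solves_Loewner_Kufarev T q g"
  show "\<forall>t\<in>I. \<forall>z. R_fun m (w t) (A_data q m n b w p t) z = 0"
  proof
    fix t assume t: "t \<in> I"
    interpret D: admissible_data m n "b t" "w t" "p t" "q t" by (rule data[OF t])
    note DG = admissible_data_simps[OF t]
    have "R_fun m (w t) (\<lambda>j. A_coef (q t) (g t) (w t j)) z = 0"
      if z: "norm z < 1" "poly (GG t) z \<noteq> 0" "z \<noteq> 0" for z
    proof -
      have zb: "z \<in> ball 0 1" using z by simp
      have "((\<lambda>s. primitive_fun (g s) z) has_vector_derivative z * g t z * P_fun (q t) (g t) z) (at t within I)"
        using LK[unfolded solves_Loewner_Kufarev_def, rule_format, OF t zb] by (simp only: deriv_primitive_fun[OF t zb])
      from vector_derivative_unique_within[OF at_within_I[OF t] this primitive_fun_derivative[OF t zb]]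
      have "z * g t z * P_fun (q t) (g t) z = z * poly (LL t) z / poly (SS t) z" .
      moreover have "poly (SS t) z \<noteq> 0" using D.S_nonzero[of z] z by (simp add: DG)
      ultimately have "poly (GG t) z * P_fun (q t) (g t) z = poly (LL t) z"
        using z by (simp add: D.g_eq DG field_simps)
      then have "P_fun (q t) (g t) z = poly (LL t) z / poly (GG t) z" using z by (simp add: field_simps)
      then show ?thesis using D.P_plus_R[of z] z by (simp add: DG)
    qed
    then have "A_coef (q t) (g t) (w t j) = 0" if "j \<in> disk_zeros m (w t)" for j
      using D.R_fun_zero_imp[of "\<lambda>j. A_coef (q t) (g t) (w t j)" j] that by (simp add: DG)
    then show "\<forall>z. R_fun m (w t) (A_data q m n b w p t) z = 0"
      unfolding A_data_eq by (simp add: R_fun_def)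
  qed
next
  assume R0: "\<forall>t\<in>I. \<forall>z. R_fun m (w t) (A_data q m n b w p t) z = 0"
  show "solves_Loewner_Kufarev T q g"
    unfolding solves_Loewner_Kufarev_def
  proof (intro ballI)
    fix t z assume t: "t \<in> I" and z: "z \<in> ball (0::complex) 1"
    interpret D: admissible_data m n "b t" "w t" "p t" "q t" by (rule data[OF t])
    note DG = admissible_data_simps[OF t]
    have "poly (LL t) z = P_fun (q t) (g t) z * poly (GG t) z"
      using D.P_times_G[of z] R0 t z by (simp add: A_data_eq DG)
    then have "z * deriv (primitive_fun (g t)) z * P_fun (q t) (g t) z = z * poly (LL t) z / poly (SS t) z"
      unfolding deriv_primitive_fun[OF t z] by (simp add: D.g_eq DG mult_ac)
    then show "((\<lambda>s. primitive_fun (g s) z) has_vector_derivative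
        z * deriv (primitive_fun (g t)) z * P_fun (q t) (g t) z) (at t within I)"
      using primitive_fun_derivative[OF t z] by simp
  qed
qed

lemma monotone_motion:
  assumes LK: "solves_Loewner_Kufarev T q g" and s: "s \<in> I" and t: "t \<in> I" and "s < t"
  shows "j < n \<Longrightarrow> norm (p s j) < norm (p t j)" "k \<in> disk_zeros m (w s) \<Longrightarrow> norm (w t k) < norm (w s k)"
proof -
  have R0: "\<forall>z. R_fun m (w t) (\<lambda>j. A_coef (q t) (g t) (w t j)) z = 0" if "t \<in> I" for t
    using LK that unfolding Loewner_Kufarev_iff A_data_eq by blast
  have higher: "zeros_reflect_to_higher_poles (g t)" if "t \<in> I" for t
    using LK that unfolding Loewner_Kufarev_iff R_zero_iff_higher_poles by blast
  have st: "0 \<le> s" "t < T" using s t by auto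
  show "norm (p s j) < norm (p t j)" if j: "j < n"
  proof (rule norm_increasing[where h = "\<lambda>t. - (poly (LL t) (p t j) / poly (GG t) (p t j))" and T = T])
    fix t assume t: "t \<in> I"
    interpret D: admissible_data m n "b t" "w t" "p t" "q t" by (rule data[OF t])
    show "((\<lambda>t. p t j) has_vector_derivative p t j * - (poly (LL t) (p t j) / poly (GG t) (p t j))) (at t within I)"
      using pole_derivative[OF t j] by (simp add: vf_def)
    show "p t j \<noteq> 0" using D.pole_norm[OF j] by auto
    show "0 < Re (- (poly (LL t) (p t j) / poly (GG t) (p t j)))"
      using D.Re_velocity_at_pole[OF R0[OF t] higher[OF t] j] by (simp add: admissible_data_simps[OF t])
  qed (use st \<open>s < t\<close> in auto)
  show "norm (w t k) < norm (w s k)" if "k \<in> disk_zeros m (w s)"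
  proof (rule norm_decreasing[where h = "\<lambda>t. - P_fun (q t) (g t) (w t k)" and T = T])
    have k: "k \<in> J" using that disk_zeros_const[OF s] by simp
    fix t assume t: "t \<in> I"
    interpret D: admissible_data m n "b t" "w t" "p t" "q t" by (rule data[OF t])
    note DG = admissible_data_simps[OF t]
    have kt: "k \<in> disk_zeros m (w t)" by (rule J_at[OF t k])
    have S0: "poly (SS t) (1 / cnj (w t k)) = 0" using R0[OF t] R_zero_iff[OF t] k unfolding A_data_eq by blast
    have "poly (dG t) (w t k) = w t k * (P_fun (q t) (g t) (w t k) * poly (pderiv (GG t)) (w t k))"
      using reflected_zero_velocity(2)[OF t k S0] D.P_times_G_deriv[OF R0[OF t] kt] by (simp add: DG)
    moreover have "poly (pderiv (GG t)) (w t k) \<noteq> 0" using D.pderiv_G_nonzero[OF kt] by (simp add: DG)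
    ultimately show "((\<lambda>t. w t k) has_vector_derivative w t k * - P_fun (q t) (g t) (w t k)) (at t within I)"
      using disk_zero_derivative[OF t k] by simp
    show "w t k \<noteq> 0" using D.w_nonzero kt D.J_iff by blast
    show "Re (- P_fun (q t) (g t) (w t k)) < 0" using D.Re_P_pos[of "w t k"] kt D.J_iff by simp
  qed (use st \<open>s < t\<close> in auto)
qed

end

section \<open>Dependence on the rational function only\<close>

text \<open>The fraction is in lowest terms with monic denominator, so the function determines both
  polynomials, though not the order in which their roots are listed.\<close>

lemma admissible_rat_fun_inject:
  assumes "admissible m n b w p" "admissible m n b' w' p'"
    and eq: "rat_fun m n b w p = rat_fun m n b' w' p'"
  shows "smult b (of_roots m w) = smult b' (of_roots m w')" "of_roots n p = of_roots n p'"
proof -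
  interpret D: admissible_data m n b w p 1 by unfold_locales (use assms in auto)
  interpret D': admissible_data m n b' w' p' 1 by unfold_locales (use assms in auto)
  have cross: "D.G * D'.S = D'.G * D.S"
  proof (rule poly_eqI_infinite)
    have "ball 0 1 \<subseteq> {z. poly (D.G * D'.S) z = poly (D'.G * D.S) z}"
    proof
      fix z :: complex assume z: "z \<in> ball 0 1"
      then have "poly D.S z \<noteq> 0" "poly D'.S z \<noteq> 0" using D.S_nonzero[of z] D'.S_nonzero[of z] by auto
      moreover have "poly D.G z / poly D.S z = poly D'.G z / poly D'.S z"
        using fun_cong[OF eq, of z] unfolding D.g_eq D'.g_eq .
      ultimately show "z \<in> {z. poly (D.G * D'.S) z = poly (D'.G * D.S) z}" by (simp add: frac_eq_eq)
    qed
    moreover have "infinite (ball (0::complex) 1)" using uncountable_ball[of 1 "0::complex"] countable_finite by auto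
    ultimately show "infinite {z. poly (D.G * D'.S) z = poly (D'.G * D.S) z}" using finite_subset by blast
  qed
  have "coprime D.S D.G" by (rule no_common_root_imp_coprime[OF goodD(6)[OF D.good]])
  moreover have "D.S dvd D.G * D'.S" by (simp add: cross)
  ultimately have "D.S dvd D'.S" by (simp add: coprime_dvd_mult_right_iff)
  then obtain k where k: "D'.S = D.S * k" by (auto elim: dvdE)
  have "k \<noteq> 0" using k goodD(8)[OF D'.good] by auto
  then have "degree k = 0"
    using arg_cong[OF k, of degree] goodD(4,8)[OF D.good] goodD(4)[OF D'.good] by (simp add: degree_mult_eq)
  moreover have "lead_coeff k = 1"
    using arg_cong[OF k, of lead_coeff] goodD(5)[OF D.good] goodD(5)[OF D'.good] by (simp add: lead_coeff_mult)
  ultimately have "k = 1" by (auto elim!: degree_eq_zeroE simp: one_pCons)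
  then have S: "D.S = D'.S" using k by simp
  then have "D.G = D'.G" using cross goodD(8)[OF D'.good] by simp
  then show "smult b (of_roots m w) = smult b' (of_roots m w')" unfolding D.G_def D'.G_def .
  show "of_roots n p = of_roots n p'" using S unfolding D.S_def D'.S_def .
qed

text \<open>A formula for \<open>R\<close> in terms of \<open>g\<close> alone, free of the labelling
  of the zeros, in which two solutions may differ.\<close>

lemma (in admissible_data) R_fun_eq_sum_zeros:
  "R_fun m w A z = \<i> * of_real (Im (\<Sum>u | norm u < 1 \<and> g u = 0. 2 * A_coef c g u / u)) +
    (\<Sum>u | norm u < 1 \<and> g u = 0. 2 * A_coef c g u / (z - u) - 2 * cnj (A_coef c g u) * z / (1 - cnj u * z))"
proof -
  have "{u. norm u < 1 \<and> g u = 0} = w ` J"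
    using S_nonzero by (auto simp: g_eq G_root J_iff image_iff)
  then show ?thesis by (simp add: R_fun_def sum.reindex[OF inj_J])
qed

text \<open>Both paths solve the coefficient equation from the same initial polynomials, so the
  functions \<open>g\<close> coincide; \<open>B = A\<close> on either side then makes
  \<open>R\<close> a function of \<open>g\<close>.\<close>

lemma rational_path_R_unique:
  assumes "rational_path q m n T b w p B" "rational_path q m n T b' w' p' B'"
    and init: "rat_fun m n (b 0) (w 0) (p 0) = rat_fun m n (b' 0) (w' 0) (p' 0)" and t: "t \<in> {0..<T}"
  shows "R_fun m (w t) (B t) = R_fun m (w' t) (B' t)"
proof -
  interpret P: rational_path q m n T b w p B by fact
  interpret P': rational_path q m n T b' w' p' B' by fact
  interpret D: admissible_data m n "b t" "w t" "p t" "q t" by (rule P.data[OF t])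
  interpret D': admissible_data m n "b' t" "w' t" "p' t" "q t" by (rule P'.data[OF t])
  have "0 \<in> {0..<T}" using P.T_pos by simp
  then have i: "P.GG 0 = P'.GG 0" "P.SS 0 = P'.SS 0"
    using admissible_rat_fun_inject[OF P.adm P'.adm init]
    unfolding P.GG_def P'.GG_def P.SS_def P'.SS_def by auto
  have qc: "continuous_on {0..<T} q" by (rule continuous_on_subset[OF P.q_cont]) auto
  have "P.GG t = P'.GG t \<and> P.SS t = P'.SS t"
    by (rule solves_field_unique[OF qc P.solves_field_path P'.solves_field_path P.degree_GG _ P'.degree_GG _ i t]) simp_all
  then have g: "P.g t = P'.g t"
    unfolding P.GG_def P'.GG_def P.SS_def P'.SS_def by (simp add: fun_eq_iff rat_fun_eq)
  have "B t j = A_coef (q t) (P.g t) (w t j)" if "j \<in> disk_zeros m (w t)" for j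
    using P.B_eq_A[OF t] that P.disk_zeros_const[OF t] by (simp add: A_data_def)
  then have 1: "R_fun m (w t) (B t) = R_fun m (w t) (\<lambda>j. A_coef (q t) (P.g t) (w t j))"
    by (simp add: fun_eq_iff R_fun_def)
  have "B' t j = A_coef (q t) (P'.g t) (w' t j)" if "j \<in> disk_zeros m (w' t)" for j
    using P'.B_eq_A[OF t] that P'.disk_zeros_const[OF t] by (simp add: A_data_def)
  then have 2: "R_fun m (w' t) (B' t) = R_fun m (w' t) (\<lambda>j. A_coef (q t) (P'.g t) (w' t j))"
    by (simp add: fun_eq_iff R_fun_def)
  show ?thesis
    unfolding 1 2 by (rule ext, rule trans[OF D.R_fun_eq_sum_zeros]) (simp only: D'.R_fun_eq_sum_zeros g)
qed

section \<open>Existence\<close>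

lemma log_derivative_algebra:
  fixes G S L z G' S' L' :: complex
  assumes "G \<noteq> 0" "S \<noteq> 0"
  shows "((L + z * L') * S - z * L * S') / S\<^sup>2 / (G / S) =
    z * (L / G) * ((G' * S - G * S') / (S * S) / (G / S)) + (L / G + z * ((L' * G - L * G') / (G * G)))"
proof -
  have "((L + z * L') * S - z * L * S') * (k * k) * (i * S) =
      z * (L * i) * ((G' * S - G * S') * (k * k) * (i * S)) + (L * i + z * ((L' * G - L * G') * (i * i)))"
    if "S * k = 1" "G * i = 1" for i k
    using that by algebra
  from this[of "inverse S" "inverse G"] show ?thesis
    using assms by (simp add: divide_inverse power2_eq_square)
qed

lemma (in admissible_data) log_derivative_identity:
  assumes z: "norm z < 1" "poly G z \<noteq> 0"
  shows "poly (transport L S) z / (poly S z)\<^sup>2 / g z =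
    z * (P_fun c g z + R_fun m w A z) * (deriv g z / g z) + deriv (\<lambda>z. z * (P_fun c g z + R_fun m w A z)) z"
proof -
  define N where "N = {z. norm z < 1 \<and> poly G z \<noteq> 0}"
  have openN: "open N" unfolding N_def
    by (intro open_Collect_conj open_Collect_less open_Collect_neq continuous_intros)
  have zN: "z \<in> N" using z by (simp add: N_def)
  have Sz: "poly S z \<noteq> 0" using S_nonzero[of z] z by simp
  have "deriv (\<lambda>z. z * (P_fun c g z + R_fun m w A z)) z = deriv (\<lambda>z. z * (poly L z / poly G z)) z"
    using eventually_nhds_in_open[OF openN zN]
    by (intro deriv_cong_ev) (auto elim!: eventually_mono simp: N_def P_plus_R)
  also have "\<dots> = poly L z / poly G z + z * ((poly (pderiv L) z * poly G z - poly L z * poly (pderiv G) z) / (poly G z * poly G z))"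
    using DERIV_mult[OF DERIV_ident DERIV_divide[OF poly_DERIV poly_DERIV z(2)]]
    by (intro DERIV_imp_deriv) (simp add: mult.commute[of _ z])
  finally show ?thesis
    using log_derivative_algebra[OF z(2) Sz]
    by (simp only: P_plus_R[OF z] g_eq poly_transport DERIV_imp_deriv[OF g_deriv[OF Sz]])
qed

text \<open>Simplicity of the disk zeros in the form of an open condition, distinct or strictly
  outside the closed disk, for the permuted list with which a continuous choice of roots
  starts.\<close>

lemma permuted_zeros_simple:
  assumes adm: "admissible m n b w0 p0" and \<sigma>: "\<sigma> permutes {..<m}" "\<And>k. k < m \<Longrightarrow> w k = w0 (\<sigma> k)"
    and jk: "j < m" "k < m" "j \<noteq> k"
  shows "w j \<noteq> w k \<or> 1 < norm (w j)"
proof (rule ccontr)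
  interpret D: admissible_data m n b w0 p0 1 by unfold_locales (use adm in auto)
  assume "\<not> (w j \<noteq> w k \<or> 1 < norm (w j))"
  then have *: "w0 (\<sigma> k) = w0 (\<sigma> j)" "norm (w0 (\<sigma> j)) \<le> 1" using \<sigma>(2) jk by auto
  have \<sigma>m: "\<sigma> j < m" "\<sigma> k < m" using permutes_in_image[OF \<sigma>(1)] jk by auto
  have "norm (w0 (\<sigma> j)) \<noteq> 1" by (rule D.w_norm[OF \<sigma>m(1)])
  then have "\<sigma> j \<in> disk_zeros m w0" using * \<sigma>m by (simp add: D.J_iff)
  then have "\<sigma> k = \<sigma> j" using D.J_simple \<sigma>m *(1) by blast
  then show False using permutes_inj[OF \<sigma>(1)] jk by (auto dest: injD)
qed

lemma admissibleI:
  assumes good: "good m n (smult b (of_roots m w)) (of_roots n p)"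
    and p: "\<And>j. j < n \<Longrightarrow> 1 < norm (p j)"
    and w: "\<And>j k. j < m \<Longrightarrow> k < m \<Longrightarrow> j \<noteq> k \<Longrightarrow> w j \<noteq> w k \<or> 1 < norm (w j)"
    and origin: "Im (rat_fun m n b w p 0) = 0" "0 < Re (rat_fun m n b w p 0)"
  shows "admissible m n b w p"
proof -
  let ?G = "smult b (of_roots m w)"
  have G: "poly ?G (w k) = 0" if "k < m" for k using that by (auto simp: poly_of_roots)
  have S: "poly (of_roots n p) (p j) = 0" if "j < n" for j using that by (auto simp: poly_of_roots)
  have wp: "w k \<noteq> p j" if "k < m" "j < n" for k j
    using G[OF that(1)] S[OF that(2)] goodD(6)[OF good] unfolding no_common_root_def by metis
  have refl: "w k \<noteq> reflect (w j)" if "j < m" "k < m" for j k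
  proof
    assume eq: "w k = reflect (w j)"
    have z: "w j \<noteq> 0" "poly (rc m ?G) (w j) \<noteq> 0"
      using goodD(7)[OF good] G[OF that(1)] unfolding no_common_root_def by (auto dest: spec[of _ "w j"])
    then show False
      using G[OF that(2)] by (simp add: poly_rc[OF degree_smult_le'] eq reflect_def)
  qed
  have "simple_disk_zeros m w"
    unfolding simple_disk_zeros_def disk_zeros_def using w by force
  then show ?thesis
    using goodD(1)[OF good] p wp refl origin
    by (simp add: admissible_def rational_form_def no_reflected_zeros_def)
qed

text \<open>At the origin the evolution reduces to \<open>g_t = q (L / G) g\<close>, where
  \<open>L / G\<close> is real by \<open>Lp_normalised\<close>. The imaginary part thus solves a
  real linear equation with zero initial value.\<close>

lemma Im_at_origin_zero:
  assumes q: "continuous_on {0..} q" and sol: "solves_field q m n G S I" and I: "convex I" "I \<subseteq> {0..}" "0 \<in> I"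
    and deg: "\<And>t. degree (G t) \<le> m" "\<And>t. degree (S t) \<le> n" and S0: "\<And>t. t \<in> I \<Longrightarrow> poly (S t) 0 \<noteq> 0"
    and init: "Im (poly (G 0) 0 / poly (S 0) 0) = 0" and t: "t \<in> I"
  shows "Im (poly (G t) 0 / poly (S t) 0) = 0"
proof -
  define \<rho> where "\<rho> t = q t * Re (poly (Lp m n (G t) (S t)) 0 / poly (G t) 0)" for t
  let ?y = "\<lambda>t. Im (poly (G t) 0 / poly (S t) 0)"
  have sf: "good m n (G t) (S t)" "has_pder G (smult (of_real (q t)) (Gv m n (G t) (S t))) (at t within I)"
    "has_pder S (smult (of_real (q t)) (Sv m n (G t) (S t))) (at t within I)" if "t \<in> I" for t
    using sol that by (auto simp: solves_field_def)
  have G0: "poly (G t) 0 \<noteq> 0" if "t \<in> I" for t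
    using goodD(7)[OF sf(1)[OF that]] unfolding no_common_root_def by (auto dest: spec[of _ 0])
  have pc: "pcont G I" "pcont S I"
    using has_pder_imp_pcont[OF sf(2)] has_pder_imp_pcont[OF sf(3)] by blast+
  have c0: "continuous_on I (\<lambda>t. poly (P t) 0)" if "pcont P I" for P :: "real \<Rightarrow> complex poly"
    using that by (simp add: poly_0_coeff_0 pcont_def)
  have \<rho>c: "continuous_on I \<rho>"
    unfolding \<rho>_def using G0 pcont_field(1)[OF pc sf(1)]
    by (intro continuous_intros c0 pc continuous_on_subset[OF q I(2)]) auto
  show ?thesis
  proof (rule linear_bound_imp_zero[where y = ?y and y' = "\<lambda>t. \<rho> t * ?y t" and I = I and ?t0.0 = 0])
    fix t assume t: "t \<in> I"
    let ?Q = "complex_of_real (q t)" and ?L = "poly (Lp m n (G t) (S t)) 0"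
    have d: "((\<lambda>t. poly (P t) 0) has_vector_derivative poly P' 0) (at t within I)"
      if "has_pder P P' (at t within I)" for P P'
      using that by (simp add: poly_0_coeff_0 has_pder_def)
    have "((\<lambda>t. poly (G t) 0 / poly (S t) 0) has_vector_derivative
        (poly (smult ?Q (Gv m n (G t) (S t))) 0 * poly (S t) 0 - poly (G t) 0 * poly (smult ?Q (Sv m n (G t) (S t))) 0) /
        (poly (S t) 0)\<^sup>2) (at t within I)"
      by (rule has_vector_derivative_divide_complex[OF d[OF sf(2)[OF t]] d[OF sf(3)[OF t]] S0[OF t]])
    moreover have "poly (smult ?Q (Gv m n (G t) (S t))) 0 * poly (S t) 0 - poly (G t) 0 * poly (smult ?Q (Sv m n (G t) (S t))) 0 =
        ?Q * poly (Gv m n (G t) (S t) * S t - G t * Sv m n (G t) (S t)) 0"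
      by (simp add: right_diff_distrib)
    moreover have "poly (Gv m n (G t) (S t) * S t - G t * Sv m n (G t) (S t)) 0 = ?L * poly (S t) 0"
      unfolding field_spec(1)[OF sf(1)[OF t]] poly_transport by simp
    moreover have "?Q * (?L * poly (S t) 0) / (poly (S t) 0)\<^sup>2 =
        ?Q * (?L / poly (G t) 0) * (poly (G t) 0 / poly (S t) 0)"
      using S0[OF t] G0[OF t] by (simp add: power2_eq_square)
    ultimately have "((\<lambda>t. poly (G t) 0 / poly (S t) 0) has_vector_derivative
        ?Q * (?L / poly (G t) 0) * (poly (G t) 0 / poly (S t) 0)) (at t within I)"
      by (simp only:)
    from bounded_linear.has_vector_derivative[OF bounded_linear_Im this]
    have "(?y has_vector_derivative Im (?Q * (?L / poly (G t) 0) * (poly (G t) 0 / poly (S t) 0))) (at t within I)" .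
    moreover have "Im (x * y * z) = Re x * Re y * Im z" if "Im x = 0" "Im y = 0" for x y z using that by simp
    note this[of ?Q, OF _ Lp_normalised[OF sf(1)[OF t]]]
    ultimately show "(?y has_vector_derivative \<rho> t * ?y t) (at t within I)" by (simp only: \<rho>_def Im_complex_of_real Re_complex_of_real)
    obtain e where e: "e > 0" "\<And>s. s \<in> I \<Longrightarrow> dist s t < e \<Longrightarrow> dist (\<rho> s) (\<rho> t) < 1"
      using \<rho>c[unfolded continuous_on_iff, rule_format, OF t, of 1] by auto
    show "\<exists>e>0. \<exists>C. \<forall>s\<in>I. dist s t < e \<longrightarrow> norm (\<rho> s * ?y s) \<le> C * norm (?y s)"
    proof (rule exI[of _ e], intro conjI e(1) exI[of _ "\<bar>\<rho> t\<bar> + 1"] ballI impI)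
      fix s assume "s \<in> I" "dist s t < e"
      then have "dist (\<rho> s) (\<rho> t) < 1" by (rule e(2))
      then have "\<bar>\<rho> s\<bar> \<le> \<bar>\<rho> t\<bar> + 1" by (simp add: dist_real_def)
      then show "norm (\<rho> s * ?y s) \<le> (\<bar>\<rho> t\<bar> + 1) * norm (?y s)"
        unfolding real_norm_def abs_mult by (intro mult_right_mono) auto
    qed
  qed (use I init t in auto)
qed

lemma rational_solution_exists:
  assumes q_pos: "\<And>t. 0 \<le> t \<Longrightarrow> 0 < q t" and q_cont: "continuous_on {0..} q" and init: "admissible m n b0 w0 p0"
  shows "\<exists>T>0. \<exists>b w p. rational_solution q m n (rat_fun m n b0 w0 p0) T b w p (A_data q m n b w p)"
proof -
  interpret D0: admissible_data m n b0 w0 p0 1 by unfold_locales (use init in auto)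
  obtain T1 G S where T1: "T1 > 0" and sol: "solves_field q m n G S {0..<T1}" and G0: "G 0 = D0.G" and S0: "S 0 = D0.S"
    and deg: "\<And>t. degree (G t) \<le> m" "\<And>t. degree (S t) = n" "\<And>t. lead_coeff (S t) = 1"
    using solves_field_exists[OF q_cont D0.good] by blast
  \<comment> \<open>The continuous choice of roots is made on a compact interval, hence the
    shortening of \<open>{0..<T1}\<close>.\<close>
  define T2 where "T2 = T1 / 2"
  have T2: "0 < T2" "{0..T2} \<subseteq> {0..<T1}" using T1 by (auto simp: T2_def)
  have sf: "good m n (G t) (S t)" "has_pder G (smult (of_real (q t)) (Gv m n (G t) (S t))) (at t within {0..<T1})"
    "has_pder S (smult (of_real (q t)) (Sv m n (G t) (S t))) (at t within {0..<T1})" if "t \<in> {0..<T1}" for t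
    using sol that by (auto simp: solves_field_def)
  have gd: "good m n (G t) (S t)" if "t \<in> {0..T2}" for t using sf(1) that T2(2) by blast
  have "pcont G {0..<T1}" "pcont S {0..<T1}"
    using has_pder_imp_pcont[OF sf(2)] has_pder_imp_pcont[OF sf(3)] by blast+
  then have pc: "pcont G {0..T2}" "pcont S {0..T2}" using T2(2) by (auto intro: pcont_subset)
  define b where "b t = coeff (G t) m" for t
  have b: "b t \<noteq> 0" if "t \<in> {0..T2}" for t
    using goodD(2,3)[OF gd[OF that]] by (auto simp: b_def)
  have bc: "continuous_on {0..T2} b" using pc(1) by (simp add: b_def[abs_def] pcont_def)
  have "\<exists>w. (\<forall>k<m. continuous_on {0..T2} (\<lambda>t. w t k)) \<and> (\<forall>t\<in>{0..T2}. smult (inverse (b t)) (G t) = of_roots m (w t))"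
  proof (rule continuous_roots[OF _ _ _ T2(1)])
    show "pcont (\<lambda>t. smult (inverse (b t)) (G t)) {0..T2}"
      using b by (intro pcont_smult pc continuous_on_inverse bc) auto
    fix t assume t: "t \<in> {0..T2}"
    show dm: "degree (smult (inverse (b t)) (G t)) = m" using b[OF t] goodD(3)[OF gd[OF t]] by simp
    show "lead_coeff (smult (inverse (b t)) (G t)) = 1" unfolding dm using b[OF t] by (simp add: b_def)
  qed
  then obtain w where wc: "\<And>k. k < m \<Longrightarrow> continuous_on {0..T2} (\<lambda>t. w t k)"
    and w: "\<And>t. t \<in> {0..T2} \<Longrightarrow> smult (inverse (b t)) (G t) = of_roots m (w t)" by blast
  have Gw: "smult (b t) (of_roots m (w t)) = G t" if "t \<in> {0..T2}" for t
    using b[OF that] by (simp flip: w[OF that])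
  have "\<exists>p. (\<forall>j<n. continuous_on {0..T2} (\<lambda>t. p t j)) \<and> (\<forall>t\<in>{0..T2}. S t = of_roots n (p t))"
    by (rule continuous_roots[OF pc(2) deg(2,3) T2(1)])
  then obtain p where pc': "\<And>j. j < n \<Longrightarrow> continuous_on {0..T2} (\<lambda>t. p t j)"
    and Sp: "\<And>t. t \<in> {0..T2} \<Longrightarrow> of_roots n (p t) = S t" by metis
  have g: "rat_fun m n (b t) (w t) (p t) z = poly (G t) z / poly (S t) z" if "t \<in> {0..T2}" for t z
    by (simp only: rat_fun_eq Gw[OF that] Sp[OF that])
  have zero: "0 \<in> {0..T2}" using T2 by simp
  have g_init: "rat_fun m n (b 0) (w 0) (p 0) = rat_fun m n b0 w0 p0"
    by (rule ext) (simp only: g[OF zero] D0.g_eq G0 S0)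
  have b0: "b 0 = b0" by (simp add: b_def G0 D0.G_def)
  have w_init: "of_roots m (w 0) = of_roots m w0"
    using w[OF zero] b[OF zero] by (simp add: b0 G0 D0.G_def)
  obtain \<sigma> where \<sigma>: "\<sigma> permutes {..<m}" "\<And>k. k < m \<Longrightarrow> w 0 k = w0 (\<sigma> k)"
    by (rule of_roots_eq_imp_permutes[OF w_init]) (rule that; blast)
  have p_init: "of_roots n (p 0) = of_roots n p0" using Sp[OF zero] by (simp add: S0 D0.S_def)
  obtain \<tau> where \<tau>: "\<tau> permutes {..<n}" "\<And>k. k < n \<Longrightarrow> p 0 k = p0 (\<tau> k)"
    by (rule of_roots_eq_imp_permutes[OF p_init]) (rule that; blast)
  \<comment> \<open>What admissibility asks beyond \<open>good\<close>, apart from reality at the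
    origin, in the form of open conditions; they hold at time \<open>0\<close> and therefore for a
    short time.\<close>
  define Q where "Q t \<longleftrightarrow> (\<forall>j\<in>{..<n}. 1 < norm (p t j)) \<and>
    (\<forall>x\<in>{x\<in>{..<m} \<times> {..<m}. fst x \<noteq> snd x}. w t (fst x) \<noteq> w t (snd x) \<or> 1 < norm (w t (fst x))) \<and>
    0 < Re (poly (G t) 0 / poly (S t) 0)" for t
  have Sz: "poly (S t) 0 \<noteq> 0" if Qt: "Q t" and t: "t \<in> {0..T2}" for t
  proof
    assume "poly (S t) 0 = 0"
    then obtain j where "j < n" "p t j = 0" by (auto simp: Sp[OF t, symmetric] poly_of_roots)
    then show False using Qt by (force simp: Q_def)
  qed
  have Q0: "Q 0"
    unfolding Q_def
  proof (intro conjI ballI)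
    show "1 < norm (p 0 j)" if "j \<in> {..<n}" for j
      using D0.pole_norm[of "\<tau> j"] \<tau> permutes_in_image[OF \<tau>(1), of j] that by simp
    show "w 0 (fst x) \<noteq> w 0 (snd x) \<or> 1 < norm (w 0 (fst x))" if "x \<in> {x\<in>{..<m} \<times> {..<m}. fst x \<noteq> snd x}" for x
      using permuted_zeros_simple[OF init \<sigma>, of "fst x" "snd x"] that by auto
    have "0 < Re (rat_fun m n b0 w0 p0 0)" using init by (simp add: admissible_def rational_form_def)
    then show "0 < Re (poly (G 0) 0 / poly (S 0) 0)" by (simp only: D0.g_eq G0 S0)
  qed
  let ?F = "at 0 within {0..T2}"
  have lim: "((\<lambda>t. w t k) \<longlongrightarrow> w 0 k) ?F" if "k < m" for k
    using wc[OF that] zero by (simp add: continuous_on_def)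
  have "\<forall>\<^sub>F t in ?F. Q t"
    unfolding Q_def
  proof (intro eventually_conj eventually_ball_finite ballI)
    fix j assume j: "j \<in> {..<n}"
    then have "((\<lambda>t. norm (p t j)) \<longlongrightarrow> norm (p 0 j)) ?F"
      using pc'[of j] zero by (intro tendsto_norm) (simp add: continuous_on_def)
    then show "\<forall>\<^sub>F t in ?F. 1 < norm (p t j)" using Q0 j by (intro order_tendstoD(1)) (auto simp: Q_def)
  next
    fix x assume x: "x \<in> {x\<in>{..<m} \<times> {..<m}. fst x \<noteq> snd x}"
    then have xm: "fst x < m" "snd x < m" by auto
    have "w 0 (fst x) \<noteq> w 0 (snd x) \<or> 1 < norm (w 0 (fst x))" using Q0 x unfolding Q_def by blast
    then show "\<forall>\<^sub>F t in ?F. w t (fst x) \<noteq> w t (snd x) \<or> 1 < norm (w t (fst x))"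
    proof
      assume "w 0 (fst x) \<noteq> w 0 (snd x)"
      then have "\<forall>\<^sub>F t in ?F. w t (fst x) - w t (snd x) \<noteq> 0"
        using tendsto_diff[OF lim[OF xm(1)] lim[OF xm(2)]] by (intro tendsto_imp_eventually_ne) auto
      then show ?thesis by eventually_elim auto
    next
      assume "1 < norm (w 0 (fst x))"
      then have "\<forall>\<^sub>F t in ?F. 1 < norm (w t (fst x))" by (rule order_tendstoD(1)[OF tendsto_norm[OF lim[OF xm(1)]]])
      then show ?thesis by eventually_elim auto
    qed
  next
    have "((\<lambda>t. poly (P t) 0) \<longlongrightarrow> poly (P 0) 0) ?F" if "pcont P {0..T2}" for P
      using that zero by (simp add: poly_0_coeff_0 pcont_def continuous_on_def)
    then have "((\<lambda>t. Re (poly (G t) 0 / poly (S t) 0)) \<longlongrightarrow> Re (poly (G 0) 0 / poly (S 0) 0)) ?F"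
      using pc Sz[OF Q0 zero] by (intro tendsto_Re tendsto_divide) auto
    then show "\<forall>\<^sub>F t in ?F. 0 < Re (poly (G t) 0 / poly (S t) 0)"
      using Q0 by (intro order_tendstoD(1)) (auto simp: Q_def)
  qed auto
  then obtain d where d: "d > 0" "\<And>t. t \<in> {0..T2} \<Longrightarrow> t \<noteq> 0 \<Longrightarrow> dist t 0 < d \<Longrightarrow> Q t"
    unfolding eventually_at by blast
  define T where "T = min d T2"
  have T: "T > 0" using d T2 by (simp add: T_def)
  have sub: "{0..<T} \<subseteq> {0..T2}" "{0..<T} \<subseteq> {0..<T1}" using T2 T1 by (auto simp: T_def T2_def)
  have QT: "Q t" if "t \<in> {0..<T}" for t
    using Q0 d(2)[of t] that by (cases "t = 0") (auto simp: T_def dist_real_def)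
  have solT: "solves_field q m n G S {0..<T}"
    using sol sub(2) unfolding solves_field_def has_pder_def
    by (meson has_vector_derivative_within_subset subsetD)
  have Im0: "Im (poly (G t) 0 / poly (S t) 0) = 0" if "t \<in> {0..<T}" for t
  proof (rule Im_at_origin_zero[OF q_cont solT _ _ _ deg(1) _ _ _ that])
    have "Im (rat_fun m n b0 w0 p0 0) = 0" using init by (simp add: admissible_def rational_form_def)
    then show "Im (poly (G 0) 0 / poly (S 0) 0) = 0" by (simp only: D0.g_eq G0 S0)
    show "poly (S t) 0 \<noteq> 0" if "t \<in> {0..<T}" for t using Sz[OF QT[OF that]] sub that by auto
  qed (use T deg(2) in auto)
  have adm: "admissible m n (b t) (w t) (p t)" if t: "t \<in> {0..<T}" for t
  proof -
    have t2: "t \<in> {0..T2}" using t sub by auto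
    note Qt = QT[OF t, unfolded Q_def]
    show ?thesis
    proof (rule admissibleI)
      show "good m n (smult (b t) (of_roots m (w t))) (of_roots n (p t))"
        unfolding Gw[OF t2] Sp[OF t2] by (rule gd[OF t2])
      show "1 < norm (p t j)" if "j < n" for j using Qt that by blast
      show "w t j \<noteq> w t k \<or> 1 < norm (w t j)" if "j < m" "k < m" "j \<noteq> k" for j k
        using Qt[THEN conjunct2, THEN conjunct1, rule_format, of "(j, k)"] that by simp
      show "Im (rat_fun m n (b t) (w t) (p t) 0) = 0" unfolding g[OF t2] by (rule Im0[OF t])
      show "0 < Re (rat_fun m n (b t) (w t) (p t) 0)" unfolding g[OF t2] using Qt by blast
    qed
  qed
  let ?g = "\<lambda>t. rat_fun m n (b t) (w t) (p t)"
  have "solves_log_eq T q ?g (\<lambda>t. R_fun m (w t) (A_data q m n b w p t))"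
    unfolding solves_log_eq_def
  proof (intro ballI impI)
    fix t and z :: complex assume t: "t \<in> {0..<T}" and z: "z \<in> ball 0 1" "?g t z \<noteq> 0"
    have t2: "t \<in> {0..T2}" using t sub by auto
    interpret D: admissible_data m n "b t" "w t" "p t" "q t"
      by unfold_locales (use adm[OF t] q_pos t in auto)
    have DG: "D.G = G t" and DS: "D.S = S t" unfolding D.G_def D.S_def by (rule Gw[OF t2], rule Sp[OF t2])
    have Szt: "poly (S t) z \<noteq> 0" using D.S_nonzero[of z] z by (simp add: DS)
    have Gz: "poly D.G z \<noteq> 0" using z(2) by (auto simp: D.g_eq)
    have DL: "smult (of_real (q t)) (transport (Lp m n (G t) (S t)) (S t)) = transport D.L D.S"
      by (rule poly_eqI_infinite) (simp add: poly_transport D.L_def DG DS pderiv_smult algebra_simps infinite_UNIV_char_0)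
    have hp: "has_pder G (smult (of_real (q t)) (Gv m n (G t) (S t))) (at t within {0..<T})"
      "has_pder S (smult (of_real (q t)) (Sv m n (G t) (S t))) (at t within {0..<T})"
      using solT t by (auto simp: solves_field_def)
    have "((\<lambda>s. poly (G s) z) has_vector_derivative poly (smult (of_real (q t)) (Gv m n (G t) (S t))) z) (at t within {0..<T})"
      using has_vector_derivative_poly_path[OF hp(1) deg(1) _ has_vector_derivative_const[of z]]
        field_spec(2)[OF gd[OF t2]] by (simp add: degree_smult_le')
    moreover have "((\<lambda>s. poly (S s) z) has_vector_derivative poly (smult (of_real (q t)) (Sv m n (G t) (S t))) z) (at t within {0..<T})"
      using has_vector_derivative_poly_path[OF hp(2) eq_refl[OF deg(2)] _ has_vector_derivative_const[of z]]
        field_spec(4)[OF gd[OF t2]] by (simp add: degree_smult_le')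
    ultimately have "((\<lambda>s. poly (G s) z / poly (S s) z) has_vector_derivative
        (poly (smult (of_real (q t)) (Gv m n (G t) (S t))) z * poly (S t) z -
         poly (G t) z * poly (smult (of_real (q t)) (Sv m n (G t) (S t))) z) / (poly (S t) z)\<^sup>2) (at t within {0..<T})"
      using Szt by (rule has_vector_derivative_divide_complex)
    moreover have "poly (smult (of_real (q t)) (Gv m n (G t) (S t))) z * poly (S t) z -
         poly (G t) z * poly (smult (of_real (q t)) (Sv m n (G t) (S t))) z = poly (transport D.L D.S) z"
      unfolding DL[symmetric] field_spec(1)[OF gd[OF t2], symmetric] by (simp add: right_diff_distrib)
    ultimately have "((\<lambda>s. poly (G s) z / poly (S s) z) has_vector_derivative
        poly (transport D.L D.S) z / (poly D.S z)\<^sup>2) (at t within {0..<T})" by (simp add: DS)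
    then have "((\<lambda>s. ?g s z) has_vector_derivative poly (transport D.L D.S) z / (poly D.S z)\<^sup>2) (at t within {0..<T})"
      by (rule has_vector_derivative_transform[OF t, rotated]) (use sub in \<open>auto intro: g\<close>)
    moreover have "A_data q m n b w p t = (\<lambda>j. A_coef (q t) (?g t) (w t j))" by (rule ext) (simp add: A_data_def)
    ultimately show "\<exists>gdot. ((\<lambda>s. ?g s z) has_vector_derivative gdot) (at t within {0..<T}) \<and>
        gdot / ?g t z = z * (P_fun (q t) (?g t) z + R_fun m (w t) (A_data q m n b w p t) z) * (deriv (?g t) z / ?g t z) +
          deriv (\<lambda>z. z * (P_fun (q t) (?g t) z + R_fun m (w t) (A_data q m n b w p t) z)) z"
      using D.log_derivative_identity[OF _ Gz] z(1) by auto
  qed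
  then have "rational_solution q m n (rat_fun m n b0 w0 p0) T b w p (A_data q m n b w p)"
    unfolding rational_solution_def using g_init adm bc wc pc' sub(1)
    by (auto intro: continuous_on_subset)
  then show ?thesis using T by blast
qed

lemma rational_solution_imp_path:
  assumes "\<And>t. 0 \<le> t \<Longrightarrow> 0 < q t" "continuous_on {0..} q" "T > 0" "rational_solution q m n g0 T b w p B"
  shows "rational_path q m n T b w p B"
  using assms by unfold_locales (auto simp: rational_solution_def)

(* Conjuncts 1-3 are part (1): existence for B = A; any B admitting a solution equals A; the
   resulting function R is unique. Conjunct 4 is part (2), conjunct 5 is part (3). *)

theorem theorem9p2:
  fixes q :: "real \<Rightarrow> real" and m n :: nat
    and b0 :: complex and w0 p0 :: "nat \<Rightarrow> complex" and g0 :: "complex \<Rightarrow> complex"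
  assumes q_pos: "\<And>t. 0 \<le> t \<Longrightarrow> 0 < q t"
    and q_cont: "continuous_on {0..} q"
    and init: "admissible m n b0 w0 p0"
    and g0: "g0 = rat_fun m n b0 w0 p0"
  shows
    "(\<exists>T>0. \<exists>b w p. rational_solution q m n g0 T b w p (A_data q m n b w p)) \<and>
     (\<forall>T>0. \<forall>b w p B. rational_solution q m n g0 T b w p B \<longrightarrow>
        (\<forall>t\<in>{0..<T}. \<forall>j\<in>disk_zeros m (w t). B t j = A_data q m n b w p t j)) \<and>
     (\<forall>T>0. \<forall>b w p B b' w' p' B'.
        rational_solution q m n g0 T b w p B \<and> rational_solution q m n g0 T b' w' p' B' \<longrightarrow>
        (\<forall>t\<in>{0..<T}. R_fun m (w t) (B t) = R_fun m (w' t) (B' t))) \<and>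
     (\<forall>T>0. \<forall>b w p. rational_solution q m n g0 T b w p (A_data q m n b w p) \<longrightarrow>
        (solves_Loewner_Kufarev T q (\<lambda>t. rat_fun m n (b t) (w t) (p t)) \<longleftrightarrow>
           (\<forall>t\<in>{0..<T}. \<forall>\<zeta>. R_fun m (w t) (A_data q m n b w p t) \<zeta> = 0)) \<and>
        ((\<forall>t\<in>{0..<T}. \<forall>\<zeta>. R_fun m (w t) (A_data q m n b w p t) \<zeta> = 0) \<longleftrightarrow>
           (\<forall>t\<in>{0..<T}. zeros_reflect_to_higher_poles (rat_fun m n (b t) (w t) (p t)))) \<and>
        (\<forall>s\<in>{0..<T}. \<forall>t\<in>{0..<T}.
           zeros_reflect_to_higher_poles (rat_fun m n (b s) (w s) (p s)) \<longrightarrow>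
           zeros_reflect_to_higher_poles (rat_fun m n (b t) (w t) (p t)))) \<and>
     (\<forall>T>0. \<forall>b w p. rational_solution q m n g0 T b w p (A_data q m n b w p) \<and>
          solves_Loewner_Kufarev T q (\<lambda>t. rat_fun m n (b t) (w t) (p t)) \<longrightarrow>
        (\<forall>s\<in>{0..<T}. \<forall>t\<in>{0..<T}. s < t \<longrightarrow>
           (\<forall>j<n. norm (p s j) < norm (p t j)) \<and>
           (\<forall>k\<in>disk_zeros m (w s). norm (w t k) < norm (w s k))))"
proof (intro conjI allI impI)
  show "\<exists>T>0. \<exists>b w p. rational_solution q m n g0 T b w p (A_data q m n b w p)"
    unfolding g0 by (rule rational_solution_exists[OF q_pos q_cont init])
next
  fix T :: real and b w p B assume T: "T > 0" and sol: "rational_solution q m n g0 T b w p B"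
  interpret rational_path q m n T b w p B by (rule rational_solution_imp_path[OF q_pos q_cont T sol])
  show "\<forall>t\<in>{0..<T}. \<forall>j\<in>disk_zeros m (w t). B t j = A_data q m n b w p t j"
  proof (intro ballI)
    fix t j assume t: "t \<in> {0..<T}" and "j \<in> disk_zeros m (w t)"
    then have "j \<in> disk_zeros m (w 0)" using disk_zeros_const[OF t] by simp
    then show "B t j = A_data q m n b w p t j" by (rule B_eq_A[OF t])
  qed
next
  fix T :: real and b w p B b' w' p' B' assume T: "T > 0"
    and sol: "rational_solution q m n g0 T b w p B \<and> rational_solution q m n g0 T b' w' p' B'"
  have "rat_fun m n (b 0) (w 0) (p 0) = rat_fun m n (b' 0) (w' 0) (p' 0)"
    using sol by (simp add: rational_solution_def)
  then show "\<forall>t\<in>{0..<T}. R_fun m (w t) (B t) = R_fun m (w' t) (B' t)"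
    using rational_path_R_unique rational_solution_imp_path[OF q_pos q_cont T] sol by blast
next
  fix T :: real and b w p
  assume T: "T > 0" and sol: "rational_solution q m n g0 T b w p (A_data q m n b w p)"
  interpret rational_path q m n T b w p "A_data q m n b w p"
    by (rule rational_solution_imp_path[OF q_pos q_cont T sol])
  show "solves_Loewner_Kufarev T q (\<lambda>t. rat_fun m n (b t) (w t) (p t)) \<longleftrightarrow>
      (\<forall>t\<in>{0..<T}. \<forall>\<zeta>. R_fun m (w t) (A_data q m n b w p t) \<zeta> = 0)"
    by (rule Loewner_Kufarev_iff)
  show "(\<forall>t\<in>{0..<T}. \<forall>\<zeta>. R_fun m (w t) (A_data q m n b w p t) \<zeta> = 0) \<longleftrightarrow>
      (\<forall>t\<in>{0..<T}. zeros_reflect_to_higher_poles (rat_fun m n (b t) (w t) (p t)))"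
    by (rule R_zero_iff_higher_poles)
  show "\<forall>s\<in>{0..<T}. \<forall>t\<in>{0..<T}. zeros_reflect_to_higher_poles (rat_fun m n (b s) (w s) (p s)) \<longrightarrow>
      zeros_reflect_to_higher_poles (rat_fun m n (b t) (w t) (p t))"
    using higher_poles_conserved by blast
next
  fix T :: real and b w p
  assume T: "T > 0" and sol: "rational_solution q m n g0 T b w p (A_data q m n b w p) \<and>
    solves_Loewner_Kufarev T q (\<lambda>t. rat_fun m n (b t) (w t) (p t))"
  interpret rational_path q m n T b w p "A_data q m n b w p"
    by (rule rational_solution_imp_path[OF q_pos q_cont T conjunct1[OF sol]])
  show "\<forall>s\<in>{0..<T}. \<forall>t\<in>{0..<T}. s < t \<longrightarrow> (\<forall>j<n. norm (p s j) < norm (p t j)) \<and>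
      (\<forall>k\<in>disk_zeros m (w s). norm (w t k) < norm (w s k))"
    using monotone_motion[OF conjunct2[OF sol]] by blast
qed

end
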